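(* The setting $\{FP_1,\mathfrak{M}_2^{+},\mathfrak{M}_2,\chi_{fr}\}$ is a Long-Moody system. That is, the morphisms $\chi_{n,fr}:FP_1(\Sigma_{n,1})\to\mathbf{\Gamma}_{1+n,1}$, $n\in\mathbb{N}$, define (by $\chi_{fr}(h,\varphi)=\chi_{n,fr}(h)\circ(id_{\Sigma_{1,1}}\natural\varphi)$ for $\varphi\in\mathbf{\Gamma}_{n,1}$, $h\in FP_1(\Sigma_{n,1})$) a functor $\chi_{fr}:\int^{\mathfrak{M}_2^{+}}FP_1\to\mathfrak{M}_2^{+}$ such that $\chi_{fr}\circ\mathfrak{s}_{FP_1}=\Sigma_{1,1}\natural-$.
   Context: $\Sigma_{n,1}=T^{\natural n}$ is the smooth compact connected oriented surface of genus $n$ with one boundary component, carrying a parametrized interval $I$ in its boundary ($T=\Sigma_{1,1}$ is the one-holed torus, $\Sigma_{0,1}=\mathbb{D}^2$), where $\natural$ is boundary connected sum along half-intervals. $\mathbf{\Gamma}_{n,1}$ is its mapping class group (isotopy classes of diffeomorphisms, or homeomorphisms, fixing the boundary pointwise). $\mathfrak{M}_2^{+}$ is the groupoid with objects $\Sigma_{n,1}$, $n\in\mathbb{N}$, and automorphism groups $\mathbf{\Gamma}_{n,1}$; it is a full subgroupoid of the braided monoidal groupoid $\mathfrak{M}_2$ of decorated surfaces under $\natural$. $\Sigma_{1,1}\natural-$ is the functor $\Sigma_{n,1}\mapsto\Sigma_{1,1}\natural\Sigma_{n,1}=\Sigma_{1+n,1}$, $\varphi\mapsto id_{\Sigma_{1,1}}\natural\varphi$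 (extension by the identity). Framed braids. Let $U\Sigma_{n,1}$ be the unit tangent bundle (for some Riemannian metric) and $FP_1(\Sigma_{n,1})=\pi_1(U\Sigma_{n,1},(x,v))$ for a point $x$ in the interior and a unit tangent vector $v$ at $x$; diffeomorphisms act through their differentials, $(x,v)$ being taken in a collar near the interval $I$ that is fixed by the diffeomorphisms. This gives a functor $FP_1:\mathfrak{M}_2^+\to\mathfrak{Gr}$. Let $\Sigma_{n,2}=\Sigma_{0,2}\natural\Sigma_{n,1}$ be the genus $n$ surface with two boundary components, one carrying $I$ and the other one, $\partial'$, lying in $\Sigma_{0,2}$, and $\mathbf{\Gamma}_{n,2}$ its mapping class group fixing the boundary pointwise. For $n\ge1$ there is a short exact sequence $$1\to FP_1(\Sigma_{n,1})\xrightarrow{\ \overrightarrow{\mathrm{Push}}_n\ }\mathbf{\Gamma}_{n,2}\xrightarrow{\ \mathrm{Cap}\ }\mathbf{\Gamma}_{n,1}\to1$$ coming from the long exact homotopy sequence of the fibration from the diffeomorphisms of $\Sigma_{n,1}$ fixing the boundary to $U\Sigma_{n,1}$ (evaluation of the normalized differential on $(x,v)$), with fibre identified with the diffeomorphisms of $\Sigma_{n,2}$ fixing the boundary; $\mathrm{Cap}$ caps $\partial'$ with a disc, and $\overrightarrow{\mathrm{Push}}_n$ pushes the boundary component $\partial'$ along a framed loop (conventions chosen so that it is a homomorphism). The sequence is split by $\varphi\mapsto id_{\Sigma_{0,2}}\natural\varphi$, giving $\mathbf{\Gamma}_{n,2}\cong FP_1(\Sigma_{n,1})\rtimes\mathbf{\Gamma}_{n,1}$.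 Let $id_{\mathring{\mathbb{T}}}\sharp-:\mathbf{\Gamma}_{n,2}\to\mathbf{\Gamma}_{1+n,1}$ be induced by gluing a one-holed torus $\mathring{\mathbb{T}}$ along $\partial'$ and extending by the identity. Then $\chi_{n,fr}=(id_{\mathring{\mathbb{T}}}\sharp-)\circ\overrightarrow{\mathrm{Push}}_n$ for $n\ge1$, and $\chi_{0,fr}$ is the trivial morphism. For a functor $\mathcal{A}:\mathfrak{C}\to\mathfrak{Gr}$, $\int^{\mathfrak{C}}\mathcal{A}$ has the objects of $\mathfrak{C}$, morphisms $c\to c'$ the pairs $(h,\varphi)$ with $\varphi\in\mathrm{Hom}_{\mathfrak{C}}(c,c')$, $h\in\mathcal{A}(c')$, composition $(h',\varphi')\circ(h,\varphi)=(h'\mathcal{A}(\varphi')(h),\varphi'\varphi)$; the section is $\mathfrak{s}_{\mathcal{A}}(\varphi)=(e,\varphi)$. *)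

theory Defs
  imports "HOL-Analysis.Analysis" "HOL-Algebra.Group"
begin

section \<open>Smooth maps, surfaces and unit tangent bundles in Euclidean space\<close>

text \<open>On an open set, a map is \<open>C^k\<close> if its iterated directional derivatives along the standard
  basis exist up to order \<open>k\<close> and are continuous (and the lower ones are differentiable).\<close>

primrec Ck_on :: "nat \<Rightarrow> ('a::euclidean_space \<Rightarrow> 'b::euclidean_space) \<Rightarrow> 'a set \<Rightarrow> bool" where
  "Ck_on 0 f U = continuous_on U f"
| "Ck_on (Suc k) f U =
     (f differentiable_on U \<and> (\<forall>b\<in>Basis. Ck_on k (\<lambda>x. frechet_derivative f (at x) b) U))"

text \<open>On an arbitrary subset of Euclidean space, smooth means: locally the restriction of a
  smooth map defined on an open set.\<close>

definition smooth_on :: "'a::euclidean_space set \<Rightarrow> ('a \<Rightarrow> 'b::euclidean_space) \<Rightarrow> bool" where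
  "smooth_on S f \<longleftrightarrow>
     (\<forall>x\<in>S. \<exists>U g. open U \<and> x \<in> U \<and> (\<forall>k. Ck_on k g U) \<and> (\<forall>y\<in>S \<inter> U. f y = g y))"

definition diffeomorphism ::
  "'a::euclidean_space set \<Rightarrow> 'b::euclidean_space set \<Rightarrow> ('a \<Rightarrow> 'b) \<Rightarrow> bool" where
  "diffeomorphism S T f \<longleftrightarrow> bij_betw f S T \<and> smooth_on S f \<and> smooth_on T (inv_into S f)"

type_synonym R3 = "real \<times> real \<times> real"

text \<open>Embedded smooth surfaces without boundary.\<close>

definition smooth_surface :: "R3 set \<Rightarrow> bool" where
  "smooth_surface M \<longleftrightarrow>
     (\<forall>p\<in>M. \<exists>U (V :: (real \<times> real) set) \<psi>.
        open U \<and> p \<in> U \<and> open V \<and> diffeomorphism V (M \<inter> U) \<psi>)"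

text \<open>The span of the velocities of curves starting at \<open>p\<close> and staying in \<open>S\<close>. Passing to the span
  gives the full tangent plane at boundary points and corners as well.\<close>

definition tangent_space :: "R3 set \<Rightarrow> R3 \<Rightarrow> R3 set" where
  "tangent_space S p =
     span {w. \<exists>c. c 0 = p \<and> c ` {0..1} \<subseteq> S \<and>
                 (c has_vector_derivative w) (at (0::real) within {0..1})}"

text \<open>The unit tangent bundle for the metric induced by the ambient space.\<close>

definition unit_tangent_bundle :: "R3 set \<Rightarrow> (R3 \<times> R3) set" where
  "unit_tangent_bundle S = {(p, w). p \<in> S \<and> w \<in> tangent_space S p \<and> norm w = 1}"

text \<open>The normalized differential of \<open>f : S \<rightarrow> S\<close>. The derivative within \<open>S\<close> is a linear map on the
  ambient space which is not unique, but its values on tangent vectors of \<open>S\<close> are.\<close>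

definition unit_differential :: "R3 set \<Rightarrow> (R3 \<Rightarrow> R3) \<Rightarrow> R3 \<times> R3 \<Rightarrow> R3 \<times> R3" where
  "unit_differential S f =
     (\<lambda>(p, w). (f p, let u = frechet_derivative f (at p within S) w in u /\<^sub>R norm u))"


section \<open>Mapping class groups\<close>

text \<open>Diffeomorphisms of \<open>S\<close> fixing \<open>B\<close> (in the sequel, the boundary of \<open>S\<close>), with the usual
  convention that they are the identity on a neighbourhood of \<open>B\<close>, so that they can be extended
  by the identity. They are represented by maps of the ambient space that are the identity
  outside \<open>S\<close>. With this representation, extending a diffeomorphism of \<open>S\<close> by the identity to a
  larger surface does not change the underlying function.\<close>

definition diffeos :: "R3 set \<Rightarrow> R3 set \<Rightarrow> (R3 \<Rightarrow> R3) set" where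
  "diffeos S B =
     {f. diffeomorphism S S f \<and> (\<forall>p. p \<notin> S \<longrightarrow> f p = p) \<and>
         (\<exists>U. open U \<and> B \<subseteq> U \<and> (\<forall>p\<in>U. f p = p))}"

definition smooth_isotopy :: "R3 set \<Rightarrow> R3 set \<Rightarrow> (real \<Rightarrow> R3 \<Rightarrow> R3) \<Rightarrow> bool" where
  "smooth_isotopy S B F \<longleftrightarrow>
     (\<forall>t\<in>{0..1}. F t \<in> diffeos S B) \<and>
     smooth_on ({0..1} \<times> S) (\<lambda>(t, p). F t p) \<and>
     (\<exists>U. open U \<and> B \<subseteq> U \<and> (\<forall>t\<in>{0..1}. \<forall>p\<in>U. F t p = p))"

definition isotopic :: "R3 set \<Rightarrow> R3 set \<Rightarrow> (R3 \<Rightarrow> R3) \<Rightarrow> (R3 \<Rightarrow> R3) \<Rightarrow> bool" where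
  "isotopic S B f g \<longleftrightarrow> (\<exists>F. smooth_isotopy S B F \<and> F 0 = f \<and> F 1 = g)"

type_synonym mclass = "(R3 \<Rightarrow> R3) set"

definition isotopy_class :: "R3 set \<Rightarrow> R3 set \<Rightarrow> (R3 \<Rightarrow> R3) \<Rightarrow> mclass" where
  "isotopy_class S B f = {g. isotopic S B f g}"

definition mapping_class_group :: "R3 set \<Rightarrow> R3 set \<Rightarrow> mclass monoid" where
  "mapping_class_group S B =
     \<lparr> carrier = isotopy_class S B ` diffeos S B,
       mult = (\<lambda>a b. \<Union>f\<in>a. \<Union>g\<in>b. isotopy_class S B (f \<circ> g)),
       one = isotopy_class S B id \<rparr>"

text \<open>The map between mapping class groups induced by extension by the identity from a subsurface
  to the surface \<open>S\<close> with boundary \<open>B\<close>.\<close>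

definition extend_class :: "R3 set \<Rightarrow> R3 set \<Rightarrow> mclass \<Rightarrow> mclass" where
  "extend_class S B a = (\<Union>f\<in>a. isotopy_class S B f)"


section \<open>Fundamental groups\<close>

type_synonym 'a loop_class = "(real \<Rightarrow> 'a) set"

definition loops_at :: "'a::topological_space set \<Rightarrow> 'a \<Rightarrow> (real \<Rightarrow> 'a) set" where
  "loops_at X p = {g. path g \<and> path_image g \<subseteq> X \<and> pathstart g = p \<and> pathfinish g = p}"

definition path_class :: "'a::topological_space set \<Rightarrow> (real \<Rightarrow> 'a) \<Rightarrow> 'a loop_class" where
  "path_class X g = {k. homotopic_paths X g k}"

text \<open>Loops are multiplied like mappings: \<open>a \<otimes> b\<close> is \<open>b\<close> followed by \<open>a\<close>. This is the convention that
  makes the push map below a homomorphism.\<close>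

definition fundamental_group :: "'a::topological_space set \<Rightarrow> 'a \<Rightarrow> 'a loop_class monoid" where
  "fundamental_group X p =
     \<lparr> carrier = path_class X ` loops_at X p,
       mult = (\<lambda>a b. \<Union>g\<in>a. \<Union>h\<in>b. path_class X (h +++ g)),
       one = path_class X (\<lambda>_. p) \<rparr>"


section \<open>The surfaces\<close>

text \<open>The disc is the flat unit square. The parametrized interval \<open>I\<close> in its boundary is the
  concatenation of the left, bottom and right sides, and the boundary connected sum of two squares
  (with handles) is formed by putting them side by side: the right end of the interval of the
  first one is glued to the left end of the interval of the second one.\<close>

definition square :: "R3 set" where
  "square = {(x, y, z). 0 \<le> x \<and> x \<le> 1 \<and> 0 \<le> y \<and> y \<le> 1 \<and> z = 0}"

definition inner_circle :: "R3 set" where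
  "inner_circle = {(x, y, z). (x - 1/2)\<^sup>2 + (y - 1/2)\<^sup>2 = (1/4)\<^sup>2 \<and> z = 0}"

text \<open>\<open>\<Sigma>\<^sub>0\<^sub>,\<^sub>2\<close>; the boundary component \<open>\<partial>'\<close> is \<^const>\<open>inner_circle\<close>.\<close>

definition annulus :: "R3 set" where
  "annulus = square - {(x, y, z). (x - 1/2)\<^sup>2 + (y - 1/2)\<^sup>2 < (1/4)\<^sup>2}"

text \<open>The standard one-holed torus: the torus in \<open>\<complex>\<^sup>2\<close> without a small open round disc.\<close>

definition standard_one_holed_torus :: "(complex \<times> complex) set" where
  "standard_one_holed_torus = (sphere 0 1 \<times> sphere 0 1) - ball (1, 1) 1"

text \<open>A one-holed torus \<open>P\<close> which can be glued to the annulus along \<open>\<partial>'\<close>. The result \<open>annulus \<union> P\<close>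
  is a smooth surface, and it is again a one-holed torus, containing the boundary of the square.\<close>

definition torus_plug :: "R3 set \<Rightarrow> bool" where
  "torus_plug P \<longleftrightarrow>
     P \<subseteq> {0<..<1} \<times> {0<..<1} \<times> UNIV \<and>
     (\<exists>f. diffeomorphism P standard_one_holed_torus f) \<and>
     P \<inter> annulus = inner_circle \<and>
     smooth_surface ((annulus \<union> P) \<inter> ({0<..<1} \<times> {0<..<1} \<times> UNIV))"

text \<open>\<open>\<Sigma>\<^sub>1\<^sub>,\<^sub>1\<close>\<close>

definition torus1 :: "R3 set \<Rightarrow> R3 set" where
  "torus1 P = annulus \<union> P"

definition shift :: "nat \<Rightarrow> R3 set \<Rightarrow> R3 set" where
  "shift k X = (\<lambda>p. p - (real k, 0, 0)) ` X"

text \<open>\<open>surf P n\<close> is \<open>\<Sigma>\<^sub>n\<^sub>,\<^sub>1\<close>, the strip \<open>[-n, 1] \<times> [0, 1]\<close> with a copy of \<open>P\<close> plugged in every unit square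
  except the last one.\<close>

primrec surf :: "R3 set \<Rightarrow> nat \<Rightarrow> R3 set" where
  "surf P 0 = square"
| "surf P (Suc n) = shift (Suc n) (torus1 P) \<union> surf P n"

text \<open>\<open>X \<natural> \<Sigma>\<^sub>n\<^sub>,\<^sub>1\<close>, for \<open>X\<close> the disc, the annulus or the one-holed torus.
  So \<open>bsum P (torus1 P) n = surf P (Suc n)\<close> is \<open>\<Sigma>\<^sub>1\<^sub>,\<^sub>1 \<natural> \<Sigma>\<^sub>n\<^sub>,\<^sub>1\<close> and \<open>bsum P annulus n\<close> is \<open>\<Sigma>\<^sub>n\<^sub>,\<^sub>2\<close>.\<close>

definition bsum :: "R3 set \<Rightarrow> R3 set \<Rightarrow> nat \<Rightarrow> R3 set" where
  "bsum P X n = shift (Suc n) X \<union> surf P n"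

text \<open>The boundary of the strip \<open>[-m, 1] \<times> [0, 1]\<close>. It is the boundary of \<open>surf P m\<close>.\<close>

definition strip_boundary :: "nat \<Rightarrow> R3 set" where
  "strip_boundary m = {(x, y, z). - real m \<le> x \<and> x \<le> 1 \<and> 0 \<le> y \<and> y \<le> 1 \<and> z = 0 \<and>
                                  (x = - real m \<or> x = 1 \<or> y = 0 \<or> y = 1)}"

text \<open>\<open>\<Gamma>\<^sub>n\<^sub>,\<^sub>1\<close> and \<open>\<Gamma>\<^sub>n\<^sub>,\<^sub>2\<close>\<close>

definition Gamma1 :: "R3 set \<Rightarrow> nat \<Rightarrow> mclass monoid" where
  "Gamma1 P n = mapping_class_group (surf P n) (strip_boundary n)"

definition bd2 :: "nat \<Rightarrow> R3 set" where
  "bd2 n = strip_boundary (Suc n) \<union> shift (Suc n) inner_circle"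

definition Gamma2 :: "R3 set \<Rightarrow> nat \<Rightarrow> mclass monoid" where
  "Gamma2 P n = mapping_class_group (bsum P annulus n) (bd2 n)"

text \<open>\<open>id \<natural> - : \<Gamma>\<^sub>n\<^sub>,\<^sub>1 \<rightarrow> \<Gamma>\<^sub>1\<^sub>+\<^sub>n\<^sub>,\<^sub>1\<close>, with the identity of \<open>\<Sigma>\<^sub>1\<^sub>,\<^sub>1\<close>\<close>

definition id_torus_bsum :: "R3 set \<Rightarrow> nat \<Rightarrow> mclass \<Rightarrow> mclass" where
  "id_torus_bsum P n = extend_class (bsum P (torus1 P) n) (strip_boundary (Suc n))"

text \<open>\<open>id \<sharp> - : \<Gamma>\<^sub>n\<^sub>,\<^sub>2 \<rightarrow> \<Gamma>\<^sub>1\<^sub>+\<^sub>n\<^sub>,\<^sub>1\<close>, gluing the one-holed torus \<open>P\<close> along \<open>\<partial>'\<close>\<close>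

definition id_torus_glue :: "R3 set \<Rightarrow> nat \<Rightarrow> mclass \<Rightarrow> mclass" where
  "id_torus_glue P n = extend_class (bsum P (torus1 P) n) (strip_boundary (Suc n))"


section \<open>Framed braids and the push map\<close>

text \<open>Capping \<open>\<partial>'\<close> in \<open>\<Sigma>\<^sub>n\<^sub>,\<^sub>2\<close> gives \<open>\<Sigma>\<^sub>0\<^sub>,\<^sub>1 \<natural> \<Sigma>\<^sub>n\<^sub>,\<^sub>1\<close>. This is the model of \<open>\<Sigma>\<^sub>n\<^sub>,\<^sub>1\<close> (with a collar attached near \<open>I\<close>)
  in which the framed loops live. The base point is the centre of the capping disc. It is in the
  collar \<open>\<Sigma>\<^sub>0\<^sub>,\<^sub>1\<close>, which is fixed by the diffeomorphisms of \<open>\<Sigma>\<^sub>n\<^sub>,\<^sub>1\<close> extended by the identity.\<close>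

definition capped :: "R3 set \<Rightarrow> nat \<Rightarrow> R3 set" where
  "capped P n = bsum P square n"

definition framed_point :: "nat \<Rightarrow> R3 \<times> R3" where
  "framed_point n = ((1/2 - real (Suc n), 1/2, 0), (1, 0, 0))"

type_synonym framed_braid = "(R3 \<times> R3) loop_class"

definition FP1 :: "R3 set \<Rightarrow> nat \<Rightarrow> framed_braid monoid" where
  "FP1 P n = fundamental_group (unit_tangent_bundle (capped P n)) (framed_point n)"

text \<open>The action of \<open>\<Gamma>\<^sub>n\<^sub>,\<^sub>1\<close> through differentials.\<close>

definition FP1_map :: "R3 set \<Rightarrow> nat \<Rightarrow> mclass \<Rightarrow> framed_braid \<Rightarrow> framed_braid" where
  "FP1_map P n \<phi> h =
     (\<Union>f\<in>\<phi>. \<Union>g\<in>h. path_class (unit_tangent_bundle (capped P n))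
                      (unit_differential (capped P n) f \<circ> g))"

text \<open>The connecting map of the fibration given by evaluating normalized differentials at the
  framed point: lift the framed loop to a path of diffeomorphisms of the capped surface starting at
  the identity, and take its end point. The fibre, consisting of the diffeomorphisms that fix the
  framed point, is replaced by the subgroup of those which are the identity on the capping disc
  and near it, that is by the diffeomorphisms of \<open>\<Sigma>\<^sub>n\<^sub>,\<^sub>2\<close>. As isotopies are smooth, they lift a loop
  in the homotopy class only.\<close>

definition push_lift :: "R3 set \<Rightarrow> nat \<Rightarrow> framed_braid \<Rightarrow> (real \<Rightarrow> R3 \<Rightarrow> R3) \<Rightarrow> bool" where
  "push_lift P n h F \<longleftrightarrow>
     smooth_isotopy (capped P n) (strip_boundary (Suc n)) F \<and>
     F 0 = id \<and>
     F 1 \<in> diffeos (bsum P annulus n) (bd2 n) \<and>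
     (\<lambda>t. unit_differential (capped P n) (F t) (framed_point n)) \<in> h"

definition Push :: "R3 set \<Rightarrow> nat \<Rightarrow> framed_braid \<Rightarrow> mclass" where
  "Push P n h = (\<Union>F\<in>{F. push_lift P n h F}. isotopy_class (bsum P annulus n) (bd2 n) (F 1))"

definition chi_fr :: "R3 set \<Rightarrow> nat \<Rightarrow> framed_braid \<Rightarrow> mclass" where
  "chi_fr P n h = (if n = 0 then \<one>\<^bsub>Gamma1 P 1\<^esub> else id_torus_glue P n (Push P n h))"


section \<open>Categories, functors and Long-Moody systems\<close>

record ('o, 'm) cat =
  Ob :: "'o set"
  Mor :: "'o \<Rightarrow> 'o \<Rightarrow> 'm set"
  Comp :: "'o \<Rightarrow> 'o \<Rightarrow> 'o \<Rightarrow> 'm \<Rightarrow> 'm \<Rightarrow> 'm"  \<comment> \<open>\<open>Comp C a b c g f\<close> is \<open>g \<circ> f\<close> for \<open>f : a \<rightarrow> b\<close> and \<open>g : b \<rightarrow> c\<close>\<close>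
  Ident :: "'o \<Rightarrow> 'm"

definition is_category :: "('o, 'm) cat \<Rightarrow> bool" where
  "is_category C \<longleftrightarrow>
     (\<forall>a\<in>Ob C. Ident C a \<in> Mor C a a) \<and>
     (\<forall>a\<in>Ob C. \<forall>b\<in>Ob C. \<forall>c\<in>Ob C. \<forall>f\<in>Mor C a b. \<forall>g\<in>Mor C b c. Comp C a b c g f \<in> Mor C a c) \<and>
     (\<forall>a\<in>Ob C. \<forall>b\<in>Ob C. \<forall>f\<in>Mor C a b.
        Comp C a a b f (Ident C a) = f \<and> Comp C a b b (Ident C b) f = f) \<and>
     (\<forall>a\<in>Ob C. \<forall>b\<in>Ob C. \<forall>c\<in>Ob C. \<forall>d\<in>Ob C. \<forall>f\<in>Mor C a b. \<forall>g\<in>Mor C b c. \<forall>h\<in>Mor C c d.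
        Comp C a c d h (Comp C a b c g f) = Comp C a b d (Comp C b c d h g) f)"

definition is_groupoid :: "('o, 'm) cat \<Rightarrow> bool" where
  "is_groupoid C \<longleftrightarrow> is_category C \<and>
     (\<forall>a\<in>Ob C. \<forall>b\<in>Ob C. \<forall>f\<in>Mor C a b. \<exists>g\<in>Mor C b a.
        Comp C a b a g f = Ident C a \<and> Comp C b a b f g = Ident C b)"

record ('o, 'm, 'p, 'n) cat_map =
  on_ob :: "'o \<Rightarrow> 'p"
  on_mor :: "'o \<Rightarrow> 'o \<Rightarrow> 'm \<Rightarrow> 'n"  \<comment> \<open>source, target, morphism\<close>

definition is_functor :: "('o, 'm) cat \<Rightarrow> ('p, 'n) cat \<Rightarrow> ('o, 'm, 'p, 'n) cat_map \<Rightarrow> bool" where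
  "is_functor C D F \<longleftrightarrow> is_category C \<and> is_category D \<and>
     (\<forall>a\<in>Ob C. on_ob F a \<in> Ob D \<and> on_mor F a a (Ident C a) = Ident D (on_ob F a)) \<and>
     (\<forall>a\<in>Ob C. \<forall>b\<in>Ob C. \<forall>f\<in>Mor C a b. on_mor F a b f \<in> Mor D (on_ob F a) (on_ob F b)) \<and>
     (\<forall>a\<in>Ob C. \<forall>b\<in>Ob C. \<forall>c\<in>Ob C. \<forall>f\<in>Mor C a b. \<forall>g\<in>Mor C b c.
        on_mor F a c (Comp C a b c g f) =
          Comp D (on_ob F a) (on_ob F b) (on_ob F c) (on_mor F b c g) (on_mor F a b f))"

definition functor_comp ::
  "('p, 'n, 'q, 'k) cat_map \<Rightarrow> ('o, 'm, 'p, 'n) cat_map \<Rightarrow> ('o, 'm, 'q, 'k) cat_map" where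
  "functor_comp G F =
     \<lparr> on_ob = (\<lambda>a. on_ob G (on_ob F a)),
       on_mor = (\<lambda>a b f. on_mor G (on_ob F a) (on_ob F b) (on_mor F a b f)) \<rparr>"

definition functor_eq ::
  "('o, 'm) cat \<Rightarrow> ('o, 'm, 'p, 'n) cat_map \<Rightarrow> ('o, 'm, 'p, 'n) cat_map \<Rightarrow> bool" where
  "functor_eq C F G \<longleftrightarrow>
     (\<forall>a\<in>Ob C. on_ob F a = on_ob G a) \<and>
     (\<forall>a\<in>Ob C. \<forall>b\<in>Ob C. \<forall>f\<in>Mor C a b. on_mor F a b f = on_mor G a b f)"

text \<open>Functors from \<open>C\<close> to the category of groups.\<close>

definition is_group_functor :: "('o, 'm) cat \<Rightarrow> ('o, 'm, 'g monoid, 'g \<Rightarrow> 'g) cat_map \<Rightarrow> bool" where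
  "is_group_functor C A \<longleftrightarrow> is_category C \<and>
     (\<forall>a\<in>Ob C. group (on_ob A a) \<and> (\<forall>x\<in>carrier (on_ob A a). on_mor A a a (Ident C a) x = x)) \<and>
     (\<forall>a\<in>Ob C. \<forall>b\<in>Ob C. \<forall>f\<in>Mor C a b. on_mor A a b f \<in> hom (on_ob A a) (on_ob A b)) \<and>
     (\<forall>a\<in>Ob C. \<forall>b\<in>Ob C. \<forall>c\<in>Ob C. \<forall>f\<in>Mor C a b. \<forall>g\<in>Mor C b c. \<forall>x\<in>carrier (on_ob A a).
        on_mor A a c (Comp C a b c g f) x = on_mor A b c g (on_mor A a b f x))"

text \<open>The Grothendieck construction \<open>\<integral>\<^sup>C A\<close> and the section \<open>s\<^sub>A\<close>.\<close>

definition grothendieck ::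
  "('o, 'm) cat \<Rightarrow> ('o, 'm, 'g monoid, 'g \<Rightarrow> 'g) cat_map \<Rightarrow> ('o, 'g \<times> 'm) cat" where
  "grothendieck C A =
     \<lparr> Ob = Ob C,
       Mor = (\<lambda>a b. carrier (on_ob A b) \<times> Mor C a b),
       Comp = (\<lambda>a b c (h', \<phi>') (h, \<phi>).
                 (h' \<otimes>\<^bsub>on_ob A c\<^esub> on_mor A b c \<phi>' h, Comp C a b c \<phi>' \<phi>)),
       Ident = (\<lambda>a. (\<one>\<^bsub>on_ob A a\<^esub>, Ident C a)) \<rparr>"

definition grothendieck_sec ::
  "('o, 'm, 'g monoid, 'g \<Rightarrow> 'g) cat_map \<Rightarrow> ('o, 'm, 'o, 'g \<times> 'm) cat_map" where
  "grothendieck_sec A = \<lparr> on_ob = (\<lambda>a. a), on_mor = (\<lambda>a b \<phi>. (\<one>\<^bsub>on_ob A b\<^esub>, \<phi>)) \<rparr>"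

text \<open>A Long-Moody system on the groupoid \<open>C\<close>, where \<open>X\<close> is the functor \<open>X \<natural> -\<close> of boundary connected
  sum with a fixed object.\<close>

definition long_moody_system ::
  "('o, 'm) cat \<Rightarrow> ('o, 'm, 'g monoid, 'g \<Rightarrow> 'g) cat_map \<Rightarrow> ('o, 'm, 'o, 'm) cat_map \<Rightarrow>
   ('o, 'g \<times> 'm, 'o, 'm) cat_map \<Rightarrow> bool" where
  "long_moody_system C A X K \<longleftrightarrow>
     is_groupoid C \<and> is_group_functor C A \<and> is_functor C C X \<and>
     is_functor (grothendieck C A) C K \<and>
     functor_eq C (functor_comp K (grothendieck_sec A)) X"

text \<open>The groupoid \<open>M\<^sub>2\<^sup>+\<close>; the object \<open>n\<close> stands for \<open>\<Sigma>\<^sub>n\<^sub>,\<^sub>1\<close>.\<close>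

definition M2plus :: "R3 set \<Rightarrow> (nat, mclass) cat" where
  "M2plus P =
     \<lparr> Ob = UNIV,
       Mor = (\<lambda>n m. if n = m then carrier (Gamma1 P n) else {}),
       Comp = (\<lambda>_ _ n g f. g \<otimes>\<^bsub>Gamma1 P n\<^esub> f),
       Ident = (\<lambda>n. \<one>\<^bsub>Gamma1 P n\<^esub>) \<rparr>"

definition FP1_functor ::
  "R3 set \<Rightarrow> (nat, mclass, framed_braid monoid, framed_braid \<Rightarrow> framed_braid) cat_map" where
  "FP1_functor P = \<lparr> on_ob = FP1 P, on_mor = (\<lambda>_ n \<phi>. FP1_map P n \<phi>) \<rparr>"

text \<open>\<open>\<Sigma>\<^sub>1\<^sub>,\<^sub>1 \<natural> -\<close>\<close>

definition torus_bsum_functor :: "R3 set \<Rightarrow> (nat, mclass, nat, mclass) cat_map" where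
  "torus_bsum_functor P = \<lparr> on_ob = (\<lambda>n. 1 + n), on_mor = (\<lambda>_ n \<phi>. id_torus_bsum P n \<phi>) \<rparr>"

definition chi_fr_functor :: "R3 set \<Rightarrow> (nat, framed_braid \<times> mclass, nat, mclass) cat_map" where
  "chi_fr_functor P =
     \<lparr> on_ob = (\<lambda>n. 1 + n),
       on_mor = (\<lambda>_ n (h, \<phi>). chi_fr P n h \<otimes>\<^bsub>Gamma1 P (1 + n)\<^esub> id_torus_bsum P n \<phi>) \<rparr>"

end

theory Submission imports Defs begin

text \<open>Evaluating normalized differentials at the framed point behaves like a fibration: a path of unit tangent
  vectors in the interior is followed, up to a small homotopy, by an isotopy that is a finite concatenation of
  supported moves, and a loop of isotopies with null homotopic trace can be corrected to fix the framed point.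
  A diffeomorphism that fixes the framed point and preserves the local orientation can be straightened to the
  identity on the capping disc, by a logarithmic cut-off followed by conjugation with a radial shrinking; the
  orientation is preserved because the plugs are orientable. So every framed braid has a push lift, unique up
  to isotopy of \<open>\<Sigma>\<^sub>n\<^sub>,\<^sub>2\<close>. Then \<open>\<chi>\<close> is a homomorphism because composed lifts trace concatenated loops, and
  equivariant because conjugating a lift by \<open>\<phi>\<close> moves its trace by the differential of \<open>\<phi>\<close>.\<close>

section \<open>Smooth maps\<close>

text \<open>The main difficulty is to build smooth isotopies with smooth inverses from local data.
  The new diffeomorphisms are composites of plane maps read in a chart, equal to the identity
  outside a disc and strongly monotone for a weighted inner product. Monotonicity alone gives
  bijectivity and an invertible derivative, hence a smooth inverse, also with a time parameter. The
  weight is forced by the straightening: fixing the framed point makes the derivative triangular in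
  the chart, and its linear interpolation to the identity is monotone once the second coordinate
  weighs enough against the off-diagonal entry. The cut-off is logarithmic because the map differs
  from the identity to first order at the fixed point, so that only a gradient small against the
  inverse distance leaves monotonicity intact. One fixed direction does not decide the sign of the
  second diagonal entry; this is where orientability is needed. Isotopies are composed rather than
  joined end to end, which keeps them smooth in time. Finally, framed loops may touch the boundary,
  which isotopies fix, so loops and homotopies are first pushed into the interior along a
  collar.\<close>

lemma Ck_on_cong:
  assumes "open U" "Ck_on k f U" "!!x. x \<in> U ==> f x = g x"
  shows "Ck_on k g U"
  using assms(2,3)
proof (induction k arbitrary: f g)
  case 0
  then show ?case using continuous_on_cong[of U U f g] by simp
next
  case (Suc k)
  have d: "(g has_derivative frechet_derivative f (at x)) (at x)" if "x \<in> U" for x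
  proof -
    have "f differentiable (at x)"
      using Suc.prems(1) that assms(1) by (simp add: differentiable_on_eq_differentiable_at)
    then have "(f has_derivative frechet_derivative f (at x)) (at x)"
      by (simp add: frechet_derivative_works)
    then show ?thesis
      by (rule has_derivative_transform_within_open[OF _ assms(1) that]) (use Suc.prems in auto)
  qed
  have "g differentiable_on U"
    unfolding differentiable_on_def differentiable_def
    using d has_derivative_at_withinI by blast
  moreover have "Ck_on k (\<lambda>x. frechet_derivative g (at x) b) U" if "b \<in> Basis" for b
    by (rule Suc.IH[of "\<lambda>x. frechet_derivative f (at x) b"])
      (use Suc.prems that frechet_derivative_at[OF d] in auto)
  ultimately show ?case by simp
qed

lemma Ck_on_SucI:
  assumes "open U" "!!x. x \<in> U ==> (f has_derivative f' x) (at x)"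
    and "!!b. b \<in> Basis ==> Ck_on k (\<lambda>x. f' x b) U"
  shows "Ck_on (Suc k) f U"
proof -
  have "f differentiable_on U"
    unfolding differentiable_on_def differentiable_def
    using assms(2) has_derivative_at_withinI by blast
  moreover have "Ck_on k (\<lambda>x. frechet_derivative f (at x) b) U" if "b \<in> Basis" for b
    by (rule Ck_on_cong[OF assms(1) assms(3)[OF that]])
      (use frechet_derivative_at[OF assms(2)] in auto)
  ultimately show ?thesis by simp
qed

lemma Ck_on_SucD:
  assumes "open U" "Ck_on (Suc k) f U"
  shows "x \<in> U ==> (f has_derivative frechet_derivative f (at x)) (at x)"
    and "b \<in> Basis ==> Ck_on k (\<lambda>x. frechet_derivative f (at x) b) U"
  using assms by (auto simp: differentiable_on_eq_differentiable_at frechet_derivative_works)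

lemma Ck_on_subset: "Ck_on k f U ==> V <= U ==> Ck_on k f V"
  by (induction k arbitrary: f) (auto intro: continuous_on_subset differentiable_on_subset)

lemma Ck_on_Suc: "open U ==> Ck_on (Suc k) f U ==> Ck_on k f U"
  by (induction k arbitrary: f) (auto intro: differentiable_imp_continuous_on)

lemma Ck_on_local:
  assumes "open U" "!!x. x \<in> U ==> \<exists>V. open V \<and> x \<in> V \<and> Ck_on k f V"
  shows "Ck_on k f U"
  using assms(2)
proof (induction k arbitrary: f)
  case 0
  show ?case unfolding Ck_on.simps
  proof (rule continuous_at_imp_continuous_on, rule ballI)
    fix x assume "x \<in> U"
    then obtain V where "open V" "x \<in> V" "Ck_on 0 f V" using 0 by blast
    then show "isCont f x" by (simp add: continuous_on_eq_continuous_at)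
  qed
next
  case (Suc k)
  have "f differentiable (at x)" if x: "x \<in> U" for x
  proof -
    obtain V where "open V" "x \<in> V" "Ck_on (Suc k) f V" using Suc.prems[OF x] by blast
    then show ?thesis by (simp add: differentiable_on_eq_differentiable_at)
  qed
  moreover have "Ck_on k (\<lambda>x. frechet_derivative f (at x) b) U" if "b \<in> Basis" for b
    by (rule Suc.IH) (use Suc.prems that in fastforce)
  ultimately show ?case by (simp add: differentiable_on_eq_differentiable_at assms(1))
qed

lemma Ck_on_const [simp]: "Ck_on k (\<lambda>x. c) U"
  by (induction k arbitrary: c) (auto simp: frechet_derivative_const)

lemma Ck_on_linear:
  assumes "open U" "bounded_linear h" "Ck_on k f U"
  shows "Ck_on k (\<lambda>x. h (f x)) U"
  using assms(3)
proof (induction k arbitrary: f)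
  case 0
  then show ?case using assms(2) by (simp add: bounded_linear.continuous_on)
next
  case (Suc k)
  note D = Ck_on_SucD[OF assms(1) Suc.prems]
  show ?case
    by (rule Ck_on_SucI[OF assms(1) bounded_linear.has_derivative[OF assms(2) D(1)]])
      (use Suc.IH[OF D(2)] in auto)
qed

lemma Ck_on_id: "open U ==> Ck_on k (\<lambda>x. x) U"
proof (cases k)
  case (Suc n)
  assume "open U"
  then show ?thesis unfolding Suc
    by (rule Ck_on_SucI[where f' = "\<lambda>x v. v"]) (auto intro: has_derivative_ident)
qed simp

lemma Ck_on_add:
  assumes "open U" "Ck_on k f U" "Ck_on k g U"
  shows "Ck_on k (\<lambda>x. f x + g x) U"
  using assms(2,3)
proof (induction k arbitrary: f g)
  case 0
  then show ?case by (simp add: continuous_on_add)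
next
  case (Suc k)
  note D = Ck_on_SucD[OF assms(1) Suc.prems(1)] Ck_on_SucD[OF assms(1) Suc.prems(2)]
  show ?case
    by (rule Ck_on_SucI[OF assms(1) has_derivative_add[OF D(1) D(3)]])
      (use Suc.IH[OF D(2,4)] in auto)
qed

lemma Ck_on_sum:
  assumes "open U" "!!i. i \<in> I ==> Ck_on k (f i) U"
  shows "Ck_on k (\<lambda>x. \<Sum>i\<in>I. f i x) U"
proof (cases "finite I")
  case True
  then show ?thesis using assms(2)
    by (induction I rule: finite_induct) (auto intro: Ck_on_add[OF assms(1)])
qed simp

lemma Ck_on_bilinear:
  assumes "open U" "bounded_bilinear h" "Ck_on k f U" "Ck_on k g U"
  shows "Ck_on k (\<lambda>x. h (f x) (g x)) U"
  using assms(3,4)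
proof (induction k arbitrary: f g)
  case 0
  then show ?case using assms(2) by (simp add: bounded_bilinear.continuous_on)
next
  case (Suc k)
  note D = Ck_on_SucD[OF assms(1) Suc.prems(1)] Ck_on_SucD[OF assms(1) Suc.prems(2)]
  show ?case
    by (rule Ck_on_SucI[OF assms(1) bounded_bilinear.FDERIV[OF assms(2) D(1) D(3)]])
      (use Suc.IH[OF Ck_on_Suc[OF assms(1) Suc.prems(1)] D(4)]
        Suc.IH[OF D(2) Ck_on_Suc[OF assms(1) Suc.prems(2)]] in \<open>auto intro: Ck_on_add[OF assms(1)]\<close>)
qed

text \<open>\<open>Ck_on\<close> records derivatives along \<open>Basis\<close> only, so the chain
  rule is expanded as a sum over the basis of the middle space; its terms are products of a
  derivative of \<open>f\<close> with a composite to which the induction applies. Since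
  \<open>g\<close> has all orders, its derivatives satisfy the same hypothesis again.\<close>

lemma Ck_on_comp:
  fixes f :: "'a::euclidean_space => 'b::euclidean_space" and g :: "'b => 'c::euclidean_space"
  assumes "open U" "open V" "Ck_on k f U" "!!j. Ck_on j g V" "f ` U <= V"
  shows "Ck_on k (\<lambda>x. g (f x)) U"
  using assms(3,4)
proof (induction k arbitrary: g)
  case 0
  have "continuous_on V g" using 0(2)[of 0] by simp
  then show ?case using 0(1) assms(5) continuous_on_compose2 by simp blast
next
  case (Suc k)
  note D = Ck_on_SucD[OF assms(1) Suc.prems(1)]
  note E = Ck_on_SucD[OF assms(2) Suc.prems(2)]
  have d: "((\<lambda>x. g (f x)) has_derivative
     (\<lambda>v. \<Sum>j\<in>Basis. (frechet_derivative f (at x) v \<bullet> j) *\<^sub>R frechet_derivative g (at (f x)) j)) (at x)"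
    if x: "x \<in> U" for x
  proof -
    have fx: "f x \<in> V" using x assms(5) by auto
    have 1: "((\<lambda>x. g (f x)) has_derivative
      (\<lambda>v. frechet_derivative g (at (f x)) (frechet_derivative f (at x) v))) (at x)"
      using diff_chain_at[OF D(1)[OF x] E(1)[OF fx]] by (simp add: o_def)
    have lin: "linear (frechet_derivative g (at (f x)))"
      using E(1)[OF fx] has_derivative_linear by blast
    have "frechet_derivative g (at (f x)) w =
        (\<Sum>j\<in>Basis. (w \<bullet> j) *\<^sub>R frechet_derivative g (at (f x)) j)" for w
      by (subst (1) euclidean_representation[symmetric, of w])
        (simp add: linear_sum[OF lin] linear_cmul[OF lin])
    then have "(\<lambda>v. frechet_derivative g (at (f x)) (frechet_derivative f (at x) v)) =
      (\<lambda>v. \<Sum>j\<in>Basis. (frechet_derivative f (at x) v \<bullet> j) *\<^sub>R frechet_derivative g (at (f x)) j)"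
      by (intro ext)
    then show ?thesis using 1 by simp
  qed
  have c: "Ck_on k (\<lambda>x. frechet_derivative g (at (f x)) j) U" if "j \<in> Basis" for j
    by (rule Suc.IH[OF Ck_on_Suc[OF assms(1) Suc.prems(1)] E(2)[OF that]])
  show ?case
    by (rule Ck_on_SucI[OF assms(1) d])
      (auto intro!: Ck_on_sum[OF assms(1)] Ck_on_bilinear[OF assms(1) bounded_bilinear_scaleR]
        Ck_on_linear[OF assms(1) bounded_linear_inner_left] D(2) c)
qed

text \<open>Bootstrapping: the derivative of \<open>g\<close> is a smooth function of
  \<open>g\<close> itself, so each order of regularity gives the next one. Reciprocals, square roots
  and the inverses of monotone families are all treated in this way.\<close>

lemma Ck_on_ode:
  fixes g :: "'a::euclidean_space => 'b::euclidean_space"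
  assumes "open U" "open V" "g ` U <= V"
    and "!!x. x \<in> U ==> (g has_derivative (\<lambda>b. R b (g x))) (at x)"
    and "!!b j. b \<in> Basis ==> Ck_on j (R b) V"
  shows "Ck_on k g U"
proof (induction k)
  case 0
  then show ?case using assms(4) assms(1)
    by (auto simp: continuous_on_eq_continuous_at intro: has_derivative_continuous)
next
  case (Suc k)
  show ?case
    by (rule Ck_on_SucI[OF assms(1,4)]) (use Ck_on_comp[OF assms(1,2) Suc assms(5,3)] in auto)
qed

section \<open>Smoothness on arbitrary subsets and its closure properties\<close>

lemma smooth_onE:
  assumes "smooth_on S f" "x \<in> S"
  obtains U g where "open U" "x \<in> U" "!!k. Ck_on k g U" "!!y. y \<in> S ==> y \<in> U ==> f y = g y"
  using assms unfolding smooth_on_def by (metis IntI)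

lemma smooth_onI:
  assumes "!!x. x \<in> S ==> \<exists>U g. open U \<and> x \<in> U \<and> (\<forall>k. Ck_on k g U) \<and> (\<forall>y\<in>S \<inter> U. f y = g y)"
  shows "smooth_on S f"
  using assms unfolding smooth_on_def by blast

lemma smooth_on_open_iff:
  assumes "open U"
  shows "smooth_on U f \<longleftrightarrow> (\<forall>k. Ck_on k f U)"
proof
  assume f: "smooth_on U f"
  show "\<forall>k. Ck_on k f U"
  proof
    fix k
    show "Ck_on k f U"
    proof (rule Ck_on_local[OF assms])
      fix x assume "x \<in> U"
      then obtain V g where V: "open V" "x \<in> V" "!!k. Ck_on k g V" "!!y. y \<in> U ==> y \<in> V ==> f y = g y"
        using smooth_onE[OF f] by metis
      have "Ck_on k f (U \<inter> V)"
        by (rule Ck_on_cong[OF _ Ck_on_subset[OF V(3)]]) (use V assms in auto)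
      then show "\<exists>V. open V \<and> x \<in> V \<and> Ck_on k f V"
        using V \<open>x \<in> U\<close> assms by (intro exI[of _ "U \<inter> V"]) auto
    qed
  qed
qed (auto intro!: smooth_onI exI[of _ U] exI[of _ f] assms)

lemma smooth_onD: "smooth_on U f ==> open U ==> Ck_on k f U"
  by (simp add: smooth_on_open_iff)

lemma smooth_on_subset:
  assumes "smooth_on S f" "T <= S"
  shows "smooth_on T f"
proof (rule smooth_onI)
  fix x assume "x \<in> T"
  then obtain U f' where "open U" "x \<in> U" "!!k. Ck_on k f' U" "!!y. y \<in> S ==> y \<in> U ==> f y = f' y"
    using smooth_onE[OF assms(1)] assms(2) by (metis subsetD)
  then show "\<exists>U h. open U \<and> x \<in> U \<and> (\<forall>k. Ck_on k h U) \<and> (\<forall>y\<in>T \<inter> U. f y = h y)"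
    using assms(2) by (intro exI[of _ U] exI[of _ f']) auto
qed

lemma smooth_on_cong:
  assumes "smooth_on S f" "!!x. x \<in> S ==> f x = g x"
  shows "smooth_on S g"
proof (rule smooth_onI)
  fix x assume "x \<in> S"
  then obtain U f' where "open U" "x \<in> U" "!!k. Ck_on k f' U" "!!y. y \<in> S ==> y \<in> U ==> f y = f' y"
    using smooth_onE[OF assms(1)] by metis
  then show "\<exists>U h. open U \<and> x \<in> U \<and> (\<forall>k. Ck_on k h U) \<and> (\<forall>y\<in>S \<inter> U. g y = h y)"
    using assms(2) by (intro exI[of _ U] exI[of _ f']) auto
qed

lemma smooth_on_local:
  assumes "!!x. x \<in> S ==> \<exists>U. open U \<and> x \<in> U \<and> smooth_on (S \<inter> U) f"
  shows "smooth_on S f"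
proof (rule smooth_onI)
  fix x assume x: "x \<in> S"
  obtain U where U: "open U" "x \<in> U" "smooth_on (S \<inter> U) f" using assms[OF x] by blast
  obtain V g where V: "open V" "x \<in> V" "!!k. Ck_on k g V" "!!y. y \<in> S \<inter> U ==> y \<in> V ==> f y = g y"
    using smooth_onE[OF U(3)] x U by (metis IntI)
  show "\<exists>U g. open U \<and> x \<in> U \<and> (\<forall>k. Ck_on k g U) \<and> (\<forall>y\<in>S \<inter> U. f y = g y)"
    using U V Ck_on_subset[OF V(3)] by (intro exI[of _ "U \<inter> V"] exI[of _ g]) auto
qed

lemma smooth_on_imp_continuous_on:
  assumes "smooth_on S f" shows "continuous_on S f"
  unfolding continuous_on_eq_continuous_within
proof
  fix x assume x: "x \<in> S"
  then obtain U g where U: "open U" "x \<in> U" "!!k. Ck_on k g U" "!!y. y \<in> S ==> y \<in> U ==> f y = g y"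
    using smooth_onE[OF assms] by metis
  have "continuous_on (S \<inter> U) f"
    by (rule continuous_on_eq[OF continuous_on_subset[of U g]]) (use U(3)[of 0] U(4) in auto)
  moreover have "at x within S \<inter> U = at x within S"
    by (rule at_within_nhd[OF U(2,1)]) auto
  ultimately have "continuous (at x within S) f"
    using x U(2) by (auto simp: continuous_on_eq_continuous_within dest: bspec[of _ _ x])
  then show "continuous (at x within S) f" .
qed

lemma smooth_on_has_derivative:
  assumes "smooth_on S f" "x \<in> S"
  shows "(f has_derivative frechet_derivative f (at x within S)) (at x within S)"
proof -
  obtain U g where U: "open U" "x \<in> U" "!!k. Ck_on k g U" "!!y. y \<in> S ==> y \<in> U ==> f y = g y"
    using smooth_onE[OF assms] by metis
  have "(g has_derivative frechet_derivative g (at x)) (at x within S \<inter> U)"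
    using Ck_on_SucD(1)[OF U(1) U(3) U(2)] has_derivative_at_withinI by blast
  then have "(f has_derivative frechet_derivative g (at x)) (at x within S \<inter> U)"
    by (rule has_derivative_transform[rotated 2]) (use U(2) assms(2) U(4) in simp_all)
  moreover have "at x within S \<inter> U = at x within S"
    by (rule at_within_nhd[OF U(2,1)]) auto
  ultimately have "(f has_derivative frechet_derivative g (at x)) (at x within S)" by simp
  then show ?thesis
    using differentiable_def frechet_derivative_works by blast
qed

lemma smooth_on_compose:
  assumes f: "smooth_on S f" and g: "smooth_on T g" and "!!x. x \<in> S ==> f x \<in> T"
  shows "smooth_on S (\<lambda>x. g (f x))"
proof (rule smooth_onI)
  fix x assume x: "x \<in> S"
  obtain U f' where U: "open U" "x \<in> U" "!!k. Ck_on k f' U" "!!y. y \<in> S ==> y \<in> U ==> f y = f' y"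
    using smooth_onE[OF f x] by metis
  obtain V g' where V: "open V" "f x \<in> V" "!!k. Ck_on k g' V" "!!y. y \<in> T ==> y \<in> V ==> g y = g' y"
    using smooth_onE[OF g assms(3)[OF x]] by metis
  let ?W = "U \<inter> f' -` V"
  have o: "open ?W"
    using U(3)[of 0] continuous_open_preimage[OF _ U(1) V(1)] by simp
  have c: "Ck_on k (\<lambda>x. g' (f' x)) ?W" for k
    by (rule Ck_on_comp[OF o V(1) Ck_on_subset[OF U(3)] V(3)]) auto
  have eq: "g (f y) = g' (f' y)" if "y \<in> S" "y \<in> U" "f' y \<in> V" for y
    using V(4)[OF assms(3)[OF that(1)]] U(4)[OF that(1,2)] that(3) by simp
  show "\<exists>U h. open U \<and> x \<in> U \<and> (\<forall>k. Ck_on k h U) \<and> (\<forall>y\<in>S \<inter> U. g (f y) = h y)"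
    using o c U(1,2) U(4)[OF x U(2)] V(2) x eq
    by (intro exI[of _ ?W] exI[of _ "\<lambda>x. g' (f' x)"]) auto
qed

lemma smooth_on_const [intro, simp]: "smooth_on S (\<lambda>x. c)"
  by (rule smooth_onI) (auto intro!: exI[of _ UNIV] exI[of _ "\<lambda>x. c"])

lemma smooth_on_UNIV_I:
  assumes "!!k. Ck_on k f UNIV" shows "smooth_on S f"
  using assms by (auto intro!: smooth_onI exI[of _ UNIV] exI[of _ f])

lemma smooth_on_id [intro, simp]: "smooth_on S (\<lambda>x. x)"
  by (rule smooth_on_UNIV_I) (simp add: Ck_on_id)

lemma smooth_on_id' [intro, simp]: "smooth_on S id"
  using smooth_on_id by (simp add: id_def)

lemma smooth_on_linear:
  assumes "bounded_linear h" "smooth_on S f"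
  shows "smooth_on S (\<lambda>x. h (f x))"
  by (rule smooth_on_compose[OF assms(2) smooth_on_UNIV_I[OF Ck_on_linear[OF _ assms(1) Ck_on_id]], of UNIV]) auto

lemma smooth_on_linear' [intro]: "bounded_linear h ==> smooth_on S h"
  by (rule smooth_on_linear[OF _ smooth_on_id])

lemma smooth_onE2:
  assumes "smooth_on S f" "smooth_on S g" "x \<in> S"
  obtains U f' g' where "open U" "x \<in> U" "!!k. Ck_on k f' U" "!!k. Ck_on k g' U"
    "!!y. y \<in> S ==> y \<in> U ==> f y = f' y" "!!y. y \<in> S ==> y \<in> U ==> g y = g' y"
proof -
  obtain U f' where U: "open U" "x \<in> U" "!!k. Ck_on k f' U" "!!y. y \<in> S ==> y \<in> U ==> f y = f' y"
    using smooth_onE[OF assms(1,3)] by metis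
  obtain V g' where V: "open V" "x \<in> V" "!!k. Ck_on k g' V" "!!y. y \<in> S ==> y \<in> V ==> g y = g' y"
    using smooth_onE[OF assms(2,3)] by metis
  show ?thesis
    by (rule that[of "U \<inter> V" f' g'])
      (use U(1,2,4) V(1,2,4) open_Int[OF U(1) V(1)] Ck_on_subset[OF U(3)] Ck_on_subset[OF V(3)] in simp_all)
qed

lemma smooth_on_bilinear:
  assumes "bounded_bilinear h" "smooth_on S f" "smooth_on S g"
  shows "smooth_on S (\<lambda>x. h (f x) (g x))"
proof (rule smooth_onI)
  fix x assume "x \<in> S"
  obtain U f' g' where U: "open U" "x \<in> U" "!!k. Ck_on k f' U" "!!k. Ck_on k g' U"
    "!!y. y \<in> S ==> y \<in> U ==> f y = f' y" "!!y. y \<in> S ==> y \<in> U ==> g y = g' y"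
    by (rule smooth_onE2[OF assms(2,3) \<open>x \<in> S\<close>]) (rule that)
  then show "\<exists>U k. open U \<and> x \<in> U \<and> (\<forall>j. Ck_on j k U) \<and> (\<forall>y\<in>S \<inter> U. h (f y) (g y) = k y)"
    by (intro exI[of _ U] exI[of _ "\<lambda>x. h (f' x) (g' x)"]) (auto intro: Ck_on_bilinear[OF U(1) assms(1)])
qed

named_theorems smooth_intros

lemma smooth_on_add [smooth_intros]:
  assumes "smooth_on S f" "smooth_on S g"
  shows "smooth_on S (\<lambda>x. f x + g x)"
proof (rule smooth_onI)
  fix x assume "x \<in> S"
  obtain U f' g' where U: "open U" "x \<in> U" "!!k. Ck_on k f' U" "!!k. Ck_on k g' U"
    "!!y. y \<in> S ==> y \<in> U ==> f y = f' y" "!!y. y \<in> S ==> y \<in> U ==> g y = g' y"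
    by (rule smooth_onE2[OF assms \<open>x \<in> S\<close>]) (rule that)
  then show "\<exists>U k. open U \<and> x \<in> U \<and> (\<forall>j. Ck_on j k U) \<and> (\<forall>y\<in>S \<inter> U. f y + g y = k y)"
    by (intro exI[of _ U] exI[of _ "\<lambda>x. f' x + g' x"]) (auto intro!: Ck_on_add)
qed

declare smooth_on_const [smooth_intros] smooth_on_id [smooth_intros]

lemmas smooth_on_fst [smooth_intros] = smooth_on_linear[OF bounded_linear_fst]
lemmas smooth_on_snd [smooth_intros] = smooth_on_linear[OF bounded_linear_snd]
lemmas smooth_on_scaleR [smooth_intros] = smooth_on_bilinear[OF bounded_bilinear_scaleR]
lemmas smooth_on_inner [smooth_intros] = smooth_on_bilinear[OF bounded_bilinear_inner]
lemmas smooth_on_mult [smooth_intros] =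
  smooth_on_bilinear[OF bounded_bilinear_mult]
lemmas smooth_on_minus [smooth_intros] = smooth_on_linear[OF bounded_linear_minus[OF bounded_linear_ident]]

lemma smooth_on_diff [smooth_intros]:
  assumes "smooth_on S f" "smooth_on S g"
  shows "smooth_on S (\<lambda>x. f x - g x)"
proof -
  have "smooth_on S (\<lambda>x. f x + - g x)"
    by (rule smooth_on_add[OF assms(1) smooth_on_minus[OF assms(2)]])
  then show ?thesis by (simp only: diff_conv_add_uminus)
qed

lemma smooth_on_power2 [smooth_intros]:
  fixes f :: "'a::euclidean_space => real"
  shows "smooth_on S f ==> smooth_on S (\<lambda>x. (f x)\<^sup>2)"
  unfolding power2_eq_square by (rule smooth_on_mult)

lemma smooth_on_sum [smooth_intros]:
  assumes "!!i. i \<in> I ==> smooth_on S (f i)"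
  shows "smooth_on S (\<lambda>x. \<Sum>i\<in>I. f i x)"
proof (cases "finite I")
  case True
  then show ?thesis using assms
    by (induction I rule: finite_induct) (auto intro: smooth_on_add)
qed simp

lemma smooth_on_Pair [smooth_intros]:
  fixes f :: "'a::euclidean_space => 'b::euclidean_space" and g :: "'a => 'c::euclidean_space"
  assumes "smooth_on S f" "smooth_on S g"
  shows "smooth_on S (\<lambda>x. (f x, g x))"
proof -
  have l: "bounded_linear (\<lambda>y::'b. (y, 0::'c))" "bounded_linear (\<lambda>y::'c. (0::'b, y))"
    by (auto intro: bounded_linear_intros)
  show ?thesis
    using smooth_on_add[OF smooth_on_linear[OF l(1) assms(1)] smooth_on_linear[OF l(2) assms(2)]] by simp
qed

lemma smooth_on_inverse_real: "smooth_on {x::real. x ~= 0} inverse"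
proof -
  have o: "open {x::real. x ~= 0}" by (simp add: open_Collect_neq)
  have "Ck_on k inverse {x::real. x ~= 0}" for k
  proof (rule Ck_on_ode[where V = UNIV and R = "\<lambda>b y. - (y * b * y)"])
    show "Ck_on j (\<lambda>y::real. - (y * b * y)) UNIV" for b j
      by (rule smooth_onD) (intro smooth_on_minus smooth_on_mult smooth_on_id smooth_on_const open_UNIV)+
    show "(inverse has_derivative (\<lambda>b. - (inverse x * b * inverse x))) (at x)"
      if "x \<in> {x::real. x ~= 0}" for x
      using has_derivative_inverse'[of x UNIV] that by simp
  qed (use o in auto)
  then show ?thesis using smooth_on_open_iff[OF o] by blast
qed

lemma smooth_on_inverse [smooth_intros]:
  fixes f :: "'a::euclidean_space => real"
  assumes "smooth_on S f" "!!x. x \<in> S ==> f x ~= 0"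
  shows "smooth_on S (\<lambda>x. inverse (f x))"
  by (rule smooth_on_compose[OF assms(1) smooth_on_inverse_real]) (use assms in auto)

lemma smooth_on_divide [smooth_intros]:
  fixes f g :: "'a::euclidean_space => real"
  assumes "smooth_on S g" "smooth_on S f" "!!x. x \<in> S ==> f x ~= 0"
  shows "smooth_on S (\<lambda>x. g x / f x)"
  unfolding divide_inverse by (rule smooth_on_mult[OF assms(1) smooth_on_inverse[OF assms(2,3)]])

lemma smooth_on_real_ode:
  fixes g :: "real => real"
  assumes "open U" "open V" "g ` U <= V"
    and "!!x. x \<in> U ==> (g has_real_derivative R (g x)) (at x)"
    and "smooth_on V R"
  shows "smooth_on U g"
  unfolding smooth_on_open_iff[OF assms(1)]
proof
  fix k show "Ck_on k g U"
  proof (rule Ck_on_ode[OF assms(1-3), where R = "\<lambda>b y. R y * b"])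
    show "(g has_derivative (\<lambda>b. R (g x) * b)) (at x)" if "x \<in> U" for x
      using assms(4)[OF that] by (simp add: has_field_derivative_def)
    show "Ck_on j (\<lambda>y. R y * b) V" for b j
      by (rule smooth_onD[OF smooth_on_mult[OF assms(5) smooth_on_const] assms(2)])
  qed
qed

lemma smooth_on_sqrt_real: "smooth_on {0<..} sqrt"
proof (rule smooth_on_real_ode[where V = "{0<..}" and R = "\<lambda>y. 1 / (2 * y)"])
  show "smooth_on {0<..} (\<lambda>y::real. 1 / (2 * y))"
    by (rule smooth_on_divide[OF smooth_on_const smooth_on_mult[OF smooth_on_const smooth_on_id]]) simp
  show "(sqrt has_real_derivative 1 / (2 * sqrt x)) (at x)" if "x \<in> {0<..}" for x
    using that by (auto intro!: derivative_eq_intros simp: field_simps)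
qed auto

lemma smooth_on_norm [smooth_intros]:
  fixes f :: "'a::euclidean_space => 'b::euclidean_space"
  assumes "smooth_on S f" "!!x. x \<in> S ==> f x ~= 0"
  shows "smooth_on S (\<lambda>x. norm (f x))"
  unfolding norm_eq_sqrt_inner
  by (rule smooth_on_compose[OF _ smooth_on_sqrt_real])
    (use assms in \<open>auto intro!: smooth_on_inner\<close>)

lemma smooth_on_ln_real: "smooth_on {0<..} (ln::real=>real)"
proof -
  have "Ck_on (Suc k) ln {0::real<..}" for k
  proof (rule Ck_on_SucI[where f' = "\<lambda>x v. inverse x * v"])
    show "Ck_on k (\<lambda>x. inverse x * b) {0::real<..}" for b
      by (rule smooth_onD[OF smooth_on_mult[OF smooth_on_inverse[OF smooth_on_id] smooth_on_const]]) auto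
    show "(ln has_derivative (*) (inverse x)) (at x)" if "x \<in> {0::real<..}" for x
      using DERIV_ln[of x] that by (simp add: has_field_derivative_def)
  qed auto
  then have "Ck_on k ln {0::real<..}" for k by (rule Ck_on_Suc[rotated]) auto
  then show ?thesis by (simp add: smooth_on_open_iff)
qed

text \<open>Linearity in the vector reduces joint smoothness to that of the derivatives along
  \<open>Basis\<close>, which \<open>Ck_on\<close> provides.\<close>

lemma smooth_on_frechet_derivative:
  fixes f :: "'a::euclidean_space => 'b::euclidean_space"
  assumes "open U" "smooth_on U f"
  shows "smooth_on (U \<times> UNIV) (\<lambda>(x, v). frechet_derivative f (at x) v)"
proof -
  have D: "(f has_derivative frechet_derivative f (at x)) (at x)" if "x \<in> U" for x
    by (rule Ck_on_SucD(1)[OF assms(1) smooth_onD[OF assms(2,1)] that])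
  have b: "smooth_on U (\<lambda>x. frechet_derivative f (at x) b)" if "b \<in> Basis" for b
    unfolding smooth_on_open_iff[OF assms(1)]
    using Ck_on_SucD(2)[OF assms(1) smooth_onD[OF assms(2,1)] that] by blast
  have b': "smooth_on (U \<times> UNIV) (\<lambda>z::'a \<times> 'a. frechet_derivative f (at (fst z)) b)"
    if "b \<in> Basis" for b
    by (rule smooth_on_compose[OF smooth_on_fst[OF smooth_on_id] b[OF that]]) auto
  have "smooth_on (U \<times> UNIV)
      (\<lambda>z. \<Sum>b\<in>Basis. (snd z \<bullet> b) *\<^sub>R frechet_derivative f (at (fst z)) b)"
    by (rule smooth_on_sum, rule smooth_on_scaleR[OF smooth_on_inner[OF smooth_on_snd[OF smooth_on_id]
        smooth_on_const] b'])
  then show ?thesis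
  proof (rule smooth_on_cong)
    fix z :: "'a \<times> 'a" assume "z \<in> U \<times> UNIV"
    then have lin: "linear (frechet_derivative f (at (fst z)))"
      using D[of "fst z"] has_derivative_linear by (metis mem_Times_iff)
    show "(\<Sum>b\<in>Basis. (snd z \<bullet> b) *\<^sub>R frechet_derivative f (at (fst z)) b) =
        (case z of (x, v) => frechet_derivative f (at x) v)"
      using arg_cong[OF euclidean_representation[of "snd z"], of "frechet_derivative f (at (fst z))"]
      by (simp add: case_prod_beta linear_sum[OF lin] linear_cmul[OF lin])
  qed
qed

lemma smooth_has_derivative_at:
  assumes "open U" "smooth_on U f" "x \<in> U"
  shows "(f has_derivative frechet_derivative f (at x)) (at x)"
  by (rule Ck_on_SucD(1)[OF assms(1) smooth_onD[OF assms(2,1)] assms(3)])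

text \<open>The derivative is continuous on the compact ball and vanishes outside it; the bounds for
  the basis directions add up to a bound for all directions.\<close>

lemma smooth_derivative_bounded:
  fixes f :: "'a::euclidean_space => 'b::euclidean_space"
  assumes f: "smooth_on UNIV f"
    and zero: "!!x. norm x > R ==> (f has_derivative (\<lambda>_. 0)) (at x)"
  obtains L where "L \<ge> 0" "!!x v. norm (frechet_derivative f (at x) v) <= L * norm v"
proof -
  let ?D = "\<lambda>b x. frechet_derivative f (at x) b"
  have "\<exists>C. \<forall>x. norm (?D b x) <= C" if "b \<in> Basis" for b
  proof -
    have "continuous_on (cball 0 R) (?D b)"
      using Ck_on_SucD(2)[OF open_UNIV smooth_onD[OF f open_UNIV] that, of 0]
      by (auto intro: continuous_on_subset)
    then have "bounded (?D b ` cball 0 R)"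
      by (intro compact_imp_bounded compact_continuous_image) auto
    then obtain C where "\<forall>y\<in>?D b ` cball 0 R. norm y <= C" unfolding bounded_iff by blast
    then have C: "norm (?D b x) <= C" if "norm x <= R" for x using that by simp
    have "norm (?D b x) <= max C 0" for x
    proof (cases "norm x <= R")
      case False
      then have "?D b x = 0" using frechet_derivative_at[OF zero[of x], symmetric] by simp
      then show ?thesis by simp
    next
      case True
      then show ?thesis using C[OF True] by simp
    qed
    then show ?thesis by blast
  qed
  then have "\<forall>b\<in>Basis. \<exists>C. \<forall>x. norm (?D b x) <= C" by blast
  from bchoice[OF this] obtain C where "\<forall>b\<in>Basis. \<forall>x. norm (?D b x) <= C b" by (elim exE)
  then have C: "norm (?D b x) <= C b" if "b \<in> Basis" for b x using that by simp
  have C0: "C b \<ge> 0" if "b \<in> Basis" for b by (rule order_trans[OF norm_ge_zero C[OF that, of 0]])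
  show thesis
  proof (rule that[of "\<Sum>b\<in>Basis. C b"])
    show "norm (frechet_derivative f (at x) v) <= (\<Sum>b\<in>Basis. C b) * norm v" for x v
    proof -
      have lin: "linear (frechet_derivative f (at x))"
        using has_derivative_linear[OF smooth_has_derivative_at[OF open_UNIV f]] by simp
      have "frechet_derivative f (at x) v = (\<Sum>b\<in>Basis. (v \<bullet> b) *\<^sub>R ?D b x)"
        by (subst (1) euclidean_representation[symmetric, of v])
          (simp add: linear_sum[OF lin] linear_cmul[OF lin])
      also have "norm \<dots> <= (\<Sum>b\<in>Basis. norm v * C b)"
        by (rule sum_norm_le) (simp add: mult_mono C Basis_le_norm)
      finally show ?thesis by (simp add: sum_distrib_left mult.commute)
    qed
  qed (auto intro: sum_nonneg C0)
qed

section \<open>Flat functions and the smooth step\<close>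

definition flat_exp :: "nat => real => real" where
  "flat_exp k x = (if x > 0 then inverse x ^ k * exp (- inverse x) else 0)"

lemma flat_exp_tendsto: "(flat_exp k \<longlongrightarrow> 0) (at 0)"
proof -
  have "((\<lambda>x::real. inverse x ^ k / exp (inverse x)) \<longlongrightarrow> 0) (at_right 0)"
    by (rule filterlim_compose[OF tendsto_power_div_exp_0 filterlim_inverse_at_top_right])
  then have "(flat_exp k \<longlongrightarrow> 0) (at_right 0)"
  proof (rule Lim_transform_eventually)
    show "\<forall>\<^sub>F x in at_right 0. inverse x ^ k / exp (inverse x) = flat_exp k x"
      using eventually_at_right_less[of 0]
      by eventually_elim (simp add: flat_exp_def exp_minus divide_inverse)
  qed
  moreover have "(flat_exp k \<longlongrightarrow> 0) (at_left 0)"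
    by (rule Lim_transform_eventually[OF tendsto_const])
      (auto simp: flat_exp_def eventually_at_left_field intro!: exI[of _ "-1"])
  ultimately show ?thesis by (simp add: filterlim_at_split)
qed

text \<open>Up to linear combinations the family is closed under differentiation, which makes an
  induction on the order possible. At 0 the difference quotient of the function of index
  \<open>k\<close> is the function of index \<open>k + 1\<close>, which tends to 0.\<close>

lemma flat_exp_deriv:
  "(flat_exp k has_real_derivative (flat_exp (k + 2) x - k * flat_exp (k + 1) x)) (at x)"
proof -
  consider "x > 0" | "x < 0" | "x = 0" by linarith
  then show ?thesis
  proof cases
    case 1
    have "((\<lambda>x. inverse x ^ k * exp (- inverse x)) has_real_derivative
        (flat_exp (k + 2) x - k * flat_exp (k + 1) x)) (at x)"
    proof -
      have "((\<lambda>x. inverse x ^ k * exp (- inverse x)) has_real_derivative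
          (inverse x ^ k * (exp (- inverse x) * (inverse x * inverse x)) +
           real k * (- (inverse x * inverse x) * inverse x ^ (k - 1)) * exp (- inverse x))) (at x)"
        using 1 by (intro derivative_eq_intros | simp)+
      moreover have "inverse x ^ k * (exp (- inverse x) * (inverse x * inverse x)) +
           real k * (- (inverse x * inverse x) * inverse x ^ (k - 1)) * exp (- inverse x) =
           flat_exp (k + 2) x - k * flat_exp (k + 1) x"
        using 1 by (cases k) (simp_all add: flat_exp_def algebra_simps)
      ultimately show ?thesis by (simp only:)
    qed
    then show ?thesis
      by (rule has_field_derivative_transform_within_open[of _ _ _ "{0<..}"])
        (use 1 in \<open>auto simp: flat_exp_def\<close>)
  next
    case 2
    have "((\<lambda>x. 0) has_real_derivative (flat_exp (k + 2) x - k * flat_exp (k + 1) x)) (at x)"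
      using 2 by (simp add: flat_exp_def)
    then show ?thesis
      by (rule has_field_derivative_transform_within_open[of _ _ _ "{..<0}"])
        (use 2 in \<open>auto simp: flat_exp_def\<close>)
  next
    case 3
    have "((\<lambda>h. (flat_exp k (0 + h) - flat_exp k 0) / h) \<longlongrightarrow> 0) (at 0)"
      by (rule Lim_transform_eventually[OF flat_exp_tendsto[of "Suc k"]])
        (auto simp: flat_exp_def eventually_at_filter field_simps)
    then show ?thesis using 3 by (simp add: DERIV_def flat_exp_def)
  qed
qed

lemma smooth_on_flat_exp: "smooth_on S (flat_exp k)"
proof (rule smooth_on_UNIV_I)
  fix j show "Ck_on j (flat_exp k) UNIV"
  proof (induction j arbitrary: k)
    case 0
    then show ?case
      using DERIV_isCont[OF flat_exp_deriv] by (auto simp: continuous_on_eq_continuous_at)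
  next
    case (Suc j)
    show ?case
    proof (rule Ck_on_SucI[where f' = "\<lambda>x v. (flat_exp (k + 2) x + (- real k) * flat_exp (k + 1) x) * v"])
      show "(flat_exp k has_derivative
          (*) (flat_exp (k + 2) x + (- real k) * flat_exp (k + 1) x)) (at x)" for x
        using flat_exp_deriv[of k x] by (simp add: has_field_derivative_def)
      show "Ck_on j (\<lambda>x. (flat_exp (k + 2) x + (- real k) * flat_exp (k + 1) x) * b) UNIV" for b
        by (rule Ck_on_linear[OF open_UNIV bounded_linear_mult_left],
            rule Ck_on_add[OF open_UNIV Suc],
            rule Ck_on_linear[OF open_UNIV bounded_linear_mult_right Suc])
    qed simp
  qed
qed

text \<open>The denominator is positive because \<open>x\<close> or \<open>1 - x\<close> is. The two
  plateaus matter later: reparametrizing with \<open>step\<close> extends an isotopy to all real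
  times, where derivatives on open sets are available, and moves can be switched on one after the
  other.\<close>

definition step :: "real => real" where
  "step x = flat_exp 0 x / (flat_exp 0 x + flat_exp 0 (1 - x))"

lemma step_denom_pos: "flat_exp 0 x + flat_exp 0 (1 - x) > 0"
  by (auto simp: flat_exp_def add_pos_pos)

lemma step_eq_0 [simp]: "x <= 0 ==> step x = 0"
  by (simp add: step_def flat_exp_def)

lemma step_eq_1 [simp]: "x \<ge> 1 ==> step x = 1"
  by (simp add: step_def flat_exp_def)

lemma step_nonneg [simp]: "0 <= step x" and step_le_1 [simp]: "step x <= 1"
proof -
  have "flat_exp 0 x \<ge> 0" "flat_exp 0 (1 - x) \<ge> 0" by (auto simp: flat_exp_def)
  then show "0 <= step x" "step x <= 1"
    using step_denom_pos[of x] by (auto simp: step_def divide_simps)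
qed

lemma smooth_on_step_real: "smooth_on UNIV step"
  unfolding step_def
proof (rule smooth_on_divide)
  have f: "smooth_on UNIV (\<lambda>x. flat_exp 0 (1 - x))"
    by (rule smooth_on_compose[OF smooth_on_diff[OF smooth_on_const smooth_on_id] smooth_on_flat_exp]) auto
  show "smooth_on UNIV (\<lambda>x. flat_exp 0 x + flat_exp 0 (1 - x))"
    by (rule smooth_on_add[OF smooth_on_flat_exp f])
qed (use step_denom_pos in \<open>auto simp: smooth_on_flat_exp less_le\<close>)

lemma smooth_on_step [smooth_intros]: "smooth_on S f ==> smooth_on S (\<lambda>x. step (f x))"
  by (rule smooth_on_compose[OF _ smooth_on_step_real]) auto

lemma step_deriv_bounded:
  obtains K where "K \<ge> 0" "!!x. \<exists>D. (step has_real_derivative D) (at x) \<and> \<bar>D\<bar> <= K"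
proof -
  have z: "(step has_derivative (\<lambda>_. 0)) (at x)" if "norm x > 1" for x :: real
  proof (cases "x > 1")
    case True
    then show ?thesis
      by (intro has_derivative_transform_within_open[OF has_derivative_const[of 1], of "{1<..}"]) auto
  next
    case False
    then have "x < 0" using that by auto
    then show ?thesis
      by (intro has_derivative_transform_within_open[OF has_derivative_const[of 0], of "{..<0}"]) auto
  qed
  obtain L where L: "L \<ge> 0" "!!x v. norm (frechet_derivative step (at x) v) <= L * norm v"
    by (rule smooth_derivative_bounded[OF smooth_on_step_real z], assumption, rule that)
  show thesis
  proof (rule that[OF L(1)])
    fix x :: real
    have d: "(step has_derivative frechet_derivative step (at x)) (at x)"
      by (rule smooth_has_derivative_at[OF open_UNIV smooth_on_step_real]) simp
    define c where "c = frechet_derivative step (at x) 1"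
    have "frechet_derivative step (at x) v = c * v" for v
      unfolding c_def using linear_cmul[OF has_derivative_linear[OF d], of v 1] by (simp add: mult.commute)
    then have "frechet_derivative step (at x) = (*) c" by (rule ext)
    then have "(step has_real_derivative c) (at x)"
      using d unfolding has_field_derivative_def by simp
    moreover have "\<bar>c\<bar> <= L" using L(2)[of x 1] by (simp add: c_def)
    ultimately show "\<exists>D. (step has_real_derivative D) (at x) \<and> \<bar>D\<bar> <= L"
      by blast
  qed
qed

section \<open>Isotopies and mapping class groups\<close>

text \<open>Elements of \<open>diffeos S B\<close> are the identity off \<open>S\<close>, hence
  bijections of the ambient space. The ambient inverse does not depend on \<open>S\<close>, which is
  convenient when a map is regarded on several surfaces.\<close>

abbreviation finv :: "('a => 'b) => 'b => 'a" where
  "finv f \<equiv> inv_into UNIV f"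

lemma diffeosI:
  assumes "smooth_on S f" "smooth_on S g"
    and "!!p. p \<in> S ==> f p \<in> S" "!!p. p \<in> S ==> g p \<in> S"
    and "!!p. p \<in> S ==> g (f p) = p" "!!p. p \<in> S ==> f (g p) = p"
    and "!!p. p \<notin> S ==> f p = p"
    and "open U" "B <= U" "!!p. p \<in> U ==> f p = p"
  shows "f \<in> diffeos S B"
proof -
  have bij: "bij_betw f S S"
    by (rule bij_betw_byWitness[where f' = g]) (use assms in auto)
  have "inv_into S f p = g p" if "p \<in> S" for p
    using inv_into_f_f[OF bij_betw_imp_inj_on[OF bij] assms(4)[OF that]] assms(6)[OF that] by simp
  then have "smooth_on S (inv_into S f)"
    by (intro smooth_on_cong[OF assms(2)]) simp
  then show ?thesis
    unfolding diffeos_def diffeomorphism_def mem_Collect_eq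
    using bij assms(1,7-10) by blast
qed

lemma diffeosD:
  assumes "f \<in> diffeos S B"
  shows "smooth_on S f" "bij f" "smooth_on S (finv f)" "f ` S = S"
    "!!p. p \<notin> S ==> f p = p" "!!p. p \<in> S ==> f p \<in> S" "!!p. p \<in> S ==> finv f p \<in> S"
    "!!p. p \<in> B ==> f p = p"
proof -
  have d: "bij_betw f S S" "smooth_on S f" "smooth_on S (inv_into S f)"
    "!!p. p \<notin> S ==> f p = p"
    using assms unfolding diffeos_def diffeomorphism_def by blast+
  show "!!p. p \<in> B ==> f p = p" using assms unfolding diffeos_def by blast
  have im: "f ` S = S" using d(1) by (simp add: bij_betw_def)
  have "bij_betw f (- S) (- S)"
    by (rule bij_betw_cong[THEN iffD1, OF _ bij_betw_id]) (use d(4) in auto)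
  then have "bij_betw f (S \<union> - S) (S \<union> - S)"
    by (rule bij_betw_combine[OF d(1)]) auto
  then show b: "bij f" by simp
  show "smooth_on S f" "f ` S = S" "!!p. p \<notin> S ==> f p = p" by (fact d im)+
  show "!!p. p \<in> S ==> f p \<in> S" using im by auto
  have e: "inv_into S f p = finv f p" if p: "p \<in> S" for p
  proof -
    have "p \<in> f ` S" using p im by simp
    then show ?thesis
      by (metis b bij_inv_eq_iff f_inv_into_f)
  qed
  show "smooth_on S (finv f)" by (rule smooth_on_cong[OF d(3) e])
  show "!!p. p \<in> S ==> finv f p \<in> S"
    using e im inv_into_into by metis
qed

lemma diffeos_nbhd:
  assumes "f \<in> diffeos S B"
  obtains U where "open U" "B <= U" "!!p. p \<in> U ==> f p = p"
  using assms unfolding diffeos_def by blast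

lemma diffeos_inv_simps:
  assumes "f \<in> diffeos S B"
  shows "finv f (f p) = p" "f (finv f p) = p" "finv f \<circ> f = id" "f \<circ> finv f = id"
  using diffeosD(2)[OF assms] by (auto simp: bij_def inj_iff surj_iff surj_f_inv_f)

lemma id_diffeos: "id \<in> diffeos S B"
  by (rule diffeosI[where g = id and U = UNIV]) auto

lemma inv_diffeos:
  assumes "f \<in> diffeos S B" shows "finv f \<in> diffeos S B"
proof -
  obtain U where U: "open U" "B <= U" "!!p. p \<in> U ==> f p = p"
    by (rule diffeos_nbhd[OF assms]) (rule that)
  have i: "finv f p = p" if "f p = p" for p
    using diffeos_inv_simps(1)[OF assms, of p] that by simp
  show ?thesis
    by (rule diffeosI[OF diffeosD(3,1)[OF assms] _ _ _ _ _ U(1,2)])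
      (use diffeosD[OF assms] diffeos_inv_simps[OF assms] i U(3) in simp_all)
qed

lemma comp_diffeos:
  assumes f: "f \<in> diffeos S B" and g: "g \<in> diffeos S B"
  shows "f \<circ> g \<in> diffeos S B"
proof -
  obtain U where U: "open U" "B <= U" "!!p. p \<in> U ==> f p = p"
    by (rule diffeos_nbhd[OF f]) (rule that)
  obtain V where V: "open V" "B <= V" "!!p. p \<in> V ==> g p = p"
    by (rule diffeos_nbhd[OF g]) (rule that)
  show ?thesis
  proof (rule diffeosI[where g = "finv g \<circ> finv f" and U = "U \<inter> V"])
    show "smooth_on S (f \<circ> g)" unfolding o_def
      by (rule smooth_on_compose[OF diffeosD(1)[OF g] diffeosD(1)[OF f] diffeosD(6)[OF g]])
    show "smooth_on S (finv g \<circ> finv f)" unfolding o_def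
      by (rule smooth_on_compose[OF diffeosD(3)[OF f] diffeosD(3)[OF g] diffeosD(7)[OF f]])
  qed (use diffeosD[OF f] diffeosD[OF g] diffeos_inv_simps[OF f] diffeos_inv_simps[OF g] U V in auto)
qed

lemma smooth_isotopyD:
  assumes "smooth_isotopy S B F"
  shows "!!t. t \<in> {0..1} ==> F t \<in> diffeos S B" "smooth_on ({0..1} \<times> S) (\<lambda>(t, p). F t p)"
  using assms unfolding smooth_isotopy_def by blast+

lemma smooth_isotopy_nbhd:
  assumes "smooth_isotopy S B F"
  obtains U where "open U" "B <= U" "!!t p. t \<in> {0..1} ==> p \<in> U ==> F t p = p"
  using assms unfolding smooth_isotopy_def by blast

lemma smooth_isotopyI:
  assumes "!!t. t \<in> {0..1} ==> F t \<in> diffeos S B" "smooth_on ({0..1} \<times> S) (\<lambda>(t, p). F t p)"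
    and "open U" "B <= U" "!!t p. t \<in> {0..1} ==> p \<in> U ==> F t p = p"
  shows "smooth_isotopy S B F"
  using assms unfolding smooth_isotopy_def by blast

lemma smooth_family_reparam:
  fixes T :: "'a::euclidean_space set" and T' :: "'b::euclidean_space set"
  assumes "smooth_on (T \<times> S) (\<lambda>(t, p). F t p)" "smooth_on T' r" "!!t. t \<in> T' ==> r t \<in> T"
  shows "smooth_on (T' \<times> S) (\<lambda>(t, p). F (r t) p)"
proof -
  have "smooth_on (T' \<times> S) (\<lambda>z. r (fst z))"
    by (rule smooth_on_compose[OF smooth_on_fst[OF smooth_on_id] assms(2)]) auto
  then have "smooth_on (T' \<times> S) (\<lambda>z. (r (fst z), snd z))"
    by (rule smooth_on_Pair[OF _ smooth_on_snd[OF smooth_on_id]])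
  from smooth_on_compose[OF this assms(1)] show ?thesis
    using assms(3) by (simp add: case_prod_beta' mem_Times_iff)
qed

lemma smooth_family_comp:
  fixes T :: "'a::euclidean_space set"
  assumes "smooth_on (T \<times> S') (\<lambda>(t, p). F t p)" "smooth_on (T \<times> S) (\<lambda>(t, p). G t p)"
    and "!!t p. t \<in> T ==> p \<in> S ==> G t p \<in> S'"
  shows "smooth_on (T \<times> S) (\<lambda>(t, p). F t (G t p))"
proof -
  have "smooth_on (T \<times> S) (\<lambda>z. (fst z, (\<lambda>(t, p). G t p) z))"
    by (rule smooth_on_Pair[OF smooth_on_fst[OF smooth_on_id] assms(2)])
  from smooth_on_compose[OF this assms(1)] show ?thesis
    using assms(3) by (simp add: case_prod_beta' mem_Times_iff)
qed

lemma smooth_isotopy_reparam: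
  assumes "smooth_isotopy S B F" "smooth_on {0..1} r" "!!t. t \<in> {0..1} ==> r t \<in> {0..1}"
  shows "smooth_isotopy S B (\<lambda>t. F (r t))"
proof -
  obtain U where U: "open U" "B <= U" "!!t p. t \<in> {0..1} ==> p \<in> U ==> F t p = p"
    by (rule smooth_isotopy_nbhd[OF assms(1)]) (rule that)
  show ?thesis
    by (rule smooth_isotopyI[OF _ smooth_family_reparam[OF smooth_isotopyD(2)[OF assms(1)] assms(2,3)] U(1,2)])
      (use smooth_isotopyD(1)[OF assms(1)] assms(3) U(3) in simp_all)
qed

lemma smooth_family_const:
  fixes T :: "'a::euclidean_space set"
  assumes "smooth_on S f"
  shows "smooth_on (T \<times> S) (\<lambda>(t, p). f p)"
  unfolding case_prod_beta
  by (rule smooth_on_compose[OF smooth_on_snd[OF smooth_on_id] assms]) auto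

lemma smooth_isotopy_const:
  assumes "f \<in> diffeos S B" shows "smooth_isotopy S B (\<lambda>_. f)"
proof -
  obtain U where U: "open U" "B <= U" "!!p. p \<in> U ==> f p = p"
    by (rule diffeos_nbhd[OF assms]) (rule that)
  show ?thesis
    by (rule smooth_isotopyI[OF _ smooth_family_const[OF diffeosD(1)[OF assms]] U(1,2)])
      (use assms U(3) in simp_all)
qed

lemma smooth_isotopy_comp:
  assumes F: "smooth_isotopy S B F" and G: "smooth_isotopy S B G"
  shows "smooth_isotopy S B (\<lambda>t. F t \<circ> G t)"
proof -
  obtain U where U: "open U" "B <= U" "!!t p. t \<in> {0..1} ==> p \<in> U ==> F t p = p"
    by (rule smooth_isotopy_nbhd[OF F]) (rule that)
  obtain V where V: "open V" "B <= V" "!!t p. t \<in> {0..1} ==> p \<in> V ==> G t p = p"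
    by (rule smooth_isotopy_nbhd[OF G]) (rule that)
  show ?thesis
  proof (rule smooth_isotopyI[where U = "U \<inter> V"])
    show "F t \<circ> G t \<in> diffeos S B" if "t \<in> {0..1}" for t
      by (rule comp_diffeos[OF smooth_isotopyD(1)[OF F that] smooth_isotopyD(1)[OF G that]])
    show "smooth_on ({0..1} \<times> S) (\<lambda>(t, p). (F t \<circ> G t) p)"
      unfolding o_def
      by (rule smooth_family_comp[OF smooth_isotopyD(2)[OF F] smooth_isotopyD(2)[OF G]
            diffeosD(6)[OF smooth_isotopyD(1)[OF G]]])
    show "open (U \<inter> V)" "B <= U \<inter> V" using U V by auto
    show "(F t \<circ> G t) p = p" if "t \<in> {0..1}" "p \<in> U \<inter> V" for t p
      using U(3)[OF that(1)] V(3)[OF that(1)] that(2) by simp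
  qed
qed

lemma isotopicI: "smooth_isotopy S B F ==> F 0 = f ==> F 1 = g ==> isotopic S B f g"
  unfolding isotopic_def by blast

lemma isotopic_diffeos: "isotopic S B f g ==> f \<in> diffeos S B \<and> g \<in> diffeos S B"
  unfolding isotopic_def using smooth_isotopyD(1)[of S B _ 0] smooth_isotopyD(1)[of S B _ 1]
  by (elim exE conjE) auto

lemma isotopic_refl: "f \<in> diffeos S B ==> isotopic S B f f"
  by (rule isotopicI[OF smooth_isotopy_const]) auto

lemma smooth_isotopy_reverse: "smooth_isotopy S B F ==> smooth_isotopy S B (\<lambda>t. F (1 - t))"
  by (rule smooth_isotopy_reparam[OF _ smooth_on_diff[OF smooth_on_const smooth_on_id]]) auto

lemma isotopic_sym:
  assumes "isotopic S B f g" shows "isotopic S B g f"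
proof -
  obtain F where F: "smooth_isotopy S B F" "F 0 = f" "F 1 = g"
    using assms unfolding isotopic_def by blast
  show ?thesis
    by (rule isotopicI[OF smooth_isotopy_reverse[OF F(1)]]) (simp_all add: F)
qed

text \<open>Isotopies are concatenated without reparametrization: composing with the inverse of the
  intermediate diffeomorphism, one can run both of them at the same time.\<close>

lemma smooth_isotopy_concat:
  assumes F: "smooth_isotopy S B F" and G: "smooth_isotopy S B G"
  shows "smooth_isotopy S B (\<lambda>t. G t \<circ> (finv (F 1) \<circ> F t))"
  by (intro smooth_isotopy_comp G F smooth_isotopy_const inv_diffeos smooth_isotopyD(1)[OF F]) simp

lemma isotopic_trans:
  assumes "isotopic S B f g" "isotopic S B g h" shows "isotopic S B f h"
proof -
  obtain F where F: "smooth_isotopy S B F" "F 0 = f" "F 1 = g"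
    using assms(1) unfolding isotopic_def by blast
  obtain G where G: "smooth_isotopy S B G" "G 0 = g" "G 1 = h"
    using assms(2) unfolding isotopic_def by blast
  have g: "g \<in> diffeos S B" using isotopic_diffeos[OF assms(1)] by simp
  show ?thesis
    by (rule isotopicI[OF smooth_isotopy_concat[OF F(1) G(1)]])
      (simp_all add: F G diffeos_inv_simps[OF g] comp_assoc[symmetric])
qed

lemma isotopic_comp:
  assumes "isotopic S B f f'" "isotopic S B g g'" shows "isotopic S B (f \<circ> g) (f' \<circ> g')"
proof -
  obtain F where F: "smooth_isotopy S B F" "F 0 = f" "F 1 = f'"
    using assms(1) unfolding isotopic_def by blast
  obtain G where G: "smooth_isotopy S B G" "G 0 = g" "G 1 = g'"
    using assms(2) unfolding isotopic_def by blast
  show ?thesis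
    by (rule isotopicI[OF smooth_isotopy_comp[OF F(1) G(1)]]) (simp_all add: F G)
qed

lemma isotopy_class_eq: "isotopic S B f g ==> isotopy_class S B f = isotopy_class S B g"
  unfolding isotopy_class_def
  by (rule Collect_cong, rule iffI) (erule isotopic_trans[OF isotopic_sym], assumption, erule (1) isotopic_trans)

lemma isotopy_class_self: "f \<in> diffeos S B ==> f \<in> isotopy_class S B f"
  unfolding isotopy_class_def by (simp add: isotopic_refl)

lemma isotopy_class_mem: "g \<in> isotopy_class S B f ==> isotopic S B f g"
  unfolding isotopy_class_def by simp

text \<open>Products and extensions of classes are defined as unions over all representatives. Such
  a union collapses as soon as its terms do not depend on the representative, so this is the form in
  which well-definedness is used.\<close>

lemma isotopy_class_Union:
  assumes "f \<in> diffeos S B" "!!g. isotopic S B f g ==> H g = H f"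
  shows "(\<Union>g\<in>isotopy_class S B f. H g) = H f"
proof -
  have "(\<Union>g\<in>isotopy_class S B f. H g) = (\<Union>g\<in>isotopy_class S B f. H f)"
    by (rule SUP_cong[OF refl assms(2)[OF isotopy_class_mem]])
  then show ?thesis using isotopy_class_self[OF assms(1)] by auto
qed

lemma mcg_mult:
  assumes f: "f \<in> diffeos S B" and g: "g \<in> diffeos S B"
  shows "isotopy_class S B f \<otimes>\<^bsub>mapping_class_group S B\<^esub> isotopy_class S B g = isotopy_class S B (f \<circ> g)"
proof -
  have "(\<Union>g'\<in>isotopy_class S B g. isotopy_class S B (f' \<circ> g')) = isotopy_class S B (f' \<circ> g)"
    if "f' \<in> diffeos S B" for f'
    by (rule isotopy_class_Union[OF g])
      (rule isotopy_class_eq[OF isotopic_comp[OF isotopic_refl[OF that] isotopic_sym]])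
  then have "(\<Union>f'\<in>isotopy_class S B f. \<Union>g'\<in>isotopy_class S B g. isotopy_class S B (f' \<circ> g')) =
      (\<Union>f'\<in>isotopy_class S B f. isotopy_class S B (f' \<circ> g))"
    by (intro SUP_cong refl) (simp add: isotopic_diffeos[OF isotopy_class_mem])
  also have "\<dots> = isotopy_class S B (f \<circ> g)"
    by (rule isotopy_class_Union[OF f])
      (rule isotopy_class_eq[OF isotopic_comp[OF isotopic_sym isotopic_refl[OF g]]])
  finally show ?thesis by (simp add: mapping_class_group_def)
qed

lemma mcg_carrier: "carrier (mapping_class_group S B) = isotopy_class S B ` diffeos S B"
  and mcg_one: "\<one>\<^bsub>mapping_class_group S B\<^esub> = isotopy_class S B id"
  by (simp_all add: mapping_class_group_def)

lemma mapping_class_group_group: "group (mapping_class_group S B)"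
proof (rule groupI)
  let ?G = "mapping_class_group S B"
  fix x assume "x \<in> carrier ?G"
  then obtain f where f: "f \<in> diffeos S B" "x = isotopy_class S B f" by (auto simp: mcg_carrier)
  show "\<exists>y\<in>carrier ?G. y \<otimes>\<^bsub>?G\<^esub> x = \<one>\<^bsub>?G\<^esub>"
    by (rule bexI[of _ "isotopy_class S B (finv f)"])
      (simp_all add: mcg_carrier mcg_mult mcg_one f inv_diffeos[OF f(1)] diffeos_inv_simps(3)[OF f(1)])
next
  let ?G = "mapping_class_group S B"
  fix x y assume "x \<in> carrier ?G" "y \<in> carrier ?G"
  then show "x \<otimes>\<^bsub>?G\<^esub> y \<in> carrier ?G"
    by (auto simp: mcg_carrier mcg_mult intro!: imageI comp_diffeos)
next
  let ?G = "mapping_class_group S B"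
  fix x y z assume "x \<in> carrier ?G" "y \<in> carrier ?G" "z \<in> carrier ?G"
  then obtain f g h where "f \<in> diffeos S B" "x = isotopy_class S B f" "g \<in> diffeos S B"
    "y = isotopy_class S B g" "h \<in> diffeos S B" "z = isotopy_class S B h" by (auto simp: mcg_carrier)
  then show "x \<otimes>\<^bsub>?G\<^esub> y \<otimes>\<^bsub>?G\<^esub> z = x \<otimes>\<^bsub>?G\<^esub> (y \<otimes>\<^bsub>?G\<^esub> z)"
    by (simp add: mcg_mult comp_diffeos comp_assoc)
next
  let ?G = "mapping_class_group S B"
  show "\<one>\<^bsub>?G\<^esub> \<in> carrier ?G" by (simp add: mcg_carrier mcg_one id_diffeos)
  fix x assume "x \<in> carrier ?G"
  then obtain f where "f \<in> diffeos S B" "x = isotopy_class S B f" by (auto simp: mcg_carrier)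
  then show "\<one>\<^bsub>?G\<^esub> \<otimes>\<^bsub>?G\<^esub> x = x" by (simp add: mcg_mult mcg_one id_diffeos)
qed

section \<open>Extension by the identity to a larger surface\<close>

locale surface_ext =
  fixes S B S' B' :: "R3 set"
  assumes closed: "closed S" and sub: "S <= S'" and bd: "B' <= B \<union> - S"
    and inner: "!!p. p \<in> S ==> p \<notin> B ==> \<exists>U. open U \<and> p \<in> U \<and> S' \<inter> U <= S"
begin

text \<open>Smoothness is checked locally. Off the closed set \<open>S\<close> and near
  \<open>B\<close> the family is the identity, and at the remaining points the larger surface has no
  points nearby other than those of \<open>S\<close>.\<close>

lemma family:
  fixes T :: "'a::euclidean_space set"
  assumes s: "smooth_on (T \<times> S) (\<lambda>(t, p). F t p)"
    and i: "!!t p. t \<in> T ==> p \<notin> S ==> F t p = p"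
    and U: "open U" "B <= U" "!!t p. t \<in> T ==> p \<in> U ==> F t p = p"
  shows "smooth_on (T \<times> S') (\<lambda>(t, p). F t p)"
proof (rule smooth_on_local)
  fix z assume "z \<in> T \<times> S'"
  then obtain t p where z: "z = (t, p)" "t \<in> T" "p \<in> S'" by auto
  have idc: "smooth_on (T \<times> S' \<inter> UNIV \<times> V) (\<lambda>(t, p). F t p)"
    if "!!t p. t \<in> T ==> p \<in> V ==> F t p = p" for V
    by (rule smooth_on_cong[OF smooth_on_snd[OF smooth_on_id]]) (use that in auto)
  consider "p \<notin> S" | "p \<in> B" | "p \<in> S" "p \<notin> B" by blast
  then show "\<exists>V. open V \<and> z \<in> V \<and> smooth_on (T \<times> S' \<inter> V) (\<lambda>(t, p). F t p)"
  proof cases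
    case 1
    then show ?thesis
      by (intro exI[of _ "UNIV \<times> - S"]) (use closed z i idc[of "- S"] in \<open>auto intro: open_Times\<close>)
  next
    case 2
    then show ?thesis
      by (intro exI[of _ "UNIV \<times> U"]) (use z U idc[of U] in \<open>auto intro: open_Times\<close>)
  next
    case 3
    then obtain V where V: "open V" "p \<in> V" "S' \<inter> V <= S" using inner by blast
    have "smooth_on (T \<times> S' \<inter> UNIV \<times> V) (\<lambda>(t, p). F t p)"
      by (rule smooth_on_subset[OF s]) (use V in auto)
    then show ?thesis
      by (intro exI[of _ "UNIV \<times> V"]) (use z V in \<open>auto intro: open_Times\<close>)
  qed
qed

lemma nbhd:
  assumes "open U" "B <= U"
  shows "open (U \<union> - S)" "B' <= U \<union> - S"
  using assms closed bd by auto

lemma single: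
  assumes f: "f \<in> diffeos S B" shows "smooth_on S' f"
proof -
  obtain U where U: "open U" "B <= U" "!!p. p \<in> U ==> f p = p"
    by (rule diffeos_nbhd[OF f]) (rule that)
  have "smooth_on ((UNIV::real set) \<times> S') (\<lambda>(t, p). f p)"
    by (rule family[OF smooth_family_const[OF diffeosD(1)[OF f]] diffeosD(5)[OF f] U(1,2)])
      (use U in auto)
  from smooth_on_compose[OF smooth_on_Pair[OF smooth_on_const[of _ 0] smooth_on_id] this, of S']
  show ?thesis by simp
qed

lemma diffeos_sub:
  assumes f: "f \<in> diffeos S B" shows "f \<in> diffeos S' B'"
proof -
  obtain U where U: "open U" "B <= U" "!!p. p \<in> U ==> f p = p"
    by (rule diffeos_nbhd[OF f]) (rule that)
  have o: "f p = p" if "p \<notin> S'" for p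
    using diffeosD(5)[OF f] sub that by blast
  have o': "f p = p" if "p \<in> U \<union> - S" for p
    using diffeosD(5)[OF f, of p] U(3)[of p] that by blast
  have m: "g p \<in> S'" if "g \<in> diffeos S B" "p \<in> S'" for g p
    using diffeosD(5,6)[OF that(1), of p] that(2) sub by (cases "p \<in> S") auto
  show ?thesis
    by (rule diffeosI[OF single[OF f] single[OF inv_diffeos[OF f]] m[OF f] m[OF inv_diffeos[OF f]]
          diffeos_inv_simps(1,2)[OF f] o nbhd[OF U(1,2)] o'])
qed

lemma isotopy:
  assumes F: "smooth_isotopy S B F" shows "smooth_isotopy S' B' F"
proof -
  obtain U where U: "open U" "B <= U" "!!t p. t \<in> {0..1} ==> p \<in> U ==> F t p = p"
    by (rule smooth_isotopy_nbhd[OF F]) (rule that)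
  have o: "F t p = p" if "t \<in> {0..1}" "p \<notin> S" for t p
    by (rule diffeosD(5)[OF smooth_isotopyD(1)[OF F that(1)] that(2)])
  have o': "F t p = p" if "t \<in> {0..1}" "p \<in> U \<union> - S" for t p
    using o[OF that(1), of p] U(3)[OF that(1), of p] that(2) by blast
  show ?thesis
    by (rule smooth_isotopyI[OF diffeos_sub[OF smooth_isotopyD(1)[OF F]]
          family[OF smooth_isotopyD(2)[OF F] o U] nbhd[OF U(1,2)] o'])
qed

lemma isotopic: "isotopic S B f g ==> isotopic S' B' f g"
  unfolding isotopic_def by (elim exE conjE) (intro exI conjI isotopy)

lemma extend_class:
  assumes "f \<in> diffeos S B"
  shows "extend_class S' B' (isotopy_class S B f) = isotopy_class S' B' f"
  unfolding extend_class_def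
  by (rule isotopy_class_Union[OF assms]) (rule isotopy_class_eq[OF isotopic_sym[OF isotopic]])

end

section \<open>Differentials and unit tangent vectors\<close>

definition dif :: "R3 set => (R3 => 'b::euclidean_space) => R3 => R3 => 'b" where
  "dif S f p = frechet_derivative f (at p within S)"

definition tangent_bundle :: "R3 set => (R3 \<times> R3) set" where
  "tangent_bundle S = {(p, w). p \<in> S \<and> w \<in> tangent_space S p}"

lemma dif_has_derivative: "smooth_on S f ==> p \<in> S ==> (f has_derivative dif S f p) (at p within S)"
  unfolding dif_def by (rule smooth_on_has_derivative)

lemma dif_linear: "smooth_on S f ==> p \<in> S ==> linear (dif S f p)"
  by (rule has_derivative_linear[OF dif_has_derivative])

lemma tangent_spaceI:
  "c 0 = p ==> c ` {0..1} <= S ==> (c has_vector_derivative w) (at (0::real) within {0..1}) ==>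
    w \<in> tangent_space S p"
  unfolding tangent_space_def by (rule span_base) blast

lemma subspace_tangent_space: "subspace (tangent_space S p)"
  unfolding tangent_space_def by (rule subspace_span)

lemma tangent_space_mono:
  assumes "S <= S'" shows "tangent_space S p <= tangent_space S' p"
  unfolding tangent_space_def
  by (rule span_mono) (use assms in blast)

lemma curve_compose_derivative:
  assumes D: "(f has_derivative D) (at p within S)"
    and c: "c 0 = p" "c ` {0..1} <= S" "(c has_vector_derivative w) (at (0::real) within {0..1})"
  shows "((\<lambda>t. f (c t)) has_vector_derivative D w) (at 0 within {0..1})"
proof -
  have "(f has_derivative D) (at (c 0) within c ` {0..1})"
    using has_derivative_subset[OF D c(2)] c(1) by simp
  from vector_derivative_diff_chain_within[OF c(3) this] show ?thesis by (simp add: o_def)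
qed

text \<open>Two derivatives within \<open>S\<close> agree on the velocities of curves in
  \<open>S\<close> by the chain rule, hence by linearity on their span. Computations with
  \<open>dif\<close> rest on this through \<open>dif_eqI\<close>.\<close>

lemma tangent_space_eq_on:
  assumes "(f has_derivative D) (at p within S)" "(f has_derivative D') (at p within S)"
    and "w \<in> tangent_space S p"
  shows "D w = D' w"
proof -
  have "at (0::real) within {0..1} ~= bot" by (simp add: at_within_Icc_at_right)
  then have "D v = D' v" if "v \<in> {w. \<exists>c. c 0 = p \<and> c ` {0..1} <= S \<and>
      (c has_vector_derivative w) (at (0::real) within {0..1})}" for v
    using that curve_compose_derivative[OF assms(1)] curve_compose_derivative[OF assms(2)]
    by (blast intro: vector_derivative_unique_within)
  then show ?thesis
    using linear_eq_on_span[OF has_derivative_linear[OF assms(1)] has_derivative_linear[OF assms(2)]] assms(3)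
    unfolding tangent_space_def by blast
qed

lemma dif_eqI:
  assumes "(f has_derivative D) (at p within S)" "w \<in> tangent_space S p"
  shows "dif S f p w = D w"
proof -
  have "(f has_derivative dif S f p) (at p within S)"
    unfolding dif_def using assms(1) differentiable_def frechet_derivative_works by blast
  from tangent_space_eq_on[OF this assms] show ?thesis .
qed

lemma has_derivative_tangent_map:
  assumes D: "(f has_derivative D) (at p within S)" and "f ` S <= S'" "w \<in> tangent_space S p"
  shows "D w \<in> tangent_space S' (f p)"
proof -
  let ?C = "{w. \<exists>c. c 0 = p \<and> c ` {0..1} <= S \<and> (c has_vector_derivative w) (at (0::real) within {0..1})}"
  have "D v \<in> tangent_space S' (f p)" if v: "v \<in> ?C" for v
  proof -
    obtain c where c: "c 0 = p" "c ` {0..1} <= S" "(c has_vector_derivative v) (at (0::real) within {0..1})"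
      using v by blast
    show ?thesis
      by (rule tangent_spaceI[OF _ _ curve_compose_derivative[OF D c]]) (use c assms(2) in auto)
  qed
  then have "D ` ?C <= tangent_space S' (f p)" by blast
  then have "span (D ` ?C) <= tangent_space S' (f p)"
    by (rule span_minimal[OF _ subspace_tangent_space])
  moreover have "D w \<in> span (D ` ?C)"
    using linear_span_image[OF has_derivative_linear[OF D], of ?C] assms(3)
    unfolding tangent_space_def by blast
  ultimately show ?thesis by blast
qed

text \<open>A curve is slowed down by a factor \<open>e\<close> until it stays in \<open>U\<close>.
  Its velocity is only scaled by \<open>e\<close>, which can be undone in a subspace.\<close>

lemma tangent_space_local:
  assumes "open U" "p \<in> U" "p \<in> S" "S \<inter> U <= S'"
  shows "tangent_space S p <= tangent_space S' p"
proof -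
  have "w \<in> tangent_space S' p" if c: "c 0 = p" "c ` {0..1} <= S"
    "(c has_vector_derivative w) (at (0::real) within {0..1})" for w c
  proof -
    have "continuous (at 0 within {0..1}) c"
      using has_derivative_continuous[OF c(3)[unfolded has_vector_derivative_def]] .
    then have "\<forall>\<^sub>F t in at 0 within {0..1}. c t \<in> U"
      using assms(1,2) c(1) by (simp add: continuous_within topological_tendstoD)
    then obtain d where d: "d > 0" "!!t. t \<in> {0..1} ==> t ~= 0 ==> dist t 0 < d ==> c t \<in> U"
      unfolding eventually_at by blast
    define e where "e = min 1 (d / 2)"
    have e: "e > 0" "e <= 1" "e < d" using d(1) by (auto simp: e_def)
    let ?c = "\<lambda>t. c (e * t)"
    have "((\<lambda>t. e * t) has_vector_derivative e) (at (0::real) within {0..1})"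
      by (auto intro!: derivative_eq_intros)
    moreover have "(c has_vector_derivative w) (at (e * 0) within (\<lambda>t. e * t) ` {0..1})"
      using has_vector_derivative_within_subset[OF c(3), of "(\<lambda>t. e * t) ` {0..1}"] e by (auto simp: mult_le_one)
    ultimately have "(?c has_vector_derivative e *\<^sub>R w) (at 0 within {0..1})"
      using vector_diff_chain_within[of "\<lambda>t. e * t" e 0 "{0..1}" c w] by (simp add: o_def)
    moreover have "?c ` {0..1} <= S'"
    proof
      fix q assume "q \<in> ?c ` {0..1}"
      then obtain t where t: "q = c (e * t)" "t \<in> {0..1}" by blast
      have r: "e * t \<in> {0..1}" using t e by (auto simp: mult_le_one)
      have "e * t <= e * 1" by (rule mult_left_mono) (use t(2) e in auto)
      then have "e * t < d" using e(3) by simp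
      then have "c (e * t) \<in> U"
        using d(2)[OF r] c(1) assms(2) r by (cases "e * t = 0") auto
      then show "q \<in> S'" using c(2) r t assms(4) by blast
    qed
    ultimately have "e *\<^sub>R w \<in> tangent_space S' p"
      by (intro tangent_spaceI[of ?c]) (use c(1) in auto)
    then have "inverse e *\<^sub>R (e *\<^sub>R w) \<in> tangent_space S' p"
      by (rule subspace_scale[OF subspace_tangent_space])
    then show ?thesis using e(1) by simp
  qed
  then have "{w. \<exists>c. c 0 = p \<and> c ` {0..1} <= S \<and> (c has_vector_derivative w) (at (0::real) within {0..1})}
      <= tangent_space S' p" by blast
  then show ?thesis
    unfolding tangent_space_def[of S] by (rule span_minimal[OF _ subspace_tangent_space])
qed

lemma dif_tangent:
  assumes "smooth_on S f" "p \<in> S" "f ` S <= S'" "w \<in> tangent_space S p"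
  shows "dif S f p w \<in> tangent_space S' (f p)"
  by (rule has_derivative_tangent_map[OF dif_has_derivative[OF assms(1,2)] assms(3,4)])

lemma dif_chain:
  assumes f: "smooth_on S f" "f ` S <= S'" and g: "smooth_on S' g" and p: "p \<in> S" "w \<in> tangent_space S p"
  shows "dif S (g \<circ> f) p w = dif S' g (f p) (dif S f p w)"
proof -
  have "(g has_derivative dif S' g (f p)) (at (f p) within f ` S)"
    by (rule has_derivative_subset[OF dif_has_derivative[OF g]]) (use f p in auto)
  then have "(g \<circ> f has_derivative dif S' g (f p) \<circ> dif S f p) (at p within S)"
    using diff_chain_within[OF dif_has_derivative[OF f(1) p(1)]] by blast
  from dif_eqI[OF this p(2)] show ?thesis by simp
qed

lemma dif_id: "w \<in> tangent_space S p ==> dif S (\<lambda>x. x) p w = w"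
  by (rule dif_eqI[OF has_derivative_ident])

text \<open>Near a point the family is the restriction of a smooth map \<open>G\<close> of time and
  position on an open set. On tangent vectors the derivative of \<open>G\<close> in the direction
  \<open>(0, w)\<close> is the differential of \<open>F t\<close>, whatever extension was
  chosen.\<close>

lemma dif_smooth:
  fixes T :: "'a::euclidean_space set" and F :: "'a => R3 => 'b::euclidean_space"
  assumes F: "smooth_on (T \<times> S) (\<lambda>(t, p). F t p)"
  shows "smooth_on (T \<times> tangent_bundle S) (\<lambda>(t, p, w). dif S (F t) p w)"
proof (rule smooth_on_local)
  fix z assume "z \<in> T \<times> tangent_bundle S"
  then obtain t0 p0 w0 where z: "z = (t0, p0, w0)" "t0 \<in> T" "p0 \<in> S"
    by (auto simp: tangent_bundle_def)
  then have "(t0, p0) \<in> T \<times> S" by simp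
  then obtain U G where U: "open U" "(t0, p0) \<in> U" "!!k. Ck_on k G U"
    "!!y. y \<in> T \<times> S ==> y \<in> U ==> (\<lambda>(t, p). F t p) y = G y"
    by (rule smooth_onE[OF F]) (rule that)
  have G: "smooth_on U G" using smooth_on_open_iff[OF U(1)] U(3) by blast
  let ?V = "{(t, p, w). (t, p) \<in> U} :: ('a \<times> R3 \<times> R3) set"
  have "?V = (\<lambda>x. (fst x, fst (snd x))) -` U" by auto
  moreover have "open ((\<lambda>x::'a \<times> R3 \<times> R3. (fst x, fst (snd x))) -` U)"
    by (rule open_vimage[OF U(1)]) (intro continuous_intros)
  ultimately have V: "open ?V" by simp
  let ?m = "\<lambda>x::'a \<times> R3 \<times> R3. ((fst x, fst (snd x)), (0::'a, snd (snd x)))"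
  have m: "smooth_on ?V ?m"
    by (intro smooth_on_Pair smooth_on_fst smooth_on_snd smooth_on_id smooth_on_const)
  have "smooth_on ?V (\<lambda>x. (\<lambda>(x, v). frechet_derivative G (at x) v) (?m x))"
    by (rule smooth_on_compose[OF m smooth_on_frechet_derivative[OF U(1) G]]) auto
  then have "smooth_on (T \<times> tangent_bundle S \<inter> ?V) (\<lambda>x. (\<lambda>(x, v). frechet_derivative G (at x) v) (?m x))"
    by (rule smooth_on_subset) blast
  then have "smooth_on (T \<times> tangent_bundle S \<inter> ?V) (\<lambda>(t, p, w). dif S (F t) p w)"
  proof (rule smooth_on_cong)
    fix x assume "x \<in> T \<times> tangent_bundle S \<inter> ?V"
    then obtain t p w where x: "x = (t, p, w)" "t \<in> T" "p \<in> S" "w \<in> tangent_space S p" "(t, p) \<in> U"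
      by (auto simp: tangent_bundle_def)
    have d: "(G has_derivative frechet_derivative G (at (t, p))) (at (t, p))"
      by (rule smooth_has_derivative_at[OF U(1) G x(5)])
    have "((\<lambda>q. (t, q)) has_derivative (\<lambda>v. (0, v))) (at p)"
      by (intro has_derivative_Pair has_derivative_const has_derivative_ident)
    from diff_chain_at[OF this d]
    have "((\<lambda>q. G (t, q)) has_derivative (\<lambda>v. frechet_derivative G (at (t, p)) (0, v))) (at p)"
      by (simp add: o_def)
    then have d': "((\<lambda>q. G (t, q)) has_derivative (\<lambda>v. frechet_derivative G (at (t, p)) (0, v))) (at p within S')" for S'
      by (rule has_derivative_at_withinI)
    let ?W = "Pair t -` U"
    have W: "open ?W" "p \<in> ?W" using x(5) by (auto intro!: open_vimage[OF U(1)] continuous_intros)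
    have "(F t has_derivative (\<lambda>v. frechet_derivative G (at (t, p)) (0, v))) (at p within S \<inter> ?W)"
      by (rule has_derivative_transform[OF _ _ d']) (use x U(4) in auto)
    moreover have "at p within S \<inter> ?W = at p within S" by (rule at_within_nhd[OF W(2,1)]) auto
    ultimately have "(F t has_derivative (\<lambda>v. frechet_derivative G (at (t, p)) (0, v))) (at p within S)"
      by (simp only:)
    from dif_eqI[OF this x(4)]
    show "(\<lambda>(x, v). frechet_derivative G (at x) v) (?m x) = (case x of (t, p, w) => dif S (F t) p w)"
      by (simp add: x(1))
  qed
  then show "\<exists>U. open U \<and> z \<in> U \<and> smooth_on (T \<times> tangent_bundle S \<inter> U) (\<lambda>(t, p, w). dif S (F t) p w)"
    using V U(2) z(1) by (intro exI[of _ ?V]) auto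
qed

abbreviation act where "act \<equiv> unit_differential"

lemma act_eq: "act S f (p, w) = (f p, dif S f p w /\<^sub>R norm (dif S f p w))"
  by (simp add: unit_differential_def dif_def Let_def)

lemma fst_act [simp]: "fst (act S f a) = f (fst a)"
  by (cases a) (simp only: act_eq fst_conv)

lemma utb_mem: "(p, w) \<in> unit_tangent_bundle S \<longleftrightarrow> p \<in> S \<and> w \<in> tangent_space S p \<and> norm w = 1"
  by (simp add: unit_tangent_bundle_def)

lemma utbE:
  assumes "a \<in> unit_tangent_bundle S"
  obtains p w where "a = (p, w)" "p \<in> S" "w \<in> tangent_space S p" "norm w = 1"
  using assms unfolding unit_tangent_bundle_def by blast

lemma dif_diffeo_nonzero:
  assumes f: "f \<in> diffeos S B" and "p \<in> S" "w \<in> tangent_space S p" "w ~= 0"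
  shows "dif S f p w ~= 0"
proof
  assume z: "dif S f p w = 0"
  have "w = dif S (finv f \<circ> f) p w"
    using dif_id[OF assms(3)] diffeos_inv_simps(3)[OF f] by (simp add: id_def)
  also have "\<dots> = dif S (finv f) (f p) 0"
    using dif_chain[OF diffeosD(1)[OF f] _ diffeosD(3)[OF f] assms(2,3)] diffeosD(4)[OF f] z by simp
  also have "\<dots> = 0"
    by (rule linear_0[OF dif_linear[OF diffeosD(3)[OF f] diffeosD(6)[OF f assms(2)]]])
  finally show False using assms(4) by simp
qed

lemma act_in:
  assumes f: "f \<in> diffeos S B" and a: "a \<in> unit_tangent_bundle S"
  shows "act S f a \<in> unit_tangent_bundle S"
proof -
  obtain p w where p: "a = (p, w)" "p \<in> S" "w \<in> tangent_space S p" "norm w = 1"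
    by (rule utbE[OF a]) (rule that)
  have "dif S f p w ~= 0" by (rule dif_diffeo_nonzero[OF f p(2,3)]) (use p(4) in auto)
  moreover have "dif S f p w \<in> tangent_space S (f p)"
    by (rule dif_tangent[OF diffeosD(1)[OF f] p(2) _ p(3)]) (simp add: diffeosD(4)[OF f])
  ultimately show ?thesis
    unfolding p(1) act_eq utb_mem
    using diffeosD(6)[OF f p(2)] subspace_scale[OF subspace_tangent_space] by simp
qed

text \<open>Normalizing in between does no harm: the positive factor passes through the linear
  differential and cancels in the final normalization.\<close>

lemma act_comp:
  assumes f: "f \<in> diffeos S B" and g: "g \<in> diffeos S B" and a: "a \<in> unit_tangent_bundle S"
  shows "act S (f \<circ> g) a = act S f (act S g a)"
proof -
  obtain p w where p: "a = (p, w)" "p \<in> S" "w \<in> tangent_space S p" "norm w = 1"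
    by (rule utbE[OF a]) (rule that)
  let ?u = "dif S g p w"
  have u: "?u ~= 0" by (rule dif_diffeo_nonzero[OF g p(2,3)]) (use p(4) in auto)
  have c: "dif S (f \<circ> g) p w = dif S f (g p) ?u"
    by (rule dif_chain[OF diffeosD(1)[OF g] _ diffeosD(1)[OF f] p(2,3)]) (simp add: diffeosD(4)[OF g])
  have "dif S f (g p) (?u /\<^sub>R norm ?u) = dif S f (g p) ?u /\<^sub>R norm ?u"
    by (rule linear_cmul[OF dif_linear[OF diffeosD(1)[OF f] diffeosD(6)[OF g p(2)]]])
  then show ?thesis
    unfolding p(1) act_eq c using u by (simp add: field_simps)
qed

lemma act_id: "a \<in> unit_tangent_bundle S ==> act S id a = a"
  by (auto simp: unit_tangent_bundle_def act_eq id_def dif_id)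

lemma act_inv:
  assumes f: "f \<in> diffeos S B" and a: "a \<in> unit_tangent_bundle S"
  shows "act S (finv f) (act S f a) = a" "act S f (act S (finv f) a) = a"
  using act_comp[OF inv_diffeos[OF f] f a] act_comp[OF f inv_diffeos[OF f] a] act_id[OF a]
    diffeos_inv_simps(3,4)[OF f] by simp_all

text \<open>Normalization is smooth here because the differential of a diffeomorphism does not
  annihilate nonzero tangent vectors.\<close>

lemma act_smooth:
  fixes T :: "'a::euclidean_space set"
  assumes F: "smooth_on (T \<times> S) (\<lambda>(t, p). F t p)" and d: "!!t. t \<in> T ==> F t \<in> diffeos S B"
  shows "smooth_on (T \<times> unit_tangent_bundle S) (\<lambda>(t, a). act S (F t) a)"
proof -
  let ?D = "T \<times> unit_tangent_bundle S"
  have sub: "?D <= T \<times> tangent_bundle S"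
    by (auto simp: unit_tangent_bundle_def tangent_bundle_def)
  have u: "smooth_on ?D (\<lambda>x. (\<lambda>(t, p, w). dif S (F t) p w) x)"
    by (rule smooth_on_subset[OF dif_smooth[OF F] sub])
  have nz: "(\<lambda>(t, p, w). dif S (F t) p w) x ~= 0" if "x \<in> ?D" for x
  proof -
    obtain t p w where x: "x = (t, p, w)" by (cases x)
    then have "t \<in> T" "p \<in> S" "w \<in> tangent_space S p" "norm w = 1"
      using that by (auto simp: utb_mem)
    then have "dif S (F t) p w ~= 0"
      by (intro dif_diffeo_nonzero[OF d]) auto
    then show ?thesis by (simp add: x)
  qed
  have nzn: "norm ((\<lambda>(t, p, w). dif S (F t) p w) x) ~= 0" if "x \<in> ?D" for x
    using nz[OF that] unfolding norm_eq_zero .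
  have f: "smooth_on ?D (\<lambda>x. (\<lambda>(t, p). F t p) (fst x, fst (snd x)))"
    by (rule smooth_on_compose[OF _ F])
      (intro smooth_on_Pair smooth_on_fst smooth_on_snd smooth_on_id, auto simp: unit_tangent_bundle_def)
  have "smooth_on ?D (\<lambda>x. ((\<lambda>(t, p). F t p) (fst x, fst (snd x)),
      inverse (norm ((\<lambda>(t, p, w). dif S (F t) p w) x)) *\<^sub>R (\<lambda>(t, p, w). dif S (F t) p w) x))"
    by (intro smooth_on_Pair f smooth_on_scaleR smooth_on_inverse smooth_on_norm u nz nzn)
  then show ?thesis
  proof (rule smooth_on_cong)
    fix x assume "x \<in> ?D"
    obtain t p w where x: "x = (t, p, w)" by (cases x)
    show "((\<lambda>(t, p). F t p) (fst x, fst (snd x)),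
      inverse (norm ((\<lambda>(t, p, w). dif S (F t) p w) x)) *\<^sub>R (\<lambda>(t, p, w). dif S (F t) p w) x) =
      (case x of (t, a) => act S (F t) a)"
      unfolding x by (simp add: act_eq)
  qed
qed

lemma act_continuous:
  assumes f: "f \<in> diffeos S B"
  shows "continuous_on (unit_tangent_bundle S) (act S f)"
proof -
  have "continuous_on ((UNIV::real set) \<times> unit_tangent_bundle S) (\<lambda>(t, a). act S f a)"
    by (rule smooth_on_imp_continuous_on[OF act_smooth[OF smooth_family_const[OF diffeosD(1)[OF f]]]])
      (rule f)
  then have "continuous_on (unit_tangent_bundle S) (\<lambda>a. (\<lambda>(t, a). act S f a) (0::real, a))"
    by (rule continuous_on_compose2) (auto intro!: continuous_intros)
  then show ?thesis by simp
qed

section \<open>Moving a framed point by isotopies\<close>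

type_synonym R2 = "real \<times> real"

definition wip :: "real => R2 => R2 => real" where
  "wip k u v = fst u * fst v + k * snd u * snd v"

lemma wip_linear: "wip k (u + u') v = wip k u v + wip k u' v" "wip k (u - u') v = wip k u v - wip k u' v"
  "wip k (s *\<^sub>R u) v = s * wip k u v" "wip k u (s *\<^sub>R v) = s * wip k u v" "wip k 0 v = 0" "wip k u 0 = 0"
  by (simp_all add: wip_def algebra_simps)

lemma bounded_linear_wip: "bounded_linear (\<lambda>u. wip k u v)"
  unfolding wip_def by (intro bounded_linear_intros)

lemma abs_wip_le:
  assumes "k \<ge> 0" shows "\<bar>wip k u v\<bar> <= (1 + k) * (norm u * norm v)"
proof -
  have 1: "\<bar>fst u * fst v\<bar> <= norm u * norm v"
    unfolding abs_mult using norm_fst_le[of "fst u" "snd u"] norm_fst_le[of "fst v" "snd v"]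
    by (intro mult_mono) simp_all
  have 2: "\<bar>snd u * snd v\<bar> <= norm u * norm v"
    unfolding abs_mult using norm_snd_le[of "snd u" "fst u"] norm_snd_le[of "snd v" "fst v"]
    by (intro mult_mono) simp_all
  have "\<bar>wip k u v\<bar> <= \<bar>fst u * fst v\<bar> + \<bar>k * (snd u * snd v)\<bar>"
    unfolding wip_def mult.assoc by (rule abs_triangle_ineq)
  also have "\<bar>k * (snd u * snd v)\<bar> = k * \<bar>snd u * snd v\<bar>"
    using assms by (simp only: abs_mult[of k] abs_of_nonneg)
  also have "\<bar>fst u * fst v\<bar> + k * \<bar>snd u * snd v\<bar> <= norm u * norm v + k * (norm u * norm v)"
    by (rule add_mono[OF 1 mult_left_mono[OF 2 assms]])
  finally show ?thesis by (simp add: algebra_simps)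
qed

text \<open>The identity outside a disc, and strongly monotone for a weighted inner product. The weight
  will make triangular matrices with positive diagonal entries monotone.\<close>

definition mono_plane :: "real => real => real => (R2 => R2) => bool" where
  "mono_plane k c R f \<longleftrightarrow> (\<forall>y z. wip k (f y - f z) (y - z) \<ge> c * (norm (y - z))\<^sup>2) \<and>
     (\<forall>y. norm y \<ge> R --> f y = y)"

locale mono_family =
  fixes F :: "real => R2 => R2" and k c R :: real
  assumes smooth: "smooth_on UNIV (\<lambda>(t, y). F t y)"
    and k: "k > 0" and c: "c > 0" and mono_plane: "!!t. mono_plane k c R (F t)"
begin

lemma mono: "wip k (F t y - F t z) (y - z) \<ge> c * (norm (y - z))\<^sup>2"
  and outside: "norm y \<ge> R ==> F t y = y"
  using mono_plane unfolding mono_plane_def by blast+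

text \<open>Monotonicity against the Cauchy-Schwarz estimate \<open>abs_wip_le\<close>. This
  quantitative injectivity is at the same time a Lipschitz bound for the inverse.\<close>

lemma lower: "c * norm (y - z) <= (1 + k) * norm (F t y - F t z)"
proof (cases "y = z")
  case False
  have "c * (norm (y - z))\<^sup>2 <= (1 + k) * (norm (F t y - F t z) * norm (y - z))"
    using mono[of y z t] abs_wip_le[of k "F t y - F t z" "y - z"] k by simp
  then have "(c * norm (y - z)) * norm (y - z) <= ((1 + k) * norm (F t y - F t z)) * norm (y - z)"
    by (simp add: power2_eq_square mult.assoc)
  then show ?thesis using False by (simp add: mult_le_cancel_right)
qed (use k in simp)

lemma inj: "inj (F t)"
proof (rule injI)
  fix y z assume "F t y = F t z"
  then have "c * norm (y - z) <= 0" using lower[of y z t] by simp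
  then show "y = z" using c by (simp add: mult_le_0_iff)
qed

lemma smooth_single: "smooth_on S (F t)"
proof -
  have "smooth_on S (\<lambda>y. (\<lambda>(t, y). F t y) (t, y))"
    by (rule smooth_on_compose[OF smooth_on_Pair[OF smooth_on_const smooth_on_id] smooth]) simp
  then show ?thesis by simp
qed

lemma surj: "surj (F t)"
  unfolding surj_def
proof
  fix z :: R2
  have cont: "continuous_on S (F t)" for S by (rule smooth_on_imp_continuous_on[OF smooth_single])
  have "bounded ((\<lambda>y. F t y - y) ` cball 0 R)"
    by (intro compact_imp_bounded compact_continuous_image continuous_intros cont compact_cball)
  then obtain C where C: "\<forall>u\<in>(\<lambda>y. F t y - y) ` cball 0 R. norm u <= C" unfolding bounded_iff by blast
  have C': "norm (F t y - y) <= max C 0" for y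
  proof (cases "norm y <= R")
    case True
    then have "norm (F t y - y) <= C" using C by simp
    then show ?thesis by simp
  next
    case False
    then show ?thesis using outside[of y t] by simp
  qed
  \<comment> \<open>The displacement \<open>F t y - y\<close> is bounded by \<open>max C 0\<close>,
    since it vanishes outside a ball. Hence \<open>z\<close> minus the displacement maps a large
    ball into itself, and a fixed point of this map is a preimage of \<open>z\<close>.\<close>
  have "\<exists>y\<in>cball 0 (norm z + max C 0). z - (F t y - y) = y"
  proof (rule brouwer)
    show "continuous_on (cball 0 (norm z + max C 0)) (\<lambda>y. z - (F t y - y))"
      by (intro continuous_intros cont)
    show "(\<lambda>y. z - (F t y - y)) \<in> cball 0 (norm z + max C 0) \<rightarrow> cball 0 (norm z + max C 0)"
    proof
      fix y :: R2
      have "norm (z - (F t y - y)) <= norm z + norm (F t y - y)" by (rule norm_triangle_ineq4)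
      then show "z - (F t y - y) \<in> cball 0 (norm z + max C 0)" using C'[of y] by simp
    qed
    have "0 <= norm z + max C 0" by (intro add_nonneg_nonneg) auto
    then show "cball 0 (norm z + max C 0) ~= {}" by (simp add: not_less)
  qed auto
  then obtain y where "z - (F t y - y) = y" by blast
  then have "z = F t y" by (simp add: algebra_simps)
  then show "\<exists>y. z = F t y" by blast
qed

lemma bij: "bij (F t)"
  using inj surj by (simp add: bij_def)

lemma F_inv [simp]: "F t (finv (F t) z) = z" and inv_F [simp]: "finv (F t) (F t y) = y"
  using inj surj by (simp_all add: surj_f_inv_f)

lemma inv_lower: "norm (finv (F t) z - y) <= ((1 + k) / c) * norm (z - F t y)"
  using lower[of "finv (F t) z" y t] c by (simp add: field_simps)

lemma inv_outside: "norm y \<ge> R ==> finv (F t) y = y"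
  using outside[of y t] inv_F[of t y] by simp

text \<open>By \<open>inv_lower\<close> the distance from the preimage to the fixed point
  \<open>y0\<close> is controlled by the distance from the value to \<open>F t y0\<close>, which
  tends to 0 as \<open>(t, z)\<close> tends to \<open>(t0, z0)\<close>.\<close>

lemma continuous_inv: "isCont (\<lambda>(t, z). finv (F t) z) x"
proof -
  obtain t0 z0 where x: "x = (t0, z0)" by (cases x)
  define y0 where "y0 = finv (F t0) z0"
  have "continuous_on UNIV (\<lambda>(t, y). F t y)" by (rule smooth_on_imp_continuous_on[OF smooth])
  then have "continuous_on UNIV (\<lambda>x::real \<times> R2. (\<lambda>(t, y). F t y) (fst x, y0))"
    by (rule continuous_on_compose2) (auto intro!: continuous_intros)
  then have "continuous_on UNIV (\<lambda>x::real \<times> R2. F (fst x) y0)" by (simp only: prod.case)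
  then have "isCont (\<lambda>x. F (fst x) y0) x"
    using continuous_on_eq_continuous_at[OF open_UNIV] by blast
  then have "isCont (\<lambda>x::real \<times> R2. ((1 + k) / c) * norm (snd x - F (fst x) y0)) x"
    by (intro continuous_intros)
  then have lim: "((\<lambda>x::real \<times> R2. ((1 + k) / c) * norm (snd x - F (fst x) y0)) \<longlongrightarrow> 0) (at x)"
    unfolding isCont_def by (simp add: x y0_def)
  have "((\<lambda>x. (\<lambda>(t, z). finv (F t) z) x - y0) \<longlongrightarrow> 0) (at x)"
  proof (rule Lim_null_comparison[OF always_eventually[OF allI] lim])
    show "norm ((\<lambda>(t, z). finv (F t) z) x - y0) <= ((1 + k) / c) * norm (snd x - F (fst x) y0)" for x
      using inv_lower[of "fst x" "snd x" y0] by (simp only: case_prod_beta')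
  qed
  then have "((\<lambda>(t, z). finv (F t) z) \<longlongrightarrow> y0) (at x)" by (rule LIM_zero_cancel)
  then show ?thesis
    unfolding isCont_def by (simp only: x y0_def prod.case)
qed

definition D :: "real \<times> R2 => real \<times> R2 => R2" where
  "D x = frechet_derivative (\<lambda>(t, y). F t y) (at x)"

lemma D_deriv: "((\<lambda>(t, y). F t y) has_derivative D x) (at x)"
  unfolding D_def by (rule smooth_has_derivative_at[OF open_UNIV smooth]) simp

lemma D_linear: "linear (D x)"
  by (rule has_derivative_linear[OF D_deriv])

lemma smooth_D: "smooth_on S (\<lambda>x. D x v)"
proof -
  have "smooth_on S (\<lambda>x. (\<lambda>(x, v). frechet_derivative (\<lambda>(t, y). F t y) (at x) v) (x, v))"
    by (rule smooth_on_compose[OF smooth_on_Pair[OF smooth_on_id smooth_on_const]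
          smooth_on_frechet_derivative[OF open_UNIV smooth]]) simp
  then show ?thesis by (simp add: D_def)
qed

text \<open>Monotonicity for the points \<open>y + s *\<^sub>R v\<close> and \<open>y\<close>,
  divided by the square of \<open>s\<close>, in the limit from the right.\<close>

lemma D_lower: "wip k (D (t, y) (0, v)) v \<ge> c * (norm v)\<^sup>2"
proof -
  have "((\<lambda>s. y + s *\<^sub>R v) has_derivative (\<lambda>s. s *\<^sub>R v)) (at (0::real))"
    by (auto intro!: derivative_eq_intros)
  then have "((\<lambda>s. (t, y + s *\<^sub>R v)) has_derivative (\<lambda>s. (0, s *\<^sub>R v))) (at (0::real))"
    by (intro has_derivative_Pair has_derivative_const)
  moreover have "((\<lambda>x. F (fst x) (snd x)) has_derivative D (t, y)) (at (t, y + 0 *\<^sub>R v))"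
    using D_deriv[of "(t, y)"] by (simp add: case_prod_beta')
  ultimately have "((\<lambda>s. F t (y + s *\<^sub>R v)) has_derivative (\<lambda>s. D (t, y) (0, s *\<^sub>R v))) (at 0)"
    using diff_chain_at[of "\<lambda>s. (t, y + s *\<^sub>R v)" "\<lambda>s. (0, s *\<^sub>R v)" 0
        "\<lambda>x. F (fst x) (snd x)" "D (t, y)"] by (simp add: o_def)
  then have "((\<lambda>s. wip k (F t (y + s *\<^sub>R v)) v) has_derivative (\<lambda>s. wip k (D (t, y) (0, s *\<^sub>R v)) v)) (at 0)"
    by (rule bounded_linear.has_derivative[OF bounded_linear_wip])
  moreover have "D (t, y) (0, s *\<^sub>R v) = s *\<^sub>R D (t, y) (0, v)" for s
    using linear_cmul[OF D_linear, of "(t, y)" s "(0, v)"] by simp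
  moreover have "(\<lambda>s. s * wip k (D (t, y) (0, v)) v) = (*) (wip k (D (t, y) (0, v)) v)"
    by (rule ext) (rule mult.commute)
  ultimately have "((\<lambda>s. wip k (F t (y + s *\<^sub>R v)) v) has_real_derivative wip k (D (t, y) (0, v)) v) (at 0)"
    unfolding has_field_derivative_def by (simp only: wip_linear)
  then have lim: "((\<lambda>s. (wip k (F t (y + s *\<^sub>R v)) v - wip k (F t y) v) / s) \<longlongrightarrow>
      wip k (D (t, y) (0, v)) v) (at_right 0)"
    by (auto simp: DERIV_def intro: filterlim_mono[OF _ order_refl at_le])
  show ?thesis
  proof (rule tendsto_lowerbound[OF lim])
    show "\<forall>\<^sub>F s in at_right 0. c * (norm v)\<^sup>2 <= (wip k (F t (y + s *\<^sub>R v)) v - wip k (F t y) v) / s"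
      using eventually_at_right_less[of 0]
    proof eventually_elim
      case (elim s)
      have "s * (s * (c * (norm v)\<^sup>2)) <= s * (wip k (F t (y + s *\<^sub>R v)) v - wip k (F t y) v)"
        using mono[of "y + s *\<^sub>R v" y t] elim
        by (simp add: wip_linear power_mult_distrib power2_eq_square algebra_simps)
      then have "s * (c * (norm v)\<^sup>2) <= wip k (F t (y + s *\<^sub>R v)) v - wip k (F t y) v"
        using elim by (simp only: mult_le_cancel_left_pos)
      then show ?case using elim by (simp add: le_divide_eq mult.commute)
    qed
  qed simp
qed

definition det :: "real \<times> R2 => real" where
  "det x = fst (D x (0, 1, 0)) * snd (D x (0, 0, 1)) - snd (D x (0, 1, 0)) * fst (D x (0, 0, 1))"

lemma D_expand: "D x (0, v) = fst v *\<^sub>R D x (0, 1, 0) + snd v *\<^sub>R D x (0, 0, 1)"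
proof -
  have "(0, v) = fst v *\<^sub>R (0, 1, 0) + snd v *\<^sub>R (0::real, 0::real, 1::real)" by simp
  then show ?thesis by (simp only: linear_add[OF D_linear] linear_cmul[OF D_linear])
qed

lemma D_zero: "D x (0, v) = 0 ==> v = 0"
  using D_lower[of v "fst x" "snd x"] c by (simp add: wip_linear mult_le_0_iff)

text \<open>If the determinant vanished, two explicit combinations of the columns would be killed by
  the derivative. By \<open>D_lower\<close> these combinations are trivial, so the first column is 0
  and \<open>(1, 0)\<close> itself would be in the kernel.\<close>

lemma det_nonzero: "det x ~= 0"
proof
  assume z: "det x = 0"
  let ?a = "D x (0, 1, 0)" and ?b = "D x (0, 0, 1)"
  have "D x (0, snd ?b, - snd ?a) = 0"
    unfolding D_expand[of x "(snd ?b, - snd ?a)"] using z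
    by (simp add: det_def prod_eq_iff algebra_simps)
  from D_zero[OF this] have 1: "snd ?b = 0" "snd ?a = 0" by (simp_all add: prod_eq_iff)
  have "D x (0, fst ?b, - fst ?a) = 0"
    unfolding D_expand[of x "(fst ?b, - fst ?a)"] using z
    by (simp add: det_def prod_eq_iff algebra_simps)
  from D_zero[OF this] have "fst ?a = 0" by (simp add: prod_eq_iff)
  with 1 have "?a = 0" by (simp add: prod_eq_iff)
  then show False using D_zero[of x "(1, 0)"] by (simp add: prod_eq_iff)
qed

text \<open>Cramer's rule for inverting the total derivative of the map taking \<open>(t, y)\<close>
  to \<open>(t, F t y)\<close>. The direction comes first and the point second, the form in which
  \<open>Ck_on_ode\<close> takes its right-hand side.\<close>

definition Dinv :: "real \<times> R2 => real \<times> R2 => real \<times> R2" where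
  "Dinv b x = (fst b,
     (fst (snd b - D x (fst b, 0)) * snd (D x (0, 0, 1)) - snd (snd b - D x (fst b, 0)) * fst (D x (0, 0, 1))) / det x,
     (fst (D x (0, 1, 0)) * snd (snd b - D x (fst b, 0)) - snd (D x (0, 1, 0)) * fst (snd b - D x (fst b, 0))) / det x)"

lemma Dinv_D: "Dinv (fst b, D x b) x = b"
proof -
  have "D x b = D x (fst b, 0) + D x (0, snd b)"
    using linear_add[OF D_linear, of x "(fst b, 0)" "(0, snd b)"] by simp
  then have e: "D x b - D x (fst b, 0) = fst (snd b) *\<^sub>R D x (0, 1, 0) + snd (snd b) *\<^sub>R D x (0, 0, 1)"
    by (simp only: D_expand[of x "snd b"] add_diff_cancel_left')
  define p q a1 a2 b1 b2 where "p = fst (snd b)" "q = snd (snd b)" "a1 = fst (D x (0, 1, 0))"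
    "a2 = snd (D x (0, 1, 0))" "b1 = fst (D x (0, 0, 1))" "b2 = snd (D x (0, 0, 1))"
  note defs = this
  have d: "det x = a1 * b2 - a2 * b1" by (simp only: det_def defs)
  have "Dinv (fst b, D x b) x = (fst b, ((p * a1 + q * b1) * b2 - (p * a2 + q * b2) * b1) / det x,
      (a1 * (p * a2 + q * b2) - a2 * (p * a1 + q * b1)) / det x)"
    unfolding Dinv_def fst_conv snd_conv e
    by (simp only: fst_add snd_add fst_scaleR snd_scaleR defs real_scaleR_def)
  also have "(p * a1 + q * b1) * b2 - (p * a2 + q * b2) * b1 = p * det x"
    unfolding d by (simp add: algebra_simps)
  also have "a1 * (p * a2 + q * b2) - a2 * (p * a1 + q * b1) = q * det x"
    unfolding d by (simp add: algebra_simps)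
  finally show ?thesis using det_nonzero[of x] by (simp add: defs(1,2))
qed

lemma Dinv_linear: "linear (\<lambda>b. Dinv b x)"
proof -
  have e: "(fst b + fst b', 0::R2) = (fst b, 0) + (fst b', 0)" "(r * fst b, 0::R2) = r *\<^sub>R (fst b, 0)"
    for b b' :: "real \<times> R2" and r by auto
  have a1: "D x (fst b + fst b', 0) = D x (fst b, 0) + D x (fst b', 0)" for b b' :: "real \<times> R2"
    unfolding e by (rule linear_add[OF D_linear])
  have a2: "D x (r * fst b, 0) = r *\<^sub>R D x (fst b, 0)" for b :: "real \<times> R2" and r
    unfolding e by (rule linear_cmul[OF D_linear])
  define w where "w b = snd b - D x (fst b, 0)" for b :: "real \<times> R2"
  have w: "w (b + b') = w b + w b'" "w (r *\<^sub>R b) = r *\<^sub>R w b" for b b' r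
    unfolding w_def by (simp_all add: a1 a2 scaleR_diff_right)
  have "Dinv b x = (fst b, (fst (w b) * snd (D x (0, 0, 1)) - snd (w b) * fst (D x (0, 0, 1))) / det x,
     (fst (D x (0, 1, 0)) * snd (w b) - snd (D x (0, 1, 0)) * fst (w b)) / det x)" for b
    by (simp only: Dinv_def w_def)
  then show ?thesis
    by (intro linearI) (simp_all add: w prod_eq_iff add_divide_distrib[symmetric] algebra_simps)
qed

lemma smooth_Dinv: "smooth_on UNIV (Dinv b)"
  unfolding Dinv_def det_def
  by (intro smooth_on_Pair smooth_on_divide smooth_on_diff smooth_on_mult smooth_on_fst smooth_on_snd
      smooth_D smooth_on_const) (use det_nonzero in \<open>simp_all add: det_def\<close>)

text \<open>Time is kept as a coordinate, so that a single map of \<open>(t, y)\<close> is inverted.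
  Its inverse is continuous and therefore differentiable, and its derivative is a smooth function of
  the inverse itself, as \<open>Ck_on_ode\<close> requires.\<close>

lemma smooth_inv: "smooth_on UNIV (\<lambda>(t, z). finv (F t) z)"
proof -
  let ?G = "\<lambda>x::real \<times> R2. (fst x, finv (F (fst x)) (snd x))"
  let ?H = "\<lambda>x::real \<times> R2. (fst x, F (fst x) (snd x))"
  have d: "(?G has_derivative (\<lambda>b. Dinv b (?G x))) (at x)" for x
  proof (rule has_derivative_inverse_basic[where f = ?H and T = UNIV])
    have "((\<lambda>x. F (fst x) (snd x)) has_derivative D (?G x)) (at (?G x))"
      using D_deriv[of "?G x"] by (simp only: case_prod_beta')
    then show "(?H has_derivative (\<lambda>b. (fst b, D (?G x) b))) (at (?G x))"
      by (intro has_derivative_Pair has_derivative_fst has_derivative_ident)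
    show "bounded_linear (\<lambda>b. Dinv b (?G x))"
      using Dinv_linear linear_conv_bounded_linear by blast
    show "(\<lambda>b. Dinv b (?G x)) \<circ> (\<lambda>b. (fst b, D (?G x) b)) = id"
      by (rule ext) (simp only: o_apply Dinv_D id_apply)
    show "isCont ?G x"
      using continuous_inv[of x] by (intro continuous_intros) (simp add: case_prod_beta')
  qed auto
  have "Ck_on j ?G UNIV" for j
    by (rule Ck_on_ode[OF open_UNIV open_UNIV _ d smooth_onD[OF smooth_Dinv open_UNIV]]) auto
  then have "smooth_on UNIV ?G" by (rule smooth_on_UNIV_I)
  from smooth_on_snd[OF this] show ?thesis by (simp add: case_prod_beta')
qed

end

lemma mono_plane_diffeo:
  assumes "smooth_on UNIV f" "mono_plane k c R f" "k > 0" "c > 0"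
  shows "bij f" "smooth_on UNIV (finv f)" "!!y. norm y \<ge> R ==> f y = y" "!!y. norm y \<ge> R ==> finv f y = y"
proof -
  interpret mono_family "\<lambda>_. f" k c R
    by unfold_locales (use assms in \<open>auto simp: case_prod_beta' intro: smooth_on_compose[OF smooth_on_snd[OF smooth_on_id] assms(1)]\<close>)
  show "bij f" by (rule bij)
  show "!!y. norm y \<ge> R ==> f y = y" "!!y. norm y \<ge> R ==> finv f y = y"
    using outside inv_outside by auto
  have "smooth_on UNIV (\<lambda>y. (\<lambda>(t, z). finv f z) (0::real, y))"
    by (rule smooth_on_compose[OF smooth_on_Pair[OF smooth_on_const smooth_on_id] smooth_inv]) simp
  then show "smooth_on UNIV (finv f)" by simp
qed

definition nrm :: "'a::real_normed_vector => 'a" where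
  "nrm x = x /\<^sub>R norm x"

lemma nrm_scale: "s > 0 ==> nrm (s *\<^sub>R x) = nrm x"
  by (simp add: nrm_def)

lemma nrm_unit: "norm x = 1 ==> nrm x = x"
  by (simp add: nrm_def)

lemma norm_nrm: "x ~= 0 ==> norm (nrm x) = 1"
  by (simp add: nrm_def)

lemma act_nrm: "act S f (p, w) = (f p, nrm (dif S f p w))"
  by (simp add: act_eq nrm_def)

lemma diffeomorphismI:
  assumes "smooth_on V f" "smooth_on S g" "!!y. y \<in> V ==> f y \<in> S" "!!p. p \<in> S ==> g p \<in> V"
    "!!y. y \<in> V ==> g (f y) = y" "!!p. p \<in> S ==> f (g p) = p"
  shows "diffeomorphism V S f"
proof -
  have bij: "bij_betw f V S"
    by (rule bij_betw_byWitness[where f' = g]) (use assms in auto)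
  have "inv_into V f p = g p" if "p \<in> S" for p
    using inv_into_f_f[OF bij_betw_imp_inj_on[OF bij] assms(4)[OF that]] assms(6)[OF that] by simp
  then have "smooth_on S (inv_into V f)"
    by (intro smooth_on_cong[OF assms(2)]) simp
  then show ?thesis
    unfolding diffeomorphism_def using bij assms(1) by blast
qed

section \<open>Charts, and plane maps extended to the surface by the identity\<close>

locale plane_chart =
  fixes M B U :: "R3 set" and V :: "R2 set" and ch :: "R2 => R3"
  assumes openU: "open U" and openV: "open V" and diffeo: "diffeomorphism V (M \<inter> U) ch"
    and UB: "U \<inter> B = {}"
begin

definition co :: "R3 => R2" where "co = inv_into V ch"

lemma smooth_ch: "smooth_on V ch" and smooth_co: "smooth_on (M \<inter> U) co"
  using diffeo unfolding diffeomorphism_def co_def by blast+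

lemma bij_ch: "bij_betw ch V (M \<inter> U)"
  using diffeo unfolding diffeomorphism_def by blast

lemma ch_in: "y \<in> V ==> ch y \<in> M" "y \<in> V ==> ch y \<in> U"
  using bij_betw_apply[OF bij_ch] by blast+

lemma co_in: "p \<in> M ==> p \<in> U ==> co p \<in> V"
  unfolding co_def using bij_betw_apply[OF bij_betw_inv_into[OF bij_ch]] by blast

lemma co_ch [simp]: "y \<in> V ==> co (ch y) = y"
  unfolding co_def by (rule bij_betw_inv_into_left[OF bij_ch])

lemma ch_co [simp]: "p \<in> M ==> p \<in> U ==> ch (co p) = p"
  unfolding co_def by (rule bij_betw_inv_into_right[OF bij_ch]) simp

definition ext :: "(R2 => R2) => R3 => R3" where
  "ext g p = (if p \<in> M \<inter> U then ch (g (co p)) else p)"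

lemma compact_image: "compact K ==> K <= V ==> open (- ch ` K)"
  using compact_continuous_image[OF continuous_on_subset[OF smooth_on_imp_continuous_on[OF smooth_ch]]]
  by (metis compact_imp_closed open_Compl)

lemma ext_outside:
  assumes "!!y. y \<in> V ==> y \<notin> K ==> g y = y" "p \<notin> ch ` K"
  shows "ext g p = p"
proof (cases "p \<in> M \<inter> U")
  case True
  then have "co p \<notin> K" using assms(2) ch_co by (metis IntD1 IntD2 image_eqI)
  then show ?thesis using True assms(1)[of "co p"] co_in by (simp add: ext_def)
qed (simp only: ext_def if_False)

text \<open>Inside the chart domain the family is a composite of smooth maps. A point outside it
  lies in the open complement of the compact image of \<open>K\<close>, where the family is the
  identity.\<close>

lemma ext_family:
  fixes T :: "'a::euclidean_space set"
  assumes K: "compact K" "K <= V" and V: "!!t y. t \<in> T ==> y \<in> V ==> g t y \<in> V"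
    and o: "!!t y. t \<in> T ==> y \<in> V ==> y \<notin> K ==> g t y = y"
    and s: "smooth_on (T \<times> V) (\<lambda>(t, y). g t y)"
  shows "smooth_on (T \<times> M) (\<lambda>(t, p). ext (g t) p)"
proof (rule smooth_on_local)
  fix z assume "z \<in> T \<times> M"
  then obtain t p where z: "z = (t, p)" "t \<in> T" "p \<in> M" by auto
  show "\<exists>N. open N \<and> z \<in> N \<and> smooth_on (T \<times> M \<inter> N) (\<lambda>(t, p). ext (g t) p)"
  proof (cases "p \<in> U")
    case True
    let ?S = "T \<times> M \<inter> UNIV \<times> U"
    have 0: "smooth_on ?S (\<lambda>x. co (snd x))"
      by (rule smooth_on_compose[OF smooth_on_snd[OF smooth_on_id] smooth_co]) auto
    have 1: "smooth_on ?S (\<lambda>x. (\<lambda>(t, y). g t y) (fst x, co (snd x)))"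
      by (rule smooth_on_compose[OF smooth_on_Pair[OF smooth_on_fst[OF smooth_on_id] 0] s])
        (auto simp: co_in)
    have "smooth_on ?S (\<lambda>x. ch ((\<lambda>(t, y). g t y) (fst x, co (snd x))))"
      by (rule smooth_on_compose[OF 1 smooth_ch]) (auto simp: co_in V)
    then have "smooth_on ?S (\<lambda>(t, p). ext (g t) p)"
      by (rule smooth_on_cong) (auto simp: ext_def)
    then show ?thesis
      using openU z True by (intro exI[of _ "UNIV \<times> U"]) (auto intro: open_Times)
  next
    case False
    let ?O = "UNIV \<times> - ch ` K"
    have "p \<notin> ch ` K" using False ch_in(2) K(2) by blast
    moreover have "smooth_on (T \<times> M \<inter> ?O) (\<lambda>(t, p). ext (g t) p)"
      by (rule smooth_on_cong[OF smooth_on_snd[OF smooth_on_id]]) (auto intro!: ext_outside[symmetric] o)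
    ultimately show ?thesis
      using compact_image[OF K] z by (intro exI[of _ ?O]) (auto intro: open_Times)
  qed
qed

lemma ext_smooth:
  assumes "compact K" "K <= V" "!!y. y \<in> V ==> g y \<in> V" "!!y. y \<in> V ==> y \<notin> K ==> g y = y"
    and s: "smooth_on V g"
  shows "smooth_on M (ext g)"
proof -
  have "smooth_on (UNIV \<times> M) (\<lambda>(t::real, p). ext g p)"
    by (rule ext_family[OF assms(1-4) smooth_family_const[OF s]])
  from smooth_on_compose[OF smooth_on_Pair[OF smooth_on_const[of _ 0] smooth_on_id] this, of M]
  show ?thesis by simp
qed

lemma ext_ext:
  assumes "!!y. y \<in> V ==> g y \<in> V" "!!y. y \<in> V ==> f (g y) = h y"
  shows "ext f (ext g p) = ext h p"
  using assms co_in[of p] ch_in by (simp add: ext_def)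

lemma ext_id: "(!!y. y \<in> V ==> g y = y) ==> ext g p = p"
  using co_in[of p] by (simp add: ext_def)

lemma ext_diffeos:
  assumes K: "compact K" "K <= V"
    and f: "!!y. y \<in> V ==> f y \<in> V" "!!y. y \<in> V ==> y \<notin> K ==> f y = y" "smooth_on V f"
    and g: "!!y. y \<in> V ==> g y \<in> V" "!!y. y \<in> V ==> y \<notin> K ==> g y = y" "smooth_on V g"
    and fg: "!!y. y \<in> V ==> f (g y) = y" "!!y. y \<in> V ==> g (f y) = y"
  shows "ext f \<in> diffeos M B"
proof (rule diffeosI[where g = "ext g" and U = "- ch ` K"])
  show "smooth_on M (ext f)" by (rule ext_smooth[OF K f])
  show "smooth_on M (ext g)" by (rule ext_smooth[OF K g])
  show "ext g (ext f p) = p" "ext f (ext g p) = p" for p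
    using ext_ext[of f g "\<lambda>y. y", OF f(1) fg(2)] ext_ext[of g f "\<lambda>y. y", OF g(1) fg(1)] ext_id by auto
  show "ext f p \<in> M" "ext g p \<in> M" if "p \<in> M" for p
    using that co_in[of p] ch_in(1) f(1) g(1) by (simp_all add: ext_def)
  show "ext f p = p" if "p \<notin> M" for p using that by (simp add: ext_def)
  show "open (- ch ` K)" by (rule compact_image[OF K])
  show "B <= - ch ` K" using UB ch_in(2) K(2) by blast
  show "ext f p = p" if "p \<in> - ch ` K" for p using ext_outside[OF f(2)] that by simp
qed

text \<open>If a point of the ball were moved to a place where \<open>f\<close> is the identity, its
  image would be a fixed point, and injectivity would make the point itself fixed. So the ball
  cannot be left.\<close>

lemma mono_plane_V:
  assumes "inj f" "!!y. norm y \<ge> R ==> f y = y" "cball 0 R <= V" "y \<in> V"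
  shows "f y \<in> V"
proof (cases "norm y \<ge> R \<or> f y = y")
  case False
  then have "\<not> norm (f y) \<ge> R" using assms(2)[of "f y"] injD[OF assms(1), of "f y" y] by auto
  then show ?thesis using assms(3) by auto
next
  case True
  then have "f y = y" using assms(2) by blast
  then show ?thesis using assms(4) by simp
qed

lemma ext_mono_diffeos:
  assumes f: "smooth_on UNIV f" "mono_plane k c R f" "k > 0" "c > 0" and R: "cball 0 R <= V"
  shows "ext f \<in> diffeos M B" "ext (finv f) = finv (ext f)"
proof -
  note d = mono_plane_diffeo[OF f]
  have i: "inj f" "inj (finv f)" using d(1) by (simp_all add: bij_is_inj bij_imp_bij_inv)
  have s: "f (finv f y) = y" "finv f (f y) = y" for y
    using d(1) by (simp_all add: bij_is_inj bij_is_surj surj_f_inv_f)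
  show e: "ext f \<in> diffeos M B"
    by (rule ext_diffeos[of "cball 0 R" f "finv f"])
      (use R d i s mono_plane_V[OF i(1) d(3) R] mono_plane_V[OF i(2) d(4) R]
        smooth_on_subset[OF f(1), of V] smooth_on_subset[OF d(2), of V] in auto)
  have 1: "ext f (ext (finv f) p) = p" for p
    using ext_ext[where f = f and g = "finv f" and h = "\<lambda>y. y" and p = p, OF mono_plane_V[OF i(2) d(4) R]]
      s ext_id by simp
  show "ext (finv f) = finv (ext f)"
  proof
    fix p show "ext (finv f) p = finv (ext f) p"
      using diffeos_inv_simps(1)[OF e, of "ext (finv f) p"] 1[of p] by simp
  qed
qed

definition dch :: "R2 => R2 => R3" where "dch y = frechet_derivative ch (at y)"

definition dco :: "R3 => R3 => R2" where "dco p = dif (M \<inter> U) co p"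

lemma dch_derivative: "y \<in> V ==> (ch has_derivative dch y) (at y)"
  unfolding dch_def by (rule smooth_has_derivative_at[OF openV smooth_ch])

lemma dch_linear: "y \<in> V ==> linear (dch y)"
  by (rule has_derivative_linear[OF dch_derivative])

lemma dco_derivative: "p \<in> M ==> p \<in> U ==> (co has_derivative dco p) (at p within M \<inter> U)"
  unfolding dco_def by (rule dif_has_derivative[OF smooth_co]) simp

lemma dco_linear: "p \<in> M ==> p \<in> U ==> linear (dco p)"
  by (rule has_derivative_linear[OF dco_derivative])

lemma tangent_MU: "p \<in> M ==> p \<in> U ==> tangent_space (M \<inter> U) p = tangent_space M p"
  by (rule equalityI[OF tangent_space_mono tangent_space_local[OF openU]]) auto

lemma dch_tangent:
  assumes y: "y \<in> V" shows "dch y v \<in> tangent_space M (ch y)"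
proof -
  obtain r where r: "r > 0" "ball y r <= V" using openV y open_contains_ball by blast
  \<comment> \<open>The denominator uses \<open>norm v + 1\<close> so that \<open>v = 0\<close> is
    covered; the segment from \<open>y\<close> to \<open>y + e *\<^sub>R v\<close> then stays in the
    ball of radius \<open>r\<close>.\<close>
  define e where "e = r / (2 * (norm v + 1))"
  have pos: "norm v + 1 > 0" using norm_ge_zero[of v] by linarith
  have "e * (norm v + 1) = r / 2" using pos by (simp add: e_def field_simps)
  moreover have "e > 0" using r(1) pos by (simp add: e_def)
  ultimately have e: "e > 0" "e * norm v < r" using r(1) by (simp_all add: algebra_simps)
  have "y + s *\<^sub>R (e *\<^sub>R v) \<in> V" if "s \<in> {0..1}" for s
  proof -
    have "norm (s *\<^sub>R (e *\<^sub>R v)) = s * (e * norm v)" using that e(1) by simp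
    also have "\<dots> <= 1 * (e * norm v)" using that e(1) by (intro mult_right_mono) auto
    finally have "y + s *\<^sub>R (e *\<^sub>R v) \<in> ball y r" using e(2) by (simp add: dist_norm)
    then show ?thesis using r(2) by blast
  qed
  moreover have "((\<lambda>s. ch (y + s *\<^sub>R (e *\<^sub>R v))) has_vector_derivative dch y (e *\<^sub>R v)) (at 0 within {0..1})"
  proof -
    have 1: "((\<lambda>s. y + s *\<^sub>R (e *\<^sub>R v)) has_vector_derivative (e *\<^sub>R v)) (at 0 within {0..1})"
      by (auto intro!: derivative_eq_intros)
    have 2: "(ch has_derivative dch y) (at (y + 0 *\<^sub>R (e *\<^sub>R v)) within (\<lambda>s. y + s *\<^sub>R (e *\<^sub>R v)) ` {0..1})"
      using has_derivative_at_withinI[OF dch_derivative[OF y]] by simp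
    show ?thesis using vector_derivative_diff_chain_within[OF 1 2] by (simp only: o_def)
  qed
  ultimately have "dch y (e *\<^sub>R v) \<in> tangent_space M (ch y)"
    by (intro tangent_spaceI[of "\<lambda>s. ch (y + s *\<^sub>R (e *\<^sub>R v))"]) (auto simp: ch_in)
  then have "inverse e *\<^sub>R dch y (e *\<^sub>R v) \<in> tangent_space M (ch y)"
    by (rule subspace_scale[OF subspace_tangent_space])
  then show ?thesis using e(1) by (simp add: linear_cmul[OF dch_linear[OF y]])
qed

lemma dch_dco:
  assumes p: "p \<in> M" "p \<in> U" "w \<in> tangent_space M p"
  shows "dch (co p) (dco p w) = w"
proof -
  have "(ch has_derivative dch (co p)) (at (co p) within co ` (M \<inter> U))"
    by (rule has_derivative_at_withinI[OF dch_derivative[OF co_in[OF p(1,2)]]])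
  from diff_chain_within[OF dco_derivative[OF p(1,2)] this]
  have "(ch \<circ> co has_derivative dch (co p) \<circ> dco p) (at p within M \<inter> U)" .
  moreover have "(ch \<circ> co has_derivative (\<lambda>x. x)) (at p within M \<inter> U)"
    by (rule has_derivative_transform[OF _ _ has_derivative_ident]) (use p in auto)
  moreover have "w \<in> tangent_space (M \<inter> U) p" using p tangent_MU by simp
  ultimately have "(dch (co p) \<circ> dco p) w = w" by (rule tangent_space_eq_on)
  then show ?thesis by simp
qed

lemma dco_dch:
  assumes y: "y \<in> V" shows "dco (ch y) (dch y v) = v"
proof -
  have "(co has_derivative dco (ch y)) (at (ch y) within ch ` V)"
    using dco_derivative[of "ch y"] y ch_in bij_ch by (simp add: bij_betw_def)
  from diff_chain_within[OF has_derivative_at_withinI[OF dch_derivative[OF y]] this]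
  have "(co \<circ> ch has_derivative dco (ch y) \<circ> dch y) (at y within V)" .
  then have 1: "(co \<circ> ch has_derivative dco (ch y) \<circ> dch y) (at y)"
    by (simp only: at_within_open[OF y openV])
  have "(co \<circ> ch has_derivative (\<lambda>x. x)) (at y)"
    by (rule has_derivative_transform_within_open[OF has_derivative_ident openV y]) simp
  from has_derivative_unique[OF 1 this] have "dco (ch y) \<circ> dch y = (\<lambda>x. x)" .
  from fun_cong[OF this, of v] show ?thesis by simp
qed

lemma dch_nonzero: "y \<in> V ==> v ~= 0 ==> dch y v ~= 0"
  using dco_dch[of y v] linear_0[OF dco_linear[of "ch y"]] ch_in by auto

text \<open>Only the direction of \<open>v\<close> matters by \<open>ray_scale\<close>, so
  normalizations in the surface never have to be computed in coordinates.\<close>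

definition ray :: "R2 => R2 => R3 \<times> R3" where "ray y v = (ch y, nrm (dch y v))"

lemma ray_scale: "y \<in> V ==> s > 0 ==> ray y (s *\<^sub>R v) = ray y v"
  by (simp add: ray_def linear_cmul[OF dch_linear] nrm_scale)

lemma ray_in: "y \<in> V ==> v ~= 0 ==> ray y v \<in> unit_tangent_bundle M"
  unfolding ray_def utb_mem
  using ch_in dch_nonzero norm_nrm subspace_scale[OF subspace_tangent_space dch_tangent]
  by (simp add: nrm_def)

lemma ray_co:
  assumes "a \<in> unit_tangent_bundle M" "fst a \<in> U"
  shows "a = ray (co (fst a)) (dco (fst a) (snd a))"
proof -
  obtain p w where p: "a = (p, w)" "p \<in> M" "w \<in> tangent_space M p" "norm w = 1"
    by (rule utbE[OF assms(1)]) (rule that)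
  show ?thesis using assms(2) p(2-4) dch_dco[of p w] unfolding p(1) by (simp add: ray_def nrm_unit)
qed

lemma dco_ray: "y \<in> V ==> dco (ch y) (snd (ray y v)) = v /\<^sub>R norm (dch y v)"
  using ch_in dco_dch[of y v] by (simp add: ray_def nrm_def linear_cmul[OF dco_linear])

text \<open>The derivative \<open>g'\<close> of the plane map enters without normalization, since
  positive factors are absorbed by \<open>ray\<close>.\<close>

lemma act_ext:
  assumes y: "y \<in> V" and g: "(g has_derivative g') (at y)" and gV: "!!y. y \<in> V ==> g y \<in> V"
    and s: "smooth_on M (ext g)" and v: "v ~= 0"
  shows "act M (ext g) (ray y v) = ray (g y) (g' v)"
proof -
  let ?p = "ch y"
  have p: "?p \<in> M" "?p \<in> U" using ch_in y by auto
  have 1: "(co has_derivative dco ?p) (at ?p within M \<inter> U)" by (rule dco_derivative[OF p])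
  have "(g has_derivative g') (at (co ?p) within co ` (M \<inter> U))"
    using has_derivative_at_withinI[OF g] y by simp
  from diff_chain_within[OF 1 this]
  have 2: "(g \<circ> co has_derivative g' \<circ> dco ?p) (at ?p within M \<inter> U)" .
  have "(ch has_derivative dch (g y)) (at ((g \<circ> co) ?p) within (g \<circ> co) ` (M \<inter> U))"
    using has_derivative_at_withinI[OF dch_derivative[OF gV[OF y]]] y by simp
  from diff_chain_within[OF 2 this]
  have "(ch \<circ> (g \<circ> co) has_derivative dch (g y) \<circ> (g' \<circ> dco ?p)) (at ?p within M \<inter> U)" .
  then have "(ext g has_derivative dch (g y) \<circ> (g' \<circ> dco ?p)) (at ?p within M \<inter> U)"
    by (rule has_derivative_transform[rotated 2]) (use p in \<open>simp_all add: ext_def\<close>)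
  moreover have "at ?p within M \<inter> U = at ?p within M" by (rule at_within_nhd[OF p(2) openU]) auto
  ultimately have "(ext g has_derivative dch (g y) \<circ> (g' \<circ> dco ?p)) (at ?p within M)" by (simp only:)
  from dif_eqI[OF this dch_tangent[OF y]]
  have d: "dif M (ext g) ?p (dch y v) = dch (g y) (g' v)" by (simp add: dco_dch[OF y])
  have "dif M (ext g) ?p (nrm (dch y v)) = dch (g y) (g' v) /\<^sub>R norm (dch y v)"
    unfolding nrm_def linear_cmul[OF dif_linear[OF s p(1)]] d ..
  moreover have "norm (dch y v) > 0" using dch_nonzero[OF y v] by simp
  ultimately have "nrm (dif M (ext g) ?p (nrm (dch y v))) = nrm (dch (g y) (g' v))"
    by (simp add: nrm_scale)
  then show ?thesis
    unfolding ray_def act_nrm using p y by (simp add: ext_def)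
qed

lemma smooth_dch: "smooth_on (V \<times> UNIV) (\<lambda>(y, v). dch y v)"
  unfolding dch_def by (rule smooth_on_frechet_derivative[OF openV smooth_ch])

lemma smooth_ray:
  assumes "smooth_on S f" "smooth_on S h" "!!x. x \<in> S ==> f x \<in> V" "!!x. x \<in> S ==> h x ~= 0"
  shows "smooth_on S (\<lambda>x. ray (f x) (h x))"
proof -
  have d: "smooth_on S (\<lambda>x. dch (f x) (h x))"
    using smooth_on_compose[OF smooth_on_Pair[OF assms(1,2)] smooth_dch] assms(3) by simp
  have n: "dch (f x) (h x) ~= 0" if "x \<in> S" for x using dch_nonzero assms(3,4) that by blast
  have n': "norm (dch (f x) (h x)) ~= 0" if "x \<in> S" for x using n[OF that] by simp
  show ?thesis
    unfolding ray_def nrm_def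
    by (intro smooth_on_Pair smooth_on_compose[OF assms(1) smooth_ch assms(3)] smooth_on_scaleR
        smooth_on_inverse smooth_on_norm d n n')
qed

lemma smooth_dco: "smooth_on {a \<in> unit_tangent_bundle M. fst a \<in> U} (\<lambda>a. dco (fst a) (snd a))"
proof -
  have "smooth_on ((UNIV::real set) \<times> tangent_bundle (M \<inter> U)) (\<lambda>(t, p, w). dif (M \<inter> U) co p w)"
    by (rule dif_smooth[OF smooth_family_const[OF smooth_co]])
  from smooth_on_compose[OF smooth_on_Pair[OF smooth_on_const[of _ 0] smooth_on_id] this,
      of "{a \<in> unit_tangent_bundle M. fst a \<in> U}"]
  show ?thesis
    by (auto simp: dco_def case_prod_beta' tangent_bundle_def unit_tangent_bundle_def tangent_MU)
qed

end

section \<open>Affine moves of frames with a cut-off\<close>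

lemma smooth_lipschitz:
  fixes f :: "'a::euclidean_space => 'b::euclidean_space"
  assumes f: "smooth_on UNIV f"
    and zero: "!!x. norm x > R ==> (f has_derivative (\<lambda>_. 0)) (at x)"
  obtains L where "L \<ge> 0" "!!x y. norm (f x - f y) <= L * norm (x - y)"
proof -
  obtain L where L: "L \<ge> 0" "!!x v. norm (frechet_derivative f (at x) v) <= L * norm v"
    by (rule smooth_derivative_bounded[OF f zero], assumption, rule that)
  show thesis
  proof (rule that[OF L(1)])
    fix x y :: 'a
    show "norm (f x - f y) <= L * norm (x - y)"
      by (rule differentiable_bound[of UNIV f "\<lambda>x. frechet_derivative f (at x)"])
        (use smooth_has_derivative_at[OF open_UNIV f] L in \<open>auto intro!: onorm_le\<close>)
  qed
qed

text \<open>A function of the squared norm, hence smooth at the origin. The constants put its two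
  plateaus inside radius \<open>r\<close> and outside radius \<open>2 * r\<close>.\<close>

definition bump :: "real => R2 => real" where
  "bump r z = step ((4 * r\<^sup>2 - z \<bullet> z) / (3 * r\<^sup>2))"

lemma smooth_bump: "smooth_on UNIV (bump r)"
  unfolding bump_def divide_inverse
  by (intro smooth_on_step smooth_on_mult smooth_on_diff smooth_on_inner smooth_on_const smooth_on_id)

lemma bump_1: "r > 0 ==> norm z <= r ==> bump r z = 1"
proof -
  assume r: "r > 0" "norm z <= r"
  then have "z \<bullet> z <= r\<^sup>2" by (simp add: dot_square_norm power_mono)
  then show ?thesis using r unfolding bump_def by (intro step_eq_1) (simp add: le_divide_eq)
qed

lemma bump_0: "r > 0 ==> norm z \<ge> 2 * r ==> bump r z = 0"
proof -
  assume r: "r > 0" "norm z \<ge> 2 * r"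
  then have "(2 * r)\<^sup>2 <= z \<bullet> z" unfolding dot_square_norm by (intro power_mono) auto
  then show ?thesis using r unfolding bump_def by (intro step_eq_0) (simp add: divide_le_0_iff power2_eq_square)
qed

lemma bump_bounds: "0 <= bump r z" "bump r z <= 1"
  by (simp_all add: bump_def)

lemma bump_lipschitz:
  assumes "r > 0"
  obtains L where "L \<ge> 0" "!!x y. \<bar>bump r x - bump r y\<bar> <= L * norm (x - y)"
proof -
  have z: "(bump r has_derivative (\<lambda>_. 0)) (at x)" if "norm x > 2 * r" for x
  proof (rule has_derivative_transform_within_open[OF has_derivative_const[of 0]])
    show "open {x::R2. 2 * r < norm x}" by (intro open_Collect_less continuous_intros)
  qed (use that bump_0[OF assms] in auto)
  obtain L where "L \<ge> 0" "!!x y. norm (bump r x - bump r y) <= L * norm (x - y)"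
    by (rule smooth_lipschitz[OF smooth_bump z], assumption, rule that)
  then show thesis using that[of L] by (simp only: real_norm_def)
qed

type_synonym frame = "R2 \<times> real"

text \<open>A frame \<open>(y, m)\<close> is the point \<open>y\<close> with the direction of slope \<open>m\<close>. The map moves one frame to
  another one by an affine map, cut off outside a disc.\<close>

definition move :: "real => frame => frame => R2 => R2" where
  "move r k k' z = z + bump r z *\<^sub>R (fst k' - fst k + (0, (snd k' - snd k) * (fst z - fst (fst k))))"

lemma smooth_move: "smooth_on S (\<lambda>((k, k'), z). move r k k' z)"
proof -
  have b: "smooth_on S (\<lambda>x. bump r (snd x))" for S :: "((frame \<times> frame) \<times> R2) set"
    by (rule smooth_on_compose[OF smooth_on_snd[OF smooth_on_id] smooth_bump]) simp
  show ?thesis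
    unfolding move_def case_prod_beta'
    by (intro smooth_on_add smooth_on_scaleR b smooth_on_diff smooth_on_Pair smooth_on_mult
        smooth_on_fst smooth_on_snd smooth_on_const smooth_on_id)
qed

definition frames :: "real => frame set" where
  "frames d = ball 0 d \<times> {-d<..<d}"

text \<open>The displacement is an affine map with coefficients of size \<open>d\<close>, times a
  bump with Lipschitz constant \<open>L\<close>. The product rule gives it the Lipschitz constant
  \<open>d * (2 * (L * (2 + 2 * r)) + 2)\<close>, at most 1/2 by the last condition on
  \<open>d\<close>, and the identity plus such a map is strongly monotone for the Euclidean
  product.\<close>

lemma mono_plane_move:
  assumes r: "r > 0" and L: "L \<ge> 0" "!!x y. \<bar>bump r x - bump r y\<bar> <= L * norm (x - y)"
    and d: "d > 0" "d <= 1" "d * (2 * (L * (2 + 2 * r)) + 2) <= 1 / 2" and k: "k \<in> frames d" "k' \<in> frames d"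
  shows "mono_plane 1 (1/2) (2 * r) (move r k k')"
proof -
  define a where "a z = fst k' - fst k + (0, (snd k' - snd k) * (fst z - fst (fst k)))" for z :: R2
  let ?E = "\<lambda>z. bump r z *\<^sub>R a z"
  have k': "norm (fst k) < d" "norm (fst k') < d" "\<bar>snd k\<bar> < d" "\<bar>snd k'\<bar> < d"
    using k unfolding frames_def mem_Times_iff mem_ball_0 by auto
  have m: "\<bar>snd k' - snd k\<bar> <= 2 * d" using k' by linarith
  have fs: "\<bar>fst z\<bar> <= norm z" for z :: R2 using norm_fst_le[of "fst z" "snd z"] by simp
  have a1: "norm (a z - a z') <= 2 * d * norm (z - z')" for z z'
  proof -
    have "a z - a z' = (0, (snd k' - snd k) * fst (z - z'))" by (simp add: a_def algebra_simps)
    then have "norm (a z - a z') = \<bar>snd k' - snd k\<bar> * \<bar>fst (z - z')\<bar>"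
      by (simp add: norm_Pair abs_mult)
    also have "\<dots> <= (2 * d) * norm (z - z')"
      by (rule mult_mono[OF m fs]) (use d in auto)
    finally show ?thesis .
  qed
  have a2: "norm (a z) <= 2 * d * (2 + 2 * r)" if "norm z <= 2 * r" for z
  proof -
    have "norm (a z) <= norm (fst k' - fst k) + norm (0::real, (snd k' - snd k) * (fst z - fst (fst k)))"
      unfolding a_def by (rule norm_triangle_ineq)
    moreover have "norm (fst k' - fst k) <= 2 * d"
      using norm_triangle_ineq4[of "fst k'" "fst k"] k' by linarith
    moreover have "norm (0::real, (snd k' - snd k) * (fst z - fst (fst k))) <= (2 * d) * (2 * r + 1)"
    proof -
      have "\<bar>fst z - fst (fst k)\<bar> <= 2 * r + 1" using fs[of z] fs[of "fst k"] that k' d(2) by linarith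
      then show ?thesis unfolding norm_Pair abs_mult
        using mult_mono[OF m, of "\<bar>fst z - fst (fst k)\<bar>" "2 * r + 1"] d by (simp add: abs_mult)
    qed
    ultimately show ?thesis by (simp add: algebra_simps)
  qed
  have E: "norm (?E z - ?E z') <= (1/2) * norm (z - z')" if "norm z' <= 2 * r" for z z'
  proof -
    have "?E z - ?E z' = (bump r z - bump r z') *\<^sub>R a z' + bump r z *\<^sub>R (a z - a z')"
      by (simp add: algebra_simps)
    then have "norm (?E z - ?E z') <= \<bar>bump r z - bump r z'\<bar> * norm (a z') + \<bar>bump r z\<bar> * norm (a z - a z')"
      by (metis norm_scaleR norm_triangle_ineq)
    also have "\<dots> <= (L * norm (z - z')) * (2 * d * (2 + 2 * r)) + 1 * (2 * d * norm (z - z'))"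
      by (intro add_mono mult_mono L(2) a2[OF that] a1) (use L(1) bump_bounds[of r z] in auto)
    also have "\<dots> = (d * (2 * (L * (2 + 2 * r)) + 2)) * norm (z - z')" by (simp add: algebra_simps)
    also have "\<dots> <= (1/2) * norm (z - z')" by (rule mult_right_mono[OF d(3)]) simp
    finally show ?thesis .
  qed
  \<comment> \<open>The previous estimate needs one of the points in the support, where the affine
    factor is bounded. If both lie outside, both displacements vanish.\<close>
  have E': "norm (?E z - ?E z') <= (1/2) * norm (z - z')" for z z'
  proof -
    consider "norm z' <= 2 * r" | "norm z <= 2 * r" | "norm z \<ge> 2 * r" "norm z' \<ge> 2 * r" by linarith
    then show ?thesis
    proof cases
      case 2
      then show ?thesis using E[OF 2, of z'] by (simp add: norm_minus_commute)
    qed (use E bump_0[OF r] in auto)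
  qed
  have mv: "move r k k' z = z + ?E z" for z by (simp add: move_def a_def)
  show ?thesis
    unfolding mono_plane_def
  proof (intro conjI allI impI)
    fix z z' :: R2
    have w: "wip 1 u v = u \<bullet> v" for u v by (simp add: wip_def inner_prod_def)
    have "\<bar>(?E z - ?E z') \<bullet> (z - z')\<bar> <= norm (?E z - ?E z') * norm (z - z')"
      by (rule Cauchy_Schwarz_ineq2)
    also have "\<dots> <= ((1/2) * norm (z - z')) * norm (z - z')"
      by (rule mult_right_mono[OF E']) simp
    finally have "(?E z - ?E z') \<bullet> (z - z') \<ge> - (1/2) * (norm (z - z'))\<^sup>2"
      by (simp add: power2_eq_square abs_le_iff)
    moreover have "(move r k k' z - move r k k' z') \<bullet> (z - z') =
        (z - z') \<bullet> (z - z') + (?E z - ?E z') \<bullet> (z - z')"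
      unfolding mv by (simp add: inner_add_left[symmetric] algebra_simps)
    ultimately show "1 / 2 * (norm (z - z'))\<^sup>2 <= wip 1 (move r k k' z - move r k k' z') (z - z')"
      unfolding w by (simp add: dot_square_norm)
  next
    fix z :: R2 assume "2 * r <= norm z"
    then show "move r k k' z = z" using bump_0[OF r] by (simp add: mv)
  qed
qed

lemma move_self: "move r k k z = z"
  by (simp add: move_def zero_prod_def[symmetric])

lemma move_point: "r > 0 ==> norm (fst k) < r ==> move r k k' (fst k) = fst k'"
  by (simp add: move_def bump_1 zero_prod_def[symmetric])

lemma move_derivative:
  assumes "r > 0" "norm (fst k) < r"
  shows "(move r k k' has_derivative (\<lambda>v. v + (0, (snd k' - snd k) * fst v))) (at (fst k))"
proof (rule has_derivative_transform_within_open[where s = "ball 0 r"])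
  show "((\<lambda>z. z + (fst k' - fst k + (0, (snd k' - snd k) * (fst z - fst (fst k)))))
      has_derivative (\<lambda>v. v + (0, (snd k' - snd k) * fst v))) (at (fst k))"
    by (auto intro!: derivative_eq_intros)
qed (use assms in \<open>auto simp: move_def bump_1\<close>)

text \<open>A local section of the evaluation of diffeomorphisms at framed points. Smooth dependence
  is required only along pairs of smooth curves, which is the way it is used to form
  isotopies.\<close>

definition trans_nbhd :: "R3 set => R3 set => (R3 \<times> R3) set => (R3 \<times> R3 => R3 \<times> R3 => R3 => R3) => bool" where
  "trans_nbhd M B W s \<longleftrightarrow>
     (\<forall>a\<in>W. \<forall>b\<in>W. s a b \<in> diffeos M B \<and> act M (s a b) a = b) \<and> (\<forall>a\<in>W. s a a = id) \<and>
     (\<forall>c c'. smooth_on {0..1} c --> smooth_on {0..1} c' --> c ` {0..1} <= W --> c' ` {0..1} <= W -->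
        smooth_isotopy M B (\<lambda>t. s (c t) (c' t)))"

definition smooth_path_connected :: "'a::euclidean_space set => bool" where
  "smooth_path_connected W \<longleftrightarrow>
     (\<forall>a\<in>W. \<forall>b\<in>W. \<exists>c. smooth_on UNIV c \<and> range c <= W \<and> c 0 = a \<and> c (1::real) = b)"

definition utb_inner :: "R3 set => R3 set => (R3 \<times> R3) set" where
  "utb_inner M B = {a \<in> unit_tangent_bundle M. fst a \<notin> B}"

section \<open>Small sets of frames in a chart\<close>

context plane_chart
begin

definition fr :: "frame => R3 \<times> R3" where "fr k = ray (fst k) (1, snd k)"

definition frco :: "R3 \<times> R3 => frame" where
  "frco a = (co (fst a), snd (dco (fst a) (snd a)) / fst (dco (fst a) (snd a)))"

lemma frco_fr [simp]: "fst k \<in> V ==> frco (fr k) = k"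
proof -
  assume k: "fst k \<in> V"
  have "dch (fst k) (1, snd k) ~= 0" by (rule dch_nonzero[OF k]) (simp add: prod_eq_iff)
  then show ?thesis
    using dco_ray[OF k, of "(1, snd k)"] k by (simp add: frco_def fr_def ray_def prod_eq_iff)
qed

lemma fr_frco:
  assumes a: "a \<in> unit_tangent_bundle M" "fst a \<in> U" and u: "fst (dco (fst a) (snd a)) > 0"
  shows "fr (frco a) = a"
proof -
  let ?u = "dco (fst a) (snd a)"
  have aM: "fst a \<in> M" using a(1) by (auto simp: unit_tangent_bundle_def)
  have "fst ?u *\<^sub>R (1, snd ?u / fst ?u) = ?u" using u by (simp add: prod_eq_iff)
  then have "ray (co (fst a)) (1, snd ?u / fst ?u) = ray (co (fst a)) ?u"
    using ray_scale[OF co_in[OF aM a(2)] u] by metis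
  then show ?thesis using ray_co[OF a] by (simp add: fr_def frco_def)
qed

lemma fr_in:
  assumes k: "fst k \<in> V" shows "fr k \<in> utb_inner M B"
proof -
  have "fst (fr k) \<notin> B" using ch_in(2)[OF k] UB by (auto simp: fr_def ray_def)
  then show ?thesis
    using ray_in[OF k, of "(1, snd k)"] by (simp add: utb_inner_def fr_def zero_prod_def)
qed

lemma smooth_fr: "smooth_on (V \<times> UNIV) fr"
  unfolding fr_def
  by (rule smooth_ray) (auto intro!: smooth_on_fst smooth_on_snd smooth_on_Pair smooth_on_id simp: prod_eq_iff)

definition fr_nbhd :: "real => (R3 \<times> R3) set" where "fr_nbhd d = fr ` frames d"

text \<open>The slope condition is written without division, as a strict inequality between the
  coordinates of the chart differential. Openness of the set and smoothness of \<open>frco\<close>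
  on it can then be read off.\<close>

lemma fr_nbhd_eq:
  assumes "ball 0 d <= V" "d > 0"
  shows "fr_nbhd d = {a \<in> utb_inner M B. fst a \<in> U \<and> (co (fst a), dco (fst a) (snd a)) \<in>
    ball 0 d \<times> UNIV \<inter> {x. 0 < fst (snd x) \<and> \<bar>snd (snd x)\<bar> < d * fst (snd x)}}" (is "?L = ?R")
proof
  show "?L <= ?R"
  proof
    fix a assume "a \<in> ?L"
    then obtain k where k: "k \<in> frames d" "a = fr k" by (auto simp: fr_nbhd_def)
    then have kV: "fst k \<in> V" "fst k \<in> ball 0 d" "\<bar>snd k\<bar> < d" using assms(1) by (auto simp: frames_def)
    have "norm (dch (fst k) (1, snd k)) > 0" using dch_nonzero[OF kV(1), of "(1, snd k)"] by (simp add: prod_eq_iff)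
    then show "a \<in> ?R"
      using fr_in[OF kV(1)] ch_in(2)[OF kV(1)] dco_ray[OF kV(1), of "(1, snd k)"] kV k(2)
      by (simp add: fr_def ray_def abs_mult field_simps)
  qed
  show "?R <= ?L"
  proof
    fix a assume a: "a \<in> ?R"
    then have "fr (frco a) = a" by (intro fr_frco) (auto simp: utb_inner_def)
    moreover have "frco a \<in> frames d"
      using a by (auto simp: frco_def frames_def field_simps abs_less_iff)
    ultimately show "a \<in> ?L" unfolding fr_nbhd_def by (metis imageI)
  qed
qed

lemma smooth_frco:
  assumes "ball 0 d <= V" "d > 0"
  shows "smooth_on (fr_nbhd d) frco"
proof -
  have sub: "fr_nbhd d <= {a \<in> unit_tangent_bundle M. fst a \<in> U}"
    unfolding fr_nbhd_eq[OF assms] by (auto simp: utb_inner_def)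
  have 1: "smooth_on (fr_nbhd d) (\<lambda>a. dco (fst a) (snd a))" by (rule smooth_on_subset[OF smooth_dco sub])
  have 2: "smooth_on (fr_nbhd d) (\<lambda>a. co (fst a))"
    by (rule smooth_on_compose[OF smooth_on_fst[OF smooth_on_id] smooth_co])
      (use sub in \<open>auto simp: unit_tangent_bundle_def\<close>)
  show ?thesis unfolding frco_def
    by (intro smooth_on_Pair 2 smooth_on_divide smooth_on_snd smooth_on_fst 1)
      (auto simp: fr_nbhd_eq[OF assms])
qed

lemma openin_fr_nbhd:
  assumes "ball 0 d <= V" "d > 0"
  shows "openin (top_of_set (utb_inner M B)) (fr_nbhd d)"
proof -
  let ?X = "utb_inner M B \<inter> {a. fst a \<in> U}"
  let ?h = "\<lambda>a. (co (fst a), dco (fst a) (snd a))"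
  let ?O = "ball 0 d \<times> UNIV \<inter> {x. 0 < fst (snd x) \<and> \<bar>snd (snd x)\<bar> < d * fst (snd x)} :: (R2 \<times> R2) set"
  have "open {x::R2 \<times> R2. 0 < fst (snd x) \<and> \<bar>snd (snd x)\<bar> < d * fst (snd x)}"
    by (intro open_Collect_conj open_Collect_less continuous_intros)
  then have O: "open ?O" by (intro open_Int open_Times) auto
  have "open {a::R3 \<times> R3. fst a \<in> U}"
    using open_vimage_fst[OF openU] by (simp add: vimage_def)
  then have X: "openin (top_of_set (utb_inner M B)) ?X" by (rule openin_open_Int)
  have "smooth_on ?X (\<lambda>a. co (fst a))"
    by (rule smooth_on_compose[OF smooth_on_fst[OF smooth_on_id] smooth_co])
      (auto simp: utb_inner_def unit_tangent_bundle_def)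
  moreover have "smooth_on ?X (\<lambda>a. dco (fst a) (snd a))"
    by (rule smooth_on_subset[OF smooth_dco]) (auto simp: utb_inner_def)
  ultimately have "continuous_on ?X ?h"
    by (intro smooth_on_imp_continuous_on smooth_on_Pair)
  then have "openin (top_of_set ?X) (?X \<inter> ?h -` ?O)" using O by (rule continuous_openin_preimage_gen)
  then have "openin (top_of_set (utb_inner M B)) (?X \<inter> ?h -` ?O)" using X by (rule openin_trans)
  moreover have "?X \<inter> ?h -` ?O = fr_nbhd d" unfolding fr_nbhd_eq[OF assms] by auto
  ultimately show ?thesis by simp
qed

lemma frames_V: "ball 0 d <= V ==> k \<in> frames d ==> fst k \<in> V"
  by (auto simp: frames_def)

lemma convex_frames: "convex (frames d)"
  unfolding frames_def by (intro convex_Times) auto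

lemma simply_connected_fr_nbhd:
  assumes "ball 0 d <= V" "d > 0"
  shows "simply_connected (fr_nbhd d)"
proof -
  have "homeomorphism (frames d) (fr_nbhd d) fr frco"
  proof (rule homeomorphismI)
    show "continuous_on (frames d) fr"
      by (rule continuous_on_subset[OF smooth_on_imp_continuous_on[OF smooth_fr]]) (use frames_V[OF assms(1)] in auto)
    show "continuous_on (fr_nbhd d) frco"
      by (rule smooth_on_imp_continuous_on[OF smooth_frco[OF assms]])
    have ff: "frco (fr k) = k" if "k \<in> frames d" for k by (rule frco_fr[OF frames_V[OF assms(1) that]])
    show "fr ` frames d <= fr_nbhd d" by (simp add: fr_nbhd_def)
    show "frco ` fr_nbhd d <= frames d" by (simp add: fr_nbhd_def image_image image_subset_iff ff)
    show "frco (fr k) = k" if "k \<in> frames d" for k by (rule ff[OF that])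
    show "fr (frco a) = a" if "a \<in> fr_nbhd d" for a
    proof -
      obtain k where "k \<in> frames d" "a = fr k" using \<open>a \<in> fr_nbhd d\<close> unfolding fr_nbhd_def by (rule imageE)
      then show ?thesis by (simp add: ff)
    qed
  qed
  then have "frames d homeomorphic fr_nbhd d" unfolding homeomorphic_def by blast
  then show ?thesis
    using homeomorphic_simply_connected_eq convex_imp_simply_connected[OF convex_frames] by blast
qed

lemma smooth_path_connected_fr_nbhd:
  assumes "ball 0 d <= V" "d > 0"
  shows "smooth_path_connected (fr_nbhd d)"
  unfolding smooth_path_connected_def
proof (intro ballI)
  fix a b assume "a \<in> fr_nbhd d" "b \<in> fr_nbhd d"
  then obtain k k' where k: "k \<in> frames d" "k' \<in> frames d" "a = fr k" "b = fr k'" by (auto simp: fr_nbhd_def)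
  define l where "l t = (1 - step t) *\<^sub>R k + step t *\<^sub>R k'" for t
  have lf: "l t \<in> frames d" for t
    unfolding l_def using convexD[OF convex_frames k(1,2), of "1 - step t" "step t"] by simp
  have "smooth_on UNIV l" unfolding l_def
    by (intro smooth_on_add smooth_on_scaleR smooth_on_step smooth_on_diff smooth_on_const smooth_on_id)
  then have "smooth_on UNIV (\<lambda>t. fr (l t))"
    by (rule smooth_on_compose[OF _ smooth_fr]) (simp add: mem_Times_iff frames_V[OF assms(1) lf])
  with lf show "\<exists>c. smooth_on UNIV c \<and> range c <= fr_nbhd d \<and> c 0 = a \<and> c (1::real) = b"
    by (intro exI[of _ "\<lambda>t. fr (l t)"]) (auto simp: fr_nbhd_def l_def k)
qed

lemma trans_nbhd_fr_nbhd:
  assumes V: "0 \<in> V"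
  obtains d0 s where "d0 > 0" "ball 0 d0 <= V" "!!d. 0 < d ==> d <= d0 ==> trans_nbhd M B (fr_nbhd d) s"
proof -
  obtain e where e: "e > 0" "cball 0 e <= V" using openV V open_contains_cball by blast
  define r where "r = e / 2"
  have r: "r > 0" "cball 0 (2 * r) <= V" using e by (auto simp: r_def)
  obtain L where L: "L \<ge> 0" "!!x y. \<bar>bump r x - bump r y\<bar> <= L * norm (x - y)"
    by (rule bump_lipschitz[OF r(1)]) (rule that)
  define C where "C = 2 * (L * (2 + 2 * r)) + 2"
  have C: "C > 0" using L r by (simp add: C_def add_nonneg_pos)
  \<comment> \<open>\<open>d0 <= r\<close> puts the frames where the bump is 1, so that
    \<open>move\<close> is affine near them. The bounds 1 and \<open>1 / (2 * C)\<close> are the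
    conditions of \<open>mono_plane_move\<close>.\<close>
  define d0 where "d0 = min (min 1 r) (1 / (2 * C))"
  have d0: "d0 > 0" "d0 <= 1" "d0 <= r" "d0 <= 1 / (2 * C)" using r C by (auto simp: d0_def)
  have d0V: "ball 0 d0 <= V" using r d0 by auto
  define s where "s a b = ext (move r (frco a) (frco b))" for a b
  show thesis
  proof (rule that[OF d0(1) d0V, of s])
    fix d assume d: "0 < d" "d <= d0"
    have dV: "ball 0 d <= V" using d0V d by auto
    have "d * C <= 1 / (2 * C) * C" using d d0 C by (intro mult_right_mono) auto
    then have dC: "d * (2 * (L * (2 + 2 * r)) + 2) <= 1 / 2" using C by (simp add: C_def[symmetric])
    have mp: "mono_plane 1 (1/2) (2 * r) (move r k k')" if "k \<in> frames d" "k' \<in> frames d" for k k'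
      by (rule mono_plane_move[OF r(1) L d(1) _ dC that]) (use d d0 in auto)
    have sm: "smooth_on UNIV (move r k k')" for k k'
      using smooth_on_compose[OF smooth_on_Pair[OF smooth_on_const[of UNIV "(k, k')"] smooth_on_id] smooth_move[of UNIV r]]
      by simp
    have mV: "move r k k' y \<in> V" if "k \<in> frames d" "k' \<in> frames d" "y \<in> V" for k k' y
      using mono_plane_V[OF bij_is_inj[OF mono_plane_diffeo(1)[OF sm mp]] mono_plane_diffeo(3)[OF sm mp] r(2)] that
      by auto
    have fc: "frco a \<in> frames d" "fr (frco a) = a" "norm (fst (frco a)) < r" if a: "a \<in> fr_nbhd d" for a
    proof -
      obtain k where "k \<in> frames d" "a = fr k" using a by (auto simp: fr_nbhd_def)
      then show "frco a \<in> frames d" "fr (frco a) = a" "norm (fst (frco a)) < r"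
        using frames_V[OF dV] d d0 by (auto simp: frames_def)
    qed
    have sd: "s a b \<in> diffeos M B" if "a \<in> fr_nbhd d" "b \<in> fr_nbhd d" for a b
      unfolding s_def
      by (rule ext_mono_diffeos(1)[OF sm mp[OF fc(1)[OF that(1)] fc(1)[OF that(2)]] _ _ r(2)]) auto
    have "act M (s a b) a = b" if ab: "a \<in> fr_nbhd d" "b \<in> fr_nbhd d" for a b
    proof -
      let ?k = "frco a" and ?k' = "frco b"
      have "act M (s a b) (fr ?k) = ray (move r ?k ?k' (fst ?k)) ((1, snd ?k) + (0, (snd ?k' - snd ?k) * fst (1::real, snd ?k)))"
        unfolding s_def fr_def
        by (rule act_ext[OF frames_V[OF dV fc(1)[OF ab(1)]] move_derivative[OF r(1) fc(3)[OF ab(1)]]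
              mV[OF fc(1)[OF ab(1)] fc(1)[OF ab(2)]] diffeosD(1)[OF sd[OF ab, unfolded s_def]]])
          (simp_all add: zero_prod_def)
      also have "\<dots> = fr ?k'"
        using move_point[OF r(1) fc(3)[OF ab(1)]] by (simp add: fr_def)
      finally show ?thesis using fc(2)[OF ab(1)] fc(2)[OF ab(2)] by simp
    qed
    moreover have "s a a = id" if "a \<in> fr_nbhd d" for a
      unfolding s_def by (rule ext) (simp add: ext_id[OF move_self])
    moreover have "smooth_isotopy M B (\<lambda>t. s (c t) (c' t))"
      if c: "smooth_on {0..1} c" "smooth_on {0..1} c'" "c ` {0..1} <= fr_nbhd d" "c' ` {0..1} <= fr_nbhd d" for c c'
    proof (rule smooth_isotopyI[where U = "- ch ` cball 0 (2 * r)"])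
      have cc: "c t \<in> fr_nbhd d" "c' t \<in> fr_nbhd d" if "t \<in> {0..1}" for t using c(3,4) that by auto
      show "s (c t) (c' t) \<in> diffeos M B" if "t \<in> {0..1}" for t using sd cc[OF that] by blast
      have f: "smooth_on ((frames d \<times> frames d) \<times> M) (\<lambda>(kk, p). ext (move r (fst kk) (snd kk)) p)"
        by (rule ext_family[OF compact_cball r(2)])
          (use mV mono_plane_diffeo(3)[OF sm mp] smooth_move[of _ r] in \<open>auto simp: case_prod_beta' dist_norm\<close>)
      have k: "smooth_on {0..1} (\<lambda>t. (frco (c t), frco (c' t)))"
        by (intro smooth_on_Pair smooth_on_compose[OF c(1) smooth_frco[OF dV d(1)]]
            smooth_on_compose[OF c(2) smooth_frco[OF dV d(1)]] cc)
      have "smooth_on ({0..1} \<times> M) (\<lambda>(t, p). ext (move r (fst (frco (c t), frco (c' t))) (snd (frco (c t), frco (c' t)))) p)"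
        by (rule smooth_family_reparam[OF f k]) (use fc(1) cc in auto)
      then show "smooth_on ({0..1} \<times> M) (\<lambda>(t, p). s (c t) (c' t) p)" by (simp add: s_def)
      show "open (- ch ` cball 0 (2 * r))" by (rule compact_image[OF compact_cball r(2)])
      show "B <= - ch ` cball 0 (2 * r)" using UB ch_in(2) r(2) by blast
      show "s (c t) (c' t) p = p" if "t \<in> {0..1}" "p \<in> - ch ` cball 0 (2 * r)" for t p
        unfolding s_def
        by (rule ext_outside[of "cball 0 (2 * r)"])
          (use that mono_plane_diffeo(3)[OF sm mp[OF fc(1)[OF cc(1)[OF that(1)]] fc(1)[OF cc(2)[OF that(1)]]]] in \<open>auto simp: dist_norm\<close>)
    qed
    ultimately show "trans_nbhd M B (fr_nbhd d) s"
      unfolding trans_nbhd_def using sd by blast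
  qed
qed

end

section \<open>Lifting paths of framed points\<close>

lemma diffeomorphismD:
  assumes "diffeomorphism V S f"
  shows "smooth_on V f" "smooth_on S (inv_into V f)" "!!y. y \<in> V ==> f y \<in> S" "!!p. p \<in> S ==> inv_into V f p \<in> V"
    "!!y. y \<in> V ==> inv_into V f (f y) = y" "!!p. p \<in> S ==> f (inv_into V f p) = p"
proof -
  have b: "bij_betw f V S" and s: "smooth_on V f" "smooth_on S (inv_into V f)"
    using assms unfolding diffeomorphism_def by blast+
  show "smooth_on V f" "smooth_on S (inv_into V f)" by (fact s)+
  show "!!y. y \<in> V ==> f y \<in> S" "!!p. p \<in> S ==> inv_into V f p \<in> V"
    using bij_betw_apply[OF b] bij_betw_apply[OF bij_betw_inv_into[OF b]] by blast+
  show "!!y. y \<in> V ==> inv_into V f (f y) = y" "!!p. p \<in> S ==> f (inv_into V f p) = p"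
    using bij_betw_inv_into_left[OF b] bij_betw_inv_into_right[OF b] by blast+
qed

locale pointed_surface =
  fixes M B :: "R3 set" and v0 :: "R3 \<times> R3"
  assumes charts: "!!p. p \<in> M ==> p \<notin> B ==>
      \<exists>U (V :: R2 set) f. open U \<and> p \<in> U \<and> open V \<and> diffeomorphism V (M \<inter> U) f"
    and closedB: "closed B" and v0: "v0 \<in> utb_inner M B"
begin

abbreviation X where "X \<equiv> utb_inner M B"

lemma X_utb: "a \<in> X ==> a \<in> unit_tangent_bundle M"
  by (simp add: utb_inner_def)

text \<open>A given chart is precomposed with a similarity of the plane, so that the framed point
  becomes the origin with the first basis direction.\<close>

lemma chart_through:
  assumes a: "a \<in> X"
  obtains U V f where "plane_chart M B U V f" "0 \<in> V" "plane_chart.fr f 0 = a"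
proof -
  obtain p w where p': "a = (p, w)" "p \<in> M" "w \<in> tangent_space M p" "norm w = 1"
    by (rule utbE[OF X_utb[OF a]]) (rule that)
  have "p \<notin> B" using a by (simp add: utb_inner_def p'(1))
  note p = p' this
  obtain U0 and V0 :: "R2 set" and f0 where c0: "open U0" "p \<in> U0" "open V0" "diffeomorphism V0 (M \<inter> U0) f0"
    using charts[OF p(2,5)] by blast
  note D0 = diffeomorphismD[OF c0(4)]
  define U where "U = U0 - B"
  define V1 where "V1 = V0 \<inter> f0 -` U"
  have U: "open U" "p \<in> U" using c0 closedB p(5) by (auto simp: U_def open_Diff)
  have V1: "open V1" unfolding V1_def
    by (rule continuous_open_preimage[OF smooth_on_imp_continuous_on[OF D0(1)] c0(3) U(1)])
  have "plane_chart M B U V1 f0"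
  proof
    show "diffeomorphism V1 (M \<inter> U) f0"
      by (rule diffeomorphismI[OF smooth_on_subset[OF D0(1)] smooth_on_subset[OF D0(2)]])
        (use D0(3-6) in \<open>auto simp: V1_def U_def\<close>)
  qed (use U V1 in \<open>auto simp: U_def\<close>)
  then interpret C1: plane_chart M B U V1 f0 .
  define y0 where "y0 = C1.co p"
  define u where "u = C1.dco p w"
  have y0: "y0 \<in> V1" "f0 y0 = p" using C1.co_in[OF p(2) U(2)] C1.ch_co[OF p(2) U(2)] by (auto simp: y0_def)
  have dw: "C1.dch y0 u = w" unfolding y0_def u_def by (rule C1.dch_dco[OF p(2) U(2) p(3)])
  have u0: "u ~= 0" using dw linear_0[OF C1.dch_linear[OF y0(1)]] p(4) by auto
  define n where "n = (fst u)\<^sup>2 + (snd u)\<^sup>2"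
  have n: "n ~= 0" using u0 by (simp add: n_def prod_eq_iff sum_power2_eq_zero_iff)
  \<comment> \<open>Multiplication by \<open>u\<close> as a complex number, so that
    \<open>(1, 0)\<close> goes to \<open>u\<close>. The map \<open>A'\<close> subtracts
    \<open>y0\<close> and divides by \<open>u\<close>, where \<open>n\<close> is the squared modulus
    of \<open>u\<close>.\<close>
  define L :: "R2 => R2" where "L y = (fst y * fst u - snd y * snd u, fst y * snd u + snd y * fst u)" for y
  define A where "A y = y0 + L y" for y
  define A' :: "R2 => R2" where "A' z = ((fst (z - y0) * fst u + snd (z - y0) * snd u) / n,
      (snd (z - y0) * fst u - fst (z - y0) * snd u) / n)" for z
  have "(fst y * fst u - snd y * snd u) * fst u + (fst y * snd u + snd y * fst u) * snd u = fst y * n"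
     "(fst y * snd u + snd y * fst u) * fst u - (fst y * fst u - snd y * snd u) * snd u = snd y * n" for y :: R2
    by (simp_all add: n_def power2_eq_square algebra_simps)
  then have AA: "A' (A y) = y" for y using n by (simp add: A_def A'_def L_def prod_eq_iff)
  have AA': "A (A' z) = z" for z
  proof -
    have "(a * fst u + b * snd u) * fst u - (b * fst u - a * snd u) * snd u = a * n"
      "(a * fst u + b * snd u) * snd u + (b * fst u - a * snd u) * fst u = b * n" for a b
      by (simp_all add: n_def power2_eq_square algebra_simps)
    note ab = this
    have d: "c / n * x - d / n * y = (c * x - d * y) / n" "c / n * x + d / n * y = (c * x + d * y) / n"
      for c d x y by (simp_all add: diff_divide_distrib add_divide_distrib)
    have "L (A' z) = z - y0" using n
      by (intro prod_eqI) (simp_all only: A'_def L_def fst_conv snd_conv d ab nonzero_mult_div_cancel_right not_False_eq_True)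
    then show ?thesis by (simp add: A_def)
  qed
  have sA: "smooth_on S A" "smooth_on S A'" for S
    unfolding A_def A'_def L_def divide_inverse
    by (intro smooth_on_add smooth_on_Pair smooth_on_diff smooth_on_mult smooth_on_fst smooth_on_snd
        smooth_on_const smooth_on_id)+
  define V where "V = A -` V1"
  define f where "f y = f0 (A y)" for y
  have V: "open V" unfolding V_def
    by (rule open_vimage[OF V1 smooth_on_imp_continuous_on[OF sA(1)]])
  have "plane_chart M B U V f"
  proof
    show "diffeomorphism V (M \<inter> U) f"
    proof (rule diffeomorphismI)
      show "smooth_on V f" unfolding f_def
        by (rule smooth_on_compose[OF sA(1) C1.smooth_ch]) (simp add: V_def)
      show "smooth_on (M \<inter> U) (\<lambda>p. A' (C1.co p))"
        by (rule smooth_on_compose[OF C1.smooth_co sA(2)[of UNIV]]) simp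
    qed (use C1.ch_in C1.co_in in \<open>simp_all add: V_def f_def AA AA'\<close>)
  qed (use U V C1.UB in auto)
  then interpret C: plane_chart M B U V f .
  have A0: "A 0 = y0" by (simp add: A_def L_def zero_prod_def[symmetric])
  have "(A has_derivative L) (at 0)"
    unfolding A_def L_def by (auto intro!: derivative_eq_intros)
  moreover have "(f0 has_derivative C1.dch y0) (at (A 0))" unfolding A0 by (rule C1.dch_derivative[OF y0(1)])
  ultimately have "(f0 \<circ> A has_derivative C1.dch y0 \<circ> L) (at 0)" by (rule diff_chain_at)
  moreover have "f0 \<circ> A = f" by (rule ext) (simp add: f_def)
  ultimately have "(f has_derivative C1.dch y0 \<circ> L) (at 0)" by simp
  from frechet_derivative_at[OF this] have "C.dch 0 = C1.dch y0 \<circ> L" by (simp add: C.dch_def)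
  then have "C.dch 0 (1, 0) = w" using dw by (simp add: L_def)
  then have "C.fr 0 = a"
    using A0 y0(2) p(1,4) by (simp add: C.fr_def C.ray_def f_def nrm_unit)
  moreover have "0 \<in> V" using A0 y0(1) by (simp add: V_def)
  ultimately show thesis by (intro that[OF C.plane_chart_axioms])
qed

text \<open>Simple connectivity serves to compare a path with the trace of its lift, smooth path
  connectedness to choose smooth curves inside \<open>W\<close>, and \<open>trans_nbhd\<close> to
  realize such curves by diffeomorphisms.\<close>

definition good where
  "good W s \<longleftrightarrow> W <= X \<and> simply_connected W \<and> smooth_path_connected W \<and> trans_nbhd M B W s"

lemma good_base:
  assumes a: "a \<in> X" and N: "open N" "a \<in> N"
  shows "\<exists>W s Q. a \<in> W \<and> W <= N \<and> open Q \<and> W = X \<inter> Q \<and> good W s"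
proof -
  obtain U V f where "plane_chart M B U V f" and V: "0 \<in> V" and f0: "plane_chart.fr f 0 = a"
    by (rule chart_through[OF a]) (rule that)
  then interpret C: plane_chart M B U V f by simp
  obtain d0 s where d0: "d0 > 0" "ball 0 d0 <= V" "!!d. 0 < d ==> d <= d0 ==> trans_nbhd M B (C.fr_nbhd d) s"
    by (rule C.trans_nbhd_fr_nbhd[OF V]) (rule that)
  have "open ((V \<times> UNIV) \<inter> C.fr -` N)"
    by (rule continuous_open_preimage[OF smooth_on_imp_continuous_on[OF C.smooth_fr] open_Times[OF C.openV open_UNIV] N(1)])
  moreover have "0 \<in> (V \<times> UNIV) \<inter> C.fr -` N" using V f0 N(2) by (simp add: mem_Times_iff)
  ultimately obtain e where e: "e > 0" "ball 0 e <= (V \<times> UNIV) \<inter> C.fr -` N"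
    by (rule openE)
  define d where "d = min d0 (e / 2)"
  have d: "0 < d" "d <= d0" "d <= e / 2" using d0(1) e(1) by (auto simp: d_def)
  have dV: "ball 0 d <= V" using d(2) d0(2) by auto
  have 1: "C.fr_nbhd d <= N"
  proof
    fix b assume "b \<in> C.fr_nbhd d"
    then obtain k where k: "k \<in> frames d" "b = C.fr k" unfolding C.fr_nbhd_def by blast
    have "norm k <= norm (fst k) + norm (snd k)" using norm_Pair_le[of "fst k" "snd k"] by simp
    moreover have "norm (fst k) < d" "\<bar>snd k\<bar> < d"
      using k(1) unfolding frames_def mem_Times_iff mem_ball_0 greaterThanLessThan_iff by linarith+
    ultimately have "norm k < e" using d(3) unfolding real_norm_def by linarith
    then have "k \<in> ball 0 e" by simp
    then have "k \<in> C.fr -` N" using e(2) by blast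
    then show "b \<in> N" using k(2) by simp
  qed
  have 2: "a \<in> C.fr_nbhd d"
    unfolding C.fr_nbhd_def by (rule image_eqI[where x = 0]) (simp_all add: f0 frames_def mem_Times_iff d(1))
  obtain Q where 3: "open Q" "C.fr_nbhd d = X \<inter> Q"
    using C.openin_fr_nbhd[OF dV d(1)] unfolding openin_open by (elim exE conjE)
  have 4: "good (C.fr_nbhd d) s"
    unfolding good_def
    using C.simply_connected_fr_nbhd[OF dV d(1)] C.smooth_path_connected_fr_nbhd[OF dV d(1)] d0(3)[OF d(1,2)]
      openin_imp_subset[OF C.openin_fr_nbhd[OF dV d(1)]] by simp
  show ?thesis by (intro exI conjI, rule 2, rule 1, rule 3, rule 3, rule 4)
qed

text \<open>A Lebesgue number for a cover by good sets. They are taken inside balls of radius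
  \<open>\<rho> / 2\<close>, so that each of them lies in the ball of radius \<open>\<rho>\<close>
  about any of its points.\<close>

lemma good_cover:
  assumes K: "compact K" "K <= X" and \<rho>: "\<rho> > 0"
  obtains e where "e > 0" "!!x. x \<in> K ==> \<exists>W s. good W s \<and> W <= ball x \<rho> \<and> X \<inter> ball x e <= W"
proof -
  define P where "P Q \<longleftrightarrow> open Q \<and> (\<exists>s y. good (X \<inter> Q) s \<and> X \<inter> Q <= ball y (\<rho> / 2))" for Q
  have sub: "K <= \<Union>(Collect P)"
  proof
    fix x assume "x \<in> K"
    then have x: "x \<in> X" using K(2) by (rule rev_subsetD)
    have "x \<in> ball x (\<rho> / 2)" using \<rho> by simp
    from good_base[OF x open_ball this] obtain W s Q where
      W: "x \<in> W" "W <= ball x (\<rho> / 2)" "open Q" "W = X \<inter> Q" "good W s" by (elim exE conjE)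
    have "P Q" unfolding P_def using W(2,3,5) unfolding W(4) by (intro conjI exI)
    moreover have "x \<in> Q" using W(1,4) by simp
    ultimately show "x \<in> \<Union>(Collect P)" by (intro UnionI[of Q]) simp_all
  qed
  have op: "open G" if "G \<in> Collect P" for G using that by (simp add: P_def)
  obtain e where e: "e > 0" "!!x. x \<in> K ==> \<exists>G\<in>Collect P. ball x e <= G"
    by (rule Heine_Borel_lemma[OF K(1) sub op], assumption, rule that)
  show thesis
  proof (rule that[OF e(1)])
    fix x assume x: "x \<in> K"
    from e(2)[OF this] obtain Q where Q: "P Q" "ball x e <= Q" by (elim bexE) simp
    then obtain s y where W: "good (X \<inter> Q) s" "X \<inter> Q <= ball y (\<rho> / 2)" unfolding P_def by (elim exE conjE)
    have xW: "x \<in> X \<inter> Q" using x K(2) Q(2) e(1) by auto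
    have 1: "X \<inter> Q <= ball x \<rho>"
    proof
      fix z assume "z \<in> X \<inter> Q"
      then have "z \<in> ball y (\<rho> / 2)" "x \<in> ball y (\<rho> / 2)" using subsetD[OF W(2)] xW by simp_all
      then show "z \<in> ball x \<rho>" using dist_triangle2[of x z y] by (simp add: dist_commute)
    qed
    have 2: "X \<inter> ball x e <= X \<inter> Q" by (rule Int_mono[OF order_refl Q(2)])
    show "\<exists>W s. good W s \<and> W <= ball x \<rho> \<and> X \<inter> ball x e <= W"
      by (rule exI[of _ "X \<inter> Q"], rule exI[of _ s]) (intro conjI W(1) 1 2)
  qed
qed

lemma act_X:
  assumes f: "f \<in> diffeos M B" and a: "a \<in> X" shows "act M f a \<in> X"
proof -
  have "f (fst a) \<notin> B"
  proof
    assume "f (fst a) \<in> B"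
    then have "f (f (fst a)) = f (fst a)" by (rule diffeosD(8)[OF f])
    then have "f (fst a) = fst a" using diffeosD(2)[OF f] by (simp add: bij_def inj_eq)
    with \<open>f (fst a) \<in> B\<close> a show False by (simp add: utb_inner_def)
  qed
  then show ?thesis using act_in[OF f X_utb[OF a]] by (simp add: utb_inner_def)
qed

end

section \<open>Traces of isotopies and uniqueness of nearby lifts\<close>

context pointed_surface begin

definition tr :: "(R3 => R3) => R3 \<times> R3" where "tr f = act M f v0"

lemma v0_utb: "v0 \<in> unit_tangent_bundle M" using X_utb[OF v0] .

lemma tr_id: "tr id = v0" unfolding tr_def by (rule act_id[OF v0_utb])

lemma tr_comp: "f \<in> diffeos M B ==> g \<in> diffeos M B ==> tr (f \<circ> g) = act M f (tr g)"
  unfolding tr_def by (rule act_comp[OF _ _ v0_utb])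

lemma tr_X: "f \<in> diffeos M B ==> tr f \<in> X"
  unfolding tr_def by (rule act_X[OF _ v0])

lemma smooth_tr:
  assumes F: "smooth_isotopy M B F" shows "smooth_on {0..1} (\<lambda>t. tr (F t))"
proof -
  have "smooth_on {0..1} (\<lambda>t. (\<lambda>(t, a). act M (F t) a) (t, v0))"
    by (rule smooth_on_compose[OF smooth_on_Pair[OF smooth_on_id smooth_on_const]
          act_smooth[OF smooth_isotopyD(2)[OF F] smooth_isotopyD(1)[OF F]]])
      (simp_all add: v0_utb)
  then show ?thesis by (simp add: tr_def)
qed

lemma path_tr: "smooth_isotopy M B F ==> path (\<lambda>t. tr (F t))"
  unfolding path_def by (rule smooth_on_imp_continuous_on[OF smooth_tr])

text \<open>Isotopy within a fibre of the evaluation map: the framed point has the same image and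
  direction at all times, while the value need not be \<open>v0\<close>.\<close>

definition fiso :: "(R3 => R3) => (R3 => R3) => bool" where
  "fiso f g \<longleftrightarrow> (\<exists>F. smooth_isotopy M B F \<and> F 0 = f \<and> F 1 = g \<and> (\<forall>t\<in>{0..1}. tr (F t) = tr f))"

lemma fisoI:
  assumes "smooth_isotopy M B F" "!!t. t \<in> {0..1} ==> tr (F t) = a" shows "fiso (F 0) (F 1)"
proof -
  have "tr (F t) = tr (F 0)" if "t \<in> {0..1}" for t using assms(2)[OF that] assms(2)[of 0] by simp
  then show ?thesis unfolding fiso_def using assms(1) by (intro exI[of _ F] conjI ballI refl)
qed

lemma fisoE:
  assumes "fiso f g"
  obtains F where "smooth_isotopy M B F" "F 0 = f" "F 1 = g" "!!t. t \<in> {0..1} ==> tr (F t) = tr f"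
  using assms unfolding fiso_def by (elim exE conjE) (rule that, assumption, assumption, assumption, blast)

lemma fiso_diffeos:
  assumes "fiso f g" shows "f \<in> diffeos M B \<and> g \<in> diffeos M B \<and> tr g = tr f"
proof -
  obtain F where F: "smooth_isotopy M B F" "F 0 = f" "F 1 = g" "!!t. t \<in> {0..1} ==> tr (F t) = tr f"
    by (rule fisoE[OF assms]) (rule that)
  show ?thesis using smooth_isotopyD(1)[OF F(1), of 0] smooth_isotopyD(1)[OF F(1), of 1] F(4)[of 1] F(2,3) by simp
qed

lemma fiso_refl: "f \<in> diffeos M B ==> fiso f f"
  by (rule fisoI[OF smooth_isotopy_const refl])

lemma fiso_sym:
  assumes "fiso f g" shows "fiso g f"
proof -
  obtain F where F: "smooth_isotopy M B F" "F 0 = f" "F 1 = g" "!!t. t \<in> {0..1} ==> tr (F t) = tr f"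
    by (rule fisoE[OF assms]) (rule that)
  have "fiso (F (1 - 0)) (F (1 - 1))"
    by (rule fisoI[OF smooth_isotopy_reverse[OF F(1)], of "tr f"]) (simp add: F(4))
  then show ?thesis using F by simp
qed

text \<open>The concatenated isotopy stays in the fibre because the inverse of the intermediate
  diffeomorphism brings the common trace back to \<open>v0\<close>.\<close>

lemma fiso_trans:
  assumes "fiso f g" "fiso g h" shows "fiso f h"
proof -
  obtain F where F: "smooth_isotopy M B F" "F 0 = f" "F 1 = g" "!!t. t \<in> {0..1} ==> tr (F t) = tr f"
    by (rule fisoE[OF assms(1)]) (rule that)
  obtain G where G: "smooth_isotopy M B G" "G 0 = g" "G 1 = h" "!!t. t \<in> {0..1} ==> tr (G t) = tr g"
    by (rule fisoE[OF assms(2)]) (rule that)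
  have g: "g \<in> diffeos M B" "tr g = tr f" using fiso_diffeos[OF assms(1)] by auto
  let ?K = "\<lambda>t. G t \<circ> (finv (F 1) \<circ> F t)"
  have K: "smooth_isotopy M B ?K" by (rule smooth_isotopy_concat[OF F(1) G(1)])
  have "tr (?K t) = tr f" if t: "t \<in> {0..1}" for t
  proof -
    have d: "G t \<in> diffeos M B" "F t \<in> diffeos M B" "finv g \<in> diffeos M B"
      using smooth_isotopyD(1)[OF F(1) t] smooth_isotopyD(1)[OF G(1) t] inv_diffeos[OF g(1)] by auto
    have "tr (?K t) = act M (G t) (act M (finv g) (tr (F t)))"
      unfolding F(3) tr_comp[OF d(1) comp_diffeos[OF d(3,2)]] tr_comp[OF d(3,2)] ..
    also have "act M (finv g) (tr (F t)) = v0"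
      using act_inv(1)[OF g(1) v0_utb] g(2) F(4)[OF t] by (simp add: tr_def)
    also have "act M (G t) v0 = tr f" using G(4)[OF t] g(2) by (simp add: tr_def)
    finally show ?thesis .
  qed
  from fisoI[OF K this] show ?thesis
    using F G diffeos_inv_simps[OF g(1)] by (simp add: comp_assoc[symmetric])
qed

lemma fiso_comp_left:
  assumes s: "s \<in> diffeos M B" and "fiso f g" shows "fiso (s \<circ> f) (s \<circ> g)"
proof -
  obtain F where F: "smooth_isotopy M B F" "F 0 = f" "F 1 = g" "!!t. t \<in> {0..1} ==> tr (F t) = tr f"
    by (rule fisoE[OF assms(2)]) (rule that)
  have "fiso (s \<circ> F 0) (s \<circ> F 1)"
    by (rule fisoI[OF smooth_isotopy_comp[OF smooth_isotopy_const[OF s] F(1)], of "act M s (tr f)"])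
      (simp add: tr_comp[OF s smooth_isotopyD(1)[OF F(1)]] F(4))
  then show ?thesis using F by simp
qed

lemma good_in: "good W s ==> a \<in> W ==> b \<in> W ==> s a b \<in> diffeos M B"
  and good_act: "good W s ==> a \<in> W ==> b \<in> W ==> act M (s a b) a = b"
  and good_self: "good W s ==> a \<in> W ==> s a a = id"
  and good_isotopy: "good W s ==> smooth_on {0..1} c ==> smooth_on {0..1} c' ==>
    (!!t. t \<in> {0..1} ==> c t \<in> W) ==> (!!t. t \<in> {0..1} ==> c' t \<in> W) ==> smooth_isotopy M B (\<lambda>t. s (c t) (c' t))"
  unfolding good_def trans_nbhd_def image_subset_iff by simp_all

text \<open>Both isotopies are followed by moves that carry their current trace to the final value
  \<open>?b\<close>. The resulting families \<open>?E\<close> and \<open>?E'\<close> have constant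
  trace. They are linked at time \<open>a\<close> by the hypothesis, and at time \<open>b\<close>
  they are the two sides of the conclusion.\<close>

lemma segment:
  assumes W: "good W s" and F: "smooth_isotopy M B F" and F': "smooth_isotopy M B F'"
    and ab: "0 <= a" "a <= b" "b <= 1"
    and c: "!!t. a <= t ==> t <= b ==> tr (F t) \<in> W" "!!t. a <= t ==> t <= b ==> tr (F' t) \<in> W"
    and st: "fiso (s (tr (F a)) (tr (F' a)) \<circ> F a) (F' a)"
  shows "fiso (s (tr (F b)) (tr (F' b)) \<circ> F b) (F' b)"
proof -
  define r where "r t = a + t * (b - a)" for t
  have r: "a <= r t" "r t <= b" "r t \<in> {0..1}" if "t \<in> {0..1}" for t
  proof -
    have "t * (b - a) <= 1 * (b - a)" by (rule mult_right_mono) (use that ab in auto)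
    moreover have "0 <= t * (b - a)" using that ab by simp
    ultimately show "a <= r t" "r t <= b" "r t \<in> {0..1}" using ab by (auto simp: r_def)
  qed
  have r01: "r 0 = a" "r 1 = b" by (simp_all add: r_def)
  have rs: "smooth_on {0..1} r" unfolding r_def
    by (intro smooth_on_add smooth_on_mult smooth_on_const smooth_on_id)
  have G: "smooth_isotopy M B (\<lambda>t. F (r t))" by (rule smooth_isotopy_reparam[OF F rs r(3)])
  have G': "smooth_isotopy M B (\<lambda>t. F' (r t))" by (rule smooth_isotopy_reparam[OF F' rs r(3)])
  have g: "tr (F (r t)) \<in> W" "tr (F' (r t)) \<in> W" if "t \<in> {0..1}" for t
    using c[OF r(1,2)[OF that]] by auto
  let ?b = "tr (F' b)"
  have b: "?b \<in> W" using c(2) ab by simp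
  have I1: "smooth_isotopy M B (\<lambda>t. s (tr (F' (r t))) ?b)"
    by (rule good_isotopy[OF W smooth_tr[OF G'] smooth_on_const g(2) b])
  have I2: "smooth_isotopy M B (\<lambda>t. s (tr (F (r t))) (tr (F' (r t))))"
    by (rule good_isotopy[OF W smooth_tr[OF G] smooth_tr[OF G'] g])
  let ?E = "\<lambda>t. s (tr (F' (r t))) ?b \<circ> (s (tr (F (r t))) (tr (F' (r t))) \<circ> F (r t))"
  let ?E' = "\<lambda>t. s (tr (F' (r t))) ?b \<circ> F' (r t)"
  have A: "fiso (?E 0) (?E 1)"
  proof (rule fisoI[OF smooth_isotopy_comp[OF I1 smooth_isotopy_comp[OF I2 G]], of ?b])
    fix t :: real assume t: "t \<in> {0..1}"
    note d = good_in[OF W g(2)[OF t] b] good_in[OF W g[OF t]] smooth_isotopyD(1)[OF G t]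
    show "tr (?E t) = ?b"
      unfolding tr_comp[OF d(1) comp_diffeos[OF d(2,3)]] tr_comp[OF d(2,3)] good_act[OF W g[OF t]]
      by (rule good_act[OF W g(2)[OF t] b])
  qed
  have A': "fiso (?E' 0) (?E' 1)"
  proof (rule fisoI[OF smooth_isotopy_comp[OF I1 G'], of ?b])
    fix t :: real assume t: "t \<in> {0..1}"
    show "tr (?E' t) = ?b"
      unfolding tr_comp[OF good_in[OF W g(2)[OF t] b] smooth_isotopyD(1)[OF G' t]]
      by (rule good_act[OF W g(2)[OF t] b])
  qed
  have A'': "fiso (?E 0) (?E' 0)"
    using fiso_comp_left[OF good_in[OF W g(2)[of 0] b] st] by (simp add: r01)
  have "fiso (?E 1) (?E' 1)" by (rule fiso_trans[OF fiso_trans[OF fiso_sym[OF A] A''] A'])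
  moreover have "?E 1 = s (tr (F b)) (tr (F' b)) \<circ> F b" "?E' 1 = F' b"
    using good_self[OF W b] by (simp_all add: r01)
  ultimately show ?thesis by simp
qed

text \<open>The curve \<open>d\<close> runs in \<open>Z\<close> from \<open>b\<close> to
  \<open>a\<close>. Moving \<open>a\<close> to \<open>d t\<close> with \<open>s\<close> and then
  \<open>d t\<close> to \<open>b\<close> with \<open>s'\<close> interpolates between
  \<open>s a b\<close> and \<open>s' a b\<close>, because \<open>s' b b\<close> and
  \<open>s a a\<close> are the identity.\<close>

lemma change:
  assumes W: "good W s" and W': "good W' s'" and Z: "good Z z" "Z <= W" "Z <= W'"
    and f: "f \<in> diffeos M B" "tr f = a" and ab: "a \<in> Z" "b \<in> Z"
  shows "fiso (s a b \<circ> f) (s' a b \<circ> f)"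
proof -
  obtain d where d: "smooth_on UNIV d" "range d <= Z" "d 0 = b" "d (1::real) = a"
    using bspec[OF bspec[OF conjunct1[OF conjunct2[OF conjunct2[OF Z(1)[unfolded good_def]]],
      unfolded smooth_path_connected_def] ab(2)] ab(1)] by (elim exE conjE)
  have dW: "d t \<in> W" "d t \<in> W'" for t using d(2) Z(2,3) by auto
  have aW: "a \<in> W" "b \<in> W'" "a \<in> W'" "b \<in> W" using ab Z by auto
  have ds: "smooth_on {0..1} d" by (rule smooth_on_subset[OF d(1)]) simp
  let ?E = "\<lambda>t. s' (d t) b \<circ> (s a (d t) \<circ> f)"
  have "fiso (?E 0) (?E 1)"
  proof (rule fisoI)
    show "smooth_isotopy M B ?E"
      by (intro smooth_isotopy_comp smooth_isotopy_const[OF f(1)] good_isotopy[OF W' ds smooth_on_const dW(2) aW(2)]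
          good_isotopy[OF W smooth_on_const ds aW(1) dW(1)])
    show "tr (?E t) = b" if "t \<in> {0..1}" for t
      unfolding tr_comp[OF good_in[OF W' dW(2) aW(2)] comp_diffeos[OF good_in[OF W aW(1) dW(1)] f(1)]]
        tr_comp[OF good_in[OF W aW(1) dW(1)] f(1)] f(2) good_act[OF W aW(1) dW(1)]
      by (rule good_act[OF W' dW(2) aW(2)])
  qed
  then show ?thesis using good_self[OF W' aW(2)] good_self[OF W aW(1)] by (simp add: d)
qed

definition lift :: "(real => R3 => R3) => bool" where
  "lift F \<longleftrightarrow> smooth_isotopy M B F \<and> F 0 = id"

definition near :: "real => (real => R3 \<times> R3) => (real => R3 => R3) => bool" where
  "near e g F \<longleftrightarrow> (\<forall>t\<in>{0..1}. dist (g t) (tr (F t)) < e)"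

lemma path_partition:
  fixes g :: "real => 'a::metric_space"
  assumes "path g" "e > 0"
  obtains N :: nat where "N > 0"
    "!!u v. u \<in> {0..1} ==> v \<in> {0..1} ==> \<bar>u - v\<bar> <= 1 / N ==> dist (g u) (g v) < e"
proof -
  have "uniformly_continuous_on {0..1} g"
    using compact_uniformly_continuous[OF _ compact_Icc] assms(1) unfolding path_def by simp
  then obtain d where d: "d > 0" "!!u v. u \<in> {0..1} ==> v \<in> {0..1} ==> dist v u < d ==> dist (g v) (g u) < e"
    using assms(2) unfolding uniformly_continuous_on_def by (elim allE[of _ e]) auto
  obtain N :: nat where N: "N > 0" "inverse (real N) < d" using ex_inverse_of_nat_less[OF d(1)] by blast
  show thesis
  proof (rule that[OF N(1)])
    fix u v :: real assume "u \<in> {0..1}" "v \<in> {0..1}" "\<bar>u - v\<bar> <= 1 / N"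
    then show "dist (g u) (g v) < e"
      using d(2)[of v u] N(2) by (simp add: dist_real_def inverse_eq_divide)
  qed
qed

text \<open>Carried along a fine partition is the claim that \<open>F\<close>, moved onto the trace
  of \<open>F'\<close> by the current local section, is fibre isotopic to \<open>F'\<close>. Lemma
  \<open>segment\<close> crosses an interval, and \<open>change\<close> passes to the next local
  section at a partition point.\<close>

lemma unique_near:
  assumes g: "path g" "path_image g <= X"
  obtains e where "e > 0" "!!F F'. lift F ==> lift F' ==> near e g F ==> near e g F' ==>
    tr (F 1) = tr (F' 1) ==> fiso (F 1) (F' 1)"
proof -
  have K: "compact (path_image g)" by (rule compact_path_image[OF g(1)])
  have gK: "g u \<in> path_image g" if "u \<in> {0..1}" for u using that by (simp add: path_image_def)
  obtain e1 where e1: "e1 > 0" "!!x. x \<in> path_image g ==> \<exists>W s. good W s \<and> W <= ball x 1 \<and> X \<inter> ball x e1 <= W"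
    by (rule good_cover[OF K g(2) zero_less_one]) (rule that)
  have e12: "e1 / 2 > 0" using e1(1) by simp
  \<comment> \<open>The sets of this second cover are so small that the one around a partition point
    lies in both neighbouring sets of the first cover, as \<open>change\<close> requires.\<close>
  obtain e2 where e2: "e2 > 0" "!!x. x \<in> path_image g ==> \<exists>W s. good W s \<and> W <= ball x (e1 / 2) \<and> X \<inter> ball x e2 <= W"
    by (rule good_cover[OF K g(2) e12]) (rule that)
  obtain N :: nat where N: "N > 0"
    "!!u v. u \<in> {0..1} ==> v \<in> {0..1} ==> \<bar>u - v\<bar> <= 1 / N ==> dist (g u) (g v) < e1 / 2"
    by (rule path_partition[OF g(1) e12]) (rule that)
  define q where "q k = real k / N" for k
  have q: "q k \<in> {0..1}" if "k <= N" for k using that N(1) by (simp add: q_def)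
  have qS: "q (Suc k) = q k + 1 / N" for k by (simp add: q_def add_divide_distrib)
  have "\<exists>Ws. k <= N --> good (fst Ws) (snd Ws) \<and> X \<inter> ball (g (q k)) e1 <= fst Ws" for k
  proof (cases "k <= N")
    case True
    from e1(2)[OF gK[OF q[OF this]]] obtain W s where
      "good W s" "X \<inter> ball (g (q k)) e1 <= W" by (elim exE conjE)
    then show ?thesis by (intro exI[of _ "(W, s)"]) simp
  qed simp
  then have "\<forall>k. \<exists>Ws. k <= N --> good (fst Ws) (snd Ws) \<and> X \<inter> ball (g (q k)) e1 <= fst Ws" ..
  from choice[OF this] obtain Ws where Ws:
    "\<forall>k. k <= N --> good (fst (Ws k)) (snd (Ws k)) \<and> X \<inter> ball (g (q k)) e1 <= fst (Ws k)" ..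
  define W s where "W k = fst (Ws k)" and "s k = snd (Ws k)" for k
  have W: "!!k. k <= N ==> good (W k) (s k)" "!!k. k <= N ==> X \<inter> ball (g (q k)) e1 <= W k"
    using Ws by (simp_all add: W_def s_def)
  \<comment> \<open>The bound \<open>e2\<close> puts both traces into the small set \<open>Z\<close>
    at a partition point; \<open>e1 / 2\<close>, together with the oscillation of \<open>g\<close>,
    keeps them in \<open>W k\<close> on the whole interval.\<close>
  let ?e = "min e2 (e1 / 2)"
  show thesis
  proof (rule that[of ?e])
    show "0 < ?e" using e1(1) e2(1) by simp
    fix F F' assume F: "lift F" "lift F'" and n: "near ?e g F" "near ?e g F'" and eq: "tr (F 1) = tr (F' 1)"
    have I: "smooth_isotopy M B F" "smooth_isotopy M B F'" "F 0 = id" "F' 0 = id"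
      using F by (auto simp: lift_def)
    have X: "tr (F t) \<in> X" "tr (F' t) \<in> X" if "t \<in> {0..1}" for t
      using tr_X[OF smooth_isotopyD(1)[OF I(1) that]] tr_X[OF smooth_isotopyD(1)[OF I(2) that]] by auto
    have nn: "dist (g t) (tr (F t)) < ?e" "dist (g t) (tr (F' t)) < ?e" if "t \<in> {0..1}" for t
      using n that unfolding near_def by simp_all
    have inW: "tr (F t) \<in> W k" "tr (F' t) \<in> W k" if k: "k < N" and t: "q k <= t" "t <= q (Suc k)" for k t
    proof -
      have t1: "t \<in> {0..1}" using t q[of k] q[of "Suc k"] k by auto
      have "dist (g (q k)) (g t) < e1 / 2"
        by (rule N(2)) (use t t1 q[of k] k qS[of k] in auto)
      then have "dist (g (q k)) (tr (F t)) < e1" "dist (g (q k)) (tr (F' t)) < e1"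
        using nn[OF t1] dist_triangle[of "g (q k)" "tr (F t)" "g t"] dist_triangle[of "g (q k)" "tr (F' t)" "g t"] by auto
      then show "tr (F t) \<in> W k" "tr (F' t) \<in> W k" using W(2)[of k] X[OF t1] k by auto
    qed
    have P: "fiso (s k (tr (F (q k))) (tr (F' (q k))) \<circ> F (q k)) (F' (q k))" if "k <= N" for k
      using that
    proof (induction k)
      case 0
      have "v0 \<in> W 0" using inW(1)[OF N(1), of "q 0"] I(3) tr_id by (simp add: q_def)
      then have "s 0 v0 v0 = id" by (rule good_self[OF W(1)[OF 0]])
      moreover have "q 0 = 0" by (simp add: q_def)
      ultimately show ?case by (simp only: I(3,4) tr_id id_o fiso_refl[OF id_diffeos])
    next
      case (Suc k)
      let ?t = "q (Suc k)"
      have k: "k < N" "k <= N" using Suc.prems by auto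
      have t1: "?t \<in> {0..1}" by (rule q[OF Suc.prems])
      have kt: "q k <= ?t" by (simp add: qS)
      have 1: "fiso (s k (tr (F ?t)) (tr (F' ?t)) \<circ> F ?t) (F' ?t)"
        by (rule segment[OF W(1)[OF k(2)] I(1,2) _ kt _ inW[OF k(1)] Suc.IH[OF k(2)]])
          (use t1 q[OF k(2)] in auto)
      obtain Z z where Z: "good Z z" "Z <= ball (g ?t) (e1 / 2)" "X \<inter> ball (g ?t) e2 <= Z"
        using e2(2)[OF gK[OF t1]] by (elim exE conjE)
      have ZX: "Z <= X" using Z(1) by (simp add: good_def)
      have ZW': "Z <= W (Suc k)"
      proof -
        have "ball (g ?t) (e1 / 2) <= ball (g ?t) e1" using e1(1) by (intro subset_ball) simp
        then have "Z <= X \<inter> ball (g ?t) e1" by (intro Int_greatest[OF ZX order_trans[OF Z(2)]])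
        then show ?thesis using W(2)[OF Suc.prems] by (rule order_trans)
      qed
      have ZW: "Z <= W k"
      proof
        fix x assume x: "x \<in> Z"
        have "dist (g (q k)) (g ?t) < e1 / 2" by (rule N(2)) (use q[OF k(2)] t1 qS[of k] in auto)
        moreover have "dist (g ?t) x < e1 / 2" using x Z(2) by auto
        ultimately have "dist (g (q k)) x < e1" using dist_triangle[of "g (q k)" x "g ?t"] by linarith
        then show "x \<in> W k" using W(2)[OF k(2)] ZX x by auto
      qed
      have "tr (F ?t) \<in> Z" "tr (F' ?t) \<in> Z" using nn[OF t1] X[OF t1] Z(3) by auto
      from change[OF W(1)[OF k(2)] W(1)[OF Suc.prems] Z(1) ZW ZW' smooth_isotopyD(1)[OF I(1) t1] refl this]
      show ?case by (rule fiso_trans[OF fiso_sym 1])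
    qed
    have qN: "q N = 1" using N(1) by (simp add: q_def)
    have "tr (F 1) \<in> W N"
      using W(2)[of N] nn(1)[of 1] X(1)[of 1] e1(1) by (auto simp: qN)
    then have "s N (tr (F 1)) (tr (F' 1)) = id" using good_self[OF W(1)[OF order_refl]] eq by simp
    then show "fiso (F 1) (F' 1)" using P[OF order_refl] by (simp add: qN)
  qed
qed

end

section \<open>Existence of lifts, and lifts of null homotopic loops\<close>

context pointed_surface begin

text \<open>The path is replaced by a chain of smooth curves in good sets through its values at the
  partition points, and each curve is realized by moves. The trace is near \<open>g\<close> because
  the good sets lie in small balls, and homotopic to \<open>g\<close> because they are simply
  connected.\<close>

lemma lift_exists:
  assumes g: "path g" "path_image g <= X" "pathstart g = v0" and e: "e > 0"
  obtains F where "lift F" "near e g F" "tr (F 1) = pathfinish g" "homotopic_paths X g (\<lambda>t. tr (F t))"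
proof -
  have K: "compact (path_image g)" by (rule compact_path_image[OF g(1)])
  have gK: "g u \<in> path_image g" if "u \<in> {0..1}" for u using that by (simp add: path_image_def)
  have e2: "e / 2 > 0" using e by simp
  obtain d where d: "d > 0" "!!x. x \<in> path_image g ==> \<exists>W s. good W s \<and> W <= ball x (e / 2) \<and> X \<inter> ball x d <= W"
    by (rule good_cover[OF K g(2) e2]) (rule that)
  obtain N :: nat where N: "N > 0"
    "!!u v. u \<in> {0..1} ==> v \<in> {0..1} ==> \<bar>u - v\<bar> <= 1 / N ==> dist (g u) (g v) < d"
    by (rule path_partition[OF g(1) d(1)]) (rule that)
  define q where "q k = real k / N" for k
  have q: "q k \<in> {0..1}" if "k <= N" for k using that N(1) by (simp add: q_def)
  have qS: "q (Suc k) = q k + 1 / N" for k by (simp add: q_def add_divide_distrib)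
  have q0: "q 0 = 0" and qN: "q N = 1" using N(1) by (simp_all add: q_def)
  have "\<exists>Ws. k <= N --> good (fst Ws) (snd Ws) \<and> fst Ws <= ball (g (q k)) (e / 2) \<and>
      X \<inter> ball (g (q k)) d <= fst Ws" for k
  proof (cases "k <= N")
    case True
    from d(2)[OF gK[OF q[OF this]]] obtain W s where
      "good W s" "W <= ball (g (q k)) (e / 2)" "X \<inter> ball (g (q k)) d <= W" by (elim exE conjE)
    then show ?thesis by (intro exI[of _ "(W, s)"]) simp
  qed simp
  then have "\<forall>k. \<exists>Ws. k <= N --> good (fst Ws) (snd Ws) \<and> fst Ws <= ball (g (q k)) (e / 2) \<and>
      X \<inter> ball (g (q k)) d <= fst Ws" ..
  from choice[OF this] obtain Ws where Ws:
    "\<forall>k. k <= N --> good (fst (Ws k)) (snd (Ws k)) \<and> fst (Ws k) <= ball (g (q k)) (e / 2) \<and>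
      X \<inter> ball (g (q k)) d <= fst (Ws k)" ..
  define W s where "W k = fst (Ws k)" and "s k = snd (Ws k)" for k
  have W: "!!k. k <= N ==> good (W k) (s k)" "!!k. k <= N ==> W k <= ball (g (q k)) (e / 2)"
    "!!k. k <= N ==> X \<inter> ball (g (q k)) d <= W k"
    using Ws by (simp_all add: W_def s_def)
  have gX: "g t \<in> X" if "t \<in> {0..1}" for t using g(2) gK[OF that] by blast
  have gW: "g t \<in> W k" if k: "k < N" and t: "q k <= t" "t <= q (Suc k)" for k t
  proof -
    have t1: "t \<in> {0..1}" using t q[of k] q[of "Suc k"] k by auto
    have "dist (g (q k)) (g t) < d" by (rule N(2)) (use t t1 q[of k] k qS[of k] in auto)
    then show ?thesis using W(3)[of k] gX[OF t1] k by auto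
  qed
  have gq: "g (q k) \<in> W k" "g (q (Suc k)) \<in> W k" if "k < N" for k
    using gW[OF that] by (simp_all add: qS)
  have "\<exists>c. k < N --> smooth_on UNIV c \<and> range c <= W k \<and> c 0 = g (q k) \<and> c (1::real) = g (q (Suc k))" for k
    using W(1)[of k] gq[of k] unfolding good_def smooth_path_connected_def by (cases "k < N") auto
  then have "\<forall>k. \<exists>c. k < N --> smooth_on UNIV c \<and> range c <= W k \<and> c 0 = g (q k) \<and> c (1::real) = g (q (Suc k))" ..
  from choice[OF this] obtain c where
    "\<forall>k. k < N --> smooth_on UNIV (c k) \<and> range (c k) <= W k \<and> c k 0 = g (q k) \<and> c k (1::real) = g (q (Suc k))" ..
  then have c: "smooth_on UNIV (c k)" "c k x \<in> W k" "c k 0 = g (q k)" "c k 1 = g (q (Suc k))" if "k < N" for k x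
    using that by auto
  \<comment> \<open>By the plateaus of \<open>step\<close> this move is the identity up to time
    \<open>q k\<close> and constant from time \<open>q (Suc k)\<close> on. The composite of all of
    them is smooth in time without any matching at the partition points.\<close>
  define G where "G k t = s k (g (q k)) (c k (step (real N * t - real k)))" for k and t :: real
  have G: "smooth_isotopy M B (G k)" if k: "k < N" for k
    unfolding G_def
  proof (rule good_isotopy[OF W(1)])
    show "smooth_on {0..1} (\<lambda>t. c k (step (real N * t - real k)))"
      by (rule smooth_on_compose[OF _ c(1)[OF k]])
        (intro smooth_on_step smooth_on_diff smooth_on_mult smooth_on_const smooth_on_id, simp)
  qed (use k c(2)[OF k] gq(1)[OF k] in auto)
  have Gd: "G k t \<in> diffeos M B" if "k < N" for k t
    unfolding G_def by (rule good_in[OF W(1)]) (use that c(2)[OF that] gq(1)[OF that] in auto)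
  have G0: "G k t = id" if "k < N" "t <= q k" for k t
  proof -
    have "real N * t - real k <= 0" using that(2) N(1) by (simp add: q_def field_simps)
    then show ?thesis using that c(3)[OF that(1)] good_self[OF W(1) gq(1)[OF that(1)]] by (simp add: G_def)
  qed
  have Ga: "act M (G k t) (g (q k)) = c k (step (real N * t - real k))" if "k < N" for k t
    unfolding G_def by (rule good_act[OF W(1)]) (use that c(2)[OF that] gq(1)[OF that] in auto)
  define H where "H = rec_nat (\<lambda>t. id) (\<lambda>k h t. G k t \<circ> h t)"
  have H0: "H 0 = (\<lambda>t. id)" and HS: "H (Suc k) = (\<lambda>t. G k t \<circ> H k t)" for k
    by (simp_all add: H_def)
  have HI: "smooth_isotopy M B (H k)" if "k <= N" for k
    using that
  proof (induction k)
    case 0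
    show ?case unfolding H0 by (rule smooth_isotopy_const[OF id_diffeos])
  next
    case (Suc k)
    then show ?case unfolding HS by (intro smooth_isotopy_comp G) auto
  qed
  have Hd: "H k t \<in> diffeos M B" if "k <= N" for k t
    using that by (induction k) (auto simp: H0 HS id_diffeos intro!: comp_diffeos Gd)
  have HSt: "tr (H (Suc k) t) = act M (G k t) (tr (H k t))" if "k < N" for k t
    unfolding HS by (rule tr_comp[OF Gd[OF that] Hd]) (use that in simp)
  have HSid: "H (Suc k) t = H k t" if "G k t = id" for k t
    unfolding HS that by (rule id_o)
  have H_0: "H k 0 = id" if "k <= N" for k
    using that
  proof (induction k)
    case (Suc k)
    then show ?case using G0[of k 0] q[of k] by (simp add: HSid)
  qed (simp add: H0)
  have Hend: "tr (H k t) = g (q k)" if "k <= N" "q k <= t" for k t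
    using that
  proof (induction k)
    case 0
    then show ?case using g(3) tr_id[unfolded id_def] by (simp add: H0 q0 pathstart_def id_def)
  next
    case (Suc k)
    then have k: "k < N" by simp
    have "q k <= q (Suc k)" by (simp add: qS)
    then have "q k <= t" using Suc.prems(2) by simp
    then have "tr (H k t) = g (q k)" using Suc by simp
    moreover have "real N * t - real k \<ge> 1" using Suc.prems(2) N(1) by (simp add: q_def field_simps)
    ultimately show ?case
      using Ga[OF k, of t] c(4)[OF k] HSt[OF k] by simp
  qed
  have Hin: "tr (H k t) \<in> W j" if "k <= N" "j < k" "q j <= t" "t <= q (Suc j)" for k j t
    using that
  proof (induction k)
    case (Suc k)
    then have k: "k < N" by simp
    have t: "tr (H (Suc k) t) = act M (G k t) (tr (H k t))"
      by (rule HSt[OF k])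
    show ?case
    proof (cases "j = k")
      case True
      then have "tr (H k t) = g (q k)" using Hend[of k t] Suc.prems by simp
      then show ?thesis unfolding t using Ga[OF k, of t] c(2)[OF k] True by simp
    next
      case False
      then have jk: "j < k" using Suc.prems by simp
      have "q (Suc j) <= q k" using jk by (simp add: q_def divide_right_mono)
      then have "G k t = id" using G0[OF k] Suc.prems(4) by simp
      then show ?thesis using Suc.IH k jk Suc.prems by (simp add: HSid)
    qed
  qed simp
  let ?F = "H N"
  have Hq: "tr (?F (q j)) = g (q j)" if "j <= N" for j
  proof -
    have "tr (H k (q j)) = g (q j)" if "j <= k" "k <= N" for k
      using that
    proof (induction rule: dec_induct)
      case base
      then show ?case by (intro Hend) auto
    next
      case (step k)
      have "q j <= q k" using step by (simp add: q_def divide_right_mono)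
      then have "G k (q j) = id" using G0[of k] step.prems by simp
      then show ?case using step by (simp add: HSid)
    qed
    then show ?thesis using that by simp
  qed
  let ?h = "\<lambda>t. tr (?F t)"
  have ph: "path ?h" by (rule path_tr[OF HI]) simp
  have hX: "?h t \<in> X" for t by (rule tr_X[OF Hd]) simp
  have hi: "path_image ?h <= X" using hX by (auto simp: path_image_def)
  \<comment> \<open>At every partition point the trace meets \<open>g\<close> exactly, so homotopies
    on the single intervals have fixed ends and can be joined.\<close>
  have hom: "homotopic_paths X (subpath 0 (q k) g) (subpath 0 (q k) ?h)" if "k <= N" for k
    using that
  proof (induction k)
    case 0
    have "subpath 0 (q 0) g = subpath 0 (q 0) ?h"
      using g(3) Hq[of 0] by (simp add: subpath_def q0 pathstart_def fun_eq_iff)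
    moreover have "path (subpath 0 (q 0) g)" "path_image (subpath 0 (q 0) g) <= X"
      using g(1) g(2) path_image_subpath_subset[of 0 "q 0" g] by (auto simp: q0 intro!: path_subpath)
    ultimately show ?case by (simp add: homotopic_paths_refl)
  next
    case (Suc k)
    then have k: "k < N" "k <= N" by auto
    note r = q[OF k(2)] q[OF Suc.prems]
    have z: "0 \<in> {0..1::real}" by simp
    have gW': "path_image (subpath (q k) (q (Suc k)) g) <= W k"
      using gW[OF k(1)] by (auto simp: path_image_subpath qS)
    have hW': "path_image (subpath (q k) (q (Suc k)) ?h) <= W k"
      using Hin[OF order_refl k(1)] by (auto simp: path_image_subpath qS)
    have "homotopic_paths (W k) (subpath (q k) (q (Suc k)) g) (subpath (q k) (q (Suc k)) ?h)"
      using W(1)[OF k(2)] gW' hW' Hq[OF k(2)] Hq[OF Suc.prems] path_subpath[OF g(1) r] path_subpath[OF ph r]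
      unfolding good_def simply_connected_eq_homotopic_paths by (simp add: pathstart_subpath pathfinish_subpath)
    then have 1: "homotopic_paths X (subpath (q k) (q (Suc k)) g) (subpath (q k) (q (Suc k)) ?h)"
      by (rule homotopic_paths_subset) (use W(1)[OF k(2)] in \<open>simp add: good_def\<close>)
    have 2: "homotopic_paths X (subpath 0 (q k) g +++ subpath (q k) (q (Suc k)) g)
        (subpath 0 (q k) ?h +++ subpath (q k) (q (Suc k)) ?h)"
      by (rule homotopic_paths_join[OF Suc.IH[OF k(2)] 1]) (simp add: pathstart_subpath pathfinish_subpath)
    have 3: "homotopic_paths X (subpath 0 (q k) g +++ subpath (q k) (q (Suc k)) g) (subpath 0 (q (Suc k)) g)"
      using homotopic_join_subpaths[OF g(1,2) z r] .
    have 4: "homotopic_paths X (subpath 0 (q k) ?h +++ subpath (q k) (q (Suc k)) ?h) (subpath 0 (q (Suc k)) ?h)"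
      using homotopic_join_subpaths[OF ph hi z r] .
    show ?case
      by (rule homotopic_paths_trans[OF homotopic_paths_trans[OF homotopic_paths_sym[OF 3] 2] 4])
  qed
  show thesis
  proof (rule that[of ?F])
    show "lift ?F" using HI[OF order_refl] H_0[OF order_refl] by (simp add: lift_def)
    show "tr (?F 1) = pathfinish g" using Hq[OF order_refl] by (simp add: qN pathfinish_def)
    show "homotopic_paths X g ?h" using hom[OF order_refl] by (simp add: qN)
    show "near e g ?F"
      unfolding near_def
    proof
      fix t :: real assume t: "t \<in> {0..1}"
      \<comment> \<open>At \<open>t = 1\<close> the floor of \<open>t * N\<close> would be
        \<open>N\<close>, one too large, so the last interval is named explicitly.\<close>
      obtain j where j: "j < N" "q j <= t" "t <= q (Suc j)"
      proof (cases "t = 1")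
        case True
        show thesis by (rule that[of "N - 1"]) (use True N(1) in \<open>auto simp: q_def field_simps\<close>)
      next
        case False
        have tN: "0 <= t * N" "t * N < N" using t False N(1) by auto
        show thesis
        proof (rule that[of "nat \<lfloor>t * N\<rfloor>"])
          show "nat \<lfloor>t * N\<rfloor> < N" using tN by linarith
          have "real (nat \<lfloor>t * N\<rfloor>) <= t * N" "t * N <= real (Suc (nat \<lfloor>t * N\<rfloor>))" using tN(1) by linarith+
          then show "q (nat \<lfloor>t * N\<rfloor>) <= t" "t <= q (Suc (nat \<lfloor>t * N\<rfloor>))"
            unfolding q_def using N(1) by (simp_all add: divide_le_eq le_divide_eq)
        qed
      qed
      have "g t \<in> ball (g (q j)) (e / 2)" "?h t \<in> ball (g (q j)) (e / 2)"
        using W(2)[of j] gW[OF j] Hin[OF order_refl j] j(1) by auto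
      then show "dist (g t) (?h t) < e"
        using dist_triangle[of "g t" "?h t" "g (q j)"] by (simp add: dist_commute)
    qed
  qed
qed

text \<open>The end of a lift close enough to a loop is determined up to fibre isotopy. Along the
  homotopy this class is locally constant in the parameter \<open>s\<close>, hence constant by
  connectedness of the interval. It is the class of \<open>F 1\<close> on one side and that of the
  identity on the other.\<close>

lemma null_homotopic_lift:
  assumes F: "lift F" and h: "homotopic_paths X (\<lambda>t. tr (F t)) (\<lambda>t. v0)"
  shows "fiso (F 1) id"
proof -
  obtain h where h: "continuous_on ({0..1} \<times> {0..1}) h" "h ` ({0..1} \<times> {0..1}) <= X"
    "\<forall>t\<in>{0..1}. h (0::real, t) = tr (F t)" "\<forall>t\<in>{0..1}. h (1, t::real) = v0"
    "\<forall>s\<in>{0..1}. h (s, 0) = tr (F 0) \<and> h (s, 1) = tr (F 1)"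
    using h unfolding homotopic_paths image_subset_iff_funcset[symmetric]
    by (elim exE conjE) (auto simp: pathstart_def pathfinish_def)
  have F1: "tr (F 1) = v0" and F0: "tr (F 0) = v0"
    using homotopic_paths_imp_pathfinish[OF assms(2)] homotopic_paths_imp_pathstart[OF assms(2)]
    by (simp_all add: pathfinish_def pathstart_def)
  define g where "g s t = h (s, t)" for s t
  have gp: "path (g s)" "path_image (g s) <= X" "pathstart (g s) = v0" "pathfinish (g s) = v0" if s: "s \<in> {0..1}" for s
  proof -
    have "continuous_on {0..1} (\<lambda>t. h (s, t))"
      by (rule continuous_on_compose2[OF h(1)]) (use s in \<open>auto intro!: continuous_intros\<close>)
    then show "path (g s)" by (simp add: path_def g_def)
    show "path_image (g s) <= X" using h(2) s by (auto simp: path_image_def g_def)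
    show "pathstart (g s) = v0" "pathfinish (g s) = v0"
      using h(5) s F0 F1 by (simp_all add: pathstart_def pathfinish_def g_def)
  qed
  \<comment> \<open>The map \<open>f\<close> represents the ends of lifts arbitrarily close to the
    loop \<open>g s\<close>. Quantifying over all \<open>e\<close> avoids any dependence on the
    tolerance of \<open>unique_near\<close>, which varies with \<open>s\<close>.\<close>
  define R where "R s f \<longleftrightarrow> (\<forall>e>0. \<exists>G. lift G \<and> near e (g s) G \<and> tr (G 1) = v0 \<and> fiso (G 1) f)" for s f
  have Rex: "\<exists>f. R s f \<and> (\<exists>d>0. \<forall>s'\<in>{0..1}. dist s' s < d --> (\<forall>f'. R s' f' --> fiso f' f))" if s: "s \<in> {0..1}" for s
  proof -
    obtain e where e: "e > 0" "!!F F'. lift F ==> lift F' ==> near e (g s) F ==> near e (g s) F' ==>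
        tr (F 1) = tr (F' 1) ==> fiso (F 1) (F' 1)"
      by (rule unique_near[OF gp(1,2)[OF s]]) (rule that)
    obtain G where G: "lift G" "near e (g s) G" "tr (G 1) = pathfinish (g s)"
      by (rule lift_exists[OF gp(1-3)[OF s] e(1)]) (rule that)
    have ex: "\<exists>G'. lift G' \<and> near e' (g s) G' \<and> tr (G' 1) = v0 \<and> fiso (G' 1) (G 1)" if e': "e' > 0" for e'
    proof -
      have m: "min e e' > 0" using e(1) e' by simp
      obtain G' where G': "lift G'" "near (min e e') (g s) G'" "tr (G' 1) = pathfinish (g s)"
        by (rule lift_exists[OF gp(1-3)[OF s] m]) (rule that)
      have n: "near e (g s) G'" "near e' (g s) G'" using G'(2) by (auto simp: near_def)
      have "fiso (G' 1) (G 1)" by (rule e(2)[OF G'(1) G(1) n(1) G(2)]) (simp add: G'(3) G(3))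
      with G' n gp(4)[OF s] show ?thesis by (intro exI[of _ G']) simp
    qed
    have uc: "uniformly_continuous_on ({0..1} \<times> {0..1}) h"
      by (rule compact_uniformly_continuous[OF h(1)]) (intro compact_Times compact_Icc)
    have e2: "e / 2 > 0" using e(1) by simp
    obtain d where d: "d > 0" "\<forall>x\<in>{0..1} \<times> {0..1}. \<forall>x'\<in>{0..1} \<times> {0..1}. dist x' x < d --> dist (h x') (h x) < e / 2"
      using uc[unfolded uniformly_continuous_on_def, rule_format, OF e2] by (elim exE conjE) simp
    have near: "fiso f' (G 1)" if s': "s' \<in> {0..1}" "dist s' s < d" and f': "R s' f'" for s' f'
    proof -
      obtain G' where G': "lift G'" "near (e / 2) (g s') G'" "tr (G' 1) = v0" "fiso (G' 1) f'"
        using f' e2 unfolding R_def by (elim allE[of _ "e / 2"]) auto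
      have "near e (g s) G'"
        unfolding near_def
      proof
        fix t :: real assume t: "t \<in> {0..1}"
        have "dist (h (s', t)) (h (s, t)) < e / 2"
          using d(2) s s' t by (auto simp: dist_Pair_Pair)
        moreover have "dist (g s' t) (tr (G' t)) < e / 2" using G'(2) t by (simp add: near_def)
        ultimately show "dist (g s t) (tr (G' t)) < e"
          using dist_triangle[of "g s t" "tr (G' t)" "g s' t"] by (simp add: g_def dist_commute)
      qed
      then have "fiso (G' 1) (G 1)"
        using e(2)[OF G'(1) G(1) _ G(2)] G'(3) G(3) gp(4)[OF s] by simp
      then show ?thesis by (rule fiso_trans[OF fiso_sym[OF G'(4)]])
    qed
    show ?thesis
      by (rule exI[of _ "G 1"]) (use ex near d(1) in \<open>auto simp: R_def\<close>)
  qed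
  have Runique: "fiso f f'" if r: "s \<in> {0..1}" "R s f" "R s f'" for s f f'
  proof -
    obtain f0 d where f0: "d > 0" "\<forall>s'\<in>{0..1}. dist s' s < d --> (\<forall>f'. R s' f' --> fiso f' f0)"
      using Rex[OF r(1)] by (elim exE conjE)
    have "fiso f f0" "fiso f' f0" using f0 r by auto
    then show ?thesis by (rule fiso_trans[OF _ fiso_sym])
  qed
  let ?Q = "\<lambda>s s'. \<forall>f f'. R s f --> R s' f' --> fiso f f'"
  have "?Q 0 1"
  proof (rule connected_equivalence_relation[of "{0..1::real}" 0 1 ?Q])
    show "?Q y x" if "?Q x y" for x y
    proof (intro allI impI)
      fix f f' assume "R y f" "R x f'"
      then have "fiso f' f" using that by simp
      then show "fiso f f'" by (rule fiso_sym)
    qed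
    show "?Q x z" if r: "?Q x y" "?Q y z" "x \<in> {0..1}" "y \<in> {0..1}" "z \<in> {0..1}" for x y z
    proof (intro allI impI)
      fix f f' assume f: "R x f" "R z f'"
      obtain f0 where "R y f0" using Rex[OF r(4)] by (elim exE conjE)
      then have "fiso f f0" "fiso f0 f'" using r(1,2) f by simp_all
      then show "fiso f f'" by (rule fiso_trans)
    qed
    show "\<exists>T. openin (top_of_set {0..1}) T \<and> s \<in> T \<and> (\<forall>x\<in>T. ?Q s x)" if s: "s \<in> {0..1}" for s
    proof -
      obtain f0 d where f0: "d > 0" "R s f0" "\<forall>s'\<in>{0..1}. dist s' s < d --> (\<forall>f'. R s' f' --> fiso f' f0)"
        using Rex[OF s] by (elim exE conjE)
      show ?thesis
      proof (intro exI[of _ "{0..1} \<inter> ball s d"] conjI ballI allI impI)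
        show "openin (top_of_set {0..1}) ({0..1} \<inter> ball s d)" by (rule openin_open_Int) simp
        show "s \<in> {0..1} \<inter> ball s d" using s f0(1) by simp
        fix x f f' assume x: "x \<in> {0..1} \<inter> ball s d" and f: "R s f" "R x f'"
        have "fiso f' f0" using f0(3) x f(2) by (auto simp: dist_commute)
        moreover have "fiso f f0" by (rule Runique[OF s f(1) f0(2)])
        ultimately show "fiso f f'" by (rule fiso_trans[OF _ fiso_sym, rotated])
      qed
    qed
  qed auto
  moreover have "R 0 (F 1)"
    unfolding R_def
  proof (intro allI impI exI[of _ F] conjI)
    show "lift F" by (rule F)
    then show "fiso (F 1) (F 1)" using fiso_refl smooth_isotopyD(1)[of M B F 1] by (simp add: lift_def)
    show "near e (g 0) F" if "e > 0" for e using h(3) that by (simp add: near_def g_def)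
  qed (rule F1)
  moreover have "R 1 id"
    unfolding R_def
  proof (intro allI impI exI[of _ "\<lambda>_. id"] conjI)
    show "lift (\<lambda>_. id)" using smooth_isotopy_const[OF id_diffeos] by (simp add: lift_def)
    show "near e (g 1) (\<lambda>_. id)" if "e > 0" for e using h(4) that by (simp add: near_def g_def tr_id[unfolded id_def] id_def)
  qed (simp_all add: tr_id fiso_refl[OF id_diffeos])
  ultimately show ?thesis by blast
qed

end

section \<open>Straightening near a fixed framed point\<close>

lemma step_mono: assumes "x <= y" shows "step x <= step y"
proof -
  have m: "flat_exp 0 a <= flat_exp 0 b" if "a <= b" for a b :: real
    using that by (auto simp: flat_exp_def le_imp_inverse_le)
  have p: "flat_exp 0 a \<ge> 0" for a by (simp add: flat_exp_def)
  have "flat_exp 0 x * flat_exp 0 (1 - y) <= flat_exp 0 y * flat_exp 0 (1 - x)"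
    using assms by (intro mult_mono m p) auto
  then have "flat_exp 0 x * (flat_exp 0 y + flat_exp 0 (1 - y)) <= flat_exp 0 y * (flat_exp 0 x + flat_exp 0 (1 - x))"
    by (simp add: algebra_simps)
  then show ?thesis
    unfolding step_def using step_denom_pos[of x] step_denom_pos[of y] by (simp add: divide_le_eq le_divide_eq mult.commute)
qed

text \<open>A cut-off function whose gradient is small compared with \<open>1 / norm y\<close>; it is a function of
  \<open>ln (norm y)\<close>.\<close>

definition log_bump :: "real => real => R2 => real" where
  "log_bump R L y = (if y = 0 then 1 else step (ln (R\<^sup>2 / (y \<bullet> y)) / L))"

lemma log_bump_0: "R > 0 ==> L > 0 ==> norm y \<ge> R ==> log_bump R L y = 0"
proof -
  assume a: "R > 0" "L > 0" "norm y \<ge> R"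
  then have y: "y ~= 0" "R\<^sup>2 <= y \<bullet> y" by (auto simp: dot_square_norm power_mono)
  then have "y \<bullet> y > 0" by simp
  then have "ln (R\<^sup>2 / (y \<bullet> y)) <= 0" using y(2) a(1) by (simp add: divide_le_eq)
  then show ?thesis using y(1) a(2) by (simp add: log_bump_def divide_le_0_iff)
qed

text \<open>The quotient inside \<open>step\<close> is at least 1 exactly up to radius
  \<open>R * exp (- L / 2)\<close>. The plateau shrinks exponentially with \<open>L\<close>, which
  is the price for the small gradient.\<close>

lemma log_bump_1: "R > 0 ==> L > 0 ==> norm y <= R * exp (- L / 2) ==> log_bump R L y = 1"
proof (cases "y = 0")
  case False
  assume a: "R > 0" "L > 0" "norm y <= R * exp (- L / 2)"
  have "y \<bullet> y <= (R * exp (- L / 2))\<^sup>2" using a by (simp add: dot_square_norm power_mono)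
  also have "\<dots> = R\<^sup>2 * exp (- L)" by (simp add: power_mult_distrib exp_double[symmetric])
  finally have "exp L * (y \<bullet> y) <= exp L * (R\<^sup>2 * exp (- L))" by (intro mult_left_mono) auto
  then have "exp L <= R\<^sup>2 / (y \<bullet> y)" using False by (simp add: le_divide_eq exp_minus field_simps)
  then have "L <= ln (R\<^sup>2 / (y \<bullet> y))" using a(1) False by (subst ln_ge_iff) auto
  then show ?thesis using a(2) False by (simp add: log_bump_def)
qed (simp add: log_bump_def)

lemma log_bump_bounds: "0 <= log_bump R L y" "log_bump R L y <= 1"
  by (simp_all add: log_bump_def)

lemma smooth_log_bump:
  assumes "R > 0" "L > 0" shows "smooth_on UNIV (log_bump R L)"
proof (rule smooth_on_local)
  fix x :: R2
  show "\<exists>U. open U \<and> x \<in> U \<and> smooth_on (UNIV \<inter> U) (log_bump R L)"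
  proof (cases "x = 0")
    case True
    have "smooth_on (UNIV \<inter> ball 0 (R * exp (- L / 2))) (log_bump R L)"
      by (rule smooth_on_cong[OF smooth_on_const[of _ 1]]) (use log_bump_1[OF assms] in auto)
    then show ?thesis using True assms by (intro exI[of _ "ball 0 (R * exp (- L / 2))"]) simp
  next
    case False
    let ?U = "- {0} :: R2 set"
    have 1: "smooth_on ?U (\<lambda>y. R\<^sup>2 / (y \<bullet> y))"
      by (intro smooth_on_divide smooth_on_const smooth_on_inner smooth_on_id) auto
    have "smooth_on ?U (\<lambda>y. ln (R\<^sup>2 / (y \<bullet> y)))"
      by (rule smooth_on_compose[OF 1 smooth_on_ln_real]) (use assms in auto)
    then have "smooth_on ?U (\<lambda>y. step (ln (R\<^sup>2 / (y \<bullet> y)) * inverse L))"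
      by (intro smooth_on_step smooth_on_mult smooth_on_const)
    then have "smooth_on (UNIV \<inter> ?U) (log_bump R L)"
      by (rule smooth_on_cong[OF smooth_on_subset]) (auto simp: log_bump_def divide_inverse)
    then show ?thesis using False by (intro exI[of _ ?U]) (simp add: open_Compl)
  qed
qed

text \<open>The gradient of \<open>ln (y \<bullet> y)\<close> has length \<open>2 / norm y\<close>,
  so its product with \<open>norm y\<close> is bounded, and division by a large \<open>L\<close>
  makes that product small.\<close>

lemma log_bump_derivative:
  assumes R: "R > 0" "L > 0"
    and K: "K \<ge> 0" "!!x. \<exists>D. (step has_real_derivative D) (at x) \<and> \<bar>D\<bar> <= K"
  obtains D where "(log_bump R L has_derivative D) (at y)" "!!v. \<bar>D v\<bar> * norm y <= (2 * K / L) * norm v"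
proof (cases "y = 0")
  case True
  have "(log_bump R L has_derivative (\<lambda>_. 0)) (at y)"
    by (rule has_derivative_transform_within_open[OF has_derivative_const[of 1], of "ball 0 (R * exp (- L / 2))"])
      (use True R log_bump_1[OF R] in auto)
  then show thesis by (rule that) (use True K R in simp)
next
  case False
  let ?q = "\<lambda>y::R2. ln (R\<^sup>2 / (y \<bullet> y)) / L"
  have q: "(?q has_derivative (\<lambda>v. - (2 * (y \<bullet> v)) / (y \<bullet> y) / L)) (at y)"
  proof -
    have "((\<lambda>y. (2 * ln R - ln (y \<bullet> y)) / L) has_derivative (\<lambda>v. - (2 * (y \<bullet> v)) / (y \<bullet> y) / L)) (at y)"
      using False R by (auto intro!: derivative_eq_intros simp: inner_commute divide_simps)
    then show ?thesis
      by (rule has_derivative_transform_within_open[of _ _ _ _ "- {0}"])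
        (use False R in \<open>auto simp: ln_div ln_realpow open_Compl\<close>)
  qed
  obtain D where D: "(step has_real_derivative D) (at (?q y))" "\<bar>D\<bar> <= K" using K(2) by blast
  have "((\<lambda>y. step (?q y)) has_derivative (\<lambda>v. D * (- (2 * (y \<bullet> v)) / (y \<bullet> y) / L))) (at y)"
    using diff_chain_at[OF q D(1)[unfolded has_field_derivative_def]] by (simp add: o_def)
  then have d: "(log_bump R L has_derivative (\<lambda>v. D * (- (2 * (y \<bullet> v)) / (y \<bullet> y) / L))) (at y)"
    by (rule has_derivative_transform_within_open[of _ _ _ _ "- {0}"])
      (use False in \<open>auto simp: log_bump_def open_Compl\<close>)
  show thesis
  proof (rule that[OF d])
    fix v
    have "\<bar>y \<bullet> v\<bar> <= norm y * norm v" by (rule Cauchy_Schwarz_ineq2)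
    then have "\<bar>y \<bullet> v\<bar> * norm y <= norm v * (y \<bullet> y)"
      using mult_right_mono[of "\<bar>y \<bullet> v\<bar>" "norm y * norm v" "norm y"]
      by (simp add: dot_square_norm power2_eq_square mult_ac)
    then have "\<bar>y \<bullet> v\<bar> * norm y / (y \<bullet> y) <= norm v" using False by (simp add: divide_le_eq)
    then have "\<bar>D\<bar> * (\<bar>y \<bullet> v\<bar> * norm y / (y \<bullet> y)) <= K * norm v"
      using D(2) K(1) by (intro mult_mono) auto
    then have "(2 / L) * (\<bar>D\<bar> * (\<bar>y \<bullet> v\<bar> * norm y / (y \<bullet> y))) <= (2 / L) * (K * norm v)"
      using R by (intro mult_left_mono) auto
    then show "\<bar>D * (- (2 * (y \<bullet> v)) / (y \<bullet> y) / L)\<bar> * norm y <= 2 * K / L * norm v"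
      using R by (simp add: abs_mult abs_divide mult_ac)
  qed
qed

text \<open>The mean value theorem along the segment from \<open>z\<close> to \<open>y\<close>,
  applied to the weighted component in its own direction.\<close>

lemma wip_monotone:
  fixes f :: "R2 => R2"
  assumes d: "!!x. (f has_derivative D x) (at x)" and l: "!!x v. wip k (D x v) v \<ge> c * (norm v)\<^sup>2"
  shows "wip k (f y - f z) (y - z) \<ge> c * (norm (y - z))\<^sup>2"
proof -
  let ?p = "\<lambda>s::real. z + s *\<^sub>R (y - z)"
  have h: "((\<lambda>s. wip k (f (?p s)) (y - z)) has_real_derivative wip k (D (?p s) (y - z)) (y - z)) (at s)" for s
  proof -
    have "(?p has_derivative (\<lambda>s. s *\<^sub>R (y - z))) (at s)" by (auto intro!: derivative_eq_intros)
    from diff_chain_at[OF this d]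
    have "((\<lambda>s. f (?p s)) has_derivative (\<lambda>r. D (?p s) (r *\<^sub>R (y - z)))) (at s)" by (simp add: o_def)
    from bounded_linear.has_derivative[OF bounded_linear_wip this]
    have "((\<lambda>s. wip k (f (?p s)) (y - z)) has_derivative (\<lambda>r. wip k (D (?p s) (r *\<^sub>R (y - z))) (y - z))) (at s)" .
    moreover have "(\<lambda>r. wip k (D (?p s) (r *\<^sub>R (y - z))) (y - z)) = (*) (wip k (D (?p s) (y - z)) (y - z))"
      by (rule ext) (simp add: linear_cmul[OF has_derivative_linear[OF d]] wip_linear)
    ultimately show ?thesis unfolding has_field_derivative_def by simp
  qed
  obtain s where "wip k (f (?p 1)) (y - z) - wip k (f (?p 0)) (y - z) = (1 - 0) * wip k (D (?p s) (y - z)) (y - z)"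
    using MVT2[of 0 1 "\<lambda>s. wip k (f (?p s)) (y - z)" "\<lambda>s. wip k (D (?p s) (y - z)) (y - z)"] h by auto
  then show ?thesis using l[of "y - z" "?p s"] by (simp add: wip_linear)
qed

text \<open>The off-diagonal term is at most
  \<open>(l / 2) * x\<^sup>2 + m\<^sup>2 / (2 * l) * y\<^sup>2\<close>. The weight is chosen so that
  \<open>k * l\<close> is \<open>l + m\<^sup>2 / (2 * l)\<close>: it pays for the second summand and
  leaves a positive multiple of the square of \<open>y\<close>.\<close>

lemma triangular_wip_lower:
  fixes a b m :: real
  assumes l: "0 < l" "l <= 1" "l <= a" "l <= n" and m: "\<bar>mu\<bar> <= m" and b: "0 <= b" "b <= 1" and k: "k = 1 + m\<^sup>2 / (2 * l\<^sup>2)"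
  shows "wip k (v + b *\<^sub>R ((a * fst v + mu * snd v, n * snd v) - v)) v \<ge> (l / 2) * (norm v)\<^sup>2"
proof -
  obtain x y where v: "v = (x, y)" by (cases v)
  have k1: "k \<ge> 1" using k by simp
  have al: "1 + b * (a - 1) \<ge> l" "1 + b * (n - 1) \<ge> l"
  proof -
    have "(1 - b) * l <= (1 - b) * 1" by (rule mult_left_mono) (use b l in auto)
    moreover have "b * l <= b * a" "b * l <= b * n" using b l by (auto intro!: mult_left_mono)
    ultimately show "1 + b * (a - 1) \<ge> l" "1 + b * (n - 1) \<ge> l" by (simp_all add: algebra_simps)
  qed
  have "\<bar>b * mu * (x * y)\<bar> <= m * \<bar>x * y\<bar>"
  proof -
    have "\<bar>b * mu\<bar> <= m" using mult_mono[of b 1 "\<bar>mu\<bar>" m] b m by (simp add: abs_mult)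
    then show ?thesis unfolding abs_mult[of "b * mu"] by (rule mult_right_mono) simp
  qed
  moreover have "m * \<bar>x * y\<bar> <= (l / 2) * x\<^sup>2 + m\<^sup>2 / (2 * l) * y\<^sup>2"
  proof -
    have "0 <= (l * \<bar>x\<bar> - m * \<bar>y\<bar>)\<^sup>2" by simp
    then have "m * \<bar>x * y\<bar> * (2 * l) <= l\<^sup>2 * x\<^sup>2 + m\<^sup>2 * y\<^sup>2"
      by (simp add: power2_diff power_mult_distrib abs_mult algebra_simps)
    then have "m * \<bar>x * y\<bar> <= (l\<^sup>2 * x\<^sup>2 + m\<^sup>2 * y\<^sup>2) / (2 * l)" using l(1) by (simp add: le_divide_eq)
    also have "\<dots> = (l / 2) * x\<^sup>2 + m\<^sup>2 / (2 * l) * y\<^sup>2"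
      using l(1) by (simp add: add_divide_distrib power2_eq_square)
    finally show ?thesis .
  qed
  moreover have "k * l = l + m\<^sup>2 / (2 * l)" using k l(1) by (simp add: field_simps power2_eq_square)
  moreover have "l * x\<^sup>2 <= (1 + b * (a - 1)) * x\<^sup>2" "k * (l * y\<^sup>2) <= k * ((1 + b * (n - 1)) * y\<^sup>2)"
    using al k1 by (auto intro!: mult_right_mono mult_left_mono)
  moreover have "wip k (v + b *\<^sub>R ((a * fst v + mu * snd v, n * snd v) - v)) v =
      (1 + b * (a - 1)) * x\<^sup>2 + b * mu * (x * y) + k * ((1 + b * (n - 1)) * y\<^sup>2)"
    by (simp add: v wip_def algebra_simps power2_eq_square)
  moreover have "(l / 2) * (norm v)\<^sup>2 = (l / 2) * x\<^sup>2 + (l / 2) * y\<^sup>2"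
    by (simp add: v norm_Pair algebra_simps)
  moreover have "k * (l * y\<^sup>2) = l * y\<^sup>2 + m\<^sup>2 / (2 * l) * y\<^sup>2"
    using \<open>k * l = l + m\<^sup>2 / (2 * l)\<close> by (metis distrib_right mult.assoc)
  moreover have "0 <= (l / 2) * y\<^sup>2" using l by simp
  ultimately show ?thesis by (auto simp: abs_le_iff)
qed

text \<open>The derivative of the interpolation consists of a triangular part, bounded below by
  \<open>l / 2\<close>, and two errors: the variation of the derivative of \<open>g t\<close> near
  the origin, and the gradient of the cut-off times \<open>g t y - y\<close>. Each error costs at
  most \<open>l / 8\<close>, which leaves \<open>l / 4\<close>. The hypothesis \<open>per\<close>
  brings all times back to a compact interval, although the family is smooth for all real
  times.\<close>

lemma planar_straighten:
  fixes g :: "real => R2 => R2"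
  assumes R1: "R1 > 0" and sm: "smooth_on (UNIV \<times> ball 0 R1) (\<lambda>(t, y). g t y)"
    and per: "!!t. \<exists>t'\<in>{0..1}. g t = g t'" and g0: "!!t. g t 0 = 0"
    and dg: "!!t. (g t has_derivative (\<lambda>v. (la t * fst v + mu t * snd v, nu t * snd v))) (at 0)"
    and pos: "!!t. la t > 0" "!!t. nu t > 0"
  obtains k c e \<beta> where "k > 0" "c > 0" "e > 0" "smooth_on UNIV \<beta>" "!!y. norm y <= e ==> \<beta> y = 1"
    "!!w. smooth_on UNIV w ==> (!!t. 0 <= w t \<and> w t <= 1) ==>
      mono_family (\<lambda>t y. y + (w t * \<beta> y) *\<^sub>R (g t y - y)) k c R1"
proof -
  let ?U = "(UNIV :: real set) \<times> ball (0::R2) R1"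
  let ?G = "\<lambda>x. g (fst x) (snd x)"
  have oU: "open ?U" by (intro open_Times) auto
  have sG: "smooth_on ?U ?G" using sm by (simp add: case_prod_beta')
  define d where "d t y v = frechet_derivative ?G (at (t, y)) (0, v)" for t y v
  have dj: "(?G has_derivative frechet_derivative ?G (at (t, y))) (at (t, y))" if "norm y < R1" for t y
    by (rule smooth_has_derivative_at[OF oU sG]) (use that in auto)
  have d: "(g t has_derivative d t y) (at y)" if y: "norm y < R1" for t y
  proof -
    have "((\<lambda>y. (t, y)) has_derivative (\<lambda>v. (0, v))) (at y)"
      by (intro has_derivative_Pair has_derivative_const has_derivative_ident)
    from diff_chain_at[OF this dj[OF y]] show ?thesis by (simp add: o_def d_def[abs_def])
  qed
  have dlin: "linear (d t y)" if "norm y < R1" for t y by (rule has_derivative_linear[OF d[OF that]])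
  have d0: "d t 0 v = (la t * fst v + mu t * snd v, nu t * snd v)" for t v
    by (rule fun_cong[OF has_derivative_unique[OF d dg]]) (use R1 in simp)
  have dper: "d t y = d t' y" if "g t = g t'" "norm y < R1" for t t' y
    using has_derivative_unique[OF d[OF that(2), of t]] d[OF that(2), of t'] that(1) by simp
  have sd: "smooth_on ?U (\<lambda>x. d (fst x) (snd x) v)" for v
  proof -
    have "smooth_on ?U (\<lambda>x. (\<lambda>(x, v). frechet_derivative ?G (at x) v) (x, (0, v)))"
      by (rule smooth_on_compose[OF smooth_on_Pair[OF smooth_on_id smooth_on_const]
            smooth_on_frechet_derivative[OF oU sG]]) auto
    then show ?thesis by (simp add: d_def)
  qed
  define R where "R = R1 / 2"
  have R: "R > 0" "R < R1" using R1 by (auto simp: R_def)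
  let ?C = "{0..1::real} \<times> cball (0::R2) R"
  have CU: "?C <= ?U" using R by auto
  have cC: "compact ?C" by (intro compact_Times) auto
  have cd: "continuous_on ?C (\<lambda>x. d (fst x) (snd x) v)" for v
    by (rule continuous_on_subset[OF smooth_on_imp_continuous_on[OF sd] CU])
  have bdd: "\<exists>b. \<forall>t\<in>{0..1}. norm (d t 0 v) <= b" for v
  proof -
    have "bounded ((\<lambda>x. d (fst x) (snd x) v) ` ?C)"
      by (intro compact_imp_bounded compact_continuous_image cd cC)
    then obtain b where "\<forall>z\<in>(\<lambda>x. d (fst x) (snd x) v) ` ?C. norm z <= b" unfolding bounded_iff by (elim exE)
    then show ?thesis using R by (intro exI[of _ b]) auto
  qed
  let ?e1 = "(1, 0) :: R2" and ?e2 = "(0, 1) :: R2"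
  obtain b1 where b1: "\<forall>t\<in>{0..1}. norm (d t 0 ?e1) <= b1" using bdd[of ?e1] by (elim exE)
  obtain b2 where b2: "\<forall>t\<in>{0..1}. norm (d t 0 ?e2) <= b2" using bdd[of ?e2] by (elim exE)
  note b = bspec[OF b1] bspec[OF b2]
  have c0: "continuous_on {0..1} (\<lambda>t. d t 0 v)" for v
  proof -
    have "continuous_on {0..1} (\<lambda>t. (\<lambda>x. d (fst x) (snd x) v) (t, 0))"
      by (rule continuous_on_compose2[OF cd]) (use R in \<open>auto intro!: continuous_intros\<close>)
    then show ?thesis by simp
  qed
  have "continuous_on {0..1} (\<lambda>t. fst (d t 0 ?e1))" "continuous_on {0..1} (\<lambda>t. snd (d t 0 ?e2))"
    by (intro continuous_intros c0)+
  then have cl: "continuous_on {0..1} la" "continuous_on {0..1} nu" by (simp_all add: d0)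
  obtain l1 where l1: "l1 \<in> {0..1}" "\<forall>t\<in>{0..1}. la l1 <= la t"
    using continuous_attains_inf[OF compact_Icc _ cl(1)] by auto
  obtain l2 where l2: "l2 \<in> {0..1}" "\<forall>t\<in>{0..1}. nu l2 <= nu t"
    using continuous_attains_inf[OF compact_Icc _ cl(2)] by auto
  define l where "l = min 1 (min (la l1) (nu l2))"
  have l: "0 < l" "l <= 1" using pos by (auto simp: l_def)
  have per': "\<exists>t'\<in>{0..1}. g t = g t' \<and> la t = la t' \<and> mu t = mu t' \<and> nu t = nu t'" for t
  proof -
    obtain t' where t': "t' \<in> {0..1}" "g t = g t'" using per[of t] by (elim bexE)
    have e: "d t 0 = d t' 0" by (rule dper[OF t'(2)]) (use R1 in simp)
    show ?thesis using t' fun_cong[OF e, of ?e1] fun_cong[OF e, of ?e2] by (intro bexI[of _ t']) (simp_all add: d0)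
  qed
  have lt: "l <= la t" "l <= nu t" for t
  proof -
    obtain t' where "t' \<in> {0..1}" "la t = la t'" "nu t = nu t'" using per'[of t] by (elim bexE conjE)
    then show "l <= la t" "l <= nu t" using l1(2) l2(2) by (auto simp: l_def min_le_iff_disj)
  qed
  have fs: "\<bar>fst z\<bar> <= norm z" "\<bar>snd z\<bar> <= norm z" for z :: R2
    using norm_fst_le[of "fst z" "snd z"] norm_snd_le[of "snd z" "fst z"] by simp_all
  define m where "m = b2"
  have mt: "\<bar>mu t\<bar> <= m" for t
  proof -
    obtain t' where t': "t' \<in> {0..1}" "mu t = mu t'" using per'[of t] by (elim bexE conjE)
    have "\<bar>mu t'\<bar> <= norm (d t' 0 ?e2)" using fs(1)[of "d t' 0 ?e2"] by (simp add: d0)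
    then show ?thesis using b(2)[OF t'(1)] t'(2) by (simp add: m_def)
  qed
  define k where "k = 1 + m\<^sup>2 / (2 * l\<^sup>2)"
  have k1: "k \<ge> 1" by (simp add: k_def)
  \<comment> \<open>The factor \<open>1 + k\<close> is the loss in \<open>abs_wip_le\<close>, so
    that the variation of the derivative contributes at most \<open>l / 8\<close>.\<close>
  define eta where "eta = l / 8 / (1 + k)"
  have "1 + k ~= 0" using k1 by simp
  from nonzero_divide_eq_eq[THEN iffD1, OF this refl, of "l / 8"]
  have eta2: "(1 + k) * eta = l / 8" unfolding eta_def by (simp only: mult.commute)
  have "eta > 0" using l k1 by (simp add: eta_def)
  note eta = this eta2
  have "\<exists>r>0. \<forall>t\<in>{0..1}. \<forall>y. norm y < r --> norm y <= R --> norm (d t y v - d t 0 v) < eta / 2" for v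
  proof -
    have "uniformly_continuous_on ?C (\<lambda>x. d (fst x) (snd x) v)"
      by (rule compact_uniformly_continuous[OF cd cC])
    moreover have "eta / 2 > 0" using eta by simp
    ultimately obtain r where r: "r > 0" "\<forall>x\<in>?C. \<forall>x'\<in>?C. dist x' x < r -->
        dist (d (fst x') (snd x') v) (d (fst x) (snd x) v) < eta / 2"
      unfolding uniformly_continuous_on_def by (elim allE[of _ "eta / 2"]) auto
    have "norm (d t y v - d t 0 v) < eta / 2" if "t \<in> {0..1}" "norm y < r" "norm y <= R" for t y
    proof -
      have "(t, 0) \<in> ?C" "(t, y) \<in> ?C" "dist (t, y) (t, 0) < r" using that R by (auto simp: dist_Pair_Pair)
      then show ?thesis using r(2) by (fastforce simp: dist_norm)
    qed
    then show ?thesis using r(1) by (intro exI[of _ r]) simp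
  qed
  note rex = this
  obtain r1 where r1: "r1 > 0" "\<forall>t\<in>{0..1}. \<forall>y. norm y < r1 --> norm y <= R --> norm (d t y ?e1 - d t 0 ?e1) < eta / 2"
    using rex[of ?e1] by (elim exE conjE)
  obtain r2 where r2: "r2 > 0" "\<forall>t\<in>{0..1}. \<forall>y. norm y < r2 --> norm y <= R --> norm (d t y ?e2 - d t 0 ?e2) < eta / 2"
    using rex[of ?e2] by (elim exE conjE)
  have r: "r1 > 0" "r2 > 0"
    "!!t y. t \<in> {0..1} ==> norm y < r1 ==> norm y <= R ==> norm (d t y ?e1 - d t 0 ?e1) < eta / 2"
    "!!t y. t \<in> {0..1} ==> norm y < r2 ==> norm y <= R ==> norm (d t y ?e2 - d t 0 ?e2) < eta / 2"
    by (rule r1(1), rule r2(1), rule r1(2)[rule_format], assumption+, rule r2(2)[rule_format], assumption+)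
  define r0 where "r0 = min R (min r1 r2)"
  have r0: "r0 > 0" "r0 <= R" "r0 <= r1" "r0 <= r2" using r R by (auto simp: r0_def)
  have ex: "d t y v = fst v *\<^sub>R d t y ?e1 + snd v *\<^sub>R d t y ?e2" if "norm y < R1" for t y v
  proof -
    have "d t y v = d t y (fst v *\<^sub>R ?e1 + snd v *\<^sub>R ?e2)" by simp
    also have "\<dots> = fst v *\<^sub>R d t y ?e1 + snd v *\<^sub>R d t y ?e2"
      by (simp only: linear_add[OF dlin[OF that]] linear_cmul[OF dlin[OF that]])
    finally show ?thesis .
  qed
  have E: "norm (d t y v - d t 0 v) <= eta * norm v" if y: "norm y < r0" for t y v
  proof -
    obtain t' where t': "t' \<in> {0..1}" "g t = g t'" using per[of t] by (elim bexE)
    have yR: "norm y < R1" "norm (0::R2) < R1" using y r0 R by auto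
    have "d t' y v - d t' 0 v = fst v *\<^sub>R (d t' y ?e1 - d t' 0 ?e1) + snd v *\<^sub>R (d t' y ?e2 - d t' 0 ?e2)"
      unfolding ex[OF yR(1), of t' v] ex[OF yR(2), of t' v] by (simp add: algebra_simps)
    then have "norm (d t' y v - d t' 0 v) <= norm (fst v *\<^sub>R (d t' y ?e1 - d t' 0 ?e1)) + norm (snd v *\<^sub>R (d t' y ?e2 - d t' 0 ?e2))"
      by (simp only: norm_triangle_ineq)
    also have "\<dots> <= norm v * (eta / 2) + norm v * (eta / 2)"
      unfolding norm_scaleR
      by (intro add_mono mult_mono fs less_imp_le[OF r(3)] less_imp_le[OF r(4)]) (use y r0 t' in auto)
    finally show ?thesis using dper[OF t'(2) yR(1)] dper[OF t'(2) yR(2)] by (simp add: mult.commute)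
  qed
  \<comment> \<open>\<open>C - 1\<close> bounds the derivatives of \<open>g t\<close> on the ball of
    radius \<open>r0\<close>; the additional 1 accounts for the identity in
    \<open>g t y - y\<close>.\<close>
  define C where "C = b1 + b2 + eta + 1"
  have b0: "b1 \<ge> 0" "b2 \<ge> 0"
    by (rule order_trans[OF norm_ge_zero b(1)[of 0]], simp, rule order_trans[OF norm_ge_zero b(2)[of 0]], simp)
  have C: "C > 0" using b0 eta by (simp add: C_def)
  have dC: "norm (d t y v) <= (C - 1) * norm v" if y: "norm y < r0" for t y v
  proof -
    obtain t' where t': "t' \<in> {0..1}" "g t = g t'" using per[of t] by (elim bexE)
    have z: "norm (0::R2) < R1" using R1 by simp
    have "norm (d t' 0 v) <= norm (fst v *\<^sub>R d t' 0 ?e1) + norm (snd v *\<^sub>R d t' 0 ?e2)"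
      unfolding ex[OF z, of t' v] by (rule norm_triangle_ineq)
    also have "\<dots> <= norm v * b1 + norm v * b2"
      unfolding norm_scaleR by (intro add_mono mult_mono fs b t') auto
    finally have "norm (d t 0 v) <= (b1 + b2) * norm v" using dper[OF t'(2) z] by (simp add: algebra_simps)
    then have "norm (d t y v) <= (b1 + b2) * norm v + eta * norm v"
      using E[OF y, of t v] norm_triangle_ineq[of "d t y v - d t 0 v" "d t 0 v"] by simp
    then show ?thesis by (simp add: C_def algebra_simps)
  qed
  have gC: "norm (g t y - y) <= C * norm y" if y: "norm y < r0" for t y
  proof -
    have "norm (g t y - g t 0) <= (C - 1) * norm (y - 0)"
    proof (rule differentiable_bound[of "ball 0 r0" "g t" "d t"])
      show "(g t has_derivative d t x) (at x within ball 0 r0)" if "x \<in> ball 0 r0" for x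
        by (rule has_derivative_at_withinI[OF d]) (use that r0 R in auto)
      show "onorm (d t x) <= C - 1" if "x \<in> ball 0 r0" for x
        by (rule onorm_le) (use dC that in auto)
    qed (use y r0 in auto)
    then show ?thesis using norm_triangle_ineq4[of "g t y" y] by (simp add: g0 algebra_simps)
  qed
  obtain K where K: "K \<ge> 0" "!!x. \<exists>D. (step has_real_derivative D) (at x) \<and> \<bar>D\<bar> <= K"
    by (rule step_deriv_bounded) (rule that)
  \<comment> \<open>Chosen to make the contribution \<open>(1 + k) * C * (2 * K / L)\<close> of the
    cut-off at most \<open>l / 8\<close>; the summand 1 keeps \<open>L\<close> positive even if
    \<open>K\<close> is 0.\<close>
  define L where "L = 16 * K * C * (1 + k) / l + 1"
  have L: "L > 0" using K C k1 l by (simp add: L_def add_nonneg_pos)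
  have LL: "(1 + k) * C * (2 * K / L) <= l / 8"
  proof -
    have "l * L = 16 * K * C * (1 + k) + l" unfolding L_def distrib_left using l(1) by simp
    then have "16 * K * C * (1 + k) <= l * L" using l(1) by simp
    then show ?thesis using L by (simp add: divide_le_eq field_simps)
  qed
  \<comment> \<open>With half of \<open>r0\<close>, the estimates hold on a neighbourhood of the
    support of the cut-off.\<close>
  define rho where "rho = r0 / 2"
  have rho: "rho > 0" "rho < r0" "rho < R1" using r0 R by (auto simp: rho_def)
  define \<beta> where "\<beta> = log_bump rho L"
  note sb = smooth_log_bump[OF rho(1) L, folded \<beta>_def]
  show thesis
  proof (rule that[of k "l / 4" "rho * exp (- L / 2)" \<beta>])
    show "k > 0" "l / 4 > 0" "rho * exp (- L / 2) > 0" using k1 l rho by auto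
    show "smooth_on UNIV \<beta>" by (rule sb)
    show "\<beta> y = 1" if "norm y <= rho * exp (- L / 2)" for y
      unfolding \<beta>_def by (rule log_bump_1[OF rho(1) L that])
    fix w :: "real => real" assume w: "smooth_on UNIV w" "!!t. 0 <= w t \<and> w t <= 1"
    let ?P = "\<lambda>t y. y + (w t * \<beta> y) *\<^sub>R (g t y - y)"
    have out: "?P t y = y" if "norm y \<ge> rho" for t y
      using log_bump_0[OF rho(1) L that] by (simp add: \<beta>_def)
    show "mono_family ?P k (l / 4) R1"
    proof
      show "smooth_on UNIV (\<lambda>(t, y). ?P t y)"
      proof (rule smooth_on_local)
        fix x :: "real \<times> R2"
        show "\<exists>N. open N \<and> x \<in> N \<and> smooth_on (UNIV \<inter> N) (\<lambda>(t, y). ?P t y)"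
        proof (cases "norm (snd x) < R1")
          case True
          have "smooth_on ?U (\<lambda>x. snd x + (w (fst x) * \<beta> (snd x)) *\<^sub>R (?G x - snd x))"
            by (intro smooth_on_add smooth_on_scaleR smooth_on_diff smooth_on_mult sG
                smooth_on_compose[OF smooth_on_fst[OF smooth_on_id] w(1)]
                smooth_on_compose[OF smooth_on_snd[OF smooth_on_id] sb] smooth_on_snd[OF smooth_on_id] UNIV_I)
          then show ?thesis using oU True by (intro exI[of _ ?U]) (simp add: case_prod_beta' mem_Times_iff)
        next
          case False
          let ?N = "UNIV \<times> - cball 0 rho :: (real \<times> R2) set"
          have "smooth_on (UNIV \<inter> ?N) (\<lambda>(t, y). ?P t y)"
            by (rule smooth_on_cong[OF smooth_on_snd[OF smooth_on_id]]) (simp add: case_prod_beta' mem_Times_iff out)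
          moreover have "open ?N" by (intro open_Times) auto
          ultimately show ?thesis using False rho by (intro exI[of _ ?N]) (simp add: mem_Times_iff)
        qed
      qed
      show "k > 0" "l / 4 > 0" using k1 l by auto
      have "\<exists>D. (?P t has_derivative D) (at y) \<and> (\<forall>v. wip k (D v) v \<ge> (l / 4) * (norm v)\<^sup>2)" for t y
      proof (cases "norm y < r0")
        case True
        then have yR: "norm y < R1" using r0 R by simp
        obtain D where D': "(log_bump rho L has_derivative D) (at y)" "!!v. \<bar>D v\<bar> * norm y <= (2 * K / L) * norm v"
          by (rule log_bump_derivative[OF rho(1) L K]) (rule that)
        note D = D'[folded \<beta>_def]
        let ?D = "\<lambda>v. v + ((w t * \<beta> y) *\<^sub>R (d t y v - v) + (w t * D v) *\<^sub>R (g t y - y))"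
        have "(?P t has_derivative ?D) (at y)"
          by (rule has_derivative_add[OF has_derivative_ident
                has_derivative_scaleR[OF has_derivative_mult_right[OF D(1)]
                  has_derivative_diff[OF d[OF yR] has_derivative_ident]]])
        moreover have "wip k (?D v) v \<ge> (l / 4) * (norm v)\<^sup>2" for v
        proof -
          define b where "b = w t * \<beta> y"
          have b01: "0 <= b" "b <= 1" using w(2)[of t] log_bump_bounds[of rho L y]
            by (auto simp: b_def \<beta>_def intro: mult_le_one)
          have split: "?D v = (v + b *\<^sub>R ((la t * fst v + mu t * snd v, nu t * snd v) - v)) +
              b *\<^sub>R (d t y v - d t 0 v) + (w t * D v) *\<^sub>R (g t y - y)"
            unfolding d0[of t v, symmetric] b_def by (simp add: algebra_simps)
          have 1: "wip k (v + b *\<^sub>R ((la t * fst v + mu t * snd v, nu t * snd v) - v)) v \<ge> (l / 2) * (norm v)\<^sup>2"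
            by (rule triangular_wip_lower[OF l lt mt b01 k_def])
          have "\<bar>b * wip k (d t y v - d t 0 v) v\<bar> <= 1 * ((1 + k) * (eta * norm v * norm v))"
            unfolding abs_mult
          proof (rule mult_mono)
            have "\<bar>wip k (d t y v - d t 0 v) v\<bar> <= (1 + k) * (norm (d t y v - d t 0 v) * norm v)"
              by (rule abs_wip_le) (use k1 in simp)
            also have "\<dots> <= (1 + k) * (eta * norm v * norm v)"
              by (intro mult_left_mono mult_right_mono E[OF True]) (use k1 in auto)
            finally show "\<bar>wip k (d t y v - d t 0 v) v\<bar> <= (1 + k) * (eta * norm v * norm v)" .
          qed (use b01 in auto)
          also have "\<dots> = l / 8 * (norm v)\<^sup>2" using eta(2) by (simp add: power2_eq_square mult.assoc[symmetric])
          finally have 2: "b * wip k (d t y v - d t 0 v) v \<ge> - (l / 8 * (norm v)\<^sup>2)" by linarith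
          have "\<bar>w t * D v * wip k (g t y - y) v\<bar> <= 1 * \<bar>D v\<bar> * ((1 + k) * (C * norm y * norm v))"
            unfolding abs_mult
          proof (intro mult_mono)
            have "\<bar>wip k (g t y - y) v\<bar> <= (1 + k) * (norm (g t y - y) * norm v)"
              by (rule abs_wip_le) (use k1 in simp)
            also have "\<dots> <= (1 + k) * (C * norm y * norm v)"
              by (intro mult_left_mono mult_right_mono gC[OF True]) (use k1 in auto)
            finally show "\<bar>wip k (g t y - y) v\<bar> <= (1 + k) * (C * norm y * norm v)" .
          qed (use w(2)[of t] in auto)
          also have "\<dots> = (1 + k) * C * (\<bar>D v\<bar> * norm y) * norm v" by (simp add: mult_ac)
          also have "\<dots> <= (1 + k) * C * ((2 * K / L) * norm v) * norm v"
            by (intro mult_left_mono mult_right_mono D(2)) (use k1 C in auto)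
          also have "\<dots> = ((1 + k) * C * (2 * K / L)) * (norm v)\<^sup>2" by (simp add: power2_eq_square mult_ac)
          also have "\<dots> <= l / 8 * (norm v)\<^sup>2" by (rule mult_right_mono[OF LL]) simp
          finally have 3: "w t * D v * wip k (g t y - y) v \<ge> - (l / 8 * (norm v)\<^sup>2)" by linarith
          have "wip k (?D v) v = wip k (v + b *\<^sub>R ((la t * fst v + mu t * snd v, nu t * snd v) - v)) v +
              b * wip k (d t y v - d t 0 v) v + w t * D v * wip k (g t y - y) v"
            unfolding split by (simp only: wip_linear)
          then show ?thesis using 1 2 3 by simp
        qed
        ultimately show ?thesis by (intro exI[of _ ?D]) simp
      next
        case False
        have "(?P t has_derivative (\<lambda>v. v)) (at y)"
          by (rule has_derivative_transform_within_open[OF has_derivative_ident, of "- cball 0 rho"])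
            (use False rho out in \<open>auto simp: dist_norm\<close>)
        moreover have "wip k v v \<ge> (l / 4) * (norm v)\<^sup>2" for v
        proof -
          have "wip k v v = (norm v)\<^sup>2 + (k - 1) * (snd v)\<^sup>2"
            by (cases v) (simp add: wip_def norm_Pair power2_eq_square algebra_simps)
          moreover have "0 <= (k - 1) * (snd v)\<^sup>2" using k1 by simp
          moreover have "(l / 4) * (norm v)\<^sup>2 <= 1 * (norm v)\<^sup>2" by (rule mult_right_mono) (use l in auto)
          ultimately show ?thesis by simp
        qed
        ultimately show ?thesis by (intro exI[of _ "\<lambda>v. v"]) simp
      qed
      note Dex = this
      define D where "D t y = (SOME D. (?P t has_derivative D) (at y) \<and> (\<forall>v. wip k (D v) v \<ge> (l / 4) * (norm v)\<^sup>2))" for t y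
      have Ds: "(?P t has_derivative D t y) (at y) \<and> (\<forall>v. wip k (D t y v) v \<ge> (l / 4) * (norm v)\<^sup>2)" for t y
        unfolding D_def by (rule someI_ex[OF Dex])
      note D = conjunct1[OF Ds] spec[OF conjunct2[OF Ds]]
      show "mono_plane k (l / 4) R1 (?P t)" for t
        unfolding mono_plane_def
      proof (intro conjI allI impI)
        show "wip k (?P t y - ?P t z) (y - z) \<ge> (l / 4) * (norm (y - z))\<^sup>2" for y z
          by (rule wip_monotone[of "?P t" "D t", OF D])
        show "?P t y = y" if "R1 <= norm y" for y by (rule out) (use that rho in simp)
      qed
    qed
  qed
qed

section \<open>The derivative at a fixed framed point\<close>

context plane_chart
begin

lemma mono_ext:
  assumes "mono_family P k c R" and R: "cball 0 R <= V"
  shows "ext (P t) \<in> diffeos M B" "finv (ext (P t)) = ext (finv (P t))"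
    "smooth_on (UNIV \<times> M) (\<lambda>(t, p). ext (P t) p)" "smooth_on (UNIV \<times> M) (\<lambda>(t, p). finv (ext (P t)) p)"
    "smooth_isotopy M B (\<lambda>t. ext (P t))" "smooth_isotopy M B (\<lambda>t. finv (ext (P t)))"
proof -
  interpret mono_family P k c R by (rule assms(1))
  note e = ext_mono_diffeos[OF smooth_single mono_plane k c R]
  show d: "ext (P t) \<in> diffeos M B" and i: "finv (ext (P t)) = ext (finv (P t))" for t
    using e(1) e(2)[symmetric] by blast+
  have V: "P t y \<in> V" "finv (P t) y \<in> V" if "y \<in> V" for t y
    using mono_plane_V[OF inj outside R that] mono_plane_V[OF bij_is_inj[OF bij_imp_bij_inv[OF bij]] inv_outside R that] by auto
  have o: "P t y = y" "finv (P t) y = y" if "y \<notin> cball 0 R" for t y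
    using that outside inv_outside by auto
  show s1: "smooth_on (UNIV \<times> M) (\<lambda>(t, p). ext (P t) p)"
    by (rule ext_family[OF compact_cball R V(1) o(1) smooth_on_subset[OF smooth]]) auto
  have "smooth_on (UNIV \<times> M) (\<lambda>(t, p). ext (finv (P t)) p)"
    by (rule ext_family[OF compact_cball R V(2) o(2) smooth_on_subset[OF smooth_inv]]) auto
  then show s2: "smooth_on (UNIV \<times> M) (\<lambda>(t, p). finv (ext (P t)) p)" unfolding i .
  have e1: "ext (P t) p = p" if "p \<in> - ch ` cball 0 R" for t p
    by (rule ext_outside[of "cball 0 R"], rule o(1), assumption) (use that in simp)
  have e2: "finv (ext (P t)) p = p" if "p \<in> - ch ` cball 0 R" for t p
    unfolding i by (rule ext_outside[of "cball 0 R"], rule o(2), assumption) (use that in simp)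
  have UB': "B <= - ch ` cball 0 R" using UB ch_in(2) R by blast
  show "smooth_isotopy M B (\<lambda>t. ext (P t))"
    by (rule smooth_isotopyI[OF d smooth_on_subset[OF s1] compact_image[OF compact_cball R] UB' e1]) auto
  show "smooth_isotopy M B (\<lambda>t. finv (ext (P t)))"
    by (rule smooth_isotopyI[OF inv_diffeos[OF d] smooth_on_subset[OF s2] compact_image[OF compact_cball R] UB' e2]) auto
qed

lemma chart_differential:
  assumes f: "f \<in> diffeos M B" and N: "open N" "y \<in> N" "N <= V" "!!z. z \<in> N ==> f (ch z) \<in> U"
    and g: "(g has_derivative g') (at y)" "!!z. z \<in> N ==> g z = co (f (ch z))"
  shows "dif M f (ch y) (dch y v) = dch (g y) (g' v)"
proof -
  have y: "y \<in> V" using N by blast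
  have fM: "f (ch z) \<in> M" if "z \<in> N" for z using diffeosD(6)[OF f ch_in(1)] that N(3) by blast
  have "(f has_derivative dif M f (ch y)) (at (ch y) within ch ` N)"
    by (rule has_derivative_subset[OF dif_has_derivative[OF diffeosD(1)[OF f] ch_in(1)[OF y]]])
      (use ch_in(1) N(3) in blast)
  from diff_chain_within[OF has_derivative_at_withinI[OF dch_derivative[OF y]] this]
  have 1: "(f \<circ> ch has_derivative dif M f (ch y) \<circ> dch y) (at y)"
    by (simp only: at_within_open[OF N(2,1)])
  have gV: "g y \<in> V" using g(2)[OF N(2)] co_in[OF fM[OF N(2)] N(4)[OF N(2)]] by simp
  have "(ch \<circ> g has_derivative dch (g y) \<circ> g') (at y)"
    by (rule diff_chain_at[OF g(1) dch_derivative[OF gV]])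
  then have "(f \<circ> ch has_derivative dch (g y) \<circ> g') (at y)"
    by (rule has_derivative_transform_within_open[OF _ N(1,2)]) (simp add: g(2) fM N(4))
  from fun_cong[OF has_derivative_unique[OF 1 this], of v] show ?thesis by simp
qed

end

locale disc_surface = plane_chart M B U "ball 0 (1/2)" ch + pointed_surface M B v0
  for M B U :: "R3 set" and ch :: "R2 => R3" and v0 :: "R3 \<times> R3" +
  assumes v0_fr: "v0 = fr 0"
begin

lemma zero_V [simp]: "(0::R2) \<in> ball 0 (1/2)" by simp

lemma v0_ray: "v0 = ray 0 (1, 0)" by (simp add: v0_fr fr_def)

definition rep :: "(R3 => R3) => R2 => R2" where "rep f y = co (f (ch y))"

definition D0 :: "(R3 => R3) => R2 => R2" where "D0 f = frechet_derivative (rep f) (at 0)"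

text \<open>For maps fixing the framed point the derivative is triangular with a positive first
  diagonal entry, so the sign of the other diagonal entry is that of the determinant.\<close>

definition ori :: "(R3 => R3) => bool" where "ori f \<longleftrightarrow> snd (D0 f (0, 1)) > 0"

lemma rep_family:
  fixes T :: "'a::euclidean_space set"
  assumes F: "smooth_on (T \<times> M) (\<lambda>(t, p). F t p)" and M: "!!t. t \<in> T ==> F t \<in> diffeos M B"
    and S: "S <= ball 0 (1/2)" "!!t y. t \<in> T ==> y \<in> S ==> F t (ch y) \<in> U"
  shows "smooth_on (T \<times> S) (\<lambda>(t, y). rep (F t) y)"
proof -
  have 0: "smooth_on (T \<times> S) (\<lambda>x. ch (snd x))"
    by (rule smooth_on_compose[OF smooth_on_snd[OF smooth_on_id] smooth_ch]) (use S(1) in auto)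
  have 1: "smooth_on (T \<times> S) (\<lambda>x. (\<lambda>(t, p). F t p) (fst x, ch (snd x)))"
    by (rule smooth_on_compose[OF smooth_on_Pair[OF smooth_on_fst[OF smooth_on_id] 0] F])
      (use S(1) ch_in(1) in auto)
  have "smooth_on (T \<times> S) (\<lambda>x. co ((\<lambda>(t, p). F t p) (fst x, ch (snd x))))"
  proof (rule smooth_on_compose[OF 1 smooth_co])
    fix x assume x: "x \<in> T \<times> S"
    then have "F (fst x) (ch (snd x)) \<in> M"
      using S(1) by (intro diffeosD(6)[OF M ch_in(1)]) (auto simp: mem_Times_iff)
    then show "(\<lambda>(t, p). F t p) (fst x, ch (snd x)) \<in> M \<inter> U"
      using S(2) x by (simp add: mem_Times_iff)
  qed
  then show ?thesis by (simp add: rep_def case_prod_beta')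
qed

lemma rep_deriv:
  assumes f: "f \<in> diffeos M B" "f (ch 0) = ch 0"
  shows "(rep f has_derivative D0 f) (at 0)" "dif M f (ch 0) (dch 0 v) = dch 0 (D0 f v)" "rep f 0 = 0"
proof -
  let ?N = "ball 0 (1/2) \<inter> (\<lambda>y. f (ch y)) -` U"
  have "continuous_on (ball 0 (1/2)) (\<lambda>y. f (ch y))"
    by (rule smooth_on_imp_continuous_on[OF smooth_on_compose[OF smooth_ch diffeosD(1)[OF f(1)] ch_in(1)]])
  then have N: "open ?N" using continuous_open_preimage openV openU by blast
  have 0: "0 \<in> ?N" using f(2) ch_in(2)[of 0] by simp
  have "smooth_on (UNIV \<times> ?N) (\<lambda>(t::real, y). rep f y)"
    by (rule rep_family[OF smooth_family_const[OF diffeosD(1)[OF f(1)]] f(1)]) auto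
  from smooth_on_compose[OF smooth_on_Pair[OF smooth_on_const[of _ 0] smooth_on_id] this, of ?N]
  have "smooth_on ?N (rep f)" by simp
  from smooth_has_derivative_at[OF N this 0] show 1: "(rep f has_derivative D0 f) (at 0)"
    by (simp add: D0_def)
  show r0: "rep f 0 = 0" using f(2) by (simp add: rep_def)
  show "dif M f (ch 0) (dch 0 v) = dch 0 (D0 f v)"
    using chart_differential[OF f(1) N 0 _ _ 1] r0 by (auto simp: rep_def)
qed

lemma tr_fixed_point:
  assumes "f \<in> diffeos M B" "tr f = v0" shows "f (ch 0) = ch 0"
proof -
  have "fst v0 = ch 0" by (simp add: v0_ray ray_def)
  moreover have "fst (tr f) = f (fst v0)" by (simp add: tr_def)
  ultimately show ?thesis using assms(2) by simp
qed

text \<open>Fixing the framed point makes \<open>(1, 0)\<close> an eigenvector with positive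
  eigenvalue, hence the triangular form. The second diagonal entry is nonzero by injectivity; its
  sign remains undetermined here.\<close>

lemma tr_fixed:
  assumes f: "f \<in> diffeos M B" "tr f = v0"
  shows "fst (D0 f (1, 0)) > 0" "snd (D0 f (1, 0)) = 0" "snd (D0 f (0, 1)) ~= 0"
    "D0 f v = (fst (D0 f (1, 0)) * fst v + fst (D0 f (0, 1)) * snd v, snd (D0 f (0, 1)) * snd v)"
proof -
  note x0 = tr_fixed_point[OF f]
  note r = rep_deriv[OF f(1) x0]
  have lin: "linear (D0 f)" by (rule has_derivative_linear[OF r(1)])
  have nz: "D0 f v ~= 0" if "v ~= 0" for v
  proof
    assume "D0 f v = 0"
    then have "dif M f (ch 0) (dch 0 v) = 0" using r(2) linear_0[OF dch_linear[of 0]] by simp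
    moreover have "dif M f (ch 0) (dch 0 v) ~= 0"
      by (rule dif_diffeo_nonzero[OF f(1) ch_in(1) dch_tangent dch_nonzero]) (use that in simp_all)
    ultimately show False by simp
  qed
  let ?e = "(1, 0) :: R2"
  define a where "a = norm (dch 0 (D0 f ?e))"
  define b where "b = norm (dch 0 ?e)"
  have e0: "?e ~= 0" by (simp add: zero_prod_def)
  have b: "b > 0" unfolding b_def using dch_nonzero[of 0 ?e] e0 by simp
  have a: "a > 0" unfolding a_def using dch_nonzero[of 0 "D0 f ?e"] nz[OF e0] by simp
  have "dif M f (ch 0) (nrm (dch 0 ?e)) = inverse b *\<^sub>R dch 0 (D0 f ?e)"
    unfolding nrm_def b_def
    using linear_cmul[OF dif_linear[OF diffeosD(1)[OF f(1)] ch_in(1)[of 0]]] r(2) by simp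
  then have "nrm (dif M f (ch 0) (nrm (dch 0 ?e))) = nrm (dch 0 (D0 f ?e))"
    using nrm_scale[of "inverse b"] b by simp
  moreover have "nrm (dif M f (ch 0) (nrm (dch 0 ?e))) = nrm (dch 0 ?e)"
  proof -
    have "act M f (ray 0 ?e) = ray 0 ?e" using f(2)[unfolded tr_def] unfolding v0_ray .
    from arg_cong[OF this, of snd] show ?thesis by (simp add: ray_def act_nrm)
  qed
  ultimately have "inverse a *\<^sub>R dch 0 (D0 f ?e) = inverse b *\<^sub>R dch 0 ?e"
    by (simp add: nrm_def a_def b_def)
  note eq = this
  have "dch 0 (D0 f ?e) = a *\<^sub>R (inverse a *\<^sub>R dch 0 (D0 f ?e))" using a by simp
  also have "\<dots> = (a * inverse b) *\<^sub>R dch 0 ?e" unfolding eq by (simp only: scaleR_scaleR)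
  also have "\<dots> = dch 0 ((a * inverse b) *\<^sub>R ?e)"
    by (rule linear_cmul[OF dch_linear[OF zero_V], symmetric])
  finally have eq2: "dch 0 (D0 f ?e) = dch 0 ((a * inverse b) *\<^sub>R ?e)" .
  have "D0 f ?e = dco (ch 0) (dch 0 (D0 f ?e))" by (rule dco_dch[OF zero_V, symmetric])
  also have "\<dots> = (a * inverse b) *\<^sub>R ?e" unfolding eq2 by (rule dco_dch[OF zero_V])
  finally have "D0 f ?e = (a * inverse b) *\<^sub>R ?e" .
  then have D1: "D0 f ?e = (a * inverse b, 0)" by simp
  show p1: "fst (D0 f ?e) > 0" "snd (D0 f ?e) = 0" unfolding D1 using a b by simp_all
  show ex: "D0 f v = (fst (D0 f (1, 0)) * fst v + fst (D0 f (0, 1)) * snd v, snd (D0 f (0, 1)) * snd v)" for v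
  proof -
    have "D0 f v = D0 f (fst v *\<^sub>R (1, 0) + snd v *\<^sub>R (0, 1))" by simp
    also have "\<dots> = fst v *\<^sub>R D0 f (1, 0) + snd v *\<^sub>R D0 f (0, 1)"
      by (simp only: linear_add[OF lin] linear_cmul[OF lin])
    finally show ?thesis using p1(2) by (simp add: prod_eq_iff mult.commute)
  qed
  show "snd (D0 f (0, 1)) ~= 0"
  proof
    assume "snd (D0 f (0, 1)) = 0"
    \<comment> \<open>With a vanishing diagonal entry this would be a kernel vector, and it is
      nonzero because its second component is the positive eigenvalue.\<close>
    then have "D0 f (- fst (D0 f (0, 1)), fst (D0 f (1, 0))) = 0"
      by (subst ex) (simp add: zero_prod_def mult.commute)
    then show False using nz[of "(- fst (D0 f (0, 1)), fst (D0 f (1, 0)))"] p1(1) by (simp add: prod_eq_iff)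
  qed
qed

text \<open>Uniform continuity on a compact disc gives one radius for all times. The bound 1/4 keeps
  this disc inside any disc that is fixed at the ends of an isotopy in
  \<open>fiso_disc_iso\<close>.\<close>

lemma chart_radius:
  assumes F: "smooth_isotopy M B F" and x0: "!!t. t \<in> {0..1} ==> F t (ch 0) = ch 0"
  obtains R where "0 < R" "R <= 1/4" "!!t y. t \<in> {0..1} ==> norm y < R ==> F t (ch y) \<in> U"
proof -
  obtain \<rho> where \<rho>: "\<rho> > 0" "ball (ch 0) \<rho> <= U"
    by (rule openE[OF openU ch_in(2)[OF zero_V]])
  have "smooth_on ({0..1} \<times> ball 0 (1/2)) (\<lambda>x. ch (snd x))"
    by (rule smooth_on_compose[OF smooth_on_snd[OF smooth_on_id] smooth_ch]) auto
  then have "smooth_on ({0..1} \<times> ball 0 (1/2)) (\<lambda>x. (\<lambda>(t, p). F t p) (fst x, ch (snd x)))"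
    by (intro smooth_on_compose[OF smooth_on_Pair[OF smooth_on_fst[OF smooth_on_id]] smooth_isotopyD(2)[OF F]])
      (use ch_in(1) in auto)
  then have "continuous_on ({0..1} \<times> cball 0 (1/4)) (\<lambda>x. F (fst x) (ch (snd x)))"
    by (intro continuous_on_subset[OF smooth_on_imp_continuous_on]) auto
  then have "uniformly_continuous_on ({0..1} \<times> cball 0 (1/4)) (\<lambda>x. F (fst x) (ch (snd x)))"
    by (rule compact_uniformly_continuous) (intro compact_Times compact_Icc compact_cball)
  from this[unfolded uniformly_continuous_on_def, rule_format, OF \<rho>(1)]
  obtain d where d: "d > 0" "\<forall>x\<in>{0..1} \<times> cball 0 (1/4). \<forall>x'\<in>{0..1} \<times> cball 0 (1/4). dist x' x < d -->
      dist (F (fst x') (ch (snd x'))) (F (fst x) (ch (snd x))) < \<rho>" by (elim exE conjE)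
  show thesis
  proof (rule that[of "min d (1/4)"])
    fix t y assume t: "t \<in> {0..1::real}" and y: "norm (y::R2) < min d (1/4)"
    have "(t, 0) \<in> {0..1} \<times> cball (0::R2) (1/4)" "(t, y) \<in> {0..1} \<times> cball 0 (1/4)" "dist (t, y) (t, 0) < d"
      using t y by (auto simp: dist_Pair_Pair)
    then have "dist (F t (ch y)) (F t (ch 0)) < \<rho>" using d(2)[rule_format, of "(t, 0)" "(t, y)"] by simp
    then show "F t (ch y) \<in> U" using x0[OF t] \<rho>(2) by (auto simp: dist_commute)
  qed (use d in auto)
qed

text \<open>The second diagonal entry is continuous in time and never 0. Reparametrization by
  \<open>step\<close> extends the family to all real times, so that this entry is a derivative of a
  smooth map on an open set.\<close>

lemma ori_continuous:
  assumes F: "smooth_isotopy M B F" and tr: "!!t. t \<in> {0..1} ==> tr (F t) = v0" and "ori (F 0)"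
  shows "t \<in> {0..1} ==> ori (F t)"
proof -
  have Fd: "F t \<in> diffeos M B" if "t \<in> {0..1}" for t by (rule smooth_isotopyD(1)[OF F that])
  note x0 = tr_fixed_point[OF Fd tr]
  obtain R where R: "0 < R" "R <= 1/4" "!!t y. t \<in> {0..1} ==> norm y < R ==> F t (ch y) \<in> U"
    by (rule chart_radius[OF F x0]) (use that in blast)+
  let ?g = "\<lambda>x. rep (F (step (fst x))) (snd x)"
  have st: "step t \<in> {0..1}" for t by simp
  have "smooth_on (UNIV \<times> ball 0 R) (\<lambda>(t, y). rep (F (step t)) y)"
    by (rule rep_family[OF smooth_family_reparam[OF smooth_isotopyD(2)[OF F] smooth_on_step_real st] Fd[OF st]])
      (use R in auto)
  then have sm: "smooth_on (UNIV \<times> ball 0 R) ?g" by (simp add: case_prod_beta')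
  have o: "open ((UNIV :: real set) \<times> ball (0::R2) R)" by (intro open_Times) auto
  have D: "frechet_derivative ?g (at (t, 0)) (0, v) = D0 (F (step t)) v" for t v
  proof -
    have 1: "((\<lambda>y. (t, y)) has_derivative (\<lambda>v. (0, v))) (at (0::R2))"
      by (intro has_derivative_Pair has_derivative_const has_derivative_ident)
    have 2: "(?g has_derivative frechet_derivative ?g (at (t, 0))) (at (t, 0))"
      by (rule smooth_has_derivative_at[OF o sm]) (use R in auto)
    have "(rep (F (step t)) has_derivative (\<lambda>v. frechet_derivative ?g (at (t, 0)) (0, v))) (at 0)"
      using diff_chain_at[OF 1 2] by (simp add: o_def)
    from fun_cong[OF has_derivative_unique[OF this rep_deriv(1)[OF Fd[OF st] x0[OF st st]]]] show ?thesis .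
  qed
  have "smooth_on UNIV (\<lambda>t. (\<lambda>(x, v). frechet_derivative ?g (at x) v) ((t, 0), (0, (0, 1))))"
    by (rule smooth_on_compose[OF smooth_on_Pair[OF smooth_on_Pair[OF smooth_on_id smooth_on_const] smooth_on_const]
          smooth_on_frechet_derivative[OF o sm]]) (use R in auto)
  then have "continuous_on UNIV (\<lambda>t. snd (D0 (F (step t)) (0, 1)))"
    by (intro continuous_on_snd smooth_on_imp_continuous_on) (simp add: D)
  then have c: "continuous_on {0..u} (\<lambda>t. snd (D0 (F (step t)) (0, 1)))" for u
    by (rule continuous_on_subset) simp
  have pos: "snd (D0 (F (step u)) (0, 1)) > 0" if "u \<ge> 0" for u
  proof (rule ccontr)
    assume "\<not> ?thesis"
    then have "snd (D0 (F (step u)) (0, 1)) <= 0" by simp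
    moreover have "0 <= snd (D0 (F (step 0)) (0, 1))" using assms(3) by (simp add: ori_def)
    ultimately have "\<exists>x\<ge>0. x <= u \<and> snd (D0 (F (step x)) (0, 1)) = 0"
      by (rule IVT2'[of "\<lambda>t. snd (D0 (F (step t)) (0, 1))", OF _ _ that c])
    then obtain x where "snd (D0 (F (step x)) (0, 1)) = 0" by (elim exE conjE)
    then show False using tr_fixed(3)[OF Fd[OF st] tr[OF st]] by simp
  qed
  assume t: "t \<in> {0..1}"
  have "continuous_on {0..1} step" by (rule smooth_on_imp_continuous_on[OF smooth_on_subset[OF smooth_on_step_real]]) simp
  then obtain u where "0 <= u" "step u = t" using IVT'[of step 0 t 1] t by auto
  then show "ori (F t)" using pos[of u] by (simp add: ori_def)
qed

lemma straighten:
  assumes F: "smooth_isotopy M B F" and tr: "!!t. t \<in> {0..1} ==> tr (F t) = v0" "!!t. t \<in> {0..1} ==> ori (F t)"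
  obtains R k c e \<beta> where "0 < R" "R <= 1/4" "k > 0" "c > 0" "e > 0" "e < R"
    "!!t y. t \<in> {0..1} ==> norm y < R ==> F t (ch y) \<in> U" "!!y. norm y <= e ==> \<beta> y = 1"
    "!!w. smooth_on UNIV w ==> (!!t. 0 <= w t \<and> w t <= 1) ==>
      mono_family (\<lambda>t y. y + (w t * \<beta> y) *\<^sub>R (rep (F (step t)) y - y)) k c R"
proof -
  have Fd: "F t \<in> diffeos M B" if "t \<in> {0..1}" for t by (rule smooth_isotopyD(1)[OF F that])
  note x0 = tr_fixed_point[OF Fd tr(1)]
  obtain R where R: "0 < R" "R <= 1/4" "!!t y. t \<in> {0..1} ==> norm y < R ==> F t (ch y) \<in> U"
    by (rule chart_radius[OF F x0]) (use that in blast)+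
  have st: "step t \<in> {0..1}" for t by simp
  let ?g = "\<lambda>t. rep (F (step t))"
  have sm: "smooth_on (UNIV \<times> ball 0 R) (\<lambda>(t, y). ?g t y)"
    by (rule rep_family[OF smooth_family_reparam[OF smooth_isotopyD(2)[OF F] smooth_on_step_real st] Fd[OF st]])
      (use R in auto)
  have per: "\<exists>t'\<in>{0..1}. ?g t = ?g t'" for t
  proof -
    consider "t <= 0" | "t \<ge> 1" | "t \<in> {0..1}" by fastforce
    then show ?thesis
    proof cases
      case 1 then show ?thesis by (intro bexI[of _ 0]) simp_all
    next
      case 2 then show ?thesis by (intro bexI[of _ 1]) simp_all
    qed blast
  qed
  have g0: "?g t 0 = 0" for t by (rule rep_deriv(3)[OF Fd[OF st] x0[OF st st]])
  note tf = tr_fixed[OF Fd[OF st] tr(1)[OF st]]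
  have dg: "(?g t has_derivative (\<lambda>v. (fst (D0 (F (step t)) (1, 0)) * fst v + fst (D0 (F (step t)) (0, 1)) * snd v,
      snd (D0 (F (step t)) (0, 1)) * snd v))) (at 0)" for t
  proof -
    have e: "D0 (F (step t)) = (\<lambda>v. (fst (D0 (F (step t)) (1, 0)) * fst v + fst (D0 (F (step t)) (0, 1)) * snd v,
        snd (D0 (F (step t)) (0, 1)) * snd v))" by (rule HOL.ext) (rule tf(4))
    show ?thesis unfolding e[symmetric] by (rule rep_deriv(1)[OF Fd[OF st] x0[OF st st]])
  qed
  have nu: "snd (D0 (F (step t)) (0, 1)) > 0" for t using tr(2)[OF st] by (simp add: ori_def)
  show thesis
  proof (rule planar_straighten[OF R(1) sm per g0 dg tf(1) nu])
    fix k c e \<beta>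
    assume P: "k > 0" "c > 0" "e > 0" "smooth_on UNIV \<beta>" "!!y. norm y <= e ==> \<beta> y = 1"
      "!!w. smooth_on UNIV w ==> (!!t. 0 <= w t \<and> w t <= 1) ==>
        mono_family (\<lambda>t y. y + (w t * \<beta> y) *\<^sub>R (?g t y - y)) k c R"
    \<comment> \<open>The plateau radius is decreased below \<open>R\<close>, as
      \<open>mono_family_fix\<close> demands.\<close>
    show thesis
    proof (rule that[of R k c "min e (R / 2)" \<beta>])
      show "\<beta> y = 1" if "norm y <= min e (R / 2)" for y by (rule P(5)) (use that in simp)
      show "mono_family (\<lambda>t y. y + (w t * \<beta> y) *\<^sub>R (?g t y - y)) k c R"
        if "smooth_on UNIV w" "!!t. 0 <= w t \<and> w t <= 1" for w by (rule P(6)[OF that])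
    qed (use R P(1-3) in simp_all)
  qed
qed

section \<open>Fixed discs and their enlargement by radial conjugation\<close>

definition fix_disc :: "real => (R3 => R3) => bool" where
  "fix_disc r f \<longleftrightarrow> (\<forall>y. norm y < r --> f (ch y) = ch y)"

text \<open>Scaling by \<open>r\<close> up to radius 3/10, the identity from radius 4/10 on. In
  these coordinates the capping disc has radius 1/4 and the chart radius 1/2, so there is room
  around the capping disc and inside the chart.\<close>

definition shrink :: "real => R2 => R2" where
  "shrink r y = (r + (1 - r) * step ((y \<bullet> y - (3/10)\<^sup>2) / ((4/10)\<^sup>2 - (3/10)\<^sup>2))) *\<^sub>R y"

lemma shrink_inside: "norm y <= 3/10 ==> shrink r y = r *\<^sub>R y"
proof -
  assume "norm y <= 3/10"
  then have "y \<bullet> y <= (3/10)\<^sup>2" unfolding dot_square_norm by (intro power_mono) auto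
  then have "step ((y \<bullet> y - (3/10)\<^sup>2) / ((4/10)\<^sup>2 - (3/10)\<^sup>2)) = 0"
    by (intro step_eq_0) (simp add: divide_le_0_iff power2_eq_square)
  then show ?thesis by (simp add: shrink_def)
qed

lemma shrink_outside: "norm y \<ge> 4/10 ==> shrink r y = y"
proof -
  assume "norm y \<ge> 4/10"
  then have "y \<bullet> y \<ge> (4/10)\<^sup>2" unfolding dot_square_norm by (intro power_mono) auto
  then have "step ((y \<bullet> y - (3/10)\<^sup>2) / ((4/10)\<^sup>2 - (3/10)\<^sup>2)) = 1"
    by (intro step_eq_1) (simp add: le_divide_eq power2_eq_square)
  then show ?thesis by (simp add: shrink_def)
qed

lemma shrink_norm: "0 <= r ==> r <= 1 ==> norm (shrink r y) <= norm y"
proof -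
  assume r: "0 <= r" "r <= 1"
  let ?s = "step ((y \<bullet> y - (3/10)\<^sup>2) / ((4/10)\<^sup>2 - (3/10)\<^sup>2))"
  have "(1 - r) * ?s <= (1 - r) * 1" by (rule mult_left_mono) (use r in simp_all)
  moreover have "0 <= (1 - r) * ?s" using r by simp
  ultimately have "\<bar>r + (1 - r) * ?s\<bar> * norm y <= 1 * norm y" using r by (intro mult_right_mono) auto
  then show ?thesis by (simp add: shrink_def)
qed

text \<open>With factors \<open>p\<close> at \<open>y\<close> and \<open>q\<close> at
  \<open>z\<close>, the inner product is \<open>(p + q) / 2\<close> times the squared distance plus
  half of \<open>(p - q) * (y \<bullet> y - z \<bullet> z)\<close>. The last product is nonnegative
  because the factor grows with the radius.\<close>

lemma shrink_mono_family:
  assumes e: "0 < e" "e <= 1" and r: "smooth_on UNIV r" "!!t. e <= r t" "!!t. r t <= 1"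
  shows "mono_family (\<lambda>t. shrink (r t)) 1 e (4/10)"
proof
  let ?d = "(4/10)\<^sup>2 - (3/10)\<^sup>2 :: real"
  let ?s = "\<lambda>y::R2. step ((y \<bullet> y - (3/10)\<^sup>2) / ?d)"
  have d: "?d > 0" by (simp add: power2_eq_square)
  have s: "smooth_on UNIV ?s" unfolding divide_inverse
    by (intro smooth_on_step smooth_on_mult smooth_on_diff smooth_on_inner smooth_on_const smooth_on_id)
  show "smooth_on UNIV (\<lambda>(t, y). shrink (r t) y)"
    unfolding shrink_def case_prod_beta'
    by (intro smooth_on_scaleR smooth_on_add smooth_on_mult smooth_on_diff smooth_on_const smooth_on_snd[OF smooth_on_id]
        smooth_on_compose[OF smooth_on_fst[OF smooth_on_id] r(1)] smooth_on_compose[OF smooth_on_snd[OF smooth_on_id] s] UNIV_I)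
  show "mono_plane 1 e (4/10) (shrink (r t))" for t
    unfolding mono_plane_def
  proof (intro conjI allI impI)
    fix y z :: R2
    define p q where "p = r t + (1 - r t) * ?s y" and "q = r t + (1 - r t) * ?s z"
    have pq: "p \<ge> e" "q \<ge> e" unfolding p_def q_def
      using r(2,3)[of t] by (simp_all add: add_increasing2)
    have mono: "(p - q) * (y \<bullet> y - z \<bullet> z) \<ge> 0"
    proof -
      have "?s y <= ?s z" if "y \<bullet> y <= z \<bullet> z" using that d by (intro step_mono divide_right_mono) auto
      moreover have "?s z <= ?s y" if "z \<bullet> z <= y \<bullet> y" using that d by (intro step_mono divide_right_mono) auto
      moreover have "p - q = (1 - r t) * (?s y - ?s z)" by (simp add: p_def q_def algebra_simps)
      ultimately show ?thesis using r(3)[of t]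
        by (cases "y \<bullet> y <= z \<bullet> z") (simp_all add: mult_nonneg_nonpos mult_nonpos_nonpos)
    qed
    have "wip 1 (shrink (r t) y - shrink (r t) z) (y - z) = (p *\<^sub>R y - q *\<^sub>R z) \<bullet> (y - z)"
      by (simp add: wip_def inner_prod_def shrink_def p_def q_def)
    also have "\<dots> = ((p + q) / 2) * ((y - z) \<bullet> (y - z)) + ((p - q) * (y \<bullet> y - z \<bullet> z)) / 2"
      by (simp add: inner_diff_left inner_diff_right inner_commute field_simps)
    also have "\<dots> \<ge> e * ((y - z) \<bullet> (y - z))"
      using mono pq mult_right_mono[of e "(p + q) / 2" "(y - z) \<bullet> (y - z)"] by simp
    finally show "e * (norm (y - z))\<^sup>2 <= wip 1 (shrink (r t) y - shrink (r t) z) (y - z)"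
      by (simp add: dot_square_norm)
  qed (simp add: shrink_outside)
qed (use e in auto)

end

context disc_surface
begin

lemma fix_discD: "fix_disc r f ==> norm y < r ==> f (ch y) = ch y"
  unfolding fix_disc_def by (elim allE[of _ y]) simp

text \<open>Near the origin \<open>P t\<close> is \<open>f\<close> in the chart, so \<open>f\<close>
  after the inverse of the extension is the identity on the image of the disc of radius
  \<open>e\<close>. By the Lipschitz bound for the inverse this image contains the disc of radius
  \<open>c * e / (1 + k)\<close>; the bound 1/2 is the size of the chart.\<close>

lemma mono_family_fix:
  assumes mf: "mono_family P k c R" and R: "cball (0::R2) R <= ball 0 (1/2)" and P0: "P t 0 = 0"
    and f: "f \<in> diffeos M B" "!!y. norm y < R ==> f (ch y) \<in> U"
    and e: "0 < e" "e < R" "!!y. norm y <= e ==> P t y = rep f y"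
  shows "fix_disc (min (1/2) (c * e / (1 + k))) (f \<circ> finv (ext (P t)))"
  unfolding fix_disc_def
proof (intro allI impI)
  interpret mono_family P k c R by (rule mf)
  fix z :: R2 assume z: "norm z < min (1/2) (c * e / (1 + k))"
  let ?y = "finv (P t) z"
  have "norm ?y <= ((1 + k) / c) * norm z" using inv_lower[of t z 0] P0 by simp
  also have "\<dots> <= ((1 + k) / c) * (c * e / (1 + k))" by (rule mult_left_mono) (use z k c in auto)
  also have "\<dots> = e" using k c by simp
  finally have y: "norm ?y <= e" .
  then have yR: "norm ?y < R" using e by simp
  then have yV: "?y \<in> ball 0 (1/2)" using subsetD[OF R, of ?y] by simp
  have zV: "z \<in> ball 0 (1/2)" using z by simp
  have "finv (ext (P t)) (ch z) = ch ?y"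
    unfolding mono_ext(2)[OF mf R] using ch_in[OF zV] zV by (simp add: ext_def del: mem_ball_0 mem_ball)
  moreover have "f (ch ?y) = ch (rep f ?y)"
    unfolding rep_def using f(2)[OF yR] diffeosD(6)[OF f(1) ch_in(1)[OF yV]] by simp
  moreover have "rep f ?y = z" using e(3)[OF y] by simp
  ultimately show "(f \<circ> finv (ext (P t))) (ch z) = ch z" by simp
qed

lemma act_mono_ext:
  assumes mf: "mono_family P k c R" and R: "cball (0::R2) R <= ball 0 (1/2)" and P0: "P t 0 = 0"
    and D: "(P t has_derivative D) (at 0)" "D (1, 0) = (a, 0)" "a > 0"
  shows "act M (ext (P t)) v0 = v0" "act M (finv (ext (P t))) v0 = v0"
proof -
  interpret mono_family P k c R by (rule mf)
  have "P t y \<in> ball 0 (1/2)" if "y \<in> ball 0 (1/2)" for y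
    by (rule mono_plane_V[of "P t" R, OF inj _ R that]) (rule outside)
  then have "act M (ext (P t)) (ray 0 (1, 0)) = ray (P t 0) (D (1, 0))"
    by (intro act_ext[OF zero_V D(1)] diffeosD(1)[OF mono_ext(1)[OF mf R]]) (simp_all add: zero_prod_def)
  also have "\<dots> = ray 0 (a *\<^sub>R (1, 0))" by (simp add: P0 D(2))
  also have "\<dots> = ray 0 (1, 0)" by (rule ray_scale[OF zero_V D(3)])
  finally show 1: "act M (ext (P t)) v0 = v0" by (simp only: v0_ray)
  show "act M (finv (ext (P t))) v0 = v0"
    using act_inv(1)[OF mono_ext(1)[OF mf R] v0_utb, of t] 1 by simp
qed

text \<open>The direction \<open>(1, 0)\<close> remains an eigenvector with positive eigenvalue
  during the whole interpolation. The corrections therefore fix the framed point and do not alter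
  traces.\<close>

lemma straight_derivative:
  assumes f: "f \<in> diffeos M B" "tr f = v0" and e: "e > 0" "!!y. norm y <= e ==> b y = (1::real)" and w: "0 <= w" "w <= 1"
  shows "\<exists>D a. ((\<lambda>y. y + (w * b y) *\<^sub>R (rep f y - y)) has_derivative D) (at 0) \<and> D (1, 0) = (a, 0) \<and> a > 0"
proof -
  note r = rep_deriv[OF f(1) tr_fixed_point[OF f]]
  let ?D = "\<lambda>v. v + w *\<^sub>R (D0 f v - v)"
  have "((\<lambda>y. y + w *\<^sub>R (rep f y - y)) has_derivative ?D) (at 0)"
    by (intro has_derivative_add has_derivative_ident has_derivative_scaleR_right has_derivative_diff r(1))
  then have 1: "((\<lambda>y. y + (w * b y) *\<^sub>R (rep f y - y)) has_derivative ?D) (at 0)"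
    by (rule has_derivative_transform_within_open[of _ _ _ _ "ball 0 e"]) (use e in auto)
  let ?l = "fst (D0 f (1, 0))"
  have "D0 f (1, 0) = (?l, 0)" using tr_fixed(2)[OF f] by (simp add: prod_eq_iff)
  then have 2: "?D (1, 0) = (1 + w * (?l - 1), 0)" by (simp add: prod_eq_iff)
  have "1 + w * (?l - 1) > 0"
  proof (cases "w = 1")
    case False
    have "1 + w * (?l - 1) = (1 - w) + w * ?l" by (simp add: algebra_simps)
    moreover have "w * ?l \<ge> 0" using w tr_fixed(1)[OF f] by simp
    ultimately show ?thesis using w False by simp
  qed (use tr_fixed(1)[OF f] in simp)
  with 1 2 show ?thesis by (intro exI[of _ ?D] exI[of _ "1 + w * (?l - 1)"]) simp
qed

abbreviation sh :: "real => R3 => R3" where "sh s \<equiv> ext (shrink s)"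

text \<open>Conjugation acts as a magnifying glass: what \<open>f\<close> does on the disc of radius
  \<open>s * (3/10)\<close> is seen on the disc of radius 3/10. A small fixed disc thus becomes one
  that contains the capping disc.\<close>

definition cj :: "real => (R3 => R3) => R3 => R3" where "cj s f = finv (sh s) \<circ> (f \<circ> sh s)"

lemma V4: "cball (0::R2) (4/10) <= ball 0 (1/2)" by auto

lemma sh_1: "sh 1 = id"
  by (rule HOL.ext) (simp add: ext_id shrink_def)

lemma sh_mf: "0 < s ==> s <= 1 ==> mono_family (\<lambda>_. shrink s) 1 s (4/10)"
  by (rule shrink_mono_family[of s "\<lambda>_. s"]) simp_all

lemma sh_diffeo: "0 < s ==> s <= 1 ==> sh s \<in> diffeos M B"
  by (rule mono_ext(1)[OF sh_mf V4])

lemma sh_act: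
  assumes "0 < s" "s <= 1" shows "act M (sh s) v0 = v0" "act M (finv (sh s)) v0 = v0"
proof -
  have "(shrink s has_derivative (\<lambda>v. s *\<^sub>R v)) (at 0)"
    by (rule has_derivative_transform_within_open[of "\<lambda>y. s *\<^sub>R y" _ _ _ "ball 0 (3/10)"])
      (auto simp: shrink_inside intro!: derivative_eq_intros)
  then show "act M (sh s) v0 = v0" "act M (finv (sh s)) v0 = v0"
    using act_mono_ext[where P = "\<lambda>_. shrink s" and t = 0 and D = "\<lambda>v. s *\<^sub>R v" and a = s, OF sh_mf[OF assms] V4]
      shrink_inside[of 0 s] assms(1) by simp_all
qed

lemma sh_ch: "norm y < 1/2 ==> sh s (ch y) = ch (shrink s y)"
  using ch_in[of y] by (simp add: ext_def)

lemma fix_cj: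
  assumes s: "0 < s" "s <= 1" and f: "fix_disc r f" "r <= 1/2"
  shows "fix_disc r (cj s f)"
  unfolding fix_disc_def
proof (intro allI impI)
  fix y :: R2 assume y: "norm y < r"
  have "norm (shrink s y) < r" using shrink_norm[of s y] s y by simp
  then have "f (sh s (ch y)) = sh s (ch y)" using fix_discD[OF f(1)] f(2) y sh_ch[of y s] by simp
  then show "cj s f (ch y) = ch y" using diffeos_inv_simps(1)[OF sh_diffeo[OF s]] by (simp add: cj_def)
qed

lemma fix_cj_small:
  assumes s: "0 < s" "s <= 1" and f: "fix_disc e f" "s * (3/10) <= e"
  shows "fix_disc (3/10) (cj s f)"
  unfolding fix_disc_def
proof (intro allI impI)
  fix y :: R2 assume y: "norm y < 3/10"
  then have "sh s (ch y) = ch (s *\<^sub>R y)" using sh_ch[of y s] shrink_inside[of y s] by simp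
  moreover have "norm (s *\<^sub>R y) < e"
  proof -
    have "s * norm y < s * (3/10)" using y s by (intro mult_strict_left_mono) auto
    then have "s * norm y < e" using f(2) by (rule less_le_trans)
    then show ?thesis using s by simp
  qed
  ultimately have "f (sh s (ch y)) = sh s (ch y)" using fix_discD[OF f(1)] by simp
  then show "cj s f (ch y) = ch y" using diffeos_inv_simps(1)[OF sh_diffeo[OF s]] by (simp add: cj_def)
qed

definition rad :: "real => real => real" where "rad e t = 1 - (1 - e) * step t"

lemma rad: "smooth_on UNIV (rad e)" "rad e 0 = 1" "rad e 1 = e" "e <= 1 ==> e <= rad e t" "e <= 1 ==> rad e t <= 1"
proof -
  show "smooth_on UNIV (rad e)" unfolding rad_def
    by (intro smooth_on_diff smooth_on_mult smooth_on_const smooth_on_step_real)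
  show "rad e 0 = 1" "rad e 1 = e" by (simp_all add: rad_def)
  assume e: "e <= 1"
  have "(1 - e) * step t <= (1 - e) * 1" by (rule mult_left_mono) (use e in simp_all)
  moreover have "0 <= (1 - e) * step t" using e by simp
  ultimately show "e <= rad e t" "rad e t <= 1" by (simp_all add: rad_def)
qed

lemma rad_mf: "0 < e ==> e <= 1 ==> mono_family (\<lambda>t. shrink (rad e t)) 1 e (4/10)"
  by (rule shrink_mono_family) (simp_all add: rad)

lemma cj_isotopy:
  assumes e: "0 < e" "e <= 1" and F: "smooth_isotopy M B F"
  shows "smooth_isotopy M B (\<lambda>t. cj (rad e t) (F t))"
  unfolding cj_def by (rule smooth_isotopy_comp[OF mono_ext(6)[OF rad_mf[OF e] V4]
      smooth_isotopy_comp[OF F mono_ext(5)[OF rad_mf[OF e] V4]]])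

lemma cj_1: "cj 1 f = f"
  by (simp add: cj_def sh_1)

text \<open>A radius above 1/4, the same for all times, means that the capping disc and a
  neighbourhood of it stay fixed. Such isotopies restrict to the surface from which the disc has
  been removed.\<close>

definition disc_iso :: "(R3 => R3) => (R3 => R3) => bool" where
  "disc_iso f g \<longleftrightarrow> (\<exists>F r. smooth_isotopy M B F \<and> F 0 = f \<and> F 1 = g \<and> r > 1/4 \<and> (\<forall>t\<in>{0..1}. fix_disc r (F t)))"

lemma disc_isoI: "smooth_isotopy M B F ==> F 0 = f ==> F 1 = g ==> r > 1/4 ==>
    (!!t. t \<in> {0..1} ==> fix_disc r (F t)) ==> disc_iso f g"
  unfolding disc_iso_def by (intro exI[of _ F] exI[of _ r]) simp

lemma disc_iso_sym:
  assumes "disc_iso f g" shows "disc_iso g f"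
proof -
  obtain F r where F: "smooth_isotopy M B F" "F 0 = f" "F 1 = g" "r > 1/4" "\<forall>t\<in>{0..1}. fix_disc r (F t)"
    using assms unfolding disc_iso_def by (elim exE conjE)
  show ?thesis
    by (rule disc_isoI[OF smooth_isotopy_reverse[OF F(1)] _ _ F(4)]) (use F in simp_all)
qed

lemma disc_iso_trans:
  assumes "disc_iso f g" "disc_iso g h" shows "disc_iso f h"
proof -
  obtain F r where F: "smooth_isotopy M B F" "F 0 = f" "F 1 = g" "r > 1/4" "\<forall>t\<in>{0..1}. fix_disc r (F t)"
    using assms(1) unfolding disc_iso_def by (elim exE conjE)
  obtain G q where G: "smooth_isotopy M B G" "G 0 = g" "G 1 = h" "q > 1/4" "\<forall>t\<in>{0..1}. fix_disc q (G t)"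
    using assms(2) unfolding disc_iso_def by (elim exE conjE)
  have g: "g \<in> diffeos M B" using smooth_isotopyD(1)[OF F(1), of 1] F(3) by simp
  have inv_eq: "finv g p = p" if "g p = p" for p using diffeos_inv_simps(1)[OF g, of p] that by simp
  have g1: "g (ch y) = ch y" if "norm y < r" for y using fix_discD[OF bspec[OF F(5), of 1] that] F(3) by simp
  show ?thesis
  proof (rule disc_isoI[OF smooth_isotopy_concat[OF F(1) G(1)], of f h "min r q"])
    show "fix_disc (min r q) (G t \<circ> (finv (F 1) \<circ> F t))" if "t \<in> {0..1}" for t
      unfolding fix_disc_def
      using fix_discD[OF bspec[OF F(5) that]] fix_discD[OF bspec[OF G(5) that]] F(3) inv_eq[OF g1] by simp
  qed (use F G diffeos_inv_simps[OF g] in \<open>simp_all add: comp_assoc[symmetric]\<close>)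
qed

lemma disc_iso_cj:
  assumes f: "f \<in> diffeos M B" "fix_disc r f" "1/4 < r" "r <= 1/2" and e: "0 < e" "e <= 1"
  shows "disc_iso f (cj e f)"
proof (rule disc_isoI[OF cj_isotopy[OF e smooth_isotopy_const[OF f(1)]] _ _ f(3)])
  show "fix_disc r (cj (rad e t) f)" for t
    by (rule fix_cj[OF _ _ f(2,4)]) (use rad(4,5)[OF e(2), of t] e in simp_all)
qed (simp_all add: rad cj_1)

lemma R_sub: "R <= 1/4 ==> cball (0::R2) R <= ball 0 (1/2)"
  by auto

text \<open>The lift is composed with the inverse of a straightening that is the identity at time 0
  and agrees with \<open>F 1\<close> near the framed point at time 1, so that the new end fixes a
  small disc. Conjugation by shrinking maps enlarges it. Both corrections fix the framed point, so
  the trace changes only by a homotopy.\<close>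

lemma lift_end:
  assumes F: "lift F" and F1: "tr (F 1) = v0" "ori (F 1)"
  obtains F' where "lift F'" "fix_disc (3/10) (F' 1)" "homotopic_paths X (\<lambda>t. tr (F t)) (\<lambda>t. tr (F' t))"
proof -
  have FI: "smooth_isotopy M B F" and F0: "F 0 = id" using F by (simp_all add: lift_def)
  define f where "f = F 1"
  have f: "f \<in> diffeos M B" "tr f = v0" "ori f" using smooth_isotopyD(1)[OF FI, of 1] F1 by (simp_all add: f_def)
  show thesis
  proof (rule straighten[OF smooth_isotopy_const[OF f(1)] f(2,3)])
    fix R k c e \<beta>
    assume R: "0 < R" "R <= 1/4" and k: "(k::real) > 0" and c: "(c::real) > 0" and e: "e > 0" "e < R"
      and fU: "!!t y. t \<in> {0..1::real} ==> norm y < R ==> f (ch y) \<in> U" and \<beta>: "!!y. norm y <= e ==> \<beta> y = 1"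
      and mf': "!!w. smooth_on UNIV w ==> (!!t. 0 <= w t \<and> w t <= 1) ==>
        mono_family (\<lambda>t y. y + (w t * \<beta> y) *\<^sub>R (rep f y - y)) k c R"
    define P where "P t y = y + (step t * \<beta> y) *\<^sub>R (rep f y - y)" for t y
    have mf: "mono_family P k c R" using mf'[OF smooth_on_step_real] by (simp add: P_def[abs_def])
    note RV = R_sub[OF R(2)]
    have rep0: "rep f 0 = 0" by (rule rep_deriv(3)[OF f(1) tr_fixed_point[OF f(1,2)]])
    have P0: "P t 0 = 0" for t using rep0 by (simp add: P_def)
    have PA: "act M (finv (ext (P t))) v0 = v0" for t
    proof -
      obtain D a where D: "((\<lambda>y. y + (step t * \<beta> y) *\<^sub>R (rep f y - y)) has_derivative D) (at 0)" "D (1, 0) = (a, 0)" "a > 0"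
      proof -
        have "\<exists>D a. ((\<lambda>y. y + (step t * \<beta> y) *\<^sub>R (rep f y - y)) has_derivative D) (at 0) \<and> D (1, 0) = (a, 0) \<and> a > 0"
          by (rule straight_derivative[OF f(1,2) e(1) _ step_nonneg step_le_1]) (rule \<beta>)
        then show thesis using that by (elim exE conjE)
      qed
      have "P t = (\<lambda>y. y + (step t * \<beta> y) *\<^sub>R (rep f y - y))" by (rule HOL.ext) (rule P_def)
      then have "(P t has_derivative D) (at 0)" using D(1) by simp
      from act_mono_ext(2)[OF mf RV P0 this D(2,3)] show ?thesis .
    qed
    define H where "H t = F t \<circ> finv (ext (P t))" for t
    have H: "smooth_isotopy M B H" unfolding H_def by (rule smooth_isotopy_comp[OF FI mono_ext(6)[OF mf RV]])
    have "ext (P 0) = id" by (rule HOL.ext) (simp add: ext_id P_def)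
    then have H0: "H 0 = id" by (simp add: H_def F0 inv_id)
    have trH: "tr (H t) = tr (F t)" if "t \<in> {0..1}" for t
      unfolding H_def tr_comp[OF smooth_isotopyD(1)[OF FI that] inv_diffeos[OF mono_ext(1)[OF mf RV]]]
      using PA by (simp add: tr_def)
    define e' where "e' = min (1/2) (c * e / (1 + k))"
    have e': "e' > 0" using c e k by (simp add: e'_def)
    have H1: "fix_disc e' (H 1)"
      unfolding H_def f_def[symmetric] e'_def
      by (rule mono_family_fix[OF mf RV P0 f(1) fU[of 0] e]) (simp_all add: P_def \<beta>)
    define s where "s = min 1 e'"
    have s: "0 < s" "s <= 1" "s * (3/10) <= e'" using e' by (auto simp: s_def min_def)
    have rs: "0 < rad s t" "rad s t <= 1" for t using rad(4,5)[OF s(2), of t] s(1) by auto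
    define F' where "F' t = cj (rad s t) (H t)" for t
    have F'I: "smooth_isotopy M B F'" unfolding F'_def by (rule cj_isotopy[OF s(1,2) H])
    have trF': "tr (F' t) = act M (finv (sh (rad s t))) (tr (F t))" if t: "t \<in> {0..1}" for t
    proof -
      note d = inv_diffeos[OF sh_diffeo[OF rs]] smooth_isotopyD(1)[OF H t] sh_diffeo[OF rs]
      have "tr (F' t) = act M (finv (sh (rad s t))) (act M (H t) (act M (sh (rad s t)) v0))"
        unfolding F'_def cj_def tr_comp[OF d(1) comp_diffeos[OF d(2,3)]] tr_comp[OF d(2,3)] by (simp add: tr_def)
      then show ?thesis using sh_act(1)[OF rs] trH[OF t] by (simp add: tr_def)
    qed
    show thesis
    proof (rule that[of F'])
      show "lift F'" using F'I by (simp add: lift_def F'_def rad cj_1 H0)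
      show "fix_disc (3/10) (F' 1)" unfolding F'_def rad by (rule fix_cj_small[OF s(1,2) H1 s(3)])
      \<comment> \<open>The first parameter switches the shrinking on. At time 0 and for parameter 0
        the shrinking map is the identity; at time 1 the trace is the framed point, which every
        shrinking map fixes.\<close>
      let ?h = "\<lambda>x. act M (finv (sh (rad s (fst x * snd x)))) (tr (F (snd x)))"
      have a: "smooth_on (UNIV \<times> unit_tangent_bundle M) (\<lambda>(t, a). act M (finv (sh (rad s t))) a)"
        by (rule act_smooth[OF mono_ext(4)[OF rad_mf[OF s(1,2)] V4] inv_diffeos[OF sh_diffeo[OF rs]]])
      have trX: "tr (F t) \<in> X" if "t \<in> {0..1}" for t by (rule tr_X[OF smooth_isotopyD(1)[OF FI that]])
      have t1: "continuous_on ({0..1} \<times> {0..1}) (\<lambda>x::real \<times> real. tr (F (snd x)))"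
        by (rule continuous_on_compose2[OF smooth_on_imp_continuous_on[OF smooth_tr[OF FI]] continuous_on_snd[OF continuous_on_id]]) auto
      have "continuous_on ({0..1} \<times> {0..1}) (\<lambda>x. (\<lambda>(t, a). act M (finv (sh (rad s t))) a) (fst x * snd x, tr (F (snd x))))"
        by (rule continuous_on_compose2[OF smooth_on_imp_continuous_on[OF a]])
          (use X_utb[OF trX] in \<open>auto intro!: continuous_intros t1\<close>)
      then have c: "continuous_on ({0..1} \<times> {0..1}) ?h" by simp
      have hX: "?h x \<in> X" if "x \<in> {0..1} \<times> {0..1}" for x
        by (rule act_X[OF inv_diffeos[OF sh_diffeo[OF rs]] trX]) (use that in auto)
      have h0: "?h (0, t) = tr (F t)" if "t \<in> {0..1}" for t
        using act_id[OF X_utb[OF trX[OF that]]] by (simp add: rad sh_1 inv_id del: id_apply)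
      have h1: "?h (1, t) = tr (F' t)" if "t \<in> {0..1}" for t using trF'[OF that] by simp
      have s0: "?h (t, 0) = tr (F 0)" for t using act_id[OF X_utb[OF trX[of 0]]] by (simp add: rad sh_1 inv_id del: id_apply)
      have s1: "?h (t, 1) = tr (F 1)" for t using sh_act(2)[OF rs] F1(1) by simp
      show "homotopic_paths X (\<lambda>t. tr (F t)) (\<lambda>t. tr (F' t))"
        unfolding homotopic_paths
        by (rule exI[of _ ?h]) (use c hX h0 h1 s0 s1 in \<open>simp add: pathstart_def pathfinish_def image_subset_iff Pi_iff\<close>)
    qed
  qed
qed

lemma fix_disc_tr:
  assumes f: "f \<in> diffeos M B" "fix_disc r f" "r > 0"
  shows "tr f = v0" "ori f"
proof -
  have x0: "f (ch 0) = ch 0" using fix_discD[OF f(2), of 0] f(3) by simp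
  note d = rep_deriv[OF f(1) x0]
  have "rep f y = y" if "norm y < min r (1/2)" for y
    using fix_discD[OF f(2), of y] that by (simp add: rep_def)
  then have "(rep f has_derivative (\<lambda>v. v)) (at 0)"
    by (intro has_derivative_transform_within_open[OF has_derivative_ident, of "ball 0 (min r (1/2))"]) (use f(3) in auto)
  from has_derivative_unique[OF d(1) this] have D: "D0 f = (\<lambda>v. v)" .
  show "ori f" by (simp add: ori_def D)
  let ?w = "dch 0 (1, 0)"
  have nz: "?w ~= 0" by (rule dch_nonzero[OF zero_V]) (simp add: zero_prod_def)
  have "dif M f (ch 0) (nrm ?w) = nrm ?w"
    unfolding nrm_def linear_cmul[OF dif_linear[OF diffeosD(1)[OF f(1)] ch_in(1)[OF zero_V]]] d(2) D ..
  then have "act M f (ray 0 (1, 0)) = ray 0 (1, 0)"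
    using x0 nrm_unit[OF norm_nrm[OF nz]] by (simp add: ray_def act_nrm)
  then show "tr f = v0" unfolding tr_def by (simp only: v0_ray)
qed

text \<open>The same correction with an isotopy in place of a single map. The ends are left
  unchanged, since there the maps are already the identity on the support of the straightening.
  Conjugation by one shrinking map then fixes a large disc for all times, and varying the factor
  leads back to the original ends.\<close>

lemma fiso_disc_iso:
  assumes fg: "fiso f g" and fix': "fix_disc r' f" "fix_disc r' g" "r' > 1/4"
  shows "disc_iso f g"
proof -
  \<comment> \<open>The radius is cut down to satisfy the upper bound 1/2 in
    \<open>disc_iso_cj\<close>, but stays above 1/4.\<close>
  define r where "r = min r' (3/10)"
  have r: "1/4 < r" "r <= 1/2" "fix_disc r f" "fix_disc r g"
    using fix' by (auto simp: r_def fix_disc_def)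
  obtain F where F: "smooth_isotopy M B F" "F 0 = f" "F 1 = g" "!!t. t \<in> {0..1} ==> tr (F t) = tr f"
    by (rule fisoE[OF fg]) (rule that)
  have fd: "f \<in> diffeos M B" "g \<in> diffeos M B" using fiso_diffeos[OF fg] by auto
  have r0: "r > 0" using r by simp
  have trF: "tr (F t) = v0" if "t \<in> {0..1}" for t using F(4)[OF that] fix_disc_tr(1)[OF fd(1) r(3) r0] by simp
  have oriF: "ori (F t)" if "t \<in> {0..1}" for t
    by (rule ori_continuous[OF F(1) trF _ that]) (use fix_disc_tr(2)[OF fd(1) r(3) r0] F(2) in simp_all)
  have Fd: "F t \<in> diffeos M B" if "t \<in> {0..1}" for t by (rule smooth_isotopyD(1)[OF F(1) that])
  have st: "step t \<in> {0..1}" for t by simp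
  show ?thesis
  proof (rule straighten[OF F(1) trF oriF])
    fix R k c e \<beta>
    assume R: "0 < R" "R <= 1/4" and k: "(k::real) > 0" and c: "(c::real) > 0" and e: "e > 0" "e < R"
      and fU: "!!t y. t \<in> {0..1::real} ==> norm y < R ==> F t (ch y) \<in> U" and \<beta>: "!!y. norm y <= e ==> \<beta> y = 1"
      and mf': "!!w. smooth_on UNIV w ==> (!!t. 0 <= w t \<and> w t <= 1) ==>
        mono_family (\<lambda>t y. y + (w t * \<beta> y) *\<^sub>R (rep (F (step t)) y - y)) k c R"
    define P where "P t y = y + \<beta> y *\<^sub>R (rep (F (step t)) y - y)" for t y
    have mf: "mono_family P k c R" using mf'[OF smooth_on_const, of 1] by (simp add: P_def[abs_def])
    note RV = R_sub[OF R(2)]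
    have P0: "P t 0 = 0" for t
      using rep_deriv(3)[OF Fd[OF st] tr_fixed_point[OF Fd[OF st] trF[OF st]], of t] by (simp add: P_def)
    define H where "H t = F (step t) \<circ> finv (ext (P t))" for t
    have FS: "smooth_isotopy M B (\<lambda>t. F (step t))"
      by (rule smooth_isotopy_reparam[OF F(1) smooth_on_subset[OF smooth_on_step_real]]) simp_all
    have H: "smooth_isotopy M B H" unfolding H_def by (rule smooth_isotopy_comp[OF FS mono_ext(6)[OF mf RV]])
    define e' where "e' = min (1/2) (c * e / (1 + k))"
    have e': "e' > 0" using c e k by (simp add: e'_def)
    have He: "fix_disc e' (H t)" for t
      unfolding H_def e'_def
      by (rule mono_family_fix[OF mf RV P0 Fd[OF st] fU[OF st] e]) (simp_all add: P_def \<beta>)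
    have ends: "H t = F (step t)" if "fix_disc r (F (step t))" for t
    proof -
      have "P t y = y" for y
      proof (cases "norm y < R")
        case True
        then have "rep (F (step t)) y = y" using fix_discD[OF that, of y] R r(1) by (simp add: rep_def)
        then show ?thesis by (simp add: P_def)
      next
        case False
        then show ?thesis using mono_family.outside[OF mf, of y t] by simp
      qed
      then have "ext (P t) = id" by (intro HOL.ext) (simp add: ext_id)
      then show ?thesis by (simp add: H_def inv_id)
    qed
    have H01: "H 0 = f" "H 1 = g" using ends[of 0] ends[of 1] F(2,3) r(3,4) by simp_all
    define s where "s = min 1 e'"
    have s: "0 < s" "s <= 1" "s * (3/10) <= e'" using e' by (auto simp: s_def min_def)
    have "disc_iso (cj s f) (cj s g)"
    proof (rule disc_isoI[where F = "\<lambda>t. cj s (H t)" and r = "3/10"])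
      show "smooth_isotopy M B (\<lambda>t. cj s (H t))"
        unfolding cj_def
        by (intro smooth_isotopy_comp smooth_isotopy_const inv_diffeos sh_diffeo s H)
      show "fix_disc (3/10) (cj s (H t))" for t by (rule fix_cj_small[OF s(1,2) He s(3)])
    qed (simp_all add: H01)
    from disc_iso_trans[OF disc_iso_trans[OF disc_iso_cj[OF fd(1) r(3,1,2) s(1,2)] this]
        disc_iso_sym[OF disc_iso_cj[OF fd(2) r(4,1,2) s(1,2)]]]
    show ?thesis .
  qed
qed

end

section \<open>The surfaces\<close>

lemma mem_shift: "(x, y, z) \<in> shift k X \<longleftrightarrow> (x + real k, y, z) \<in> X"
  unfolding shift_def by (auto simp: image_iff algebra_simps intro!: bexI[of _ "(x + real k, y, z)"])

lemma mem_translate: "q \<in> (\<lambda>p. p - a) ` S \<longleftrightarrow> q + a \<in> S" for q a :: "'a::ab_group_add"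
  by (auto simp: image_iff intro!: bexI[of _ "q + a"])

text \<open>The strip with a round hole in each square numbered by \<open>K\<close>. The surfaces
  are such strips together with plugs, so inclusions between them become comparisons of index
  sets.\<close>

definition flat :: "nat => nat set => R3 set" where
  "flat m K = {(x, y, z). - real m <= x \<and> x <= 1 \<and> 0 <= y \<and> y <= 1 \<and> z = 0 \<and>
     (\<forall>k\<in>K. (x + real k - 1/2)\<^sup>2 + (y - 1/2)\<^sup>2 \<ge> (1/4)\<^sup>2)}"

definition plugs :: "R3 set => nat set => R3 set" where
  "plugs P K = (\<Union>k\<in>K. shift k P)"

lemma sq_ge: "\<bar>a\<bar> \<ge> 1/4 ==> a\<^sup>2 + b\<^sup>2 \<ge> (1/4 :: real)\<^sup>2"
proof -
  assume "\<bar>a\<bar> \<ge> 1/4"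
  then have "a\<^sup>2 \<ge> (1/4)\<^sup>2" by (metis abs_ge_zero abs_le_square_iff abs_of_nonneg zero_le_divide_1_iff zero_le_numeral)
  then show ?thesis by (simp add: add_increasing2)
qed

lemma flat_square:
  assumes K: "K <= {1..n}"
  shows "shift (Suc n) square \<union> flat n K = flat (Suc n) K"
proof (rule Set.set_eqI)
  fix p :: R3
  obtain x y z where p: "p = (x, y, z)" by (cases p)
  have "(x + real k - 1/2)\<^sup>2 + (y - 1/2)\<^sup>2 \<ge> (1/4)\<^sup>2" if "k \<in> K" "x + real (Suc n) <= 1" for k
    by (rule sq_ge) (use that K in force)
  then show "p \<in> shift (Suc n) square \<union> flat n K \<longleftrightarrow> p \<in> flat (Suc n) K"
    unfolding p Un_iff mem_shift by (auto simp: square_def flat_def)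
qed

lemma flat_annulus:
  assumes K: "K <= {1..n}"
  shows "shift (Suc n) annulus \<union> flat n K = flat (Suc n) (insert (Suc n) K)"
proof (rule Set.set_eqI)
  fix p :: R3
  obtain x y z where p: "p = (x, y, z)" by (cases p)
  have 1: "(x + real k - 1/2)\<^sup>2 + (y - 1/2)\<^sup>2 \<ge> (1/4)\<^sup>2" if "k \<in> K" "x + real (Suc n) <= 1" for k
    by (rule sq_ge) (use that K in force)
  have 2: "(x + real (Suc n) - 1/2)\<^sup>2 + (y - 1/2)\<^sup>2 \<ge> (1/4)\<^sup>2" if "- real n <= x"
    by (rule sq_ge) (use that in simp)
  show "p \<in> shift (Suc n) annulus \<union> flat n K \<longleftrightarrow> p \<in> flat (Suc n) (insert (Suc n) K)"
    unfolding p Un_iff mem_shift using 1 2 by (auto simp: annulus_def square_def flat_def not_less)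
qed

lemma square_flat: "square = flat 0 {}"
  by (auto simp: square_def flat_def)

lemma surf_eq: "surf P n = flat n {1..n} \<union> plugs P {1..n}"
proof (induction n)
  case 0
  then show ?case by (simp add: square_flat plugs_def)
next
  case (Suc n)
  have i: "{1..Suc n} = insert (Suc n) {1..n}" by auto
  have s: "shift (Suc n) (torus1 P) = shift (Suc n) annulus \<union> shift (Suc n) P"
    by (simp add: torus1_def shift_def image_Un)
  show ?case
    unfolding surf.simps Suc.IH s i flat_annulus[of "{1..n}" n, symmetric, OF order_refl] by (auto simp: plugs_def)
qed

lemma capped_eq: "capped P n = flat (Suc n) {1..n} \<union> plugs P {1..n}"
  unfolding capped_def bsum_def surf_eq using flat_square[of "{1..n}" n] by blast

lemma annulus_eq: "bsum P annulus n = flat (Suc n) {1..Suc n} \<union> plugs P {1..n}"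
proof -
  have i: "{1..Suc n} = insert (Suc n) {1..n}" by auto
  show ?thesis unfolding bsum_def surf_eq i using flat_annulus[of "{1..n}" n] by blast
qed

lemma torus_eq: "bsum P (torus1 P) n = surf P (Suc n)"
  by (simp add: bsum_def)

lemma flatD:
  assumes "(x, y, z) \<in> flat m K"
  shows "- real m <= x" "x <= 1" "0 <= y" "y <= 1" "z = 0"
    "k \<in> K ==> (1/4)\<^sup>2 <= (x + real k - 1/2)\<^sup>2 + (y - 1/2)\<^sup>2"
  using assms by (simp_all add: flat_def)

lemma closed_flat: "closed (flat m K)"
proof -
  have "flat m K = {p. - real m <= fst p \<and> fst p <= 1 \<and> 0 <= fst (snd p) \<and> fst (snd p) <= 1 \<and> snd (snd p) = 0} \<inter>
      (\<Inter>k\<in>K. {p. (1/4)\<^sup>2 <= (fst p + real k - 1/2)\<^sup>2 + (fst (snd p) - 1/2)\<^sup>2})"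
    by (auto simp: flat_def)
  moreover have "closed {p::R3. - real m <= fst p \<and> fst p <= 1 \<and> 0 <= fst (snd p) \<and> fst (snd p) <= 1 \<and> snd (snd p) = 0}"
    by (intro closed_Collect_conj closed_Collect_le closed_Collect_eq continuous_intros)
  moreover have "closed (\<Inter>k\<in>K. {p::R3. (1/4)\<^sup>2 <= (fst p + real k - 1/2)\<^sup>2 + (fst (snd p) - 1/2)\<^sup>2})"
    by (intro closed_INT ballI closed_Collect_le continuous_intros)
  ultimately show ?thesis by (simp only: closed_Int)
qed

lemma closed_strip: "closed (strip_boundary m)"
proof -
  have "strip_boundary m = {p. - real m <= fst p \<and> fst p <= 1 \<and> 0 <= fst (snd p) \<and> fst (snd p) <= 1 \<and> snd (snd p) = 0 \<and>
      (fst p = - real m \<or> fst p = 1 \<or> fst (snd p) = 0 \<or> fst (snd p) = 1)}"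
    by (auto simp: strip_boundary_def)
  also have "closed \<dots>"
    by (intro closed_Collect_conj closed_Collect_disj closed_Collect_le closed_Collect_eq continuous_intros)
  finally show ?thesis .
qed

locale plug =
  fixes P :: "R3 set" assumes plug: "torus_plug P"
begin

lemma compact_P: "compact P"
proof -
  obtain f where f: "diffeomorphism P standard_one_holed_torus f"
    using plug unfolding torus_plug_def by blast
  note D = diffeomorphismD[OF f]
  have "compact standard_one_holed_torus"
    unfolding standard_one_holed_torus_def by (intro compact_diff compact_Times) auto
  then have "compact (inv_into P f ` standard_one_holed_torus)"
    by (intro compact_continuous_image smooth_on_imp_continuous_on[OF D(2)])
  moreover have "inv_into P f ` standard_one_holed_torus = P"
  proof
    show "P <= inv_into P f ` standard_one_holed_torus"
      using D(3,5) by (metis image_eqI subsetI)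
  qed (use D(4) in blast)
  ultimately show ?thesis by simp
qed

lemma P_sub: "(x, y, z) \<in> P ==> 0 < x \<and> x < 1 \<and> 0 < y \<and> y < 1"
  and P_annulus: "P \<inter> annulus = inner_circle"
  and P_smooth: "smooth_surface ((annulus \<union> P) \<inter> ({0<..<1} \<times> {0<..<1} \<times> UNIV))"
  using plug unfolding torus_plug_def by auto

text \<open>A compact set in the open square keeps a uniform distance from its sides. The bound 1/8
  stays below the gap 1/4 between the hole and the sides.\<close>

lemma P_margin:
  obtains d where "0 < d" "d <= 1/8" "!!x y z. (x, y, z) \<in> P ==> d <= x \<and> x <= 1 - d \<and> d <= y \<and> y <= 1 - d"
proof -
  have "(3/4, 1/2, 0) \<in> inner_circle" by (simp add: inner_circle_def)
  then have ne: "P ~= {}" using P_annulus by blast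
  let ?f = "\<lambda>p::R3. min (min (fst p) (1 - fst p)) (min (fst (snd p)) (1 - fst (snd p)))"
  have "continuous_on P ?f" by (intro continuous_intros)
  from continuous_attains_inf[OF compact_P ne this] obtain q where q: "q \<in> P" "\<forall>p\<in>P. ?f q <= ?f p"
    by (rule bexE) (rule that)
  obtain a b c where qq: "q = (a, b, c)" by (cases q)
  show thesis
  proof (rule that[of "min (1/8) (?f q)"])
    show "0 < min (1/8) (?f q)" using q(1) P_sub qq by auto
    show "min (1/8) (?f q) <= x \<and> x <= 1 - min (1/8) (?f q) \<and> min (1/8) (?f q) <= y \<and> y <= 1 - min (1/8) (?f q)"
      if "(x, y, z) \<in> P" for x y z
      using bspec[OF q(2) that] by (auto simp: min_def split: if_splits)
  qed (rule min.cobounded1)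
qed

definition mg where "mg = (SOME d. 0 < d \<and> d <= 1/8 \<and> (\<forall>x y z. (x, y, z) \<in> P --> d <= x \<and> x <= 1 - d \<and> d <= y \<and> y <= 1 - d))"

lemma mg: "0 < mg" "mg <= 1/8" "(x, y, z) \<in> P ==> mg <= x \<and> x <= 1 - mg \<and> mg <= y \<and> y <= 1 - mg"
proof -
  have "\<exists>d. 0 < d \<and> d <= 1/8 \<and> (\<forall>x y z. (x, y, z) \<in> P --> d <= x \<and> x <= 1 - d \<and> d <= y \<and> y <= 1 - d)"
    by (rule P_margin) blast
  from someI_ex[OF this, folded mg_def] show "0 < mg" "mg <= 1/8" "(x, y, z) \<in> P ==> mg <= x \<and> x <= 1 - mg \<and> mg <= y \<and> y <= 1 - mg"
    by blast+
qed

lemma plugs_coord: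
  assumes "(x, y, z) \<in> plugs P K"
  obtains k where "k \<in> K" "mg - real k <= x" "x <= 1 - mg - real k" "mg <= y" "y <= 1 - mg" "(x + real k, y, z) \<in> P"
proof -
  obtain k where "k \<in> K" "(x + real k, y, z) \<in> P" using assms by (auto simp: plugs_def mem_shift)
  then show thesis using that mg(3)[of "x + real k" y z] by simp
qed

lemma closed_plugs: "finite K ==> closed (plugs P K)"
  unfolding plugs_def shift_def
  by (intro closed_UN ballI compact_imp_closed compact_continuous_image continuous_intros compact_P)

lemma closed_sets: "closed (surf P n)" "closed (capped P n)" "closed (bsum P annulus n)"
  unfolding surf_eq capped_eq annulus_eq by (intro closed_Un closed_flat closed_plugs finite_atLeastAtMost)+

lemma open_rect: "open {p::R3. a < fst p \<and> fst p < b \<and> c < fst (snd p) \<and> fst (snd p) < d}"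
  by (intro open_Collect_conj open_Collect_less continuous_intros)

text \<open>The set is the open half-space to the right of the smaller surface's left side. By
  \<open>capped_right\<close> and \<open>surf_right\<close> the larger surfaces have no further
  points there.\<close>

lemma surf_ext_inner:
  assumes p: "p \<in> surf P n" "p \<notin> strip_boundary n"
  shows "\<exists>U. open U \<and> p \<in> U \<and> {q. - real n < fst q} \<inter> U = U"
proof -
  obtain x y z where q: "p = (x, y, z)" by (cases p)
  have "- real n < x"
  proof (cases "p \<in> plugs P {1..n}")
    case True
    then obtain k where "k \<in> {1..n}" "mg - real k <= x" unfolding q by (rule plugs_coord)
    then show ?thesis using mg(1) by auto
  qed (use p q in \<open>auto simp: surf_eq flat_def strip_boundary_def\<close>)
  then show ?thesis
    by (intro exI[of _ "{q. - real n < fst q}"]) (auto simp: q intro!: open_Collect_less continuous_intros)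
qed

lemma capped_right: "q \<in> capped P n ==> - real n < fst q ==> q \<in> surf P n"
  and surf_right: "q \<in> surf P (Suc n) ==> - real n < fst q ==> q \<in> surf P n"
  and surf_capped: "q \<in> surf P n ==> q \<in> capped P n"
  and surf_surf: "q \<in> surf P n ==> q \<in> surf P (Suc n)"
proof -
  show "q \<in> surf P n ==> q \<in> capped P n" "q \<in> surf P n ==> q \<in> surf P (Suc n)"
    by (auto simp: capped_def bsum_def)
  show "q \<in> capped P n ==> - real n < fst q ==> q \<in> surf P n"
    by (cases q) (auto simp: capped_eq surf_eq flat_def)
  assume s: "q \<in> surf P (Suc n)" "- real n < fst q"
  obtain x y z where q: "q = (x, y, z)" by (cases q)
  have "q \<notin> shift (Suc n) (torus1 P)"
    using s(2) P_sub[of "x + real (Suc n)" y z] unfolding q mem_shift by (auto simp: torus1_def annulus_def square_def)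
  then show "q \<in> surf P n" using s(1) by simp
qed

lemma strip_boundary_Suc: "strip_boundary (Suc n) <= strip_boundary n \<union> - surf P n"
proof
  fix p assume p: "p \<in> strip_boundary (Suc n)"
  obtain x y z where q: "p = (x, y, z)" by (cases p)
  show "p \<in> strip_boundary n \<union> - surf P n"
  proof (cases "p \<in> surf P n")
    case True
    have "- real n <= x"
    proof (cases "p \<in> plugs P {1..n}")
      case True
      then obtain k where "k \<in> {1..n}" "mg - real k <= x" unfolding q by (rule plugs_coord)
      then show ?thesis using mg(1) by auto
    qed (use True q in \<open>auto simp: surf_eq flat_def\<close>)
    then show ?thesis using p q by (auto simp: strip_boundary_def)
  qed simp
qed

lemma ext_capped: "surface_ext (surf P n) (strip_boundary n) (capped P n) (strip_boundary (Suc n))"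
proof
  fix p assume "p \<in> surf P n" "p \<notin> strip_boundary n"
  from surf_ext_inner[OF this] obtain U where "open U" "p \<in> U" "{q. - real n < fst q} \<inter> U = U" by blast
  then show "\<exists>U. open U \<and> p \<in> U \<and> capped P n \<inter> U <= surf P n"
    using capped_right by (intro exI[of _ U]) blast
qed (use closed_sets strip_boundary_Suc surf_capped in blast)+

lemma ext_surf: "surface_ext (surf P n) (strip_boundary n) (surf P (Suc n)) (strip_boundary (Suc n))"
proof
  fix p assume "p \<in> surf P n" "p \<notin> strip_boundary n"
  from surf_ext_inner[OF this] obtain U where "open U" "p \<in> U" "{q. - real n < fst q} \<inter> U = U" by blast
  then show "\<exists>U. open U \<and> p \<in> U \<and> surf P (Suc n) \<inter> U <= surf P n"
    using surf_right by (intro exI[of _ U]) blast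
qed (use closed_sets strip_boundary_Suc surf_surf in blast)+

lemma circle_mem: "(x, y, z) \<in> shift (Suc n) inner_circle \<longleftrightarrow> (x + real (Suc n) - 1/2)\<^sup>2 + (y - 1/2)\<^sup>2 = (1/4)\<^sup>2 \<and> z = 0"
  unfolding mem_shift by (simp add: inner_circle_def)

lemma annulus_inner:
  assumes p: "p \<in> bsum P annulus n" "p \<notin> bd2 n"
  shows "(fst p + real (Suc n) - 1/2)\<^sup>2 + (fst (snd p) - 1/2)\<^sup>2 > (1/4)\<^sup>2"
proof -
  obtain x y z where q: "p = (x, y, z)" by (cases p)
  show ?thesis
  proof (cases "p \<in> plugs P {1..n}")
    case True
    then obtain k where "k \<in> {1..n}" "mg - real k <= x" unfolding q by (rule plugs_coord)
    then have "\<bar>x + real (Suc n) - 1/2\<bar> > 1/4" using mg(1) by auto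
    then have "(x + real (Suc n) - 1/2)\<^sup>2 > (1/4)\<^sup>2" by (metis abs_ge_zero abs_le_square_iff abs_of_nonneg linorder_not_le zero_le_divide_1_iff zero_le_numeral)
    then show ?thesis using zero_le_power2[of "y - 1/2"] unfolding q fst_conv snd_conv by linarith
  next
    case False
    then have "p \<in> flat (Suc n) {1..Suc n}" using p(1) annulus_eq by blast
    then have a: "(x + real (Suc n) - 1/2)\<^sup>2 + (y - 1/2)\<^sup>2 \<ge> (1/4)\<^sup>2" "z = 0" unfolding q
      by (rule flatD(6), simp) (use \<open>p \<in> flat (Suc n) {1..Suc n}\<close> q flatD(5) in blast)
    moreover have "\<not> ((x + real (Suc n) - 1/2)\<^sup>2 + (y - 1/2)\<^sup>2 = (1/4)\<^sup>2 \<and> z = 0)"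
      using p(2) unfolding bd2_def q circle_mem[symmetric] by blast
    ultimately show ?thesis unfolding q by simp
  qed
qed

lemma open_outside: "open {q::R3. (fst q + real (Suc n) - 1/2)\<^sup>2 + (fst (snd q) - 1/2)\<^sup>2 > (1/4)\<^sup>2}"
  by (intro open_Collect_less continuous_intros)

lemma outside_annulus:
  assumes "q \<in> capped P n \<or> q \<in> surf P (Suc n)" "(fst q + real (Suc n) - 1/2)\<^sup>2 + (fst (snd q) - 1/2)\<^sup>2 > (1/4)\<^sup>2"
    "- real n < fst q \<or> snd (snd q) = 0 \<and> q \<notin> shift (Suc n) P"
  shows "q \<in> bsum P annulus n"
proof -
  obtain x y z where q: "q = (x, y, z)" by (cases q)
  show ?thesis
  proof (cases "q \<in> plugs P {1..n}")
    case True then show ?thesis by (simp add: annulus_eq)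
  next
    case False
    have "q \<in> flat (Suc n) {1..n} \<or> q \<in> flat (Suc n) {1..Suc n}"
    proof -
      have "q \<notin> shift (Suc n) P"
        using assms(3) P_sub[of "x + real (Suc n)" y z] unfolding q mem_shift by auto
      moreover have "plugs P {1..Suc n} <= plugs P {1..n} \<union> shift (Suc n) P"
        by (auto simp: plugs_def le_Suc_eq)
      ultimately show ?thesis using assms(1) False unfolding capped_eq surf_eq[of P "Suc n"] by blast
    qed
    then have "q \<in> flat (Suc n) {1..Suc n}" using assms(2) by (auto simp: flat_def q le_Suc_eq)
    then show ?thesis by (simp add: annulus_eq)
  qed
qed

lemma annulus_capped: "bsum P annulus n <= capped P n"
  unfolding annulus_eq capped_eq by (auto simp: flat_def)

lemma annulus_surf: "bsum P annulus n <= surf P (Suc n)"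
  unfolding annulus_eq surf_eq[of P "Suc n"] by (auto simp: plugs_def)

lemma strip_bd2: "strip_boundary (Suc n) <= bd2 n \<union> - bsum P annulus n"
  by (simp add: bd2_def le_supI1)

lemma ext_annulus_capped: "surface_ext (bsum P annulus n) (bd2 n) (capped P n) (strip_boundary (Suc n))"
proof
  fix p assume p: "p \<in> bsum P annulus n" "p \<notin> bd2 n"
  let ?U = "{q::R3. (fst q + real (Suc n) - 1/2)\<^sup>2 + (fst (snd q) - 1/2)\<^sup>2 > (1/4)\<^sup>2}"
  have "q \<in> bsum P annulus n" if "q \<in> capped P n" "q \<in> ?U" for q
  proof (rule outside_annulus)
    show "- real n < fst q \<or> snd (snd q) = 0 \<and> q \<notin> shift (Suc n) P"
    proof (cases "- real n < fst q")
      case False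
      obtain x y z where qq: "q = (x, y, z)" by (cases q)
      have "q \<notin> plugs P {1..n}"
      proof
        assume "q \<in> plugs P {1..n}"
        then obtain k where "k \<in> {1..n}" "mg - real k <= x" unfolding qq by (rule plugs_coord)
        then show False using False mg(1) qq by auto
      qed
      then have z: "q \<in> flat (Suc n) {1..n}" using that(1) capped_eq by blast
      have "q \<notin> shift (Suc n) P"
      proof
        assume "q \<in> shift (Suc n) P"
        then have a: "(x + real (Suc n), y, z) \<in> P" unfolding qq mem_shift .
        have "(x + real (Suc n), y, z) \<in> annulus"
          using z P_sub[OF a] that(2) unfolding qq by (auto simp: flat_def annulus_def square_def)
        then have "(x + real (Suc n), y, z) \<in> inner_circle" using a P_annulus by blast
        then show False using that(2) unfolding qq by (simp add: inner_circle_def)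
      qed
      then show ?thesis using z unfolding qq flat_def by auto
    qed simp
  qed (use that in auto)
  then show "\<exists>U. open U \<and> p \<in> U \<and> capped P n \<inter> U <= bsum P annulus n"
    using annulus_inner[OF p] open_outside by (intro exI[of _ ?U]) auto
qed (use closed_sets annulus_capped strip_bd2 in blast)+

lemma closed_shift: "closed (shift k P)"
  unfolding shift_def by (intro compact_imp_closed compact_continuous_image continuous_intros compact_P)

text \<open>A point of the added plug that also lies in the flat part is on the inner circle, hence
  in \<open>bd2\<close>. Any other point of the smaller surface has a neighbourhood that misses the
  closed plug.\<close>

lemma ext_annulus_surf: "surface_ext (bsum P annulus n) (bd2 n) (surf P (Suc n)) (strip_boundary (Suc n))"
proof
  fix p assume p: "p \<in> bsum P annulus n" "p \<notin> bd2 n"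
  obtain x y z where q: "p = (x, y, z)" by (cases p)
  have "p \<notin> shift (Suc n) P"
  proof
    assume "p \<in> shift (Suc n) P"
    then have a: "(x + real (Suc n), y, z) \<in> P" unfolding q mem_shift .
    have "p \<notin> plugs P {1..n}"
    proof
      assume "p \<in> plugs P {1..n}"
      then obtain k where "k \<in> {1..n}" "mg - real k <= x" unfolding q by (rule plugs_coord)
      then show False using P_sub[OF a] mg(1) by auto
    qed
    then have "(x, y, z) \<in> flat (Suc n) {1..Suc n}" using p(1) q annulus_eq by blast
    note F = flatD(5)[OF this] flatD(6)[OF this, of "Suc n"]
    have "(x + real (Suc n), y, z) \<in> annulus"
      using P_sub[OF a] F by (simp add: annulus_def square_def not_less)
    then have "p \<in> shift (Suc n) inner_circle" using a P_annulus unfolding q mem_shift by blast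
    then show False using p(2) by (simp add: bd2_def)
  qed
  moreover have "surf P (Suc n) <= bsum P annulus n \<union> shift (Suc n) P"
    unfolding annulus_eq surf_eq[of P "Suc n"] by (auto simp: plugs_def le_Suc_eq)
  ultimately show "\<exists>U. open U \<and> p \<in> U \<and> surf P (Suc n) \<inter> U <= bsum P annulus n"
    using closed_shift by (intro exI[of _ "- shift (Suc n) P"]) auto
qed (use closed_sets annulus_surf strip_bd2 in blast)+

section \<open>Charts of the capped surface and its distinguished disc\<close>

lemma diffeomorphism_translate:
  assumes f: "diffeomorphism V S f"
  shows "diffeomorphism V ((\<lambda>p::R3. p - a) ` S) (\<lambda>y. f y - a)"
proof -
  note D = diffeomorphismD[OF f]
  have s: "smooth_on ((\<lambda>p. p - a) ` S) (\<lambda>p. inv_into V f (p + a))"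
    by (rule smooth_on_compose[OF smooth_on_add[OF smooth_on_id smooth_on_const] D(2)]) auto
  show ?thesis
    by (rule diffeomorphismI[OF smooth_on_diff[OF D(1) smooth_on_const] s]) (use D(3-6) in auto)
qed

lemma flat_chart: "diffeomorphism V ((\<lambda>y::R2. (a + fst y, b + snd y, 0)) ` V) (\<lambda>y. (a + fst y, b + snd y, 0::real))"
  by (rule diffeomorphismI[where g = "\<lambda>p. (fst p - a, fst (snd p) - b)"])
    (auto intro!: smooth_on_Pair smooth_on_add smooth_on_diff smooth_on_fst smooth_on_snd)

text \<open>Over an open unit square that contains a plug, the chart comes from the smoothness of
  the annulus with its plug, up to translation. Otherwise the first coordinate is at least
  \<open>mg\<close> away from all plugs, and the surface is a flat piece of the plane
  nearby.\<close>

lemma capped_charts: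
  assumes p: "p \<in> capped P n" "p \<notin> strip_boundary (Suc n)"
  shows "\<exists>U (V :: R2 set) f. open U \<and> p \<in> U \<and> open V \<and> diffeomorphism V (capped P n \<inter> U) f"
proof -
  obtain x y z where q: "p = (x, y, z)" by (cases p)
  have pp: "p \<in> flat (Suc n) {1..n} \<or> p \<in> plugs P {1..n}" using p(1) capped_eq by blast
  have xy: "- real (Suc n) < x" "x < 1" "0 < y" "y < 1"
  proof -
    have "- real (Suc n) < x \<and> x < 1 \<and> 0 < y \<and> y < 1"
    proof (cases "p \<in> plugs P {1..n}")
      case True
      then obtain k where "k \<in> {1..n}" "mg - real k <= x" "x <= 1 - mg - real k" "mg <= y" "y <= 1 - mg" unfolding q by (rule plugs_coord)
      then show ?thesis using mg(1) by auto
    next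
      case False
      then show ?thesis using pp p(2) unfolding q by (auto simp: flat_def strip_boundary_def)
    qed
    then show "- real (Suc n) < x" "x < 1" "0 < y" "y < 1" by auto
  qed
  show ?thesis
  proof (cases "\<exists>k\<in>{1..n}. - real k < x \<and> x < 1 - real k")
    case True
    then obtain k where k: "k \<in> {1..n}" "- real k < x" "x < 1 - real k" by blast
    let ?Q = "(annulus \<union> P) \<inter> ({0<..<1} \<times> {0<..<1} \<times> UNIV)"
    let ?b = "{q::R3. - real k < fst q \<and> fst q < 1 - real k \<and> 0 < fst (snd q) \<and> fst (snd q) < 1}"
    have cap: "(u, v, w) \<in> capped P n \<longleftrightarrow> (u + real k, v, w) \<in> annulus \<union> P" if "- real k < u" "u < 1 - real k" for u v w
    proof -
      have "(u, v, w) \<in> plugs P {1..n} \<longleftrightarrow> (u + real k, v, w) \<in> P"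
      proof
        assume "(u, v, w) \<in> plugs P {1..n}"
        then obtain j where j: "mg - real j <= u" "u <= 1 - mg - real j" "(u + real j, v, w) \<in> P" by (rule plugs_coord)
        then have "real j < real k + 1" "real k < real j + 1" using that mg(1) by linarith+
        then have "j = k" by linarith
        then show "(u + real k, v, w) \<in> P" using j(3) by simp
      qed (use k(1) in \<open>auto simp: plugs_def mem_shift\<close>)
      moreover have "(u, v, w) \<in> flat (Suc n) {1..n} \<longleftrightarrow> (u + real k, v, w) \<in> annulus"
      proof -
        have "(u + real j - 1/2)\<^sup>2 + (v - 1/2)\<^sup>2 \<ge> (1/4)\<^sup>2" if "j ~= k" for j
        proof (rule sq_ge)
          have "real j <= real k - 1 \<or> real j \<ge> real k + 1" using that by linarith
          then show "1/4 <= \<bar>u + real j - 1/2\<bar>" using \<open>- real k < u\<close> \<open>u < 1 - real k\<close> by linarith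
        qed
        then have "(\<forall>j\<in>{1..n}. (u + real j - 1/2)\<^sup>2 + (v - 1/2)\<^sup>2 \<ge> (1/4)\<^sup>2) \<longleftrightarrow>
            (u + real k - 1/2)\<^sup>2 + (v - 1/2)\<^sup>2 \<ge> (1/4)\<^sup>2" using k(1) by metis
        then show ?thesis using that k(1) by (auto simp: flat_def annulus_def square_def not_less)
      qed
      ultimately show ?thesis unfolding capped_eq by blast
    qed
    have "(x + real k, y, z) \<in> ?Q" using p(1) cap[OF k(2,3), of y z] xy k unfolding q by simp
    from P_smooth[unfolded smooth_surface_def, rule_format, OF this] obtain U f and V :: "R2 set"
      where U: "open U" "(x + real k, y, z) \<in> U" "open V" "diffeomorphism V (?Q \<inter> U) f" by blast
    let ?a = "(real k, 0, 0) :: R3"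
    let ?U = "?b \<inter> (\<lambda>q. q + ?a) -` U"
    have "(\<lambda>p. p - ?a) ` (?Q \<inter> U) = capped P n \<inter> ?U"
    proof (rule Set.set_eqI)
      fix q :: R3
      obtain u v w where qq: "q = (u, v, w)" by (cases q)
      have "q \<in> (\<lambda>p. p - ?a) ` (?Q \<inter> U) \<longleftrightarrow> q + ?a \<in> ?Q \<inter> U"
        by (rule mem_translate)
      also have "\<dots> \<longleftrightarrow> q \<in> capped P n \<inter> ?U" using cap[of u v w] unfolding qq by auto
      finally show "q \<in> (\<lambda>p. p - ?a) ` (?Q \<inter> U) \<longleftrightarrow> q \<in> capped P n \<inter> ?U" .
    qed
    then have d: "diffeomorphism V (capped P n \<inter> ?U) (\<lambda>y. f y - ?a)"
      using diffeomorphism_translate[OF U(4), of ?a] by simp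
    have o: "open ?U" by (intro open_Int open_rect open_vimage[OF U(1)] continuous_intros)
    have "p \<in> ?U" using U(2) k xy unfolding q by simp
    with d o U(3) show ?thesis by blast
  next
    case False
    have pl: "mg <= \<bar>u - x\<bar>" if uvw: "(u, v, w) \<in> plugs P {1..n}" for u v w
    proof -
      obtain k where k: "k \<in> {1..n}" "mg - real k <= u" "u <= 1 - mg - real k" using uvw by (rule plugs_coord)
      then have "x <= - real k \<or> 1 - real k <= x" using False by force
      then show ?thesis using k by linarith
    qed
    have "p \<notin> plugs P {1..n}" using pl[of x y z] mg(1) unfolding q by auto
    then have z: "z = 0" using pp unfolding q by (auto simp: flat_def)
    have fl: "(u + real k - 1/2)\<^sup>2 + (v - 1/2)\<^sup>2 \<ge> (1/4)\<^sup>2" if "k \<in> {1..n}" "\<bar>u - x\<bar> < mg" for u v k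
    proof (rule sq_ge)
      have "x <= - real k \<or> 1 - real k <= x" using False that(1) by force
      then show "1/4 <= \<bar>u + real k - 1/2\<bar>" using that(2) mg(2) by linarith
    qed
    \<comment> \<open>The window extends by \<open>mg\<close> to both sides, where neither plugs nor
      holes are met, and is cut off at the ends of the strip.\<close>
    define a b where "a = max (- real (Suc n)) (x - mg)" and "b = min 1 (x + mg)"
    let ?U = "{q::R3. a < fst q \<and> fst q < b \<and> 0 < fst (snd q) \<and> fst (snd q) < 1}"
    let ?V = "{q::R2. a < fst q \<and> fst q < b \<and> 0 < snd q \<and> snd q < 1}"
    have "(u, v, w) \<in> capped P n \<longleftrightarrow> w = 0" if "(u, v, w) \<in> ?U" for u v w
    proof -
      have uv: "\<bar>u - x\<bar> < mg" using that by (auto simp: a_def b_def)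
      then have "(u, v, w) \<notin> plugs P {1..n}" using pl[of u v w] by auto
      moreover have "(u, v, w) \<in> flat (Suc n) {1..n} \<longleftrightarrow> w = 0"
        using that fl[OF _ uv, of _ v] by (auto simp: flat_def a_def b_def)
      ultimately show ?thesis unfolding capped_eq by blast
    qed
    then have "capped P n \<inter> ?U = (\<lambda>y. (0 + fst y, 0 + snd y, 0)) ` ?V"
      by (auto simp: image_iff)
    then have "diffeomorphism ?V (capped P n \<inter> ?U) (\<lambda>y. (0 + fst y, 0 + snd y, 0))"
      using flat_chart[of ?V 0 0] by simp
    moreover have "p \<in> ?U" using xy mg(1) unfolding q a_def b_def by simp
    moreover have "open ?U" by (rule open_rect)
    moreover have "open ?V" by (intro open_Collect_conj open_Collect_less continuous_intros)
    ultimately show ?thesis by blast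
  qed
qed

definition dc :: "nat => R2 => R3" where
  "dc n y = (1/2 - real (Suc n) + fst y, 1/2 + snd y, 0)"

text \<open>There is no condition on the height, so this is an open cylinder in space. Still it
  meets the capped surface only in a flat disc for positive \<open>r\<close> up to 1/2, as
  \<open>capped_disc\<close> shows.\<close>

definition dnb :: "nat => real => R3 set" where
  "dnb n r = {q. (fst q + real (Suc n) - 1/2)\<^sup>2 + (fst (snd q) - 1/2)\<^sup>2 < r\<^sup>2}"

lemma norm_R2: "norm (a, b :: real) < r \<longleftrightarrow> 0 < r \<and> a\<^sup>2 + b\<^sup>2 < r\<^sup>2" for a :: real
proof -
  have "norm (a, b) < r \<longleftrightarrow> 0 < r \<and> sqrt (a\<^sup>2 + b\<^sup>2) < r"
    using norm_ge_zero[of "(a, b)"] le_less_trans[of 0 "norm (a, b)" r] by (auto simp: norm_Pair)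
  then show ?thesis
    by (metis abs_of_pos real_sqrt_abs real_sqrt_less_iff)
qed

lemma capped_disc:
  assumes r: "0 < r" "r <= 1/2"
  shows "capped P n \<inter> dnb n r = dc n ` ball 0 r"
proof (rule Set.set_eqI)
  fix q :: R3
  obtain u v w where q: "q = (u, v, w)" by (cases q)
  have "q \<in> dc n ` ball 0 r \<longleftrightarrow> w = 0 \<and> norm (u + real (Suc n) - 1/2, v - 1/2) < r"
  proof
    assume "w = 0 \<and> norm (u + real (Suc n) - 1/2, v - 1/2) < r"
    then show "q \<in> dc n ` ball 0 r"
      by (intro image_eqI[of _ _ "(u + real (Suc n) - 1/2, v - 1/2)"]) (simp_all add: q dc_def del: norm_Pair)
  qed (auto simp: q dc_def)
  moreover have "(u, v, w) \<in> capped P n \<longleftrightarrow> w = 0" if n: "norm (u + real (Suc n) - 1/2, v - 1/2) < r"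
  proof -
    have b: "\<bar>u + real (Suc n) - 1/2\<bar> < 1/2" "\<bar>v - 1/2\<bar> < 1/2"
      using norm_fst_le[of "u + real (Suc n) - 1/2" "v - 1/2"] norm_snd_le[of "v - 1/2" "u + real (Suc n) - 1/2"] n r by auto
    have "(u, v, w) \<notin> plugs P {1..n}"
    proof
      assume "(u, v, w) \<in> plugs P {1..n}"
      then obtain k where "k \<in> {1..n}" "mg - real k <= u" by (rule plugs_coord)
      then show False using b mg(1) by auto
    qed
    moreover have "(u, v, w) \<in> flat (Suc n) {1..n} \<longleftrightarrow> w = 0"
    proof -
      have "(u + real k - 1/2)\<^sup>2 + (v - 1/2)\<^sup>2 \<ge> (1/4)\<^sup>2" if "k \<in> {1..n}" for k
      proof (rule sq_ge)
        have "real k <= real n" using that by auto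
        then show "1/4 <= \<bar>u + real k - 1/2\<bar>" using b(1) unfolding of_nat_Suc by linarith
      qed
      moreover have "- real (Suc n) <= u" "u <= 1" "0 <= v" "v <= 1" using b unfolding abs_less_iff of_nat_Suc by linarith+
      ultimately show ?thesis by (simp add: flat_def)
    qed
    ultimately show ?thesis unfolding capped_eq by blast
  qed
  moreover have "q \<in> dnb n r \<longleftrightarrow> norm (u + real (Suc n) - 1/2, v - 1/2) < r"
    unfolding norm_R2 using r by (simp add: dnb_def q)
  ultimately show "q \<in> capped P n \<inter> dnb n r \<longleftrightarrow> q \<in> dc n ` ball 0 r" unfolding q by blast
qed

lemma open_dnb: "open (dnb n r)"
  unfolding dnb_def by (intro open_Collect_less continuous_intros)

lemma dnb_coord: "(x, y, z) \<in> dnb n (1/2) ==> - real (Suc n) < x \<and> x < - real n \<and> 0 < y \<and> y < 1"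
proof -
  assume "(x, y, z) \<in> dnb n (1/2)"
  then have a: "(x + real (Suc n) - 1/2)\<^sup>2 + (y - 1/2)\<^sup>2 < (1/2)\<^sup>2" by (simp add: dnb_def)
  have "(x + real (Suc n) - 1/2)\<^sup>2 < (1/2)\<^sup>2" "(y - 1/2)\<^sup>2 < (1/2)\<^sup>2"
    using a zero_le_power2[of "x + real (Suc n) - 1/2"] zero_le_power2[of "y - 1/2"] by linarith+
  then have "\<bar>x + real (Suc n) - 1/2\<bar> < 1/2" "\<bar>y - 1/2\<bar> < 1/2"
    using power2_less_imp_less[of "\<bar>x + real (Suc n) - 1/2\<bar>" "1/2"] power2_less_imp_less[of "\<bar>y - 1/2\<bar>" "1/2"] by simp_all
  then show ?thesis unfolding abs_less_iff of_nat_Suc by (intro conjI) linarith+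
qed

lemma dc_derivative: "frechet_derivative (dc n) (at y) = (\<lambda>v. (fst v, snd v, 0))"
proof -
  have "(dc n has_derivative (\<lambda>v. (fst v, snd v, 0))) (at y)"
    unfolding dc_def[abs_def] by (auto intro!: derivative_eq_intros)
  from frechet_derivative_at[OF this] show ?thesis by simp
qed

lemma disc_surface_capped: "disc_surface (capped P n) (strip_boundary (Suc n)) (dnb n (1/2)) (dc n) (framed_point n)"
proof -
  have d: "diffeomorphism (ball 0 (1/2)) (capped P n \<inter> dnb n (1/2)) (dc n)"
    using flat_chart[of "ball 0 (1/2)" "1/2 - real (Suc n)" "1/2"] capped_disc[of "1/2" n] by (simp add: dc_def[abs_def])
  have pc: "plane_chart (capped P n) (strip_boundary (Suc n)) (dnb n (1/2)) (ball 0 (1/2)) (dc n)"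
  proof
    show "dnb n (1/2) \<inter> strip_boundary (Suc n) = {}"
      using dnb_coord by (fastforce simp: strip_boundary_def)
  qed (use d open_dnb in auto)
  interpret C: plane_chart "capped P n" "strip_boundary (Suc n)" "dnb n (1/2)" "ball 0 (1/2)" "dc n" by (rule pc)
  have D: "C.dch 0 = (\<lambda>v. (fst v, snd v, 0))" by (simp add: C.dch_def dc_derivative)
  have fr: "framed_point n = C.fr 0"
    by (simp add: framed_point_def C.fr_def C.ray_def D dc_def nrm_def norm_Pair)
  have "framed_point n \<in> utb_inner (capped P n) (strip_boundary (Suc n))"
    unfolding fr by (rule C.fr_in) simp
  then have "pointed_surface (capped P n) (strip_boundary (Suc n)) (framed_point n)"
    by unfold_locales (use capped_charts closed_strip in auto)
  then show ?thesis
    using pc fr by (simp add: disc_surface_def disc_surface_axioms_def)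
qed

end

locale capped_plug = plug + fixes n :: nat

sublocale capped_plug \<subseteq> disc_surface "capped P n" "strip_boundary (Suc n)" "dnb n (1/2)" "dc n" "framed_point n"
  by (rule disc_surface_capped)

lemma (in capped_plug) dch_eq: "dch y v = (fst v, snd v, 0)"
  by (simp add: dch_def dc_derivative)

section \<open>Tangent planes of the flat part and the collar retraction\<close>

lemma loops_atI:
  "path g ==> (!!t. t \<in> {0..1} ==> g t \<in> X) ==> g 0 = p ==> g 1 = p ==> g \<in> loops_at X p"
  by (auto simp: loops_at_def path_image_def pathstart_def pathfinish_def)

text \<open>From any point of the unit interval one can move by 1/8 in the direction of a suitable
  sign \<open>d\<close> without leaving the interval, and either without approaching the centre or
  while staying at distance at least 1/4 from it. Such a motion along one coordinate does not enter
  a round hole.\<close>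

lemma unit_direction:
  fixes u :: real assumes "0 <= u" "u <= 1"
  obtains d where "d * d = 1" "!!s. 0 <= s ==> s <= 1 ==> 0 <= u + d * s / 8 \<and> u + d * s / 8 <= 1 \<and>
    ((1/4)\<^sup>2 <= (u + d * s / 8 - 1/2)\<^sup>2 \<or> (u - 1/2)\<^sup>2 <= (u + d * s / 8 - 1/2)\<^sup>2)"
proof (cases "u <= 1/8 \<or> 1/2 <= u \<and> u <= 7/8")
  case True
  show thesis
  proof (rule that[of 1])
    fix s :: real assume s: "0 <= s" "s <= 1"
    have "\<bar>1/4\<bar> <= \<bar>u + s / 8 - 1/2\<bar> \<or> \<bar>u - 1/2\<bar> <= \<bar>u + s / 8 - 1/2\<bar>"
      using True s assms by (auto simp: abs_if)
    then show "0 <= u + 1 * s / 8 \<and> u + 1 * s / 8 <= 1 \<and>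
      ((1/4)\<^sup>2 <= (u + 1 * s / 8 - 1/2)\<^sup>2 \<or> (u - 1/2)\<^sup>2 <= (u + 1 * s / 8 - 1/2)\<^sup>2)"
      unfolding abs_le_square_iff using True s assms by auto
  qed simp
next
  case False
  show thesis
  proof (rule that[of "-1"])
    fix s :: real assume s: "0 <= s" "s <= 1"
    have "\<bar>1/4\<bar> <= \<bar>u + - 1 * s / 8 - 1/2\<bar> \<or> \<bar>u - 1/2\<bar> <= \<bar>u + - 1 * s / 8 - 1/2\<bar>"
      using False s assms by (auto simp: abs_if)
    then show "0 <= u + - 1 * s / 8 \<and> u + - 1 * s / 8 <= 1 \<and>
      ((1/4)\<^sup>2 <= (u + - 1 * s / 8 - 1/2)\<^sup>2 \<or> (u - 1/2)\<^sup>2 <= (u + - 1 * s / 8 - 1/2)\<^sup>2)"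
      unfolding abs_le_square_iff using False s assms by auto
  qed simp
qed

text \<open>Only \<open>d / 8\<close> times the vector is known to be a velocity; since
  \<open>d\<close> is a sign, the factor \<open>8 * d\<close> undoes this in the subspace.\<close>

lemma tangent_direction:
  assumes d: "d * d = (1::real)" and c: "!!s. 0 <= s ==> s <= 1 ==> p + (d * s / 8) *\<^sub>R w \<in> S"
  shows "w \<in> tangent_space S p"
proof -
  have "((\<lambda>s. p + (d * s / 8) *\<^sub>R w) has_vector_derivative (d / 8) *\<^sub>R w) (at 0 within {0..1})"
    by (auto intro!: derivative_eq_intros simp: has_vector_derivative_def)
  then have "(d / 8) *\<^sub>R w \<in> tangent_space S p"
    by (rule tangent_spaceI[rotated 2]) (use c in auto)
  from subspace_scale[OF subspace_tangent_space this, of "8 * d"] d show ?thesis by simp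
qed

text \<open>Also at corners and on the rims of holes the horizontal plane is tangent, because each
  coordinate direction, up to sign, is the velocity of a segment inside the strip.\<close>

lemma flat_tangent:
  assumes p: "(x, y, z) \<in> flat (Suc n) K" and K: "K <= {1..n}"
  shows "(a, b, 0) \<in> tangent_space (flat (Suc n) K) (x, y, z)"
proof -
  note F = flatD[OF p]
  \<comment> \<open>This is the number of a unit square of the strip over \<open>x\<close>; the
    horizontal segment stays in its column and can meet no hole other than the one there.\<close>
  obtain k :: nat where k: "k <= Suc n" "0 <= x + real k" "x + real k <= 1"
  proof (cases "0 <= x")
    case True then show thesis using that[of 0] F by simp
  next
    case False
    then show thesis using that[of "nat \<lceil>- x\<rceil>"] F(1) by (simp add: nat_le_iff ceiling_le_iff) linarith
  qed
  have e1: "(1, 0, 0) \<in> tangent_space (flat (Suc n) K) (x, y, z)"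
  proof -
    obtain d where d: "d * d = 1" "!!s. 0 <= s ==> s <= 1 ==> 0 <= x + real k + d * s / 8 \<and> x + real k + d * s / 8 <= 1 \<and>
      ((1/4)\<^sup>2 <= (x + real k + d * s / 8 - 1/2)\<^sup>2 \<or> (x + real k - 1/2)\<^sup>2 <= (x + real k + d * s / 8 - 1/2)\<^sup>2)"
      using unit_direction[OF k(2,3)] by blast
    show ?thesis
    proof (rule tangent_direction[OF d(1)])
      fix s :: real assume s: "0 <= s" "s <= 1"
      let ?x = "x + d * s / 8"
      note D = d(2)[OF s]
      have "(1/4)\<^sup>2 <= (?x + real j - 1/2)\<^sup>2 + (y - 1/2)\<^sup>2" if j: "j \<in> K" for j
      proof (cases "j = k")
        case True
        have e: "?x + real j - 1/2 = x + real k + d * s / 8 - 1/2" using True by simp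
        show ?thesis unfolding e using D F(6)[OF j] zero_le_power2[of "y - 1/2"] unfolding True by linarith
      next
        case False
        then have "real j <= real k - 1 \<or> real j \<ge> real k + 1" by linarith
        then show ?thesis using D by (intro sq_ge) linarith
      qed
      moreover have "- real (Suc n) <= ?x" "?x <= 1" using D k(1) by linarith+
      ultimately show "(x, y, z) + (d * s / 8) *\<^sub>R (1, 0, 0) \<in> flat (Suc n) K"
        using F by (simp add: flat_def)
    qed
  qed
  have e2: "(0, 1, 0) \<in> tangent_space (flat (Suc n) K) (x, y, z)"
  proof -
    obtain d where d: "d * d = 1" "!!s. 0 <= s ==> s <= 1 ==> 0 <= y + d * s / 8 \<and> y + d * s / 8 <= 1 \<and>
      ((1/4)\<^sup>2 <= (y + d * s / 8 - 1/2)\<^sup>2 \<or> (y - 1/2)\<^sup>2 <= (y + d * s / 8 - 1/2)\<^sup>2)"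
      using unit_direction[OF F(3,4)] by blast
    show ?thesis
    proof (rule tangent_direction[OF d(1)])
      fix s :: real assume s: "0 <= s" "s <= 1"
      note D = d(2)[OF s]
      have "(1/4)\<^sup>2 <= (x + real j - 1/2)\<^sup>2 + (y + d * s / 8 - 1/2)\<^sup>2" if j: "j \<in> K" for j
        using D F(6)[OF j] zero_le_power2[of "x + real j - 1/2"] by linarith
      then show "(x, y, z) + (d * s / 8) *\<^sub>R (0, 1, 0) \<in> flat (Suc n) K"
        using F D by (simp add: flat_def)
    qed
  qed
  from subspace_add[OF subspace_tangent_space subspace_scale[OF subspace_tangent_space e1, of a] subspace_scale[OF subspace_tangent_space e2, of b]]
  show ?thesis by simp
qed

text \<open>On the plane of height 0 the height function has both 0 and the projection to the height
  as derivatives; on tangent vectors the two must agree.\<close>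

lemma tangent_horizontal:
  assumes N: "open N" "p \<in> N" "p \<in> S" "!!q. q \<in> S ==> q \<in> N ==> snd (snd q) = 0" and w: "w \<in> tangent_space S p"
  shows "snd (snd (w :: R3)) = 0"
proof -
  let ?Z = "{q::R3. snd (snd q) = 0}"
  have p: "p \<in> ?Z" using N by simp
  have w': "w \<in> tangent_space ?Z p" using tangent_space_local[OF N(1-3), of ?Z] N(4) w by blast
  have 1: "((\<lambda>q::R3. snd (snd q)) has_derivative (\<lambda>w. snd (snd w))) (at p within ?Z)"
    by (intro derivative_eq_intros) auto
  have 2: "((\<lambda>q::R3. snd (snd q)) has_derivative (\<lambda>w. 0)) (at p within ?Z)"
    by (rule has_derivative_transform[OF p, of _ "\<lambda>_. 0"]) auto
  show ?thesis by (rule tangent_space_eq_on[OF 1 2 w'])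
qed

context capped_plug
begin

abbreviation Cp where "Cp \<equiv> capped P n"
abbreviation Bd where "Bd \<equiv> strip_boundary (Suc n)"
abbreviation UT where "UT \<equiv> unit_tangent_bundle (capped P n)"

lemma M_cases: "p \<in> Cp ==> p \<in> flat (Suc n) {1..n} \<or> p \<in> plugs P {1..n}"
  and flat_M: "flat (Suc n) {1..n} <= Cp"
  by (auto simp: capped_eq)

lemma M_bounds:
  assumes "(x, y, z) \<in> Cp"
  shows "- real (Suc n) <= x" "x <= 1" "0 <= y" "y <= 1"
proof -
  have "- real (Suc n) <= x \<and> x <= 1 \<and> 0 <= y \<and> y <= 1"
    using M_cases[OF assms]
  proof
    assume "(x, y, z) \<in> plugs P {1..n}"
    then obtain k where "k \<in> {1..n}" "mg - real k <= x" "x <= 1 - mg - real k" "mg <= y" "y <= 1 - mg" by (rule plugs_coord)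
    then show ?thesis using mg(1) by auto
  qed (simp add: flat_def)
  then show "- real (Suc n) <= x" "x <= 1" "0 <= y" "y <= 1" by auto
qed

lemma horizontal_tangent: "(x, y, z) \<in> flat (Suc n) {1..n} ==> (a, b, 0) \<in> tangent_space Cp (x, y, z)"
  using flat_tangent[of x y z n "{1..n}"] tangent_space_mono[OF flat_M] by blast

lemma tangent_horizontal_M:
  assumes "p \<in> Cp" "p \<notin> plugs P {1..n}" "w \<in> tangent_space Cp p"
  shows "snd (snd w) = 0"
proof (rule tangent_horizontal[OF _ _ assms(1) _ assms(3)])
  show "open (- plugs P {1..n})" using closed_plugs[of "{1..n}"] by auto
  show "q \<in> Cp ==> q \<in> - plugs P {1..n} ==> snd (snd q) = 0" for q
    using M_cases[of q] by (cases q) (auto simp: flat_def)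
qed (use assms in auto)

text \<open>Coordinates are clamped to keep the distance \<open>s * mg\<close> from the sides of the
  strip; by the choice of the margin, plugs do not move. Framed loops may run through the boundary,
  where isotopies cannot carry the framed point, and this map pushes them into the interior.\<close>

definition rho :: "real => R3 => R3" where
  "rho s p = (max (s * mg - real (Suc n)) (min (1 - s * mg) (fst p)), max (s * mg) (min (1 - s * mg) (fst (snd p))), snd (snd p))"

lemma smg: "0 <= s ==> s <= 1 ==> 0 <= s * mg \<and> s * mg <= mg"
  using mg(1) by (simp add: mult_left_le_one_le)

lemma rho_plugs:
  assumes "p \<in> plugs P {1..n}" "0 <= s" "s <= 1" shows "rho s p = p"
proof -
  obtain x y z where q: "p = (x, y, z)" by (cases p)
  obtain k where k: "k \<in> {1..n}" "mg - real k <= x" "x <= 1 - mg - real k" "mg <= y" "y <= 1 - mg"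
    using assms(1) unfolding q by (rule plugs_coord)
  have kk: "1 <= real k" "real k <= real n" using k(1) by auto
  have "s * mg - real (Suc n) <= x" "x <= 1 - s * mg" "s * mg <= y" "y <= 1 - s * mg"
    using k(2-5) kk smg[OF assms(2,3)] mg(1) by (simp_all; linarith)+
  then show ?thesis by (simp add: rho_def q max_def min_def)
qed

text \<open>A coordinate changed by the clamping ends within 1/8 of a side of the strip, and there
  its distance from the corresponding coordinate of every hole's centre is at least 1/4. So no point
  is pushed into a hole.\<close>

lemma rho_flat:
  assumes "p \<in> flat (Suc n) {1..n}" "0 <= s" "s <= 1" shows "rho s p \<in> flat (Suc n) {1..n}"
proof -
  obtain x y z where q: "p = (x, y, z)" by (cases p)
  note F = flatD[OF assms(1)[unfolded q]]
  define a where "a = s * mg"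
  have a: "0 <= a" "a <= 1/8" using smg[OF assms(2,3)] mg(2) by (auto simp: a_def)
  define x' y' where "x' = max (a - real (Suc n)) (min (1 - a) x)" and "y' = max a (min (1 - a) y)"
  have b: "- real (Suc n) <= x'" "x' <= 1" "0 <= y'" "y' <= 1" using a F(1-4) by (auto simp: x'_def y'_def)
  have "(1/4)\<^sup>2 <= (x' + real k - 1/2)\<^sup>2 + (y' - 1/2)\<^sup>2" if k: "k \<in> {1..n}" for k
  proof (cases "y' = y")
    case False
    then have "y' = a \<or> y' = 1 - a" by (auto simp: y'_def max_def min_def split: if_splits)
    then have "1/4 <= \<bar>y' - 1/2\<bar>" using a by auto
    from sq_ge[OF this, of "x' + real k - 1/2"] show ?thesis by simp
  next
    case y: True
    show ?thesis
    proof (cases "x' = x")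
      case True then show ?thesis using F(6)[OF k] y by simp
    next
      case False
      then have "x' = a - real (Suc n) \<or> x' = 1 - a" by (auto simp: x'_def max_def min_def split: if_splits)
      then show ?thesis using a k by (intro sq_ge) auto
    qed
  qed
  then have "(x', y', z) \<in> flat (Suc n) {1..n}" using b F(5) unfolding flat_def by simp
  then show ?thesis by (simp add: rho_def q x'_def y'_def a_def)
qed

lemma rho_bd:
  assumes "0 < s" "s <= 1" shows "rho s p \<notin> Bd"
proof -
  have "0 < s * mg" using assms mg(1) by simp
  moreover have "s * mg <= 1/8" using smg[OF less_imp_le[OF assms(1)] assms(2)] mg(2) by linarith
  ultimately show ?thesis by (auto simp: strip_boundary_def rho_def)
qed

lemma rho_0: "p \<in> Cp ==> rho 0 p = p"
  using M_bounds[of "fst p" "fst (snd p)" "snd (snd p)"] by (cases p) (simp add: rho_def max_def min_def)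

lemma rho_M: "p \<in> Cp ==> 0 <= s ==> s <= 1 ==> rho s p \<in> Cp"
  using M_cases[of p] rho_plugs[of p s] rho_flat[of p s] flat_M by auto

definition retr :: "real => R3 \<times> R3 => R3 \<times> R3" where "retr s a = (rho s (fst a), snd a)"

text \<open>The vector is kept while the point slides. Points of plugs do not move, and off the
  plugs tangent vectors are horizontal and remain tangent at any point of the flat part.\<close>

lemma retr_utb:
  assumes a: "a \<in> UT" and s: "0 <= s" "s <= 1"
  shows "retr s a \<in> UT"
proof -
  obtain p w where aw: "a = (p, w)" "p \<in> Cp" "w \<in> tangent_space Cp p" "norm w = 1" using a by (rule utbE)
  have "w \<in> tangent_space Cp (rho s p)"
  proof (cases "p \<in> plugs P {1..n}")
    case True then show ?thesis using aw(3) rho_plugs[OF True s] by simp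
  next
    case False
    then have "rho s p \<in> flat (Suc n) {1..n}" using M_cases[OF aw(2)] rho_flat s by blast
    moreover have "w = (fst w, fst (snd w), 0)" using tangent_horizontal_M[OF aw(2) False aw(3)] by (simp add: prod_eq_iff)
    ultimately show ?thesis using horizontal_tangent by (metis prod.collapse)
  qed
  then show ?thesis using rho_M[OF aw(2) s] aw(4) by (simp add: retr_def aw(1) utb_mem)
qed

lemma retr_X:
  assumes a: "a \<in> X" and s: "0 <= s" "s <= 1" shows "retr s a \<in> X"
proof (cases "s = 0")
  case True
  have "fst a \<in> Cp" using X_utb[OF a] by (auto elim: utbE)
  then show ?thesis using a rho_0 by (simp add: True retr_def)
next
  case False
  then show ?thesis using retr_utb[OF X_utb[OF a] s] rho_bd[of s] s by (simp add: utb_inner_def retr_def)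
qed

lemma retr_1_X: "a \<in> UT ==> retr 1 a \<in> X"
  using retr_utb[of a 1] rho_bd[of 1] by (simp add: utb_inner_def retr_def)

lemma retr_0: "a \<in> UT ==> retr 0 a = a"
  by (auto elim!: utbE simp: retr_def rho_0)

lemma retr_base: "0 <= s ==> s <= 1 ==> retr s (framed_point n) = framed_point n"
  using smg[of s] mg(2) by (simp add: retr_def rho_def framed_point_def max_def min_def)

lemma continuous_retr: "continuous_on S (\<lambda>z. retr (fst z) (snd z))"
  unfolding retr_def rho_def by (intro continuous_intros)

lemma continuous_retr1: "continuous_on S (retr s)"
  unfolding retr_def[abs_def] rho_def by (intro continuous_intros)

lemma retr_homotopic:
  assumes g: "g \<in> loops_at Y (framed_point n)" and Y: "Y <= UT"
    and r: "!!s a. 0 <= s ==> s <= 1 ==> a \<in> Y ==> retr s a \<in> Y"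
  shows "homotopic_paths Y g (retr 1 \<circ> g)"
proof -
  have g': "continuous_on {0..1} g" "!!t. t \<in> {0..1} ==> g t \<in> Y" "g 0 = framed_point n" "g 1 = framed_point n"
    using g by (auto simp: loops_at_def path_def path_image_def pathstart_def pathfinish_def)
  let ?h = "\<lambda>z. retr (fst z) (g (snd z))"
  have 1: "continuous_on ({0..1} \<times> {0..1}) (\<lambda>z. (fst z, g (snd z)))"
    by (intro continuous_intros continuous_on_compose2[OF g'(1)]) auto
  have "continuous_on ({0..1} \<times> {0..1}) ?h"
    using continuous_on_compose2[OF continuous_retr[of UNIV] 1] by simp
  moreover have "?h \<in> ({0..1} \<times> {0..1}) \<rightarrow> Y"
  proof (rule Pi_I)
    fix z :: "real \<times> real" assume "z \<in> {0..1} \<times> {0..1}"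
    then have "fst z \<in> {0..1}" "snd z \<in> {0..1}" by (simp_all add: mem_Times_iff)
    then show "?h z \<in> Y" using r[of "fst z" "g (snd z)"] g'(2)[of "snd z"] by simp
  qed
  moreover have "\<forall>x\<in>{0..1}. ?h (0, x) = g x"
  proof
    fix x :: real assume "x \<in> {0..1}"
    then show "?h (0, x) = g x" using retr_0[OF subsetD[OF Y g'(2)]] by simp
  qed
  moreover have "\<forall>t\<in>{0..1}. pathstart (?h \<circ> Pair t) = pathstart g \<and> pathfinish (?h \<circ> Pair t) = pathfinish g"
    using retr_base g'(3,4) by (simp add: pathstart_def pathfinish_def)
  moreover have "\<forall>x\<in>{0..1}. ?h (1, x) = (retr 1 \<circ> g) x" by simp
  ultimately show ?thesis unfolding homotopic_paths by blast
qed

lemma loop_in_X: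
  assumes g: "g \<in> loops_at UT (framed_point n)"
  obtains g' where "g' \<in> loops_at X (framed_point n)" "homotopic_paths UT g g'"
proof (rule that)
  show h: "homotopic_paths UT g (retr 1 \<circ> g)"
    by (rule retr_homotopic[OF g order_refl]) (rule retr_utb)
  have g': "path g" "!!t. t \<in> {0..1} ==> g t \<in> UT" "g 0 = framed_point n" "g 1 = framed_point n"
    using g by (auto simp: loops_at_def path_image_def pathstart_def pathfinish_def)
  have "path (retr 1 \<circ> g)" by (rule path_continuous_image[OF g'(1) continuous_retr1])
  then show "retr 1 \<circ> g \<in> loops_at X (framed_point n)"
    by (rule loops_atI) (use g'(3,4) retr_base[of 1] in \<open>simp_all add: retr_1_X[OF g'(2)]\<close>)
qed

text \<open>The final retraction carries the whole homotopy into the interior, and each of the two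
  loops is joined to its retraction without leaving the interior.\<close>

lemma homotopic_in_X:
  assumes g: "g \<in> loops_at X (framed_point n)" and h: "h \<in> loops_at X (framed_point n)"
    and gh: "homotopic_paths UT g h"
  shows "homotopic_paths X g h"
proof -
  have X: "X <= UT" using X_utb by blast
  have "homotopic_paths X (retr 1 \<circ> g) (retr 1 \<circ> h)"
    by (rule homotopic_paths_continuous_image[OF gh continuous_retr1]) (use retr_1_X in auto)
  moreover have "homotopic_paths X g (retr 1 \<circ> g)" by (rule retr_homotopic[OF g X retr_X])
  moreover have "homotopic_paths X h (retr 1 \<circ> h)" by (rule retr_homotopic[OF h X retr_X])
  ultimately show ?thesis using homotopic_paths_trans homotopic_paths_sym by blast
qed

section \<open>The surface without the capping disc and maps fixing a disc\<close>

lemma annulus_minus_disc: "bsum P annulus n = Cp - dnb n (1/4)"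
proof (rule Set.set_eqI)
  fix q :: R3
  obtain x y z where q: "q = (x, y, z)" by (cases q)
  have i: "{1..Suc n} = insert (Suc n) {1..n}" by auto
  have "q \<notin> dnb n (1/4)" if qp: "q \<in> plugs P {1..n}"
  proof
    assume "q \<in> dnb n (1/4)"
    then have "q \<in> dnb n (1/2)" unfolding dnb_def by (auto simp: power2_eq_square)
    then have "x < - real n" using dnb_coord q by blast
    moreover obtain k where "k \<in> {1..n}" "mg - real k <= x" using qp unfolding q by (rule plugs_coord)
    ultimately show False using mg(1) by auto
  qed
  moreover have "q \<in> flat (Suc n) {1..Suc n} \<longleftrightarrow> q \<in> flat (Suc n) {1..n} \<and> q \<notin> dnb n (1/4)"
    unfolding i by (auto simp: q flat_def dnb_def not_less)
  ultimately show "q \<in> bsum P annulus n \<longleftrightarrow> q \<in> Cp - dnb n (1/4)"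
    unfolding annulus_eq capped_eq by blast
qed

lemma dc_norm: "dc n y \<in> dnb n r \<longleftrightarrow> (norm y)\<^sup>2 < r\<^sup>2"
  by (cases y) (simp add: dnb_def dc_def norm_Pair)

lemma gamma2_capped: "f \<in> diffeos (bsum P annulus n) (bd2 n) ==> f \<in> diffeos Cp Bd"
  by (rule surface_ext.diffeos_sub[OF ext_annulus_capped])

text \<open>The map is the identity on the removed disc because it is so off the surface, and near
  the rim because the rim belongs to \<open>bd2\<close>. Compactness of the closed disc makes room
  for a larger concentric disc.\<close>

lemma gamma2_fix_disc:
  assumes f: "f \<in> diffeos (bsum P annulus n) (bd2 n)"
  obtains r where "r > 1/4" "fix_disc r f"
proof -
  obtain U where U: "open U" "bd2 n <= U" "!!p. p \<in> U ==> f p = p" using diffeos_nbhd[OF f] by blast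
  let ?W = "{y. dc n y \<in> U} \<union> ball 0 (1/4)"
  have "open {y. dc n y \<in> U}"
  proof -
    have "continuous_on UNIV (dc n)" unfolding dc_def[abs_def] by (intro continuous_intros)
    from open_vimage[OF U(1) this] show ?thesis by (simp add: vimage_def)
  qed
  then have W: "open ?W" by auto
  have sub: "cball 0 (1/4) <= ?W"
  proof
    fix y :: R2 assume y: "y \<in> cball 0 (1/4)"
    show "y \<in> ?W"
    proof (cases "norm y = 1/4")
      case True
      then have "(norm y)\<^sup>2 = (1/4)\<^sup>2" by simp
      then have "dc n y \<in> shift (Suc n) inner_circle"
        unfolding dc_def circle_mem by (cases y) (simp add: norm_Pair)
      then show ?thesis using U(2) by (auto simp: bd2_def)
    qed (use y in auto)
  qed
  then obtain e where e: "e > 0" "(\<Union>x\<in>cball 0 (1/4). ball x e) <= ?W"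
    using compact_subset_open_imp_ball_epsilon_subset[OF compact_cball W sub] by blast
  show thesis
  proof (rule that[of "1/4 + e"])
    have "f (dc n y) = dc n y" if y: "norm y < 1/4 + e" for y
    proof -
      have "y \<in> ?W"
      proof (cases "norm y <= 1/4")
        case True show ?thesis by (rule subsetD[OF sub]) (use True in simp)
      next
        case False
        then have "y ~= 0" by auto
        \<comment> \<open>The radial projection of \<open>y\<close> to the circle of radius 1/4 lies
          at distance \<open>norm y - 1/4\<close>, less than \<open>e\<close>.\<close>
        have "dist ((1/4 / norm y) *\<^sub>R y) y = norm ((1/4 / norm y - 1) *\<^sub>R y)"
          by (simp add: dist_norm scaleR_diff_left)
        also have "\<dots> = \<bar>(1/4 / norm y - 1) * norm y\<bar>" by (simp add: abs_mult)
        also have "(1/4 / norm y - 1) * norm y = 1/4 - norm y" using \<open>y ~= 0\<close> by (simp add: field_simps)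
        also have "\<bar>\<dots>\<bar> < e" using False y by auto
        finally have "y \<in> ball ((1/4 / norm y) *\<^sub>R y) e" by simp
        moreover have "(1/4 / norm y) *\<^sub>R y \<in> cball 0 (1/4)" using \<open>y ~= 0\<close> by simp
        ultimately show ?thesis using e(2) by blast
      qed
      then show ?thesis
      proof
        assume "y \<in> ball 0 (1/4)"
        then have "dc n y \<in> dnb n (1/4)" unfolding dc_norm by (intro power_strict_mono) auto
        then show ?thesis using diffeosD(5)[OF f] annulus_minus_disc by blast
      qed (use U(3) in auto)
    qed
    then show "fix_disc (1/4 + e) f" by (simp add: fix_disc_def)
  qed (use e in auto)
qed

lemma fix_disc_dnb:
  assumes f: "f \<in> diffeos Cp Bd" "fix_disc r f" and s: "0 < s" "s <= r" "s <= 1/2" and p: "p \<in> dnb n s"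
  shows "f p = p"
proof (cases "p \<in> Cp")
  case True
  then have "p \<in> dc n ` ball 0 s" using capped_disc[OF s(1,3), of n] p by blast
  then show ?thesis using fix_discD[OF f(2)] s(2) by auto
qed (rule diffeosD(5)[OF f(1)])

lemma circle_dnb: "1/4 < s ==> shift (Suc n) inner_circle <= dnb n s"
proof
  fix p assume s: "1/4 < s" and p: "p \<in> shift (Suc n) inner_circle"
  obtain x y z where q: "p = (x, y, z)" by (cases p)
  have "(1/4)\<^sup>2 < s\<^sup>2" using s by (intro power_strict_mono) auto
  then show "p \<in> dnb n s" using p unfolding q circle_mem by (simp add: dnb_def algebra_simps)
qed

text \<open>Points of the disc are fixed, so by injectivity no point from outside can be mapped into
  it.\<close>

lemma fix_disc_stable:
  assumes f: "f \<in> diffeos Cp Bd" "fix_disc r f" "r > 1/4" and p: "p \<in> bsum P annulus n"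
  shows "f p \<in> bsum P annulus n" "finv f p \<in> bsum P annulus n"
proof -
  have d: "f q = q" if "q \<in> dnb n (1/4)" for q using fix_disc_dnb[OF f(1,2) _ _ _ that] f(3) by simp
  have p': "p \<in> Cp" "p \<notin> dnb n (1/4)" using p annulus_minus_disc by auto
  show "f p \<in> bsum P annulus n"
  proof (rule ccontr)
    assume "f p \<notin> bsum P annulus n"
    then have m: "f p \<in> dnb n (1/4)" using diffeosD(6)[OF f(1) p'(1)] annulus_minus_disc by blast
    then have "f (f p) = f p" by (rule d)
    then have "f p = p" using diffeos_inv_simps(1)[OF f(1)] by metis
    then show False using m p'(2) by simp
  qed
  show "finv f p \<in> bsum P annulus n"
  proof (rule ccontr)
    assume "finv f p \<notin> bsum P annulus n"
    then have m: "finv f p \<in> dnb n (1/4)" using diffeosD(7)[OF f(1) p'(1)] annulus_minus_disc by blast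
    then have "f (finv f p) = finv f p" by (rule d)
    then show False using m p'(2) diffeos_inv_simps(2)[OF f(1), of p] by simp
  qed
qed

lemma fix_disc_gamma2:
  assumes f: "f \<in> diffeos Cp Bd" "fix_disc r f" "r > 1/4"
  shows "f \<in> diffeos (bsum P annulus n) (bd2 n)"
proof -
  obtain U where U: "open U" "Bd <= U" "!!p. p \<in> U ==> f p = p" using diffeos_nbhd[OF f(1)] by blast
  note D = diffeosD[OF f(1)]
  show ?thesis
  proof (rule diffeosI[where g = "finv f" and U = "U \<union> dnb n (min r (1/2))"])
    show "smooth_on (bsum P annulus n) f" "smooth_on (bsum P annulus n) (finv f)"
      using smooth_on_subset[OF D(1) annulus_capped] smooth_on_subset[OF D(3) annulus_capped] by auto
    show "f p = p" if "p \<notin> bsum P annulus n" for p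
    proof (cases "p \<in> Cp")
      case True
      then have "p \<in> dnb n (1/4)" using that annulus_minus_disc by blast
      then show ?thesis using fix_disc_dnb[OF f(1,2), of "1/4" p] f(3) by simp
    qed (rule D(5))
    show "bd2 n <= U \<union> dnb n (min r (1/2))" using U(2) circle_dnb[of "min r (1/2)"] f(3) by (auto simp: bd2_def)
    show "f p = p" if "p \<in> U \<union> dnb n (min r (1/2))" for p
      using that
    proof
      assume "p \<in> dnb n (min r (1/2))"
      then show "f p = p" by (rule fix_disc_dnb[OF f(1,2), rotated -1]) (use f(3) in auto)
    qed (rule U(3))
  qed (use fix_disc_stable[OF f] diffeos_inv_simps[OF f(1)] U(1) open_dnb in auto)
qed

lemma disc_iso_isotopic:
  assumes "disc_iso f g" shows "isotopic (bsum P annulus n) (bd2 n) f g"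
proof -
  obtain F r where F: "smooth_isotopy Cp Bd F" "F 0 = f" "F 1 = g" "r > 1/4"
    "\<forall>t\<in>{0..1}. fix_disc r (F t)" using assms unfolding disc_iso_def by blast
  obtain U where U: "open U" "Bd <= U" "!!t p. t \<in> {0..1} ==> p \<in> U ==> F t p = p"
    using smooth_isotopy_nbhd[OF F(1)] by blast
  have "smooth_isotopy (bsum P annulus n) (bd2 n) F"
  proof (rule smooth_isotopyI[where U = "U \<union> dnb n (min r (1/2))"])
    show "F t \<in> diffeos (bsum P annulus n) (bd2 n)" if "t \<in> {0..1}" for t
      by (rule fix_disc_gamma2[OF smooth_isotopyD(1)[OF F(1) that] _ F(4)]) (use F(5) that in blast)
    show "smooth_on ({0..1} \<times> bsum P annulus n) (\<lambda>(t, p). F t p)"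
      by (rule smooth_on_subset[OF smooth_isotopyD(2)[OF F(1)]]) (use annulus_capped in blast)
    show "bd2 n <= U \<union> dnb n (min r (1/2))" using U(2) circle_dnb[of "min r (1/2)"] F(4) by (auto simp: bd2_def)
    show "F t p = p" if t: "t \<in> {0..1}" and p: "p \<in> U \<union> dnb n (min r (1/2))" for t p
      using p
    proof
      assume "p \<in> dnb n (min r (1/2))"
      then show "F t p = p"
        by (rule fix_disc_dnb[OF smooth_isotopyD(1)[OF F(1) t] bspec[OF F(5) t], rotated -1]) (use F(4) in auto)
    qed (rule U(3)[OF t])
  qed (use U(1) open_dnb in auto)
  then show ?thesis using F(2,3) by (rule isotopicI)
qed

end

section \<open>Orientations\<close>

text \<open>The inner product of the wedge product of \<open>a\<close> and \<open>b\<close> with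
  that of \<open>c\<close> and \<open>d\<close>.\<close>

definition gram :: "'a::real_inner => 'a => 'a => 'a => real" where
  "gram a b c d = (a \<bullet> c) * (b \<bullet> d) - (a \<bullet> d) * (b \<bullet> c)"

definition det2 :: "R2 => R2 => real" where "det2 u v = fst u * snd v - snd u * fst v"

lemma gram_swap: "gram a b d c = - gram a b c d"
  by (simp add: gram_def)

text \<open>The vector \<open>?w\<close> is a positive multiple of the component of \<open>a\<close>
  orthogonal to \<open>b\<close>, and its squared length is \<open>b \<bullet> b\<close> times the
  Gram determinant.\<close>

lemma gram_independent:
  assumes "!!s t. s *\<^sub>R a + t *\<^sub>R b = 0 ==> s = 0 \<and> t = 0"
  shows "gram a b a b > 0"
proof -
  let ?w = "(b \<bullet> b) *\<^sub>R a + (- (a \<bullet> b)) *\<^sub>R b"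
  have "b ~= 0" using assms[of 0 1] by auto
  then have b: "b \<bullet> b > 0" by simp
  then have "?w ~= 0" using assms[of "b \<bullet> b" "- (a \<bullet> b)"] by auto
  then have "?w \<bullet> ?w > 0" by (simp only: inner_gt_zero_iff not_False_eq_True)
  also have "?w \<bullet> ?w = (b \<bullet> b) * gram a b a b"
    by (simp add: gram_def inner_diff_left inner_diff_right inner_commute algebra_simps)
  finally show ?thesis using b by (simp add: zero_less_mult_iff)
qed

text \<open>Bivectors of a plane form a line, so the value is a product of two determinants and a
  factor that depends only on \<open>E\<close>.\<close>

lemma gram_plane:
  fixes E :: "R2 => 'a::real_inner"
  assumes "linear E"
  shows "gram (E u) (E v) (E s) (E t) = det2 u v * det2 s t * gram (E (1, 0)) (E (0, 1)) (E (1, 0)) (E (0, 1))"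
proof -
  have e: "E x = fst x *\<^sub>R E (1, 0) + snd x *\<^sub>R E (0, 1)" for x
    using linear_add[OF assms, of "fst x *\<^sub>R (1, 0)" "snd x *\<^sub>R (0, 1)"]
      linear_scale[OF assms, of "fst x" "(1, 0)"] linear_scale[OF assms, of "snd x" "(0, 1)"] by simp
  define A B C where "A = E (1, 0) \<bullet> E (1, 0)" and "B = E (1, 0) \<bullet> E (0, 1)" and "C = E (0, 1) \<bullet> E (0, 1)"
  have i: "E (1, 0) \<bullet> E (1, 0) = A" "E (1, 0) \<bullet> E (0, 1) = B" "E (0, 1) \<bullet> E (1, 0) = B" "E (0, 1) \<bullet> E (0, 1) = C"
    by (simp_all only: A_def B_def C_def inner_commute)
  have g: "E x \<bullet> E y = fst x * fst y * A + fst x * snd y * B + snd x * fst y * B + snd x * snd y * C" for x y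
  proof -
    have "E x \<bullet> E y = (fst x *\<^sub>R E (1, 0) + snd x *\<^sub>R E (0, 1)) \<bullet> (fst y *\<^sub>R E (1, 0) + snd y *\<^sub>R E (0, 1))"
      by (simp only: e[symmetric])
    also have "\<dots> = fst x * fst y * A + fst x * snd y * B + snd x * fst y * B + snd x * snd y * C"
      by (simp only: inner_add_left inner_add_right inner_scaleR_left inner_scaleR_right i) (simp add: algebra_simps)
    finally show ?thesis .
  qed
  show ?thesis unfolding gram_def g det2_def by (simp add: algebra_simps)
qed

text \<open>The sign of \<^const>\<open>gram\<close> compares the orientations of two frames of a plane.\<close>

lemma gram_plane_nonzero:
  fixes E :: "R2 => 'a::real_inner"
  assumes E: "linear E" and r: "{a, b, c, d} <= range E" and g: "gram a b a b > 0" "gram c d c d > 0"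
  shows "gram a b c d ~= 0"
proof -
  define K where "K = gram (E (1, 0)) (E (0, 1)) (E (1, 0)) (E (0, 1))"
  have G: "gram (E x) (E y) (E z) (E w) = det2 x y * det2 z w * K" for x y z w unfolding K_def by (rule gram_plane[OF E])
  have m: "a \<in> range E" "b \<in> range E" "c \<in> range E" "d \<in> range E" using r by simp_all
  obtain s where s: "a = E s" using m(1) by (rule rangeE)
  obtain t where t: "b = E t" using m(2) by (rule rangeE)
  obtain u where u: "c = E u" using m(3) by (rule rangeE)
  obtain v where v: "d = E v" using m(4) by (rule rangeE)
  have "det2 s t * det2 s t * K > 0" "det2 u v * det2 u v * K > 0" using g unfolding s t u v G .
  then have "det2 s t ~= 0" "det2 u v ~= 0" "K ~= 0" by auto
  then show ?thesis unfolding s t u v G by simp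
qed

text \<open>A cocycle rule, again because bivectors of a plane form a line: two frames can be
  compared through a third one.\<close>

lemma gram_plane_mult:
  fixes E :: "R2 => 'a::real_inner"
  assumes E: "linear E" and r: "{a, b, c, d, e, f} <= range E"
  shows "gram a b c d * gram e f e f = gram a b e f * gram e f c d"
proof -
  define K where "K = gram (E (1, 0)) (E (0, 1)) (E (1, 0)) (E (0, 1))"
  have G: "gram (E x) (E y) (E z) (E w) = det2 x y * det2 z w * K" for x y z w unfolding K_def by (rule gram_plane[OF E])
  have m: "a \<in> range E" "b \<in> range E" "c \<in> range E" "d \<in> range E" "e \<in> range E" "f \<in> range E" using r by simp_all
  obtain s where s: "a = E s" using m(1) by (rule rangeE)
  obtain t where t: "b = E t" using m(2) by (rule rangeE)
  obtain u where u: "c = E u" using m(3) by (rule rangeE)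
  obtain v where v: "d = E v" using m(4) by (rule rangeE)
  obtain x where x: "e = E x" using m(5) by (rule rangeE)
  obtain y where y: "f = E y" using m(6) by (rule rangeE)
  show ?thesis unfolding s t u v x y G by (simp only: mult.assoc mult.commute mult.left_commute)
qed

lemma continuous_on_gram [continuous_intros]:
  fixes a :: "'a::topological_space => 'b::real_inner"
  assumes "continuous_on S a" "continuous_on S b" "continuous_on S c" "continuous_on S d"
  shows "continuous_on S (\<lambda>x. gram (a x) (b x) (c x) (d x))"
  unfolding gram_def using assms by (intro continuous_intros)

section \<open>The rotation frame of the one-holed torus\<close>

lemma torus_mem:
  "(z, w) \<in> standard_one_holed_torus \<longleftrightarrow> norm z = 1 \<and> norm w = 1 \<and> Re z + Re w <= 3/2"
proof -
  \<comment> \<open>On the product of unit circles the squared distance to \<open>(1, 1)\<close> is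
    affine in the real parts, and is less than 1 exactly if their sum exceeds 3/2.\<close>
  have "(dist (1, 1) (z, w))\<^sup>2 = 4 - 2 * (Re z + Re w)" if "norm z = 1" "norm w = 1"
  proof -
    have r: "(Re z)\<^sup>2 + (Im z)\<^sup>2 = 1" "(Re w)\<^sup>2 + (Im w)\<^sup>2 = 1" using that cmod_power2[of z] cmod_power2[of w] by auto
    have "(dist (1, 1) (z, w))\<^sup>2 = (norm (1 - z))\<^sup>2 + (norm (1 - w))\<^sup>2"
      unfolding dist_Pair_Pair by (simp add: dist_norm)
    also have "\<dots> = (1 - Re z)\<^sup>2 + (Im z)\<^sup>2 + ((1 - Re w)\<^sup>2 + (Im w)\<^sup>2)" by (simp add: cmod_power2)
    finally show ?thesis using r by (simp add: power2_diff)
  qed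
  moreover have "dist (1, 1) (z, w) < 1 \<longleftrightarrow> (dist (1, 1) (z, w))\<^sup>2 < 1"
    using power2_less_imp_less[of "dist (1, 1) (z, w)" 1] power_strict_mono[of "dist (1, 1) (z, w)" 1 2] by auto
  ultimately show ?thesis unfolding standard_one_holed_torus_def by auto
qed

text \<open>Turning away from 1 decreases a nonnegative real part, and keeps a negative one from
  becoming positive, since the angle is at most 1. Both alternatives preserve the condition in
  \<open>torus_mem\<close>, the other real part being at most 1.\<close>

lemma circle_direction:
  fixes z :: complex
  assumes "norm z = 1"
  obtains d :: real where "d * d = 1" "!!s. 0 <= s ==> s <= 1 ==> norm (z * cis (d * s)) = 1 \<and>
    (Re (z * cis (d * s)) <= Re z \<or> Re (z * cis (d * s)) <= 1/2)"
proof -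
  define d :: real where "d = (if Im z \<ge> 0 then 1 else - 1)"
  show thesis
  proof (rule that[of d])
    fix s :: real assume s: "0 <= s" "s <= 1"
    have c: "0 <= cos s" "0 <= sin s" using s pi_gt3 by (auto intro!: cos_ge_zero sin_ge_zero)
    have e: "Re (z * cis (d * s)) = Re z * cos s - \<bar>Im z\<bar> * sin s" by (simp add: d_def)
    have le: "Re (z * cis (d * s)) <= Re z * cos s" unfolding e using c by simp
    have "Re (z * cis (d * s)) <= Re z \<or> Re (z * cis (d * s)) <= 1/2"
    proof (cases "Re z \<ge> 0")
      case True
      then have "Re z * cos s <= Re z" by (simp add: mult_left_le)
      then show ?thesis using le by linarith
    next
      case False
      then have "Re z * cos s <= 0" using c by (simp add: mult_nonpos_nonneg)
      then show ?thesis using le by linarith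
    qed
    then show "norm (z * cis (d * s)) = 1 \<and> (Re (z * cis (d * s)) <= Re z \<or> Re (z * cis (d * s)) <= 1/2)"
      using assms by (simp add: norm_mult)
  qed (simp add: d_def)
qed

lemma torus_Re_le: "(z, w) \<in> standard_one_holed_torus ==> Re z <= 1 \<and> Re w <= 1"
  unfolding torus_mem using complex_Re_le_cmod[of z] complex_Re_le_cmod[of w] by auto

lemma rotate_derivative:
  "((\<lambda>s. z * cis (d * s)) has_vector_derivative d *\<^sub>R (\<i> * z)) (at 0 within S)"
proof -
  have e: "(\<lambda>s. exp (s *\<^sub>R (\<i> * of_real d))) = (\<lambda>s. cis (d * s))"
    by (auto simp: cis_conv_exp scaleR_conv_of_real mult.commute mult.left_commute)
  have "((\<lambda>s. cis (d * s)) has_vector_derivative \<i> * of_real d) (at 0 within S)"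
    using exp_scaleR_has_vector_derivative_right[of "\<i> * of_real d" 0 S] unfolding e by simp
  from has_vector_derivative_mult_right[OF this, of z] show ?thesis
    by (simp add: scaleR_conv_of_real mult.commute mult.left_commute)
qed

lemma torus_curves:
  assumes q: "q \<in> standard_one_holed_torus" and w: "w \<in> {(\<i> * fst q, 0), (0, \<i> * snd q)}"
  obtains c and d :: real where "d * d = 1" "c 0 = q" "c ` {0..1} <= standard_one_holed_torus"
    "(c has_vector_derivative d *\<^sub>R w) (at (0::real) within {0..1})"
proof -
  obtain y z where yz: "q = (y, z)" by (cases q)
  note T = q[unfolded yz torus_mem] and R = torus_Re_le[OF q[unfolded yz]]
  consider "w = (\<i> * y, 0)" | "w = (0, \<i> * z)" using w yz by auto
  then show thesis
  proof cases
    case 1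
    obtain d :: real where d: "d * d = 1" "!!s. 0 <= s ==> s <= 1 ==> norm (y * cis (d * s)) = 1 \<and>
      (Re (y * cis (d * s)) <= Re y \<or> Re (y * cis (d * s)) <= 1/2)" using circle_direction[of y] T by blast
    show thesis
    proof (rule that[of d "\<lambda>s. (y * cis (d * s), z)"])
      have "(y * cis (d * s), z) \<in> standard_one_holed_torus" if "0 <= s" "s <= 1" for s
        unfolding torus_mem using d(2)[OF that] T R by linarith
      then show "(\<lambda>s. (y * cis (d * s), z)) ` {0..1} <= standard_one_holed_torus" by auto
      show "((\<lambda>s. (y * cis (d * s), z)) has_vector_derivative d *\<^sub>R w) (at 0 within {0..1})"
        using has_vector_derivative_Pair[OF rotate_derivative[of y d "{0..1}"] has_vector_derivative_const[of z]] 1 by simp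
    qed (use d(1) yz in auto)
  next
    case 2
    obtain d :: real where d: "d * d = 1" "!!s. 0 <= s ==> s <= 1 ==> norm (z * cis (d * s)) = 1 \<and>
      (Re (z * cis (d * s)) <= Re z \<or> Re (z * cis (d * s)) <= 1/2)" using circle_direction[of z] T by blast
    show thesis
    proof (rule that[of d "\<lambda>s. (y, z * cis (d * s))"])
      have "(y, z * cis (d * s)) \<in> standard_one_holed_torus" if "0 <= s" "s <= 1" for s
        unfolding torus_mem using d(2)[OF that] T R by linarith
      then show "(\<lambda>s. (y, z * cis (d * s))) ` {0..1} <= standard_one_holed_torus" by auto
      show "((\<lambda>s. (y, z * cis (d * s))) has_vector_derivative d *\<^sub>R w) (at 0 within {0..1})"
        using has_vector_derivative_Pair[OF has_vector_derivative_const[of y] rotate_derivative[of z d "{0..1}"]] 2 by simp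
    qed (use d(1) yz in auto)
  qed
qed

lemma derivative_along_curve:
  fixes h :: "'a::euclidean_space => 'b::euclidean_space"
  assumes D: "(h has_derivative D) (at q within S)"
    and c: "c 0 = q" "c ` {0..1} <= S" "(c has_vector_derivative w) (at (0::real) within {0..1})"
  shows "((\<lambda>t. h (c t)) has_vector_derivative D w) (at 0 within {0..1})"
proof -
  have "(h has_derivative D) (at (c 0) within c ` {0..1})" using has_derivative_subset[OF D c(2)] c(1) by simp
  from vector_derivative_diff_chain_within[OF c(3) this] show ?thesis by (simp add: o_def)
qed

lemma torus_derivative_unique:
  fixes h :: "complex \<times> complex => 'b::euclidean_space"
  assumes q: "q \<in> standard_one_holed_torus" and w: "w \<in> {(\<i> * fst q, 0), (0, \<i> * snd q)}"
    and D: "(h has_derivative D) (at q within standard_one_holed_torus)" "(h has_derivative D') (at q within standard_one_holed_torus)"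
  shows "D w = D' w"
proof -
  obtain c and d :: real where c: "d * d = 1" "c 0 = q" "c ` {0..1} <= standard_one_holed_torus"
    "(c has_vector_derivative d *\<^sub>R w) (at (0::real) within {0..1})" using torus_curves[OF q w] by blast
  have "D (d *\<^sub>R w) = D' (d *\<^sub>R w)"
    by (rule vector_derivative_unique_within_closed_interval[of 0 1 0 "\<lambda>t. h (c t)"])
      (use derivative_along_curve[OF D(1) c(2-4)] derivative_along_curve[OF D(2) c(2-4)] in simp_all)
  then have "d *\<^sub>R d *\<^sub>R D w = d *\<^sub>R d *\<^sub>R D' w"
    using linear_scale[OF has_derivative_linear[OF D(1)]] linear_scale[OF has_derivative_linear[OF D(2)]] by metis
  then show ?thesis using c(1) by simp
qed

text \<open>The rotation directions are, up to sign, velocities of curves in the holed torus, also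
  at its rim. In these directions the derivative within the torus is that of any local smooth
  extension.\<close>

lemma torus_derivative_smooth:
  fixes h :: "complex \<times> complex => 'b::euclidean_space"
  assumes h: "smooth_on standard_one_holed_torus h" and v: "smooth_on UNIV v"
    and vw: "!!q. v q \<in> {(\<i> * fst q, 0), (0, \<i> * snd q)}"
  shows "smooth_on standard_one_holed_torus (\<lambda>q. frechet_derivative h (at q within standard_one_holed_torus) (v q))"
    (is "smooth_on ?S ?f")
proof (rule smooth_on_local)
  fix q assume q: "q \<in> ?S"
  obtain U g where U: "open U" "q \<in> U" "!!k. Ck_on k g U" "!!y. y \<in> ?S ==> y \<in> U ==> h y = g y"
    using smooth_onE[OF h q] by blast
  let ?g = "\<lambda>y. \<Sum>b\<in>Basis. (v y \<bullet> b) *\<^sub>R frechet_derivative g (at y) b"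
  have 1: "smooth_on U (\<lambda>y. frechet_derivative g (at y) b)" if "b \<in> Basis" for b
    unfolding smooth_on_open_iff[OF U(1)] using Ck_on_SucD(2)[OF U(1) U(3)] that by blast
  have 2: "smooth_on U (\<lambda>y. v y \<bullet> b)" for b
    by (rule smooth_on_linear[OF bounded_linear_inner_left smooth_on_subset[OF v]]) simp
  have "smooth_on U ?g"
    by (intro smooth_on_sum smooth_on_bilinear[OF bounded_bilinear_scaleR] 1 2)
  moreover have "?g y = ?f y" if y: "y \<in> ?S \<inter> U" for y
  proof -
    have yS: "y \<in> ?S" "y \<in> U" using y by auto
    have D: "(g has_derivative frechet_derivative g (at y)) (at y)" by (rule Ck_on_SucD(1)[OF U(1) U(3) yS(2)])
    obtain e where e: "e > 0" "ball y e <= U" using U(1) yS(2) open_contains_ball by blast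
    have "(h has_derivative frechet_derivative g (at y)) (at y within ?S)"
      by (rule has_derivative_transform_within[OF has_derivative_at_withinI[OF D] e(1) yS(1)])
        (use U(4) e(2) in \<open>auto simp: dist_commute subset_iff\<close>)
    from torus_derivative_unique[OF yS(1) vw smooth_on_has_derivative[OF h yS(1)] this]
    have "?f y = frechet_derivative g (at y) (v y)" .
    also have "\<dots> = frechet_derivative g (at y) (\<Sum>b\<in>Basis. (v y \<bullet> b) *\<^sub>R b)" by (simp only: euclidean_representation)
    also have "\<dots> = ?g y"
      using linear_sum[OF has_derivative_linear[OF D], of "\<lambda>b. (v y \<bullet> b) *\<^sub>R b" Basis] linear_scale[OF has_derivative_linear[OF D]] by simp
    finally show ?thesis by simp
  qed
  ultimately have "smooth_on (?S \<inter> U) ?f"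
    by (intro smooth_on_cong[OF smooth_on_subset[of U ?g "?S \<inter> U"]]) auto
  then show "\<exists>U. open U \<and> q \<in> U \<and> smooth_on (?S \<inter> U) ?f" using U(1,2) by blast
qed

context plug
begin

text \<open>The torus is parallelizable: its two rotation fields are transported to the plug by the
  differential of the inverse of \<open>f\<close>. They stay independent because the differential of
  \<open>f\<close> takes them back.\<close>

lemma torus_frame:
  obtains X1 X2 :: "R3 => R3" where "continuous_on P X1" "continuous_on P X2"
    "!!p. p \<in> P ==> X1 p \<in> tangent_space P p" "!!p. p \<in> P ==> X2 p \<in> tangent_space P p"
    "!!p. p \<in> P ==> gram (X1 p) (X2 p) (X1 p) (X2 p) > 0"
proof -
  let ?S = standard_one_holed_torus
  obtain f where f: "diffeomorphism P ?S f" using plug unfolding torus_plug_def by blast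
  note F = diffeomorphismD[OF f]
  define h where "h = inv_into P f"
  define v1 v2 :: "complex \<times> complex => complex \<times> complex"
    where "v1 q = (\<i> * fst q, 0)" and "v2 q = (0, \<i> * snd q)" for q
  define Y where "Y v q = frechet_derivative h (at q within ?S) (v q)" for v :: "complex \<times> complex => complex \<times> complex" and q
  have h: "smooth_on ?S h" using F(2) by (simp add: h_def)
  have bl: "bounded_linear v1" "bounded_linear v2"
    unfolding v1_def[abs_def] v2_def[abs_def]
    by (rule bounded_linear_Pair[OF bounded_linear_const_mult[OF bounded_linear_fst] bounded_linear_zero],
        rule bounded_linear_Pair[OF bounded_linear_zero bounded_linear_const_mult[OF bounded_linear_snd]])
  have sY: "smooth_on ?S (Y v)" if v: "v = v1 \<or> v = v2" for v
    unfolding Y_def[abs_def]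
  proof (rule torus_derivative_smooth[OF h])
    show "smooth_on UNIV v" using v smooth_on_linear'[OF bl(1)] smooth_on_linear'[OF bl(2)] by (elim disjE) simp_all
    show "v q \<in> {(\<i> * fst q, 0), (0, \<i> * snd q)}" for q using v by (auto simp: v1_def v2_def)
  qed
  have T: "Y v (f p) \<in> tangent_space P p" and FY: "dif P f p (Y v (f p)) = v (f p)"
    if p: "p \<in> P" and v: "v = v1 \<or> v = v2" for p v
  proof -
    have q: "f p \<in> ?S" by (rule F(3)[OF p])
    have vm: "v (f p) \<in> {(\<i> * fst (f p), 0), (0, \<i> * snd (f p))}"
      using v by (elim disjE) (simp_all add: v1_def v2_def)
    obtain c :: "real => complex \<times> complex" and d :: real where c: "d * d = 1" "c 0 = f p" "c ` {0..1} <= ?S"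
      "(c has_vector_derivative d *\<^sub>R v (f p)) (at (0::real) within {0..1})" by (rule torus_curves[OF q vm]) (rule that)
    have cS: "c t \<in> ?S" if "t \<in> {0..1}" for t by (rule subsetD[OF c(3) imageI[OF that]])
    have d0: "d ~= 0" using c(1) by auto
    note H = smooth_on_has_derivative[OF h q]
    have hc: "((\<lambda>t. h (c t)) has_vector_derivative d *\<^sub>R Y v (f p)) (at 0 within {0..1})"
      using derivative_along_curve[OF H c(2-4)] unfolding linear_scale[OF has_derivative_linear[OF H]] Y_def .
    have h0: "h (c 0) = p" unfolding c(2) h_def by (rule F(5)[OF p])
    have hP: "(\<lambda>t. h (c t)) ` {0..1} <= P" unfolding h_def by (rule image_subsetI) (rule F(4)[OF cS])
    have "d *\<^sub>R Y v (f p) \<in> tangent_space P p" by (rule tangent_spaceI[OF h0 hP hc])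
    from subspace_scale[OF subspace_tangent_space this, of d] show "Y v (f p) \<in> tangent_space P p"
      by (simp only: scaleR_scaleR c(1) scaleR_one)
    note G = dif_has_derivative[OF F(1) p]
    have 1: "((\<lambda>t. f (h (c t))) has_vector_derivative dif P f p (d *\<^sub>R Y v (f p))) (at 0 within {0..1})"
      by (rule derivative_along_curve[OF G h0 hP hc])
    have fh: "f (h (c t)) = c t" if "t \<in> {0..1}" for t unfolding h_def by (rule F(6)[OF cS[OF that]])
    have 2: "((\<lambda>t. f (h (c t))) has_vector_derivative d *\<^sub>R v (f p)) (at 0 within {0..1})"
      by (rule has_vector_derivative_transform[OF _ fh c(4)]) simp_all
    have "dif P f p (d *\<^sub>R Y v (f p)) = d *\<^sub>R v (f p)"
      by (rule vector_derivative_unique_within_closed_interval[of 0 1 0, unfolded cbox_interval, OF _ _ 1 2]) simp_all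
    then have "d *\<^sub>R dif P f p (Y v (f p)) = d *\<^sub>R v (f p)" unfolding linear_scale[OF dif_linear[OF F(1) p]] .
    then show "dif P f p (Y v (f p)) = v (f p)" using d0 by (simp only: real_vector.scale_cancel_left) simp
  qed
  show thesis
  proof (rule that[of "\<lambda>p. Y v1 (f p)" "\<lambda>p. Y v2 (f p)"])
    have c: "continuous_on P (\<lambda>p. Y v (f p))" if "v = v1 \<or> v = v2" for v
      by (rule continuous_on_compose2[OF smooth_on_imp_continuous_on[OF sY[OF that]] smooth_on_imp_continuous_on[OF F(1)]])
        (rule image_subsetI, rule F(3))
    show "continuous_on P (\<lambda>p. Y v1 (f p))" "continuous_on P (\<lambda>p. Y v2 (f p))" by (rule c, simp)+
    fix p assume p: "p \<in> P"
    show "Y v1 (f p) \<in> tangent_space P p" "Y v2 (f p) \<in> tangent_space P p" by (rule T[OF p], simp)+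
    show "gram (Y v1 (f p)) (Y v2 (f p)) (Y v1 (f p)) (Y v2 (f p)) > 0"
    proof (rule gram_independent)
      fix s t assume "s *\<^sub>R Y v1 (f p) + t *\<^sub>R Y v2 (f p) = 0"
      then have "dif P f p (s *\<^sub>R Y v1 (f p) + t *\<^sub>R Y v2 (f p)) = 0"
        by (simp only: linear_0[OF dif_linear[OF F(1) p]])
      moreover have "dif P f p (Y v1 (f p)) = v1 (f p)" "dif P f p (Y v2 (f p)) = v2 (f p)" by (rule FY[OF p], simp)+
      ultimately have e: "s *\<^sub>R v1 (f p) + t *\<^sub>R v2 (f p) = 0"
        by (simp only: linear_add[OF dif_linear[OF F(1) p]] linear_scale[OF dif_linear[OF F(1) p]])
      have "(fst (f p), snd (f p)) \<in> ?S" unfolding prod.collapse by (rule F(3)[OF p])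
      then have "fst (f p) ~= 0" "snd (f p) ~= 0" unfolding torus_mem by (elim conjE, force)+
      with arg_cong[OF e, of fst] arg_cong[OF e, of snd] show "s = 0 \<and> t = 0" by (simp add: v1_def v2_def)
    qed
  qed
qed

end

section \<open>Comparison of frames along a lift\<close>

abbreviation hx :: R3 where "hx \<equiv> (1, 0, 0)"
abbreviation hy :: R3 where "hy \<equiv> (0, 1, 0)"

lemma gram_hxy [simp]: "gram hx hy hx hy = 1"
  by (simp add: gram_def)

lemma connected_circle: "connected (shift k inner_circle)"
proof -
  let ?c = "\<lambda>t::real. (1/2 - real k + cos t / 4, 1/2 + sin t / 4, 0::real)"
  have "shift k inner_circle = range ?c"
  proof
    show "range ?c <= shift k inner_circle"
    proof
      fix p assume "p \<in> range ?c"
      then obtain t where p: "p = ?c t" by blast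
      have "(cos t / 4)\<^sup>2 + (sin t / 4)\<^sup>2 = (1/4)\<^sup>2"
        using sin_cos_squared_add[of t] by (simp add: power_divide field_simps)
      then show "p \<in> shift k inner_circle" unfolding p mem_shift by (simp add: inner_circle_def algebra_simps)
    qed
    show "shift k inner_circle <= range ?c"
    proof
      fix p assume p: "p \<in> shift k inner_circle"
      obtain x y z where q: "p = (x, y, z)" by (cases p)
      have e: "(x + real k - 1/2)\<^sup>2 + (y - 1/2)\<^sup>2 = (1/4)\<^sup>2" "z = 0" using p unfolding q mem_shift by (auto simp: inner_circle_def)
      then have "(4 * (x + real k - 1/2))\<^sup>2 + (4 * (y - 1/2))\<^sup>2 = 1" unfolding power_mult_distrib by (simp add: power2_eq_square)
      then obtain t where "4 * (x + real k - 1/2) = cos t" "4 * (y - 1/2) = sin t" by (rule sincos_total_2pi)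
      then have "p = ?c t" using e(2) by (simp add: q)
      then show "p \<in> range ?c" by blast
    qed
  qed
  moreover have "connected (range ?c)" by (intro connected_continuous_image continuous_intros connected_UNIV) auto
  ultimately show ?thesis by simp
qed

context capped_plug
begin

text \<open>At an interior point the tangent space is the image of a chart differential, so Gram
  determinants of tangent vectors reduce to determinants in the plane.\<close>

lemma plane_at:
  assumes a: "(p, w) \<in> X"
  obtains E :: "R2 => R3" where "linear E" "range E = tangent_space Cp p"
proof -
  obtain U V f where c: "plane_chart Cp Bd U V f" "0 \<in> V" "plane_chart.fr f 0 = (p, w)"
    using chart_through[OF a] by blast
  interpret C: plane_chart "Cp" "Bd" U V f by (rule c(1))
  have f0: "p = f 0" using arg_cong[OF c(3), of fst] by (simp add: C.fr_def C.ray_def)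
  have p: "f 0 \<in> Cp" "f 0 \<in> U" "C.co (f 0) = 0" using C.ch_in c(2) by auto
  show thesis
  proof (rule that[of "C.dch 0"])
    show "linear (C.dch 0)" by (rule C.dch_linear[OF c(2)])
    show "range (C.dch 0) = tangent_space Cp p"
    proof (rule subset_antisym)
      show "range (C.dch 0) <= tangent_space Cp p"
        unfolding f0 by (rule image_subsetI) (rule C.dch_tangent[OF c(2)])
      show "tangent_space Cp p <= range (C.dch 0)"
      proof
        fix u assume "u \<in> tangent_space Cp p"
        from C.dch_dco[OF p(1,2) this[unfolded f0]] have "u = C.dch 0 (C.dco (f 0) u)" unfolding p(3) by (rule sym)
        then show "u \<in> range (C.dch 0)" by (rule range_eqI)
      qed
    qed
  qed
qed

lemma horizontal_X:
  assumes "p \<in> flat (Suc n) {1..n}" "p \<notin> Bd"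
  shows "(p, hx) \<in> X" "hx \<in> tangent_space Cp p" "hy \<in> tangent_space Cp p"
proof -
  have t: "(a, b, 0) \<in> tangent_space Cp p" for a b using horizontal_tangent assms(1) by (cases p) blast
  show "(p, hx) \<in> X" using t assms flat_M by (auto simp: utb_inner_def utb_mem norm_Pair)
  show "hx \<in> tangent_space Cp p" "hy \<in> tangent_space Cp p" using t by auto
qed

lemma flat_plug:
  assumes k: "k \<in> {1..n}" and p: "p \<in> flat (Suc n) {1..n}" "p \<in> shift k P"
  shows "p \<in> shift k inner_circle"
proof -
  obtain x y z where q: "p = (x, y, z)" by (cases p)
  have a: "(x + real k, y, z) \<in> P" using p(2) unfolding q mem_shift .
  note F = flatD[OF p(1)[unfolded q]]
  have "(x + real k, y, z) \<in> annulus"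
    using F(5) F(6)[OF k] P_sub[OF a] by (simp add: annulus_def square_def not_less)
  then show ?thesis using a P_annulus unfolding q mem_shift by blast
qed

lemma circle_flat:
  assumes k: "k \<in> {1..n}" and p: "p \<in> shift k inner_circle"
  shows "p \<in> flat (Suc n) {1..n}" "p \<notin> Bd" "p \<in> shift k P"
proof -
  obtain x y z where q: "p = (x, y, z)" by (cases p)
  have e: "(x + real k - 1/2)\<^sup>2 + (y - 1/2)\<^sup>2 = (1/4)\<^sup>2" "z = 0" using p unfolding q mem_shift by (auto simp: inner_circle_def)
  have "\<bar>x + real k - 1/2\<bar> <= \<bar>1/4\<bar>" "\<bar>y - 1/2\<bar> <= \<bar>1/4\<bar>" unfolding abs_le_square_iff using e(1) zero_le_power2[of "x + real k - 1/2"] zero_le_power2[of "y - 1/2"] by linarith+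
  then have b: "\<bar>x + real k - 1/2\<bar> <= 1/4" "\<bar>y - 1/2\<bar> <= 1/4" by simp_all
  have kk: "1 <= real k" "real k <= real n" using k by auto
  have c: "- real (Suc n) < x" "x < 1" "0 < y" "y < 1" using b kk unfolding abs_le_iff of_nat_Suc by linarith+
  have "(1/4)\<^sup>2 <= (x + real j - 1/2)\<^sup>2 + (y - 1/2)\<^sup>2" if "j \<in> {1..n}" for j
  proof (cases "j = k")
    case False
    then have "real j <= real k - 1 \<or> real j \<ge> real k + 1" by linarith
    then show ?thesis using b(1) by (intro sq_ge) linarith
  qed (use e in simp)
  then show "p \<in> flat (Suc n) {1..n}" using c e(2) by (simp add: q flat_def)
  show "p \<notin> Bd" using c by (simp add: q strip_boundary_def)
  have "inner_circle <= P" using P_annulus by blast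
  then show "p \<in> shift k P" using p unfolding shift_def by blast
qed

text \<open>On the rim the flat frame and the frame of the plug span the same tangent plane, so
  their comparison does not vanish. It has one sign on the connected circle, and if this is
  negative, exchanging the two fields corrects it.\<close>

lemma plug_frame:
  assumes k: "k \<in> {1..n}"
  obtains Y1 Y2 :: "R3 => R3" where "continuous_on (shift k P) Y1" "continuous_on (shift k P) Y2"
    "!!p. p \<in> shift k P ==> Y1 p \<in> tangent_space Cp p" "!!p. p \<in> shift k P ==> Y2 p \<in> tangent_space Cp p"
    "!!p. p \<in> shift k P ==> gram (Y1 p) (Y2 p) (Y1 p) (Y2 p) > 0"
    "!!p. p \<in> shift k inner_circle ==> gram hx hy (Y1 p) (Y2 p) > 0"
proof -
  let ?a = "(real k, 0, 0) :: R3"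
  obtain X1 X2 :: "R3 => R3" where X: "continuous_on P X1" "continuous_on P X2"
    "!!p. p \<in> P ==> X1 p \<in> tangent_space P p" "!!p. p \<in> P ==> X2 p \<in> tangent_space P p"
    "!!p. p \<in> P ==> gram (X1 p) (X2 p) (X1 p) (X2 p) > 0" using torus_frame by blast
  define Y1 Y2 where "Y1 p = X1 (p + ?a)" and "Y2 p = X2 (p + ?a)" for p
  have m: "p + ?a \<in> P" if "p \<in> shift k P" for p using that unfolding shift_def mem_translate .
  have kM: "shift k P <= Cp" using k by (auto simp: capped_eq plugs_def)
  have T: "w \<in> tangent_space Cp p" if "p \<in> shift k P" "w \<in> tangent_space P (p + ?a)" for p w
  proof -
    have "((\<lambda>p. p - ?a) has_derivative (\<lambda>w. w)) (at (p + ?a) within P)" by (auto intro!: derivative_eq_intros)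
    from has_derivative_tangent_map[OF this _ that(2), of "shift k P"]
    have "w \<in> tangent_space (shift k P) (p + ?a - ?a)" unfolding shift_def by (simp only: order_refl)
    then have "w \<in> tangent_space (shift k P) p" by (simp only: add_diff_cancel)
    then show ?thesis using tangent_space_mono[OF kM] by blast
  qed
  have Y: "continuous_on (shift k P) Y1" "continuous_on (shift k P) Y2"
    unfolding Y1_def[abs_def] Y2_def[abs_def]
    by (rule continuous_on_compose2[OF X(1)], intro continuous_intros, rule image_subsetI, rule m, assumption,
        rule continuous_on_compose2[OF X(2)], intro continuous_intros, rule image_subsetI, rule m, assumption)
  have YT: "Y1 p \<in> tangent_space Cp p" "Y2 p \<in> tangent_space Cp p" "gram (Y1 p) (Y2 p) (Y1 p) (Y2 p) > 0"
    if "p \<in> shift k P" for p using T[OF that X(3)[OF m[OF that]]] T[OF that X(4)[OF m[OF that]]] X(5)[OF m[OF that]] unfolding Y1_def Y2_def .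
  have nz: "gram hx hy (Y1 p) (Y2 p) ~= 0" if p: "p \<in> shift k inner_circle" for p
  proof -
    note C = circle_flat[OF k p] and H = horizontal_X[OF circle_flat(1,2)[OF k p]]
    obtain E :: "R2 => R3" where E: "linear E" "range E = tangent_space Cp p" by (rule plane_at[OF H(1)]) (rule that)
    show ?thesis by (rule gram_plane_nonzero[OF E(1)]) (use H YT[OF C(3)] in \<open>simp_all add: E(2)\<close>)
  qed
  let ?g = "\<lambda>p. gram hx hy (Y1 p) (Y2 p)"
  have "connected (?g ` shift k inner_circle)"
  proof (rule connected_continuous_image[OF _ connected_circle])
    have s: "shift k inner_circle <= shift k P" by (rule subsetI) (rule circle_flat(3)[OF k])
    show "continuous_on (shift k inner_circle) ?g"
      by (intro continuous_intros continuous_on_subset[OF Y(1) s] continuous_on_subset[OF Y(2) s])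
  qed
  then have iv: "is_interval (?g ` shift k inner_circle)" by (simp add: is_interval_connected_1)
  have sgn: "(\<forall>p\<in>shift k inner_circle. ?g p > 0) \<or> (\<forall>p\<in>shift k inner_circle. ?g p < 0)"
  proof (rule ccontr)
    assume "\<not> ?thesis"
    then obtain p q where pq: "p \<in> shift k inner_circle" "q \<in> shift k inner_circle" "?g p <= 0" "?g q \<ge> 0" by (meson not_less)
    then have "0 \<in> ?g ` shift k inner_circle" using iv unfolding is_interval_1 by blast
    then show False using nz by (elim imageE) metis
  qed
  then show thesis
  proof
    assume "\<forall>p\<in>shift k inner_circle. ?g p > 0"
    then show thesis by (intro that[OF Y YT]) simp_all
  next
    assume n: "\<forall>p\<in>shift k inner_circle. ?g p < 0"
    show thesis
    proof (rule that[of Y2 Y1])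
      show "gram hx hy (Y2 p) (Y1 p) > 0" if "p \<in> shift k inner_circle" for p
        using n that by (simp add: gram_swap[of hx hy "Y2 p" "Y1 p"])
      show "gram (Y2 p) (Y1 p) (Y2 p) (Y1 p) > 0" if "p \<in> shift k P" for p
        using YT(3)[OF that] by (simp add: gram_def mult.commute)
    qed (rule Y YT; assumption)+
  qed
qed

lemma dif_frame_independent:
  assumes f: "f \<in> diffeos Cp Bd" and p: "p \<in> Cp"
    and T: "hx \<in> tangent_space Cp p" "hy \<in> tangent_space Cp p"
  shows "gram (snd (act Cp f (p, hx))) (snd (act Cp f (p, hy)))
    (snd (act Cp f (p, hx))) (snd (act Cp f (p, hy))) > 0"
proof (rule gram_independent)
  let ?D = "dif Cp f p"
  have L: "linear ?D" by (rule dif_linear[OF diffeosD(1)[OF f] p])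
  have nz: "?D w ~= 0" if "w \<in> tangent_space Cp p" "w ~= 0" for w using dif_diffeo_nonzero[OF f p] that by blast
  fix s t assume a: "s *\<^sub>R snd (act Cp f (p, hx)) + t *\<^sub>R snd (act Cp f (p, hy)) = 0"
  define s' t' where "s' = s / norm (?D hx)" and "t' = t / norm (?D hy)"
  have "?D (s' *\<^sub>R hx + t' *\<^sub>R hy) = s' *\<^sub>R ?D hx + t' *\<^sub>R ?D hy" using linear_add[OF L] linear_scale[OF L] by metis
  also have "\<dots> = 0" using a by (simp add: act_eq s'_def t'_def divide_inverse)
  finally have "s' *\<^sub>R hx + t' *\<^sub>R hy = 0"
    using nz[OF subspace_add[OF subspace_tangent_space subspace_scale[OF subspace_tangent_space T(1)] subspace_scale[OF subspace_tangent_space T(2)]]] by blast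
  then have "s' = 0" "t' = 0" by (simp_all add: zero_prod_def)
  moreover have "?D hx ~= 0" "?D hy ~= 0" using nz[OF T(1)] nz[OF T(2)] by (simp_all add: zero_prod_def)
  ultimately show "s = 0 \<and> t = 0" by (simp add: s'_def t'_def)
qed

text \<open>The comparison sign of the moved frame with the flat frame on the strip and
  with the frames of the plugs is constant along the isotopy. This is where it is used that the plugs are orientable.\<close>

lemma lift_ori:
  assumes F: "lift F" and F1: "tr (F 1) = framed_point n"
  shows "ori (F 1)"
proof -
  let ?M = "Cp" and ?B = "Bd"
  define x0 :: R3 where "x0 = (1/2 - real (Suc n), 1/2, 0)"
  have I: "smooth_isotopy ?M ?B F" "F 0 = id" using F by (auto simp: lift_def)
  have ch0: "dc n 0 = x0" by (simp add: dc_def x0_def)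
  have x0': "x0 \<in> dnb n (1/2)" unfolding ch0[symmetric] dc_norm by simp
  have x0f: "x0 \<in> flat (Suc n) {1..n}"
  proof -
    have "(1/4)\<^sup>2 <= (1/2 - real (Suc n) + real k - 1/2)\<^sup>2 + (1/2 - 1/2)\<^sup>2" if "k \<in> {1..n}" for k
      by (rule sq_ge) (use that in auto)
    then show ?thesis by (simp add: flat_def x0_def)
  qed
  have x0B: "x0 \<notin> ?B" by (auto simp: x0_def strip_boundary_def)
  have x0M: "x0 \<in> ?M" using x0f flat_M by blast
  note H0 = horizontal_X[OF x0f x0B]
  have hyX: "(x0, hy) \<in> X" using H0(3) x0M x0B by (simp add: utb_inner_def utb_mem norm_Pair)
  \<comment> \<open>The same point, framed by the second basis vector. Its trace follows the image
    of \<open>hy\<close>, so that both traces together form a moving frame.\<close>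
  interpret W: pointed_surface ?M ?B "(x0, hy)"
    by unfold_locales (rule charts closedB hyX; assumption)+
  define A B c where "A t = snd (tr (F t))" and "B t = snd (W.tr (F t))" and "c t = F t x0" for t
  have fp: "framed_point n = (x0, hx)" by (simp add: framed_point_def x0_def)
  have t1: "fst (tr (F t)) = c t" for t unfolding tr_def fst_act c_def by (simp add: fp)
  have t2: "fst (W.tr (F t)) = c t" for t unfolding W.tr_def fst_act c_def by simp
  have tA: "tr (F t) = (c t, A t)" for t by (rule prod_eqI) (simp_all only: t1 A_def fst_conv snd_conv)
  have tB: "W.tr (F t) = (c t, B t)" for t by (rule prod_eqI) (simp_all only: t2 B_def fst_conv snd_conv)
  have "continuous_on {0..1} (\<lambda>t. (c t, A t))" using path_tr[OF I(1)] unfolding path_def tA .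
  from continuous_on_fst[OF this] continuous_on_snd[OF this] have cc: "continuous_on {0..1} c" and cA: "continuous_on {0..1} A" by simp_all
  have "continuous_on {0..1} (\<lambda>t. (c t, B t))" using W.path_tr[OF I(1)] unfolding path_def tB .
  from continuous_on_snd[OF this] have cB: "continuous_on {0..1} B" by simp
  have AX: "(c t, A t) \<in> X" "(c t, B t) \<in> X" if "t \<in> {0..1}" for t
    using tr_X[OF smooth_isotopyD(1)[OF I(1) that]] W.tr_X[OF smooth_isotopyD(1)[OF I(1) that]] by (simp_all only: tA tB)
  have AT: "A t \<in> tangent_space ?M (c t)" "B t \<in> tangent_space ?M (c t)" "c t \<in> ?M" "c t \<notin> ?B" if "t \<in> {0..1}" for t
    using AX[OF that] by (auto simp: utb_inner_def utb_mem)
  have AB: "gram (A t) (B t) (A t) (B t) > 0" if "t \<in> {0..1}" for t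
    using dif_frame_independent[OF smooth_isotopyD(1)[OF I(1) that] x0M H0(2,3)]
    unfolding A_def B_def tr_def W.tr_def unfolding fp .
  define FR where "FR k Y \<longleftrightarrow> continuous_on (shift k P) (\<lambda>p. fst (Y p)) \<and> continuous_on (shift k P) (\<lambda>p. snd (Y p)) \<and>
    (\<forall>p\<in>shift k P. fst (Y p) \<in> tangent_space ?M p) \<and> (\<forall>p\<in>shift k P. snd (Y p) \<in> tangent_space ?M p) \<and>
    (\<forall>p\<in>shift k P. gram (fst (Y p)) (snd (Y p)) (fst (Y p)) (snd (Y p)) > 0) \<and>
    (\<forall>p\<in>shift k inner_circle. gram hx hy (fst (Y p)) (snd (Y p)) > 0)" for k and Y :: "R3 => R3 \<times> R3"
  have "\<exists>Y. FR k Y" if k: "k \<in> {1..n}" for k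
  proof (rule plug_frame[OF k])
    fix Y1 Y2 :: "R3 => R3"
    assume Y: "continuous_on (shift k P) Y1" "continuous_on (shift k P) Y2"
    "!!p. p \<in> shift k P ==> Y1 p \<in> tangent_space Cp p" "!!p. p \<in> shift k P ==> Y2 p \<in> tangent_space Cp p"
    "!!p. p \<in> shift k P ==> gram (Y1 p) (Y2 p) (Y1 p) (Y2 p) > 0"
    "!!p. p \<in> shift k inner_circle ==> gram hx hy (Y1 p) (Y2 p) > 0"
    have "FR k (\<lambda>p. (Y1 p, Y2 p))" unfolding FR_def fst_conv snd_conv by (intro conjI ballI Y)
    then show "\<exists>Y. FR k Y" by (rule exI[where x = "\<lambda>p. (Y1 p, Y2 p)"])
  qed
  then have "\<forall>k\<in>{1..n}. \<exists>Y. FR k Y" by (intro ballI)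
  from bchoice[OF this] obtain Y where "\<forall>k\<in>{1..n}. FR k (Y k)" by (rule exE) (rule that)
  note FY = bspec[OF this, unfolded FR_def]
  have Yc: "continuous_on (shift k P) (\<lambda>p. fst (Y k p))" "continuous_on (shift k P) (\<lambda>p. snd (Y k p))" if "k \<in> {1..n}" for k
    using FY[OF that] by blast+
  have YT: "fst (Y k p) \<in> tangent_space ?M p" "snd (Y k p) \<in> tangent_space ?M p"
    "gram (fst (Y k p)) (snd (Y k p)) (fst (Y k p)) (snd (Y k p)) > 0" if "k \<in> {1..n}" "p \<in> shift k P" for k p
    using FY[OF that(1)] that(2) by blast+
  have Yp: "gram hx hy (fst (Y k p)) (snd (Y k p)) > 0" if "k \<in> {1..n}" "p \<in> shift k inner_circle" for k p
    using FY[OF that(1)] that(2) by blast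
  \<comment> \<open>Index 0 stands for the flat part with its constant frame, an index
    \<open>k\<close> from 1 to \<open>n\<close> for the plug in square \<open>k\<close>. The sets
    \<open>Q k\<close> are a finite closed cover of the surface.\<close>
  define Z where "Z k p = (if k = 0 then (hx, hy) else Y k p)" for k p
  define Q where "Q k = (if k = 0 then flat (Suc n) {1..n} else shift k P)" for k
  define sg where "sg k t = gram (A t) (B t) (fst (Z k (c t))) (snd (Z k (c t)))" for k t
  have clQ: "closed (Q k)" for k unfolding Q_def using closed_flat closed_shift by auto
  have cov: "\<exists>k\<in>{0..n}. p \<in> Q k" if "p \<in> ?M" for p
  proof -
    have "p \<in> Q 0 \<or> (\<exists>k\<in>{1..n}. p \<in> Q k)" using M_cases[OF that] by (auto simp: Q_def plugs_def)
    then show ?thesis by auto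
  qed
  have ZT: "fst (Z k (c t)) \<in> tangent_space ?M (c t)" "snd (Z k (c t)) \<in> tangent_space ?M (c t)"
    "gram (fst (Z k (c t))) (snd (Z k (c t))) (fst (Z k (c t))) (snd (Z k (c t))) > 0"
    if t: "t \<in> {0..1}" "k \<in> {0..n}" "c t \<in> Q k" for k t
  proof -
    have "fst (Z k (c t)) \<in> tangent_space ?M (c t) \<and> snd (Z k (c t)) \<in> tangent_space ?M (c t) \<and>
      gram (fst (Z k (c t))) (snd (Z k (c t))) (fst (Z k (c t))) (snd (Z k (c t))) > 0"
    proof (cases "k = 0")
      case True
      then have "c t \<in> flat (Suc n) {1..n}" using t(3) by (simp add: Q_def)
      from horizontal_X(2,3)[OF this AT(4)[OF t(1)]] show ?thesis by (simp add: Z_def True)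
    next
      case False
      then have "k \<in> {1..n}" "c t \<in> shift k P" using t by (simp_all add: Q_def)
      from YT[OF this] show ?thesis using False by (simp add: Z_def)
    qed
    then show "fst (Z k (c t)) \<in> tangent_space ?M (c t)" "snd (Z k (c t)) \<in> tangent_space ?M (c t)"
    "gram (fst (Z k (c t))) (snd (Z k (c t))) (fst (Z k (c t))) (snd (Z k (c t))) > 0" by blast+
  qed
  have nz: "sg k t ~= 0" if t: "t \<in> {0..1}" and k: "k \<in> {0..n}" and q: "c t \<in> Q k" for k t
  proof -
    obtain E :: "R2 => R3" where E: "linear E" "range E = tangent_space ?M (c t)" by (rule plane_at[OF AX(1)[OF t]]) (rule that)
    have "{A t, B t, fst (Z k (c t)), snd (Z k (c t))} <= range E" unfolding E(2) insert_subset by (intro conjI AT(1,2)[OF t] ZT(1,2)[OF t k q] empty_subsetI)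
    from gram_plane_nonzero[OF E(1) this AB[OF t] ZT(3)[OF t k q]] show ?thesis unfolding sg_def .
  qed
  \<comment> \<open>A point in both pieces lies on the rim, where the frame of the plug was chosen
    to agree in orientation with the flat one.\<close>
  have agree0: "sg k t > 0 \<longleftrightarrow> sg 0 t > 0" if t: "t \<in> {0..1}" and k: "k \<in> {1..n}" and q: "c t \<in> Q k" "c t \<in> Q 0" for k t
  proof -
    have k0: "k \<in> {0..n}" "k ~= 0" "0 \<in> {0..n}" using k by auto
    have "c t \<in> flat (Suc n) {1..n}" "c t \<in> shift k P" using q k0(2) by (simp_all add: Q_def)
    then have p: "c t \<in> shift k inner_circle" by (rule flat_plug[OF k])
    obtain E :: "R2 => R3" where E: "linear E" "range E = tangent_space ?M (c t)" by (rule plane_at[OF AX(1)[OF t]]) (rule that)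
    have z0: "fst (Z 0 (c t)) = hx" "snd (Z 0 (c t)) = hy" by (simp_all add: Z_def)
    have "{A t, B t, fst (Z k (c t)), snd (Z k (c t)), hx, hy} <= range E"
      unfolding E(2) insert_subset by (intro conjI AT(1,2)[OF t] ZT(1,2)[OF t k0(1) q(1)] ZT(1,2)[OF t k0(3) q(2), unfolded z0] empty_subsetI)
    from gram_plane_mult[OF E(1) this]
    have "sg k t * gram hx hy hx hy = sg 0 t * gram hx hy (fst (Z k (c t))) (snd (Z k (c t)))" by (simp only: sg_def z0)
    moreover have "gram hx hy (fst (Z k (c t))) (snd (Z k (c t))) > 0" using Yp[OF k p] k0(2) by (simp add: Z_def)
    ultimately show ?thesis by (simp add: zero_less_mult_iff)
  qed
  have disj: "j = k" if "j \<in> {1..n}" "k \<in> {1..n}" "p \<in> Q j" "p \<in> Q k" for j k p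
  proof -
    obtain x y z where q: "p = (x, y, z)" by (cases p)
    have "(x + real j, y, z) \<in> P" "(x + real k, y, z) \<in> P" using that by (auto simp: Q_def q mem_shift)
    from P_sub[OF this(1)] P_sub[OF this(2)] have "real j < real k + 1" "real k < real j + 1" by linarith+
    then show ?thesis by linarith
  qed
  have agree: "sg j t > 0 \<longleftrightarrow> sg k t > 0" if "t \<in> {0..1}" "j \<in> {0..n}" "k \<in> {0..n}" "c t \<in> Q j" "c t \<in> Q k" for j k t
  proof (cases "j = 0 \<or> k = 0")
    case True
    then show ?thesis using agree0[of t j] agree0[of t k] that by (cases "j = 0"; cases "k = 0") auto
  next
    case False
    then show ?thesis using disj[of j k "c t"] that by auto
  qed
  \<comment> \<open>Two closed sets that cover the interval. A common time would give opposite signs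
    for two pieces at one point, against their agreement and nonvanishing; so connectedness leaves
    only one of the sets.\<close>
  define pos neg where "pos = (\<Union>k\<in>{0..n}. {t \<in> {0..1}. c t \<in> Q k \<and> sg k t \<ge> 0})"
    and "neg = (\<Union>k\<in>{0..n}. {t \<in> {0..1}. c t \<in> Q k \<and> sg k t <= 0})"
  have csg: "continuous_on ({0..1} \<inter> c -` Q k) (sg k)" if k: "k \<in> {0..n}" for k
  proof -
    have s: "{0..1} \<inter> c -` Q k <= {0..1}" by auto
    have Zc: "continuous_on (Q k) (\<lambda>p. fst (Z k p))" "continuous_on (Q k) (\<lambda>p. snd (Z k p))"
      using Yc[of k] k by (cases "k = 0"; simp add: Q_def Z_def)+
    have 1: "continuous_on ({0..1} \<inter> c -` Q k) (\<lambda>t. fst (Z k (c t)))"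
      by (rule continuous_on_compose2[OF Zc(1) continuous_on_subset[OF cc s]]) blast
    have 2: "continuous_on ({0..1} \<inter> c -` Q k) (\<lambda>t. snd (Z k (c t)))"
      by (rule continuous_on_compose2[OF Zc(2) continuous_on_subset[OF cc s]]) blast
    show ?thesis unfolding sg_def
      by (rule continuous_on_gram[OF continuous_on_subset[OF cA s] continuous_on_subset[OF cB s] 1 2])
  qed
  have cl1: "closed ({0..1} \<inter> c -` Q k)" for k by (rule continuous_closed_preimage[OF cc closed_atLeastAtMost clQ])
  have "closed {t \<in> {0..1}. c t \<in> Q k \<and> sg k t \<ge> 0}" "closed {t \<in> {0..1}. c t \<in> Q k \<and> sg k t <= 0}" if k: "k \<in> {0..n}" for k
  proof -
    have "closed ({0..1} \<inter> c -` Q k \<inter> sg k -` {0..})" "closed ({0..1} \<inter> c -` Q k \<inter> sg k -` {..0})"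
      by (rule continuous_closed_preimage[OF csg[OF k] cl1]; simp)+
    moreover have "{t \<in> {0..1}. c t \<in> Q k \<and> sg k t \<ge> 0} = {0..1} \<inter> c -` Q k \<inter> sg k -` {0..}"
      "{t \<in> {0..1}. c t \<in> Q k \<and> sg k t <= 0} = {0..1} \<inter> c -` Q k \<inter> sg k -` {..0}" by auto
    ultimately show "closed {t \<in> {0..1}. c t \<in> Q k \<and> sg k t \<ge> 0}" "closed {t \<in> {0..1}. c t \<in> Q k \<and> sg k t <= 0}" by simp_all
  qed
  then have cl: "closed pos" "closed neg" unfolding pos_def neg_def by (auto intro!: closed_UN)
  have cover: "{0..1} <= pos \<union> neg"
  proof
    fix t :: real assume t: "t \<in> {0..1}"
    obtain k where k: "k \<in> {0..n}" "c t \<in> Q k" using cov[OF AT(3)[OF t]] by blast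
    have "t \<in> pos" if "sg k t \<ge> 0" unfolding pos_def by (rule UN_I[OF k(1)]) (use t k that in simp)
    moreover have "t \<in> neg" if "sg k t <= 0" unfolding neg_def by (rule UN_I[OF k(1)]) (use t k that in simp)
    ultimately show "t \<in> pos \<union> neg" using linear[of 0 "sg k t"] by blast
  qed
  have disjoint: "pos \<inter> neg \<inter> {0..1} = {}"
  proof (rule ccontr)
    assume "pos \<inter> neg \<inter> {0..1} ~= {}"
    then obtain t where t0: "t \<in> {0..1}" "t \<in> pos" "t \<in> neg" by blast
    obtain j where j: "j \<in> {0..n}" "c t \<in> Q j" "sg j t \<ge> 0" using t0(2) unfolding pos_def by blast
    obtain k where k: "k \<in> {0..n}" "c t \<in> Q k" "sg k t <= 0" using t0(3) unfolding neg_def by blast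
    note t = t0(1) j(1) k(1) j(2) k(2) j(3) k(3)
    show False using t(6,7) agree[OF t(1-5)] nz[OF t(1,2,4)] nz[OF t(1,3,5)] by auto
  qed
  have "F 0 x0 = x0" by (simp add: I(2))
  have tr0: "tr (F 0) = (x0, hx)" by (rule trans[OF _ fp]) (simp only: I(2) tr_id)
  have tr0': "W.tr (F 0) = (x0, hy)" by (simp only: I(2) W.tr_id)
  have c0: "c 0 = x0" "A 0 = hx" "B 0 = hy" using tr0 tr0' unfolding tA tB by (simp_all only: prod.inject)
  have "sg 0 0 = 1" by (simp add: sg_def Z_def c0)
  then have "0 \<in> pos" using x0f c0(1) unfolding pos_def Q_def by (auto intro!: bexI[of _ 0])
  then have "pos \<inter> {0..1} ~= {}" by auto
  then have "neg \<inter> {0..1} = {}"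
    using connected_closed[of "{0..1::real}"] cl cover disjoint connected_Icc by blast
  have c1: "c 1 = x0" "A 1 = hx" using trans[OF F1 fp] unfolding tA by (simp_all only: prod.inject)
  have "1 \<in> neg" if "sg 0 1 <= 0" unfolding neg_def by (rule UN_I[of 0]) (use that x0f c1(1) in \<open>simp_all add: Q_def\<close>)
  then have "\<not> sg 0 1 <= 0" using \<open>neg \<inter> {0..1} = {}\<close> by auto
  \<comment> \<open>At the end the point is \<open>x0\<close> and the first vector
    \<open>hx\<close>, so the comparison is the second coordinate of the image of \<open>hy\<close>:
    a positive multiple of the entry that defines \<open>ori\<close>.\<close>
  then have "fst (snd (B 1)) > 0" by (simp add: sg_def Z_def c1 gram_def inner_prod_def)
  moreover have "B 1 = dch 0 (D0 (F 1) (0, 1)) /\<^sub>R norm (dch 0 (D0 (F 1) (0, 1)))"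
  proof -
    have d: "F 1 \<in> diffeos ?M ?B" using smooth_isotopyD(1)[OF I(1)] by simp
    have "F 1 (dc n 0) = dc n 0" using c1(1) by (simp add: ch0 c_def)
    from rep_deriv(2)[OF d this, of "(0, 1)"] have "dif ?M (F 1) x0 hy = dch 0 (D0 (F 1) (0, 1))" by (simp add: ch0 dch_eq)
    then show ?thesis by (simp add: B_def W.tr_def act_eq)
  qed
  ultimately have "0 < snd (D0 (F 1) (0, 1)) / norm (dch 0 (D0 (F 1) (0, 1)))" by (simp add: dch_eq divide_inverse mult.commute)
  then show ?thesis unfolding ori_def by (simp add: zero_less_divide_iff)
qed

end

section \<open>Framed braids and the push map\<close>

lemma path_class_mem: "h \<in> path_class X g \<longleftrightarrow> homotopic_paths X g h"
  by (simp add: path_class_def)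

lemma path_class_eq: "homotopic_paths X g h ==> path_class X g = path_class X h"
  unfolding path_class_def by (intro Collect_cong iffI) (metis homotopic_paths_trans homotopic_paths_sym)+

lemma loops_atD:
  assumes "g \<in> loops_at X p"
  shows "path g" "path_image g <= X" "pathstart g = p" "pathfinish g = p" "t \<in> {0..1} ==> g t \<in> X" "g 0 = p" "g 1 = p"
  using assms by (auto simp: loops_at_def path_image_def pathstart_def pathfinish_def)

lemma path_class_self: "g \<in> loops_at X p ==> g \<in> path_class X g"
  unfolding path_class_mem homotopic_paths_refl using loops_atD by blast

lemma loops_at_homotopic:
  assumes g: "g \<in> loops_at X p" and h: "homotopic_paths X g h" shows "h \<in> loops_at X p"
  using loops_atD[OF g] homotopic_paths_imp_path[OF h] homotopic_paths_imp_subset[OF h]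
    homotopic_paths_imp_pathstart[OF h] homotopic_paths_imp_pathfinish[OF h] by (simp add: loops_at_def)

lemma loops_at_join: "g \<in> loops_at X p ==> h \<in> loops_at X p ==> g +++ h \<in> loops_at X p"
  by (simp add: loops_at_def path_image_join)

lemma loops_at_const: "p \<in> X ==> (\<lambda>_. p) \<in> loops_at X p"
  by (auto simp: loops_at_def path_def path_image_def pathstart_def pathfinish_def)

lemma loops_at_reverse: "g \<in> loops_at X p ==> reversepath g \<in> loops_at X p"
  by (simp add: loops_at_def)

lemma UN2_constant: "(!!a b. a \<in> A ==> b \<in> B ==> H a b = C) ==> a \<in> A ==> b \<in> B ==> (\<Union>a\<in>A. \<Union>b\<in>B. H a b) = C"
  by auto

lemma UN1_constant: "(!!a. a \<in> A ==> H a = C) ==> a \<in> A ==> (\<Union>a\<in>A. H a) = C"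
  by auto

lemma fundamental_group_mult:
  assumes g: "g \<in> loops_at X p" and h: "h \<in> loops_at X p"
  shows "path_class X g \<otimes>\<^bsub>fundamental_group X p\<^esub> path_class X h = path_class X (h +++ g)"
proof -
  have "path_class X (h' +++ g') = path_class X (h +++ g)" if g': "g' \<in> path_class X g" and h': "h' \<in> path_class X h" for g' h'
  proof (rule path_class_eq[symmetric])
    show "homotopic_paths X (h +++ g) (h' +++ g')"
      by (rule homotopic_paths_join[OF h'[unfolded path_class_mem] g'[unfolded path_class_mem]])
        (simp add: loops_atD(3)[OF g] loops_atD(4)[OF h])
  qed
  from UN2_constant[of "path_class X g" "path_class X h" "\<lambda>g h. path_class X (h +++ g)", OF this path_class_self[OF g] path_class_self[OF h]]
  show ?thesis by (simp add: fundamental_group_def)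
qed

lemma fundamental_group_group:
  fixes p :: "'a::real_normed_vector"
  assumes p: "p \<in> X" shows "group (fundamental_group X p)"
proof -
  let ?G = "fundamental_group X p"
  have C: "carrier ?G = path_class X ` loops_at X p" "\<one>\<^bsub>?G\<^esub> = path_class X (\<lambda>_. p)" by (simp_all add: fundamental_group_def)
  show ?thesis
  proof (rule groupI)
    fix x y assume "x \<in> carrier ?G" "y \<in> carrier ?G"
    then obtain g h where gh: "g \<in> loops_at X p" "x = path_class X g" "h \<in> loops_at X p" "y = path_class X h" unfolding C by blast
    show "x \<otimes>\<^bsub>?G\<^esub> y \<in> carrier ?G"
      unfolding gh(2,4) fundamental_group_mult[OF gh(1,3)] C using loops_at_join[OF gh(3,1)] by blast
  next
    show "\<one>\<^bsub>?G\<^esub> \<in> carrier ?G" unfolding C using loops_at_const[OF p] by blast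
  next
    fix x y z assume "x \<in> carrier ?G" "y \<in> carrier ?G" "z \<in> carrier ?G"
    then obtain f g h where fgh: "f \<in> loops_at X p" "x = path_class X f" "g \<in> loops_at X p" "y = path_class X g"
      "h \<in> loops_at X p" "z = path_class X h" unfolding C by blast
    note F = loops_atD[OF fgh(1)] and G = loops_atD[OF fgh(3)] and H = loops_atD[OF fgh(5)]
    have "homotopic_paths X (h +++ (g +++ f)) ((h +++ g) +++ f)"
      by (rule homotopic_paths_assoc) (use F G H in simp_all)
    from path_class_eq[OF this] show "x \<otimes>\<^bsub>?G\<^esub> y \<otimes>\<^bsub>?G\<^esub> z = x \<otimes>\<^bsub>?G\<^esub> (y \<otimes>\<^bsub>?G\<^esub> z)"
      unfolding fgh(2,4,6) by (simp add: fundamental_group_mult loops_at_join fgh(1,3,5))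
  next
    fix x assume "x \<in> carrier ?G"
    then obtain g where g: "g \<in> loops_at X p" "x = path_class X g" unfolding C by blast
    note G = loops_atD[OF g(1)]
    have "homotopic_paths X (g +++ (\<lambda>_. p)) g"
      using homotopic_paths_rid[OF G(1,2)] unfolding G(4) linepath_refl .
    from path_class_eq[OF this] show "\<one>\<^bsub>?G\<^esub> \<otimes>\<^bsub>?G\<^esub> x = x"
      unfolding C g(2) by (simp add: fundamental_group_mult loops_at_const p g(1))
    have "homotopic_paths X (g +++ reversepath g) (\<lambda>_. p)"
      using homotopic_paths_rinv[OF G(1,2)] unfolding G(3) linepath_refl .
    from path_class_eq[OF this] have "path_class X (reversepath g) \<otimes>\<^bsub>?G\<^esub> x = \<one>\<^bsub>?G\<^esub>"
      unfolding C g(2) by (simp add: fundamental_group_mult loops_at_reverse g(1))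
    then show "\<exists>y\<in>carrier ?G. y \<otimes>\<^bsub>?G\<^esub> x = \<one>\<^bsub>?G\<^esub>"
      unfolding C(1) using loops_at_reverse[OF g(1)] by blast
  qed
qed

context plug
begin

lemma surf_left: "p \<in> surf P n ==> - real n <= fst p"
proof -
  assume p: "p \<in> surf P n"
  obtain x y z where q: "p = (x, y, z)" by (cases p)
  show ?thesis
  proof (cases "p \<in> plugs P {1..n}")
    case True
    then obtain k where "k \<in> {1..n}" "mg - real k <= x" unfolding q by (rule plugs_coord)
    then show ?thesis using mg(1) q by auto
  qed (use p q in \<open>auto simp: surf_eq flat_def\<close>)
qed

lemma Gamma1_group: "group (Gamma1 P n)"
  unfolding Gamma1_def by (rule mapping_class_group_group)

lemma Gamma1_carrier: "carrier (Gamma1 P n) = isotopy_class (surf P n) (strip_boundary n) ` diffeos (surf P n) (strip_boundary n)"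
  and Gamma1_one: "\<one>\<^bsub>Gamma1 P n\<^esub> = isotopy_class (surf P n) (strip_boundary n) id"
  by (simp_all add: Gamma1_def mcg_carrier mcg_one)

lemma Gamma1_mult:
  assumes "f \<in> diffeos (surf P n) (strip_boundary n)" "g \<in> diffeos (surf P n) (strip_boundary n)"
  shows "isotopy_class (surf P n) (strip_boundary n) f \<otimes>\<^bsub>Gamma1 P n\<^esub> isotopy_class (surf P n) (strip_boundary n) g =
    isotopy_class (surf P n) (strip_boundary n) (f \<circ> g)"
  unfolding Gamma1_def by (rule mcg_mult[OF assms])

lemma id_torus_bsum_class:
  assumes "f \<in> diffeos (surf P n) (strip_boundary n)"
  shows "id_torus_bsum P n (isotopy_class (surf P n) (strip_boundary n) f) = isotopy_class (surf P (Suc n)) (strip_boundary (Suc n)) f"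
    "f \<in> diffeos (surf P (Suc n)) (strip_boundary (Suc n))"
  using surface_ext.extend_class[OF ext_surf assms] surface_ext.diffeos_sub[OF ext_surf assms]
  by (simp_all only: id_torus_bsum_def torus_eq)

text \<open>Extension by the identity leaves the representing functions unchanged, so products are
  represented by the same composites on both sides.\<close>

lemma id_torus_bsum_hom: "id_torus_bsum P n \<in> hom (Gamma1 P n) (Gamma1 P (Suc n))"
proof (rule homI)
  fix x y assume "x \<in> carrier (Gamma1 P n)" "y \<in> carrier (Gamma1 P n)"
  then obtain f g where fg: "f \<in> diffeos (surf P n) (strip_boundary n)" "g \<in> diffeos (surf P n) (strip_boundary n)"
    "x = isotopy_class (surf P n) (strip_boundary n) f" "y = isotopy_class (surf P n) (strip_boundary n) g" unfolding Gamma1_carrier by blast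
  show "id_torus_bsum P n x \<in> carrier (Gamma1 P (Suc n))"
    unfolding fg(3) Gamma1_carrier id_torus_bsum_class(1)[OF fg(1)] using id_torus_bsum_class(2)[OF fg(1)] by blast
  show "id_torus_bsum P n (x \<otimes>\<^bsub>Gamma1 P n\<^esub> y) = id_torus_bsum P n x \<otimes>\<^bsub>Gamma1 P (Suc n)\<^esub> id_torus_bsum P n y"
    unfolding fg(3,4) Gamma1_mult[OF fg(1,2)] id_torus_bsum_class(1)[OF fg(1)] id_torus_bsum_class(1)[OF fg(2)]
      id_torus_bsum_class(1)[OF comp_diffeos[OF fg(1,2)]] Gamma1_mult[OF id_torus_bsum_class(2)[OF fg(1)] id_torus_bsum_class(2)[OF fg(2)]] ..
qed

end

section \<open>The action on framed braids, and push lifts up to isotopy\<close>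

context capped_plug
begin

abbreviation LT where "LT \<equiv> loops_at UT (framed_point n)"
abbreviation LX where "LX \<equiv> loops_at (utb_inner Cp Bd) (framed_point n)"
abbreviation Dsurf where "Dsurf \<equiv> diffeos (surf P n) (strip_boundary n)"
abbreviation Dcap where "Dcap \<equiv> diffeos Cp Bd"
abbreviation Dann where "Dann \<equiv> diffeos (bsum P annulus n) (bd2 n)"
abbreviation cls where "cls \<equiv> isotopy_class (surf P n) (strip_boundary n)"
abbreviation cls' where "cls' \<equiv> isotopy_class (surf P (Suc n)) Bd"

lemma FP1_group: "group (FP1 P n)"
  unfolding FP1_def by (rule fundamental_group_group[OF v0_utb])

lemma FP1_carrier: "carrier (FP1 P n) = path_class UT ` LT"
  and FP1_one: "\<one>\<^bsub>FP1 P n\<^esub> = path_class UT (\<lambda>_. framed_point n)"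
  and FP1_mult: "g \<in> LT ==> h \<in> LT ==> path_class UT g \<otimes>\<^bsub>FP1 P n\<^esub> path_class UT h = path_class UT (h +++ g)"
  by (simp_all only: FP1_def fundamental_group_mult) (simp_all add: fundamental_group_def)

lemma Dsurf_cap: "f \<in> Dsurf ==> f \<in> Dcap"
  by (rule surface_ext.diffeos_sub[OF ext_capped])

text \<open>The chart disc lies in the added square, to the left of the smaller surface, where the
  map is the identity. In particular the framed point is fixed and the action preserves based
  loops.\<close>

lemma Dsurf_fix:
  assumes f: "f \<in> Dsurf" shows "fix_disc (1/2) f"
  unfolding fix_disc_def
proof (intro allI impI)
  fix y :: R2 assume y: "norm y < 1/2"
  have "dc n y \<in> dnb n (1/2)" unfolding dc_norm using y by (intro power_strict_mono) auto
  then have "fst (dc n y) < - real n" using dnb_coord[of "fst (dc n y)" "fst (snd (dc n y))" "snd (snd (dc n y))" n] by simp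
  then have "dc n y \<notin> surf P n" using surf_left[of "dc n y" n] by auto
  then show "f (dc n y) = dc n y" by (rule diffeosD(5)[OF f])
qed

lemma act_base: "f \<in> Dsurf ==> act Cp f (framed_point n) = framed_point n"
  using fix_disc_tr(1)[OF Dsurf_cap Dsurf_fix] by (simp add: tr_def)

lemma act_homotopic:
  assumes f: "f \<in> Dsurf" and gh: "homotopic_paths UT g h"
  shows "homotopic_paths UT (act Cp f \<circ> g) (act Cp f \<circ> h)"
  by (rule homotopic_paths_continuous_image[OF gh act_continuous[OF Dsurf_cap[OF f]]]) (rule Pi_I, rule act_in[OF Dsurf_cap[OF f]])

lemma act_loop:
  assumes f: "f \<in> Dsurf" and g: "g \<in> LT" shows "act Cp f \<circ> g \<in> LT"
proof -
  note G = loops_atD[OF g]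
  have "path (act Cp f \<circ> g)"
    by (rule path_continuous_image[OF G(1) continuous_on_subset[OF act_continuous[OF Dsurf_cap[OF f]] G(2)]])
  then show ?thesis
    by (rule loops_atI) (simp_all add: G(6,7) act_base[OF f] act_in[OF Dsurf_cap[OF f] G(5)])
qed

text \<open>The isotopy moves the loop through based loops, since each of its stages fixes the
  framed point.\<close>

lemma act_isotopic:
  assumes i: "isotopic (surf P n) (strip_boundary n) f f'" and g: "g \<in> LT"
  shows "homotopic_paths UT (act Cp f \<circ> g) (act Cp f' \<circ> g)"
proof -
  obtain F where F: "smooth_isotopy (surf P n) (strip_boundary n) F" "F 0 = f" "F 1 = f'" using i unfolding isotopic_def by blast
  note FM = surface_ext.isotopy[OF ext_capped F(1)]
  note G = loops_atD[OF g]
  let ?h = "\<lambda>z. act Cp (F (fst z)) (g (snd z))"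
  have c: "continuous_on ({0..1} \<times> UT) (\<lambda>(t, a). act Cp (F t) a)"
    by (rule smooth_on_imp_continuous_on[OF act_smooth[OF smooth_isotopyD(2)[OF FM] smooth_isotopyD(1)[OF FM]]])
  have cg: "continuous_on ({0..1} \<times> {0..1}) (\<lambda>z. (fst z, g (snd z)))"
    by (intro continuous_intros continuous_on_compose2[OF G(1)[unfolded path_def]]) auto
  have sub: "(\<lambda>z. (fst z, g (snd z))) ` ({0..1} \<times> {0..1}) <= {0..1} \<times> UT"
    by (rule image_subsetI) (simp add: mem_Times_iff G(5))
  have 1: "continuous_on ({0..1} \<times> {0..1}) ?h" using continuous_on_compose2[OF c cg sub] by (simp only: prod.case)
  have 2: "?h \<in> ({0..1} \<times> {0..1}) \<rightarrow> UT"
    by (rule Pi_I, rule act_in[OF smooth_isotopyD(1)[OF FM] G(5)]) (simp_all add: mem_Times_iff)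
  have 3: "\<forall>x\<in>{0..1}. ?h (0, x) = (act Cp f \<circ> g) x" "\<forall>x\<in>{0..1}. ?h (1, x) = (act Cp f' \<circ> g) x"
    by (simp_all add: F(2,3))
  have 4: "\<forall>t\<in>{0..1}. pathstart (?h \<circ> Pair t) = pathstart (act Cp f \<circ> g) \<and> pathfinish (?h \<circ> Pair t) = pathfinish (act Cp f \<circ> g)"
  proof
    fix t :: real assume t: "t \<in> {0..1}"
    show "pathstart (?h \<circ> Pair t) = pathstart (act Cp f \<circ> g) \<and> pathfinish (?h \<circ> Pair t) = pathfinish (act Cp f \<circ> g)"
      using act_base[OF smooth_isotopyD(1)[OF F(1) t]] act_base[OF conjunct1[OF isotopic_diffeos[OF i]]]
      by (simp add: pathstart_def pathfinish_def G(6,7))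
  qed
  show ?thesis unfolding homotopic_paths using 1 2 3 4 by blast
qed

lemma FP1_map_eq:
  assumes f: "f \<in> Dsurf" and g: "g \<in> LT"
  shows "FP1_map P n (cls f) (path_class UT g) = path_class UT (act Cp f \<circ> g)"
proof -
  have "path_class UT (act Cp f' \<circ> g') = path_class UT (act Cp f \<circ> g)"
    if f': "f' \<in> cls f" and g': "g' \<in> path_class UT g" for f' g'
  proof (rule path_class_eq[symmetric])
    note gg = g'[unfolded path_class_mem]
    show "homotopic_paths UT (act Cp f \<circ> g) (act Cp f' \<circ> g')"
      by (rule homotopic_paths_trans[OF act_homotopic[OF f gg] act_isotopic[OF isotopy_class_mem[OF f'] loops_at_homotopic[OF g gg]]])
  qed
  from UN2_constant[of "cls f" "path_class UT g" "\<lambda>f g. path_class UT (act Cp f \<circ> g)", OF this isotopy_class_self[OF f] path_class_self[OF g]]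
  show ?thesis unfolding FP1_map_def .
qed

lemma FP1_map_hom:
  assumes phi: "phi \<in> carrier (Gamma1 P n)" shows "FP1_map P n phi \<in> hom (FP1 P n) (FP1 P n)"
proof -
  obtain f where f: "f \<in> Dsurf" "phi = cls f" using phi unfolding Gamma1_carrier by blast
  show ?thesis
  proof (rule homI)
    fix x y assume "x \<in> carrier (FP1 P n)" "y \<in> carrier (FP1 P n)"
    then obtain g h where gh: "g \<in> LT" "h \<in> LT" "x = path_class UT g" "y = path_class UT h" unfolding FP1_carrier by blast
    show "FP1_map P n phi x \<in> carrier (FP1 P n)"
      unfolding f(2) gh(3) FP1_map_eq[OF f(1) gh(1)] FP1_carrier using act_loop[OF f(1) gh(1)] by blast
    show "FP1_map P n phi (x \<otimes>\<^bsub>FP1 P n\<^esub> y) = FP1_map P n phi x \<otimes>\<^bsub>FP1 P n\<^esub> FP1_map P n phi y"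
      unfolding f(2) gh(3,4) FP1_mult[OF gh(1,2)] FP1_map_eq[OF f(1) gh(1)] FP1_map_eq[OF f(1) gh(2)]
        FP1_map_eq[OF f(1) loops_at_join[OF gh(2,1)]] FP1_mult[OF act_loop[OF f(1) gh(1)] act_loop[OF f(1) gh(2)]]
        path_compose_join ..
  qed
qed

lemma FP1_map_id: "x \<in> carrier (FP1 P n) ==> FP1_map P n \<one>\<^bsub>Gamma1 P n\<^esub> x = x"
proof -
  assume "x \<in> carrier (FP1 P n)"
  then obtain g where g: "g \<in> LT" "x = path_class UT g" unfolding FP1_carrier by blast
  note G = loops_atD[OF g(1)]
  have "homotopic_paths UT g (act Cp id \<circ> g)"
    by (rule homotopic_paths_eq[OF G(1,2)]) (simp add: act_id G(5))
  then show ?thesis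
    unfolding g(2) Gamma1_one FP1_map_eq[OF id_diffeos g(1)] using path_class_eq by metis
qed

lemma FP1_map_comp:
  assumes "phi \<in> carrier (Gamma1 P n)" "psi \<in> carrier (Gamma1 P n)" "x \<in> carrier (FP1 P n)"
  shows "FP1_map P n (psi \<otimes>\<^bsub>Gamma1 P n\<^esub> phi) x = FP1_map P n psi (FP1_map P n phi x)"
proof -
  obtain f f' where f: "f \<in> Dsurf" "phi = cls f" "f' \<in> Dsurf" "psi = cls f'" using assms unfolding Gamma1_carrier by blast
  obtain g where g: "g \<in> LT" "x = path_class UT g" using assms(3) unfolding FP1_carrier by blast
  note G = loops_atD[OF act_loop[OF f(3) act_loop[OF f(1) g(1)]]]
  have "homotopic_paths UT (act Cp f' \<circ> (act Cp f \<circ> g)) (act Cp (f' \<circ> f) \<circ> g)"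
    by (rule homotopic_paths_eq[OF G(1,2)]) (simp add: act_comp[OF Dsurf_cap[OF f(3)] Dsurf_cap[OF f(1)]] loops_atD(5)[OF g(1)])
  from path_class_eq[OF this] show ?thesis
    unfolding f(2,4) g(2) Gamma1_mult[OF f(3,1)] FP1_map_eq[OF f(1) g(1)] FP1_map_eq[OF f(3) act_loop[OF f(1) g(1)]]
      FP1_map_eq[OF comp_diffeos[OF f(3,1)] g(1)] by simp
qed

lemma push_lift_iff:
  "push_lift P n h F \<longleftrightarrow> lift F \<and> F 1 \<in> Dann \<and> (\<lambda>t. tr (F t)) \<in> h"
  by (auto simp: push_lift_def lift_def tr_def)

lemma tr_loop:
  assumes F: "lift F" "tr (F 1) = framed_point n" shows "(\<lambda>t. tr (F t)) \<in> LX"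
proof -
  have I: "smooth_isotopy Cp Bd F" "F 0 = id" using F by (auto simp: lift_def)
  show ?thesis
    by (rule loops_atI[OF path_tr[OF I(1)]]) (simp_all add: tr_X[OF smooth_isotopyD(1)[OF I(1)]] I(2) tr_id F(2))
qed

lemma Dann_tr:
  assumes f: "f \<in> Dann" shows "tr f = framed_point n"
proof -
  obtain r where "r > 1/4" "fix_disc r f" using gamma2_fix_disc[OF f] by blast
  then show ?thesis using fix_disc_tr(1)[OF gamma2_capped[OF f], of r] by simp
qed

lemma lift_1: "lift F ==> F 1 \<in> Dcap"
  unfolding lift_def using smooth_isotopyD(1)[of "Cp" "Bd" F 1] by simp

text \<open>The map \<open>?Q\<close> is defined on the square of two independent times. Two
  successive sides of the square give the concatenation of the traces, the diagonal gives the trace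
  of the composite, and in a convex square these two paths are homotopic.\<close>

lemma trace_comp:
  assumes F: "lift F" and G: "lift G" and F1: "tr (F 1) = framed_point n"
  shows "homotopic_paths X ((\<lambda>t. tr (F t)) +++ (\<lambda>t. tr (G t))) (\<lambda>t. tr (G t \<circ> F t))"
proof -
  let ?M = "Cp" and ?B = "Bd"
  have I: "smooth_isotopy ?M ?B F" "F 0 = id" "smooth_isotopy ?M ?B G" "G 0 = id" using F G by (auto simp: lift_def)
  have X: "X <= UT" using X_utb by blast
  have trX: "tr (F t) \<in> X" if "t \<in> {0..1}" for t by (rule tr_X[OF smooth_isotopyD(1)[OF I(1) that]])
  let ?Q = "\<lambda>z :: real \<times> real. act ?M (G (fst z)) (tr (F (snd z)))"
  let ?S = "{0..1} \<times> {0..1} :: (real \<times> real) set"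
  let ?p = "linepath (0, 0) (0, 1) +++ linepath (0, 1) (1, 1 :: real) :: real => real \<times> real"
  let ?q = "linepath (0, 0) (1, 1) :: real => real \<times> real"
  have c: "continuous_on ({0..1} \<times> UT) (\<lambda>(t, a). act ?M (G t) a)"
    by (rule smooth_on_imp_continuous_on[OF act_smooth[OF smooth_isotopyD(2)[OF I(3)] smooth_isotopyD(1)[OF I(3)]]])
  have trU: "tr (F t) \<in> UT" if "t \<in> {0..1}" for t by (rule subsetD[OF X trX[OF that]])
  have trG: "tr (G s) = act ?M (G s) (framed_point n)" for s by (simp add: tr_def)
  have cg: "continuous_on ?S (\<lambda>z. (fst z, tr (F (snd z))))"
    by (intro continuous_intros continuous_on_compose2[OF path_tr[OF I(1), unfolded path_def]]) auto
  have sub: "(\<lambda>z. (fst z, tr (F (snd z)))) ` ?S <= {0..1} \<times> UT"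
    by (rule image_subsetI) (simp add: mem_Times_iff trU)
  have cQ: "continuous_on ?S ?Q" using continuous_on_compose2[OF c cg sub] by (simp only: prod.case)
  have QX: "?Q \<in> ?S \<rightarrow> X"
    by (rule Pi_I, rule act_X[OF smooth_isotopyD(1)[OF I(3)] trX]) (simp_all add: mem_Times_iff)
  have cv: "convex ?S" by (intro convex_Times) auto
  have sg: "path_image (linepath a b) <= ?S" if "a \<in> ?S" "b \<in> ?S" for a b
    using closed_segment_subset[OF that cv] by simp
  have "homotopic_paths ?S ?p ?q"
  proof -
    have "simply_connected ?S" by (rule convex_imp_simply_connected[OF cv])
    moreover have "path_image ?p <= ?S" by (rule order_trans[OF path_image_join_subset]) (use sg in simp)
    moreover have "path_image ?q <= ?S" by (rule sg) simp_all
    ultimately show ?thesis unfolding simply_connected_eq_homotopic_paths by (simp del: path_image_linepath)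
  qed
  from homotopic_paths_continuous_image[OF this cQ QX]
  have h: "homotopic_paths X (?Q \<circ> ?p) (?Q \<circ> ?q)" .
  have "(?Q \<circ> ?p) t = ((\<lambda>t. tr (F t)) +++ (\<lambda>t. tr (G t))) t" if t: "t \<in> {0..1}" for t
  proof (cases "t <= 1/2")
    case True
    then have "tr (F (2 * t)) \<in> UT" using t by (intro trU) auto
    then show ?thesis using True by (simp add: joinpaths_def linepath_def I(4) act_id)
  next
    case False
    then show ?thesis by (simp add: joinpaths_def linepath_def F1 trG)
  qed
  then have 1: "homotopic_paths X (?Q \<circ> ?p) ((\<lambda>t. tr (F t)) +++ (\<lambda>t. tr (G t)))"
    using homotopic_paths_imp_path[OF h] homotopic_paths_imp_subset[OF h] by (intro homotopic_paths_eq) simp_all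
  have "(?Q \<circ> ?q) t = tr (G t \<circ> F t)" if t: "t \<in> {0..1}" for t
    using tr_comp[OF smooth_isotopyD(1)[OF I(3) t] smooth_isotopyD(1)[OF I(1) t]] by (simp add: linepath_def)
  then have 2: "homotopic_paths X (?Q \<circ> ?q) (\<lambda>t. tr (G t \<circ> F t))"
    using homotopic_paths_imp_path[OF h] homotopic_paths_imp_subset[OF h] by (intro homotopic_paths_eq) simp_all
  show ?thesis using homotopic_paths_trans[OF homotopic_paths_sym[OF 1] homotopic_paths_trans[OF h 2]] .
qed

lemma lift_comp: "lift F ==> lift G ==> lift (\<lambda>t. G t \<circ> F t)"
  using smooth_isotopy_comp by (auto simp: lift_def)

text \<open>The loop is retracted into the interior before it is lifted. By \<open>lift_ori\<close>
  the end can be straightened, and the fixed radius 3/10 exceeds 1/4, so the end restricts to the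
  surface without the capping disc.\<close>

lemma push_lift_exists:
  assumes g: "g \<in> LT" obtains F where "push_lift P n (path_class UT g) F"
proof -
  obtain g' where g': "g' \<in> LX" "homotopic_paths UT g g'" using loop_in_X[OF g] by blast
  note G = loops_atD[OF g'(1)]
  obtain F where F: "lift F" "tr (F 1) = pathfinish g'" "homotopic_paths X g' (\<lambda>t. tr (F t))"
    by (rule lift_exists[OF G(1,2,3) zero_less_one]) (rule that)
  have F1: "tr (F 1) = framed_point n" using F(2) G(4) by simp
  obtain F' where F': "lift F'" "fix_disc (3/10) (F' 1)" "homotopic_paths X (\<lambda>t. tr (F t)) (\<lambda>t. tr (F' t))"
    using lift_end[OF F(1) F1 lift_ori[OF F(1) F1]] by blast
  have "F' 1 \<in> Dcap" by (rule lift_1[OF F'(1)])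
  then have D: "F' 1 \<in> Dann" by (rule fix_disc_gamma2[OF _ F'(2)]) simp
  have "homotopic_paths UT g' (\<lambda>t. tr (F' t))"
    by (rule homotopic_paths_subset[OF homotopic_paths_trans[OF F(3) F'(3)]]) (use X_utb in blast)
  then have "(\<lambda>t. tr (F' t)) \<in> path_class UT g" unfolding path_class_mem by (rule homotopic_paths_trans[OF g'(2)])
  then show thesis using that F'(1) D unfolding push_lift_iff by blast
qed

text \<open>A lift \<open>H\<close> of the reversed trace is composed with each of the two lifts.
  Both composites have null homotopic traces, so their ends are fibre isotopic to the identity.
  Cancelling \<open>H 1\<close> leaves a fibre isotopy between the two ends, which
  \<open>fiso_disc_iso\<close> improves to one that fixes a disc.\<close>

lemma push_lift_unique:
  assumes F: "lift F" "F 1 \<in> Dann" and F': "lift F'" "F' 1 \<in> Dann"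
    and h: "homotopic_paths UT (\<lambda>t. tr (F t)) (\<lambda>t. tr (F' t))"
  shows "isotopic (bsum P annulus n) (bd2 n) (F 1) (F' 1)"
proof -
  note L = tr_loop[OF F(1) Dann_tr[OF F(2)]] and L' = tr_loop[OF F'(1) Dann_tr[OF F'(2)]]
  have hX: "homotopic_paths X (\<lambda>t. tr (F t)) (\<lambda>t. tr (F' t))" by (rule homotopic_in_X[OF L L' h])
  note R = loops_atD[OF loops_at_reverse[OF L]]
  obtain H where H: "lift H" "homotopic_paths X (reversepath (\<lambda>t. tr (F t))) (\<lambda>t. tr (H t))"
    by (rule lift_exists[OF R(1-3) zero_less_one]) (rule that)
  have null: "fiso (H 1 \<circ> K 1) id" if K: "lift K" "K 1 \<in> Dann" "homotopic_paths X (\<lambda>t. tr (F t)) (\<lambda>t. tr (K t))" for K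
  proof (rule null_homotopic_lift[OF lift_comp[OF K(1) H(1)]])
    note KL = loops_atD[OF tr_loop[OF K(1) Dann_tr[OF K(2)]]]
    have "homotopic_paths X ((\<lambda>t. tr (K t)) +++ (\<lambda>t. tr (H t))) ((\<lambda>t. tr (F t)) +++ reversepath (\<lambda>t. tr (F t)))"
      by (rule homotopic_paths_join[OF homotopic_paths_sym[OF K(3)] homotopic_paths_sym[OF H(2)]])
        (use KL(4) homotopic_paths_imp_pathstart[OF H(2)] R(3) in simp)
    note 1 = this
    have 2: "homotopic_paths X ((\<lambda>t. tr (F t)) +++ reversepath (\<lambda>t. tr (F t))) (\<lambda>_. framed_point n)"
      using homotopic_paths_rinv[OF loops_atD(1,2)[OF L]] unfolding loops_atD(3)[OF L] linepath_refl .
    show "homotopic_paths X (\<lambda>t. tr (H t \<circ> K t)) (\<lambda>t. framed_point n)"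
      by (rule homotopic_paths_trans[OF homotopic_paths_sym[OF trace_comp[OF K(1) H(1) Dann_tr[OF K(2)]]] homotopic_paths_trans[OF 1 2]])
  qed
  have Fr: "homotopic_paths X (\<lambda>t. tr (F t)) (\<lambda>t. tr (F t))" unfolding homotopic_paths_refl using loops_atD(1,2)[OF L] by blast
  have "fiso (H 1 \<circ> F 1) (H 1 \<circ> F' 1)" by (rule fiso_trans[OF null[OF F Fr] fiso_sym[OF null[OF F' hX]]])
  note HF = this
  have H1: "H 1 \<in> Dcap" by (rule lift_1[OF H(1)])
  have "fiso (finv (H 1) \<circ> (H 1 \<circ> F 1)) (finv (H 1) \<circ> (H 1 \<circ> F' 1))" by (rule fiso_comp_left[OF inv_diffeos[OF H1] HF])
  then have f: "fiso (F 1) (F' 1)" using diffeos_inv_simps(3)[OF H1] by (simp add: o_assoc)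
  obtain r where r: "r > 1/4" "fix_disc r (F 1)" using gamma2_fix_disc[OF F(2)] by blast
  obtain r' where r': "r' > 1/4" "fix_disc r' (F' 1)" using gamma2_fix_disc[OF F'(2)] by blast
  have "disc_iso (F 1) (F' 1)"
    by (rule fiso_disc_iso[OF f, of "min r r'"]) (use r r' in \<open>simp_all add: fix_disc_def\<close>)
  then show ?thesis by (rule disc_iso_isotopic)
qed

text \<open>\<open>Push\<close> unites the classes of the ends of all lifts of the braid; by
  uniqueness they coincide, so one lift suffices to compute the value.\<close>

lemma chi_fr_class:
  assumes n: "n ~= 0" and g: "g \<in> LT" and F: "push_lift P n (path_class UT g) F"
  shows "chi_fr P n (path_class UT g) = cls' (F 1)" "F 1 \<in> diffeos (surf P (Suc n)) Bd"
proof -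
  have F': "lift F" "F 1 \<in> Dann" "homotopic_paths UT g (\<lambda>t. tr (F t))"
    using F unfolding push_lift_iff path_class_mem by auto
  have e: "isotopy_class (bsum P annulus n) (bd2 n) (K 1) = isotopy_class (bsum P annulus n) (bd2 n) (F 1)"
    if "push_lift P n (path_class UT g) K" for K
  proof (rule isotopy_class_eq, rule push_lift_unique)
    have K: "lift K" "K 1 \<in> Dann" "homotopic_paths UT g (\<lambda>t. tr (K t))"
      using that unfolding push_lift_iff path_class_mem by auto
    show "lift K" "K 1 \<in> Dann" "lift F" "F 1 \<in> Dann" using K F' by auto
    show "homotopic_paths UT (\<lambda>t. tr (K t)) (\<lambda>t. tr (F t))"
      by (rule homotopic_paths_trans[OF homotopic_paths_sym[OF K(3)] F'(3)])
  qed
  have "Push P n (path_class UT g) = isotopy_class (bsum P annulus n) (bd2 n) (F 1)"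
    unfolding Push_def
  proof (rule UN1_constant[where a = F])
    show "F \<in> {F. push_lift P n (path_class UT g) F}" using F by simp
    fix K assume "K \<in> {F. push_lift P n (path_class UT g) F}"
    then show "isotopy_class (bsum P annulus n) (bd2 n) (K 1) = isotopy_class (bsum P annulus n) (bd2 n) (F 1)"
      unfolding mem_Collect_eq by (rule e)
  qed
  then show "chi_fr P n (path_class UT g) = cls' (F 1)"
    using n surface_ext.extend_class[OF ext_annulus_surf F'(2)] by (simp only: chi_fr_def id_torus_glue_def torus_eq if_False)
  show "F 1 \<in> diffeos (surf P (Suc n)) Bd" by (rule surface_ext.diffeos_sub[OF ext_annulus_surf F'(2)])
qed

lemma chi_fr_hom: "chi_fr P n \<in> hom (FP1 P n) (Gamma1 P (Suc n))"
proof (cases "n = 0")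
  case True
  interpret G: group "Gamma1 P (Suc n)" by (rule Gamma1_group)
  have "chi_fr P n x = \<one>\<^bsub>Gamma1 P (Suc n)\<^esub>" for x using True by (simp add: chi_fr_def)
  then show ?thesis by (intro homI) simp_all
next
  case False
  show ?thesis
  proof (rule homI)
    fix x y assume "x \<in> carrier (FP1 P n)" "y \<in> carrier (FP1 P n)"
    then obtain g h where gh: "g \<in> LT" "h \<in> LT" "x = path_class UT g" "y = path_class UT h" unfolding FP1_carrier by blast
    obtain F where F: "push_lift P n (path_class UT g) F" using push_lift_exists[OF gh(1)] by blast
    obtain K where K: "push_lift P n (path_class UT h) K" using push_lift_exists[OF gh(2)] by blast
    note cF = chi_fr_class[OF False gh(1) F] and cK = chi_fr_class[OF False gh(2) K]
    show "chi_fr P n x \<in> carrier (Gamma1 P (Suc n))" unfolding gh(3) cF(1) Gamma1_carrier using cF(2) by blast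
    have F': "lift F" "F 1 \<in> Dann" "homotopic_paths UT g (\<lambda>t. tr (F t))" and K': "lift K" "K 1 \<in> Dann" "homotopic_paths UT h (\<lambda>t. tr (K t))"
      using F K unfolding push_lift_iff path_class_mem by auto
    have 1: "homotopic_paths UT (h +++ g) ((\<lambda>t. tr (K t)) +++ (\<lambda>t. tr (F t)))"
      by (rule homotopic_paths_join[OF K'(3) F'(3)]) (simp add: loops_atD(3)[OF gh(1)] loops_atD(4)[OF gh(2)])
    have 2: "homotopic_paths UT ((\<lambda>t. tr (K t)) +++ (\<lambda>t. tr (F t))) (\<lambda>t. tr (F t \<circ> K t))"
      by (rule homotopic_paths_subset[OF trace_comp[OF K'(1) F'(1) Dann_tr[OF K'(2)]]]) (use X_utb in blast)
    \<comment> \<open>The product of the classes of \<open>g\<close> and \<open>h\<close> runs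
      through \<open>h\<close> first, which matches the order of the composite
      \<open>F t \<circ> K t\<close>.\<close>
    have "push_lift P n (path_class UT (h +++ g)) (\<lambda>t. F t \<circ> K t)"
      unfolding push_lift_iff path_class_mem
      using lift_comp[OF K'(1) F'(1)] comp_diffeos[OF F'(2) K'(2)] homotopic_paths_trans[OF 1 2] by blast
    from chi_fr_class(1)[OF False loops_at_join[OF gh(2,1)] this]
    show "chi_fr P n (x \<otimes>\<^bsub>FP1 P n\<^esub> y) = chi_fr P n x \<otimes>\<^bsub>Gamma1 P (Suc n)\<^esub> chi_fr P n y"
      unfolding gh(3,4) FP1_mult[OF gh(1,2)] cF(1) cK(1) Gamma1_mult[OF cF(2) cK(2)] .
  qed
qed

lemma chi_fr_equivariant:
  assumes phi: "phi \<in> carrier (Gamma1 P n)" and x: "x \<in> carrier (FP1 P n)"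
  shows "chi_fr P n (FP1_map P n phi x) \<otimes>\<^bsub>Gamma1 P (Suc n)\<^esub> id_torus_bsum P n phi =
    id_torus_bsum P n phi \<otimes>\<^bsub>Gamma1 P (Suc n)\<^esub> chi_fr P n x"
proof (cases "n = 0")
  case True
  interpret G: group "Gamma1 P (Suc n)" by (rule Gamma1_group)
  have "chi_fr P n x = \<one>\<^bsub>Gamma1 P (Suc n)\<^esub>" for x using True by (simp add: chi_fr_def)
  then show ?thesis using hom_in_carrier[OF id_torus_bsum_hom phi] by simp
next
  case False
  obtain f where f: "f \<in> Dsurf" "phi = cls f" using phi unfolding Gamma1_carrier by blast
  obtain g where g: "g \<in> LT" "x = path_class UT g" using x unfolding FP1_carrier by blast
  obtain F where F: "push_lift P n (path_class UT g) F" using push_lift_exists[OF g(1)] by blast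
  note cF = chi_fr_class[OF False g(1) F]
  have F': "lift F" "F 1 \<in> Dann" "homotopic_paths UT g (\<lambda>t. tr (F t))" using F unfolding push_lift_iff path_class_mem by auto
  have I: "smooth_isotopy Cp Bd F" "F 0 = id" using F'(1) by (auto simp: lift_def)
  \<comment> \<open>The conjugated isotopy again starts at the identity, and its end is a
    diffeomorphism of the surface without the disc because \<open>f\<close> and its inverse are.
    Since the inverse of \<open>f\<close> fixes the framed point, the trace of \<open>K\<close> is
    the image under \<open>f\<close> of that of \<open>F\<close>.\<close>
  define K where "K t = f \<circ> (F t \<circ> finv f)" for t
  note fc = Dsurf_cap[OF f(1)] and fi = inv_diffeos[OF f(1)]
  note s = id_torus_bsum_class[OF f(1)]
  have fa: "f \<in> Dann" "finv f \<in> Dann"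
    using fix_disc_gamma2[OF fc Dsurf_fix[OF f(1)]] fix_disc_gamma2[OF Dsurf_cap[OF fi] Dsurf_fix[OF fi]] by simp_all
  have lK: "lift K"
    unfolding lift_def K_def[abs_def] I(2)
    using smooth_isotopy_comp[OF smooth_isotopy_const[OF fc] smooth_isotopy_comp[OF I(1) smooth_isotopy_const[OF inv_diffeos[OF fc]]]]
      diffeos_inv_simps(4)[OF f(1)] by simp
  have K1: "K 1 \<in> Dann" unfolding K_def by (intro comp_diffeos fa F'(2))
  have trK: "act Cp f (tr (F t)) = tr (K t)" if t: "t \<in> {0..1}" for t
  proof -
    note Ft = smooth_isotopyD(1)[OF I(1) t]
    have "tr (K t) = act Cp f (tr (F t \<circ> finv f))" unfolding K_def by (rule tr_comp[OF fc comp_diffeos[OF Ft inv_diffeos[OF fc]]])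
    also have "tr (F t \<circ> finv f) = act Cp (F t) (tr (finv f))" by (rule tr_comp[OF Ft inv_diffeos[OF fc]])
    also have "tr (finv f) = framed_point n" using act_base[OF fi] by (simp add: tr_def)
    finally show ?thesis by (simp add: tr_def)
  qed
  note 1 = act_homotopic[OF f(1) F'(3)]
  have 2: "homotopic_paths UT (act Cp f \<circ> (\<lambda>t. tr (F t))) (\<lambda>t. tr (K t))"
    using homotopic_paths_imp_path[OF 1] homotopic_paths_imp_subset[OF 1] by (intro homotopic_paths_eq) (simp_all add: trK)
  have "push_lift P n (path_class UT (act Cp f \<circ> g)) K"
    unfolding push_lift_iff path_class_mem using lK K1 homotopic_paths_trans[OF 1 2] by blast
  note cK = chi_fr_class[OF False act_loop[OF f(1) g(1)] this]
  have "K 1 \<circ> f = f \<circ> F 1" using diffeos_inv_simps(3)[OF f(1)] by (simp add: K_def comp_assoc)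
  then show ?thesis
    unfolding f(2) g(2) FP1_map_eq[OF f(1) g(1)] cK(1) cF(1) s(1) Gamma1_mult[OF cK(2) s(2)] Gamma1_mult[OF s(2) cF(2)] by simp
qed

end

section \<open>The Grothendieck construction and the Long-Moody system\<close>

lemma grothendieck_category:
  assumes A: "is_group_functor C A" shows "is_category (grothendieck C A)"
proof -
  have C: "is_category C" using A by (simp add: is_group_functor_def)
  have grp: "group (on_ob A a)" "x \<in> carrier (on_ob A a) ==> on_mor A a a (Ident C a) x = x" if "a \<in> Ob C" for a x
    using A that by (auto simp: is_group_functor_def)
  have hom: "on_mor A a b f \<in> hom (on_ob A a) (on_ob A b)" if "a \<in> Ob C" "b \<in> Ob C" "f \<in> Mor C a b" for a b f
    using A that by (simp add: is_group_functor_def)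
  have func: "on_mor A a c (Comp C a b c g f) x = on_mor A b c g (on_mor A a b f x)"
    if "a \<in> Ob C" "b \<in> Ob C" "c \<in> Ob C" "f \<in> Mor C a b" "g \<in> Mor C b c" "x \<in> carrier (on_ob A a)" for a b c f g x
    using A that by (simp add: is_group_functor_def)
  have mon: "monoid (on_ob A a)" if "a \<in> Ob C" for a using grp(1)[OF that] by (simp add: group.is_monoid)
  have cl: "on_mor A a b f x \<in> carrier (on_ob A b)" if "a \<in> Ob C" "b \<in> Ob C" "f \<in> Mor C a b" "x \<in> carrier (on_ob A a)" for a b f x
    by (rule hom_in_carrier[OF hom[OF that(1-3)] that(4)])
  have one: "on_mor A a b f \<one>\<^bsub>on_ob A a\<^esub> = \<one>\<^bsub>on_ob A b\<^esub>" if "a \<in> Ob C" "b \<in> Ob C" "f \<in> Mor C a b" for a b f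
    by (rule hom_one[OF hom[OF that] grp(1)[OF that(1)] grp(1)[OF that(2)]])
  have C1: "Ident C a \<in> Mor C a a" if "a \<in> Ob C" for a using C that by (simp add: is_category_def)
  have C2: "Comp C a b c g f \<in> Mor C a c" if "a \<in> Ob C" "b \<in> Ob C" "c \<in> Ob C" "f \<in> Mor C a b" "g \<in> Mor C b c" for a b c f g
    using C that by (simp add: is_category_def)
  have C3: "Comp C a a b f (Ident C a) = f" "Comp C a b b (Ident C b) f = f" if "a \<in> Ob C" "b \<in> Ob C" "f \<in> Mor C a b" for a b f
    using C that by (simp_all add: is_category_def)
  have C4: "Comp C a c d h (Comp C a b c g f) = Comp C a b d (Comp C b c d h g) f"
    if "a \<in> Ob C" "b \<in> Ob C" "c \<in> Ob C" "d \<in> Ob C" "f \<in> Mor C a b" "g \<in> Mor C b c" "h \<in> Mor C c d" for a b c d f g h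
    using C that by (simp add: is_category_def)
  show ?thesis
    unfolding is_category_def
  proof (intro conjI ballI)
    fix a b c f g assume h: "a \<in> Ob (grothendieck C A)" "b \<in> Ob (grothendieck C A)" "c \<in> Ob (grothendieck C A)"
      "f \<in> Mor (grothendieck C A) a b" "g \<in> Mor (grothendieck C A) b c"
    then show "Comp (grothendieck C A) a b c g f \<in> Mor (grothendieck C A) a c"
      by (cases f; cases g) (auto simp: grothendieck_def intro!: C2 cl monoid.m_closed mon)
  next
    fix a b c d f g h assume h: "a \<in> Ob (grothendieck C A)" "b \<in> Ob (grothendieck C A)" "c \<in> Ob (grothendieck C A)" "d \<in> Ob (grothendieck C A)"
      "f \<in> Mor (grothendieck C A) a b" "g \<in> Mor (grothendieck C A) b c" "h \<in> Mor (grothendieck C A) c d"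
    obtain x f' y g' z h' where e: "f = (x, f')" "g = (y, g')" "h = (z, h')" by (metis prod.exhaust)
    have m: "a \<in> Ob C" "b \<in> Ob C" "c \<in> Ob C" "d \<in> Ob C" "f' \<in> Mor C a b" "g' \<in> Mor C b c" "h' \<in> Mor C c d"
      "x \<in> carrier (on_ob A b)" "y \<in> carrier (on_ob A c)" "z \<in> carrier (on_ob A d)" using h by (auto simp: grothendieck_def e)
    \<comment> \<open>Associativity in the first component combines three facts: morphisms act by
      homomorphisms, the action is functorial, and the group is associative.\<close>
    have "z \<otimes>\<^bsub>on_ob A d\<^esub> on_mor A c d h' (y \<otimes>\<^bsub>on_ob A c\<^esub> on_mor A b c g' x) =
      z \<otimes>\<^bsub>on_ob A d\<^esub> on_mor A c d h' y \<otimes>\<^bsub>on_ob A d\<^esub> on_mor A b d (Comp C b c d h' g') x"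
      using hom_mult[OF hom[OF m(3,4,7)] m(9) cl[OF m(2,3,6,8)]] func[OF m(2-4,6,7,8)]
        monoid.m_assoc[OF mon[OF m(4)] m(10) cl[OF m(3,4,7,9)] cl[OF m(3,4,7) cl[OF m(2,3,6,8)]]] by simp
    moreover have "Comp C a c d h' (Comp C a b c g' f') = Comp C a b d (Comp C b c d h' g') f'" by (rule C4[OF m(1-7)])
    ultimately show "Comp (grothendieck C A) a c d h (Comp (grothendieck C A) a b c g f) =
      Comp (grothendieck C A) a b d (Comp (grothendieck C A) b c d h g) f" by (simp add: grothendieck_def e)
  next
    fix a assume "a \<in> Ob (grothendieck C A)"
    then show "Ident (grothendieck C A) a \<in> Mor (grothendieck C A) a a"
      using C1[of a] monoid.one_closed[OF mon[of a]] by (simp add: grothendieck_def)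
  next
    fix a b f assume h: "a \<in> Ob (grothendieck C A)" "b \<in> Ob (grothendieck C A)" "f \<in> Mor (grothendieck C A) a b"
    obtain x f' where e: "f = (x, f')" by (cases f)
    have m: "a \<in> Ob C" "b \<in> Ob C" "f' \<in> Mor C a b" "x \<in> carrier (on_ob A b)" using h by (auto simp: grothendieck_def e)
    have i: "Comp C a a b f' (Ident C a) = f'" "Comp C a b b (Ident C b) f' = f'" by (rule C3[OF m(1-3)])+
    show "Comp (grothendieck C A) a a b f (Ident (grothendieck C A) a) = f"
      using i one[OF m(1-3)] monoid.r_one[OF mon[OF m(2)] m(4)] by (simp add: grothendieck_def e)
    show "Comp (grothendieck C A) a b b (Ident (grothendieck C A) b) f = f"
      using i grp(2)[OF m(2,4)] monoid.l_one[OF mon[OF m(2)] m(4)] by (simp add: grothendieck_def e)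
  qed
qed

lemma M2plus_simps [simp]:
  "a \<in> Ob (M2plus P)" "f \<in> Mor (M2plus P) a b \<longleftrightarrow> a = b \<and> f \<in> carrier (Gamma1 P b)"
  "Comp (M2plus P) a b c g f = g \<otimes>\<^bsub>Gamma1 P c\<^esub> f" "Ident (M2plus P) a = \<one>\<^bsub>Gamma1 P a\<^esub>"
  by (simp_all add: M2plus_def)

context plug
begin

lemma M2plus_category: "is_category (M2plus P)" and M2plus_groupoid: "is_groupoid (M2plus P)"
proof -
  interpret G: group "Gamma1 P n" for n by (rule Gamma1_group)
  show c: "is_category (M2plus P)"
    unfolding is_category_def by (auto simp: G.m_assoc)
  have "\<exists>g\<in>Mor (M2plus P) b a. Comp (M2plus P) a b a g f = Ident (M2plus P) a \<and> Comp (M2plus P) b a b f g = Ident (M2plus P) b"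
    if "f \<in> Mor (M2plus P) a b" for a b f
    using that by (intro bexI[of _ "m_inv (Gamma1 P a) f"]) auto
  with c show "is_groupoid (M2plus P)" unfolding is_groupoid_def by blast
qed

lemma FP1_group_functor: "is_group_functor (M2plus P) (FP1_functor P)"
proof -
  have "group (FP1 P n)" "x \<in> carrier (FP1 P n) ==> FP1_map P n \<one>\<^bsub>Gamma1 P n\<^esub> x = x"
    "f \<in> carrier (Gamma1 P n) ==> FP1_map P n f \<in> hom (FP1 P n) (FP1 P n)"
    "f \<in> carrier (Gamma1 P n) ==> g \<in> carrier (Gamma1 P n) ==> x \<in> carrier (FP1 P n) ==>
      FP1_map P n (g \<otimes>\<^bsub>Gamma1 P n\<^esub> f) x = FP1_map P n g (FP1_map P n f x)" for n x f g
  proof -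
    interpret capped_plug P n by unfold_locales
    show "group (FP1 P n)" "x \<in> carrier (FP1 P n) ==> FP1_map P n \<one>\<^bsub>Gamma1 P n\<^esub> x = x"
      "f \<in> carrier (Gamma1 P n) ==> FP1_map P n f \<in> hom (FP1 P n) (FP1 P n)"
      "f \<in> carrier (Gamma1 P n) ==> g \<in> carrier (Gamma1 P n) ==> x \<in> carrier (FP1 P n) ==>
      FP1_map P n (g \<otimes>\<^bsub>Gamma1 P n\<^esub> f) x = FP1_map P n g (FP1_map P n f x)"
      by (fact FP1_group FP1_map_id FP1_map_hom FP1_map_comp)+
  qed
  then show ?thesis unfolding is_group_functor_def FP1_functor_def using M2plus_category by auto
qed

lemma chi_hom: "chi_fr P n \<in> hom (FP1 P n) (Gamma1 P (Suc n))"
proof -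
  interpret capped_plug P n by unfold_locales
  show ?thesis by (rule chi_fr_hom)
qed

lemma chi_equivariant:
  assumes "phi \<in> carrier (Gamma1 P n)" "x \<in> carrier (FP1 P n)"
  shows "chi_fr P n (FP1_map P n phi x) \<otimes>\<^bsub>Gamma1 P (Suc n)\<^esub> id_torus_bsum P n phi =
    id_torus_bsum P n phi \<otimes>\<^bsub>Gamma1 P (Suc n)\<^esub> chi_fr P n x"
proof -
  interpret capped_plug P n by unfold_locales
  show ?thesis by (rule chi_fr_equivariant[OF assms])
qed

lemma long_moody: "long_moody_system (M2plus P) (FP1_functor P) (torus_bsum_functor P) (chi_fr_functor P)"
proof -
  interpret G: group "Gamma1 P n" for n by (rule Gamma1_group)
  have FG: "group (FP1 P n)" for n using FP1_group_functor by (auto simp: is_group_functor_def FP1_functor_def)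
  have FC: "FP1_map P n f x \<in> carrier (FP1 P n)" if "f \<in> carrier (Gamma1 P n)" "x \<in> carrier (FP1 P n)" for n f x
    using FP1_group_functor that hom_in_carrier by (fastforce simp: is_group_functor_def FP1_functor_def)
  have sc: "f \<in> carrier (Gamma1 P n) ==> id_torus_bsum P n f \<in> carrier (Gamma1 P (Suc n))" for n f
    by (rule hom_in_carrier[OF id_torus_bsum_hom])
  have sm: "id_torus_bsum P n (g \<otimes>\<^bsub>Gamma1 P n\<^esub> f) = id_torus_bsum P n g \<otimes>\<^bsub>Gamma1 P (Suc n)\<^esub> id_torus_bsum P n f"
    if "f \<in> carrier (Gamma1 P n)" "g \<in> carrier (Gamma1 P n)" for n f g by (rule hom_mult[OF id_torus_bsum_hom that(2,1)])
  have s1: "id_torus_bsum P n \<one>\<^bsub>Gamma1 P n\<^esub> = \<one>\<^bsub>Gamma1 P (Suc n)\<^esub>" for n by (rule hom_one[OF id_torus_bsum_hom Gamma1_group Gamma1_group])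
  have cc: "x \<in> carrier (FP1 P n) ==> chi_fr P n x \<in> carrier (Gamma1 P (Suc n))" for n x by (rule hom_in_carrier[OF chi_hom])
  have cm: "chi_fr P n (x \<otimes>\<^bsub>FP1 P n\<^esub> y) = chi_fr P n x \<otimes>\<^bsub>Gamma1 P (Suc n)\<^esub> chi_fr P n y"
    if "x \<in> carrier (FP1 P n)" "y \<in> carrier (FP1 P n)" for n x y by (rule hom_mult[OF chi_hom that])
  have c1: "chi_fr P n \<one>\<^bsub>FP1 P n\<^esub> = \<one>\<^bsub>Gamma1 P (Suc n)\<^esub>" for n by (rule hom_one[OF chi_hom FG Gamma1_group])
  have X: "is_functor (M2plus P) (M2plus P) (torus_bsum_functor P)"
    unfolding is_functor_def torus_bsum_functor_def using M2plus_category sc sm s1 by auto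
  \<comment> \<open>This is the multiplication of a semidirect product: equivariance moves the
    extended mapping class of \<open>g\<close> past the image of the braid \<open>x\<close>.\<close>
  have key: "chi_fr P n (y \<otimes>\<^bsub>FP1 P n\<^esub> FP1_map P n g x) \<otimes>\<^bsub>Gamma1 P (Suc n)\<^esub> id_torus_bsum P n (g \<otimes>\<^bsub>Gamma1 P n\<^esub> f) =
      (chi_fr P n y \<otimes>\<^bsub>Gamma1 P (Suc n)\<^esub> id_torus_bsum P n g) \<otimes>\<^bsub>Gamma1 P (Suc n)\<^esub> (chi_fr P n x \<otimes>\<^bsub>Gamma1 P (Suc n)\<^esub> id_torus_bsum P n f)"
    if m: "x \<in> carrier (FP1 P n)" "y \<in> carrier (FP1 P n)" "f \<in> carrier (Gamma1 P n)" "g \<in> carrier (Gamma1 P n)" for n x y f g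
  proof -
    let ?m = "\<lambda>a b. a \<otimes>\<^bsub>Gamma1 P (Suc n)\<^esub> b" and ?s = "id_torus_bsum P n" and ?c = "chi_fr P n"
    note k = cc[OF m(1)] cc[OF m(2)] sc[OF m(3)] sc[OF m(4)] cc[OF FC[OF m(4,1)]]
    have "?m (?c (y \<otimes>\<^bsub>FP1 P n\<^esub> FP1_map P n g x)) (?s (g \<otimes>\<^bsub>Gamma1 P n\<^esub> f)) =
        ?m (?m (?c y) (?c (FP1_map P n g x))) (?m (?s g) (?s f))"
      by (simp only: cm[OF m(2) FC[OF m(4,1)]] sm[OF m(3,4)])
    also have "\<dots> = ?m (?m (?c y) (?m (?c (FP1_map P n g x)) (?s g))) (?s f)" using k by (simp add: G.m_assoc)
    also have "\<dots> = ?m (?m (?c y) (?m (?s g) (?c x))) (?s f)" by (simp only: chi_equivariant[OF m(4,1)])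
    also have "\<dots> = ?m (?m (?c y) (?s g)) (?m (?c x) (?s f))" using k by (simp add: G.m_assoc)
    finally show ?thesis .
  qed
  have S: "Ob (grothendieck (M2plus P) (FP1_functor P)) = UNIV"
    "f \<in> Mor (grothendieck (M2plus P) (FP1_functor P)) a b \<longleftrightarrow> a = b \<and> fst f \<in> carrier (FP1 P b) \<and> snd f \<in> carrier (Gamma1 P b)"
    "Comp (grothendieck (M2plus P) (FP1_functor P)) a b c g f =
      (fst g \<otimes>\<^bsub>FP1 P c\<^esub> FP1_map P c (snd g) (fst f), snd g \<otimes>\<^bsub>Gamma1 P c\<^esub> snd f)"
    "Ident (grothendieck (M2plus P) (FP1_functor P)) a = (\<one>\<^bsub>FP1 P a\<^esub>, \<one>\<^bsub>Gamma1 P a\<^esub>)"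
    "on_ob (chi_fr_functor P) a = Suc a"
    "on_mor (chi_fr_functor P) a b f = chi_fr P b (fst f) \<otimes>\<^bsub>Gamma1 P (Suc b)\<^esub> id_torus_bsum P b (snd f)" for a b c f g
    by (auto simp: grothendieck_def FP1_functor_def chi_fr_functor_def M2plus_def case_prod_beta mem_Times_iff)
  have K: "is_functor (grothendieck (M2plus P) (FP1_functor P)) (M2plus P) (chi_fr_functor P)"
    unfolding is_functor_def
  proof (intro conjI ballI)
    show "is_category (grothendieck (M2plus P) (FP1_functor P))" by (rule grothendieck_category[OF FP1_group_functor])
    show "is_category (M2plus P)" by (rule M2plus_category)
  next
    fix a
    show "on_ob (chi_fr_functor P) a \<in> Ob (M2plus P)" by simp
    show "on_mor (chi_fr_functor P) a a (Ident (grothendieck (M2plus P) (FP1_functor P)) a) = Ident (M2plus P) (on_ob (chi_fr_functor P) a)"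
      unfolding S M2plus_simps by (simp add: c1 s1)
  next
    fix a b f assume "f \<in> Mor (grothendieck (M2plus P) (FP1_functor P)) a b"
    then have f: "a = b" "fst f \<in> carrier (FP1 P b)" "snd f \<in> carrier (Gamma1 P b)" unfolding S by blast+
    show "on_mor (chi_fr_functor P) a b f \<in> Mor (M2plus P) (on_ob (chi_fr_functor P) a) (on_ob (chi_fr_functor P) b)"
      unfolding S M2plus_simps using f(1) G.m_closed[OF cc[OF f(2)] sc[OF f(3)]] by simp
  next
    fix a b c f g assume "f \<in> Mor (grothendieck (M2plus P) (FP1_functor P)) a b" "g \<in> Mor (grothendieck (M2plus P) (FP1_functor P)) b c"
    then have fg: "b = c" "fst f \<in> carrier (FP1 P b)" "snd f \<in> carrier (Gamma1 P b)" "fst g \<in> carrier (FP1 P c)" "snd g \<in> carrier (Gamma1 P c)"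
      unfolding S by blast+
    show "on_mor (chi_fr_functor P) a c (Comp (grothendieck (M2plus P) (FP1_functor P)) a b c g f) =
      Comp (M2plus P) (on_ob (chi_fr_functor P) a) (on_ob (chi_fr_functor P) b) (on_ob (chi_fr_functor P) c)
        (on_mor (chi_fr_functor P) b c g) (on_mor (chi_fr_functor P) a b f)"
      unfolding S M2plus_simps fst_conv snd_conv fg(1) by (rule key[OF fg(2)[unfolded fg(1)] fg(4) fg(3)[unfolded fg(1)] fg(5)])
  qed
  have "functor_eq (M2plus P) (functor_comp (chi_fr_functor P) (grothendieck_sec (FP1_functor P))) (torus_bsum_functor P)"
    unfolding functor_eq_def using c1 sc
    by (auto simp: functor_comp_def grothendieck_sec_def torus_bsum_functor_def chi_fr_functor_def FP1_functor_def)
  then show ?thesis unfolding long_moody_system_def using M2plus_groupoid FP1_group_functor X K by blast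
qed

end

theorem proposition3p19:
  fixes P :: "R3 set"
  assumes "torus_plug P"
  shows "(\<forall>n. chi_fr P n \<in> hom (FP1 P n) (Gamma1 P (1 + n))) \<and>
    long_moody_system (M2plus P) (FP1_functor P) (torus_bsum_functor P) (chi_fr_functor P)"
proof -
  interpret plug P using assms by unfold_locales
  show ?thesis using chi_hom long_moody by simp
qed

end
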